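(* Let $\Pi:=L_{an}\mathrm{GL}_2(\mathbb{C})\times\Delta$ and let $\delta:=\delta((1,1))=z\,\mathrm{Id}$ (all notation as fixed in the context). (a) Let $(g,\delta(m))\in\Pi$ be a point satisfying condition $(BC_0)$: there exists $\gamma_0(t)\in\Gamma_0$ with $\delta(m)\gamma_0(t)g\gamma_0(t)^{-1}\delta(-m)\in\Omega=U_-P_+$. Then, in the setting $(R_0(g,\delta(m)),\{\partial/\partial t_i\mid i\geq 0\})$, the element $$\Psi_{g,\delta(m)}:=u_-(g,\delta(m))\,\delta(m)\,\gamma_0(t)$$ is a wave matrix of type $\delta(m)$ of the AKNS hierarchy, and it determines a solution $Q_{g,\delta(m)}=u_-(g,\delta(m))\,Q_0\,u_-(g,\delta(m))^{-1}$ of the AKNS hierarchy. Moreover, for each $p_1\in P_+$, every $\gamma_0^c(s)\in\Gamma_0^c$ and all $k\in\mathbb{Z}$, the point $(\gamma_0^c(s)\,g\,\delta(-m)p_1\delta(m),\ \delta^k\delta(m))$ again satisfies $(BC_0)$ and $$Q_{\gamma_0^c(s)g\delta(-m)p_1\delta(m),\ \delta^k\delta(m)}=Q_{g,\delta(m)}.$$ (b) Let $(g,\delta(m))\in\Pi$ be a point satisfying condition $(BC_1)$: there exists $\gamma_1(t)\in\Gamma_1$ with $\delta(m)\gamma_1(t)g\gamma_1(t)^{-1}\delta(-m)\in\Omega=P_-U_+$. Then, in the setting $(R_1(g,\delta(m)),\{\partial/\partial t_i\mid i\geq 1\})$, the element $$\Phi_{g,\delta(m)}:=p_-(g,\delta(m))\,\delta(m)\,\gamma_1(t)$$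 is a wave matrix of type $\delta(m)$ of the strict AKNS hierarchy, and it determines a solution $Z_{g,\delta(m)}=p_-(g,\delta(m))\,Q_0z\,p_-(g,\delta(m))^{-1}$ of the strict AKNS hierarchy. Moreover, for each $u_1\in U_+$, every $\gamma_1^c(s)\in\Gamma_1^c$ and all $k\in\mathbb{Z}$, the point $(\gamma_1^c(s)\,g\,\delta(-m)u_1\delta(m),\ \delta^k\delta(m))$ again satisfies $(BC_1)$ and $$Z_{\gamma_1^c(s)g\delta(-m)u_1\delta(m),\ \delta^k\delta(m)}=Z_{g,\delta(m)}.$$
   Context: **Loop groups.** For $0<r<1$ let $A_r=\{z\in\mathbb{C}\mid r\leq|z|\leq 1/r\}$. $L_{an}\mathrm{gl}_2(\mathbb{C})$ is the Lie algebra of maps holomorphic on an open neighbourhood of some annulus $A_r$ with values in $\mathrm{gl}_2(\mathbb{C})$ (two maps being identified if they agree near some $A_r$), with pointwise commutator, topologized as the direct limit over $r$ of the spaces for fixed $A_r$ with the topology of uniform convergence. $L_{an}\mathrm{GL}_2(\mathbb{C})$ is the group, under pointwise multiplication, of holomorphic maps from (a neighbourhood of) some $A_r$ into $\mathrm{GL}_2(\mathbb{C})$; it is an infinite-dimensional Lie group with Lie algebra $L_{an}\mathrm{gl}_2(\mathbb{C})$. Each loop has a Fourier (Laurent) expansion $\gamma=\sum_{k\in\mathbb{Z}}\gamma_kz^k$ with $\gamma_k\in\mathrm{gl}_2(\mathbb{C})$. Subgroups of $L_{an}\mathrm{GL}_2(\mathbb{C})$: - $P_+$: loops $\gamma=\gamma_0+\sum_{k\geq1}\gamma_kz^k$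 extending to a holomorphic map from a disk $\{|z|\leq 1/r\}$, for some $0<r<1$, into $\mathrm{GL}_2(\mathbb{C})$ (in particular $\gamma_0\in\mathrm{GL}_2(\mathbb{C})$); $U_+=\{\gamma\in P_+\mid\gamma_0=\mathrm{Id}\}$. - $P_-$: loops $\gamma=\gamma_0+\sum_{k\leq-1}\gamma_kz^k$ extending to a holomorphic map from $\{z\in\mathbb{P}^1(\mathbb{C})\mid|z|\geq r\}$, for some $0<r<1$, into $\mathrm{GL}_2(\mathbb{C})$ (in particular $\gamma_0\in\mathrm{GL}_2(\mathbb{C})$); $U_-=\{\gamma\in P_-\mid\gamma_0=\mathrm{Id}\}$. - $\Omega:=U_-P_+=P_-U_+$ (the big cell), an open subset of $L_{an}\mathrm{GL}_2(\mathbb{C})$. - $\Delta=\{\delta(m)\mid m=(m_1,m_2)\in\mathbb{Z}^2\}$, with $\delta(m)=\begin{pmatrix}z^{m_1}&0\\0&z^{m_2}\end{pmatrix}$. - With $Q_0=\begin{pmatrix}-i&0\\0&i\end{pmatrix}$: $\Gamma_0=\{\gamma_0(t)=\exp(\sum_{i\geq0}t_iQ_0z^i)\in P_+\}$, $\Gamma_1=\{\gamma_1(t)=\exp(\sum_{i\geq1}t_iQ_0z^i)\in U_+\}$, $\Gamma_0^c=\{\gamma_0^c(s)=\exp(\sum_{k\geq1}s_kQ_0z^{-k})\in U_-\}$, $\Gamma_1^c=\{\gamma_1^c(s)=\exp(\sum_{k\geq0}s_kQ_0z^{-k})\in P_-\}$, with complex parameters $t_i$, $s_k$. **Data attached to a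 point.** If $(g,\delta(m))$ satisfies $(BC_0)$, let $\Gamma_0(g,\delta(m))$ be the (open, non-empty) set of all $\gamma_0(t)\in\Gamma_0$ with $\delta(m)\gamma_0(t)g\gamma_0(t)^{-1}\delta(-m)\in\Omega$, and let $R_0(g,\delta(m))$ be the algebra of analytic functions $\Gamma_0(g,\delta(m))\to\mathbb{C}$, with commuting derivations $\partial_i=\partial/\partial t_i$, $i\geq0$. For $\gamma_0(t)\in\Gamma_0(g,\delta(m))$ there is a unique decomposition $$\delta(m)\gamma_0(t)g\gamma_0(t)^{-1}\delta(-m)=u_-(g,\delta(m))^{-1}p_+(g,\delta(m)),\quad u_-(g,\delta(m))\in U_-,\ p_+(g,\delta(m))\in P_+,$$ both factors depending on $t$. Likewise, if $(g,\delta(m))$ satisfies $(BC_1)$, let $\Gamma_1(g,\delta(m))$ be the (open, non-empty) set of all $\gamma_1(t)\in\Gamma_1$ with $\delta(m)\gamma_1(t)g\gamma_1(t)^{-1}\delta(-m)\in\Omega$, let $R_1(g,\delta(m))$ be the algebra of analytic functions $\Gamma_1(g,\delta(m))\to\mathbb{C}$ with derivations $\partial_i=\partial/\partial t_i$, $i\geq1$, and decompose uniquely $$\delta(m)\gamma_1(t)g\gamma_1(t)^{-1}\delta(-m)=p_-(g,\delta(m))^{-1}u_+(g,\delta(m)),\quad p_-(g,\delta(m))\in P_-,\ u_+(g,\delta(m))\in U_+.$$ **The hierarchies.** A setting for the AKNS (resp. strict AKNS) hierarchy is a commutative $\mathbb{C}$-algebra $R$ with commuting $\mathbb{C}$-linear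 derivations $\partial_i$, $i\geq0$ (resp. $i\geq1$). $\mathrm{gl}_2(R)[z,z^{-1})$ is the algebra of series $X=\sum_{j=-\infty}^NX_jz^j$, $X_j\in\mathrm{gl}_2(R)$, $N\in\mathbb{Z}$, on which each $\partial_i$ acts coefficientwise; $(X)_{\geq0}=\sum_{j\geq0}X_jz^j$ and $(X)_{>0}=\sum_{j\geq1}X_jz^j$. Let $G_{<0}=\{\mathrm{Id}+\sum_{j\geq1}Y_jz^{-j}\mid Y_j\in\mathrm{gl}_2(R)\}$ and $G_{\leq0}=\{\sum_{j\geq0}K_jz^{-j}\mid K_j\in\mathrm{gl}_2(R),\ K_0\text{ invertible in }\mathrm{gl}_2(R)\}$. A solution of the AKNS hierarchy is $Q=hQ_0h^{-1}$ with $h\in G_{<0}$ such that $\partial_i(Q)=[(Qz^i)_{\geq0},Q]$ for all $i\geq0$. A solution of the strict AKNS hierarchy is $Z=hQ_0zh^{-1}$ with $h\in G_{\leq0}$ such that $\partial_i(Z)=[(Zz^{i-1})_{>0},Z]$ for all $i\geq1$. **Wave matrices.** Let $\psi_0=\exp(\sum_{i\geq0}t_iQ_0z^i)$ (here $\gamma_0(t)$) and $\varphi_0=\exp(\sum_{i\geq1}t_iQ_0z^i)$ (here $\gamma_1(t)$). $\mathcal{M}_0$ (resp. $\mathcal{M}_1$) is the free left $\mathrm{gl}_2(R)[z,z^{-1})$-module of products $\{g(z)\}\psi_0$ (resp. $\{g(z)\}\varphi_0$), with right actions $\{g(z)\}\psi_0Q_0:=\{g(z)Q_0\}\psi_0$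 and $\{g(z)\}\varphi_0Q_0z:=\{g(z)Q_0z\}\varphi_0$, and derivations $\partial_i(\{g(z)\}\psi_0)=\{\partial_i(g(z))+g(z)Q_0z^i\}\psi_0$, and similarly with $\varphi_0$. A wave matrix of the AKNS hierarchy of type $\delta(m)$ is $\psi=\{h(z)\delta(m)\}\psi_0\in\mathcal{M}_0$ with $h(z)\in G_{<0}$ such that, for $Q=h(z)Q_0h(z)^{-1}$, one has $Q\psi=\psi Q_0$ and $\partial_i(\psi)=(Qz^i)_{\geq0}\psi$ for all $i\geq0$. A wave matrix of the strict AKNS hierarchy of type $\delta(m)$ is $\varphi=\{h(z)\delta(m)\}\varphi_0\in\mathcal{M}_1$ with $h(z)\in G_{\leq0}$ such that, for $Z=h(z)Q_0zh(z)^{-1}$, one has $Z\varphi=\varphi Q_0z$ and $\partial_i(\varphi)=(Zz^{i-1})_{>0}\varphi$ for all $i\geq1$. Here $\Psi_{g,\delta(m)}$ is regarded as $\{u_-(g,\delta(m))\delta(m)\}\psi_0$ over $R=R_0(g,\delta(m))$ and $\Phi_{g,\delta(m)}$ as $\{p_-(g,\delta(m))\delta(m)\}\varphi_0$ over $R=R_1(g,\delta(m))$. *)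

theory Defs
  imports "HOL-Complex_Analysis.Complex_Analysis" "HOL-Algebra.Module" "HOL-Algebra.Coset"
begin

unbundle no fps_syntax

section \<open>Loops: germs of holomorphic maps near an annulus\<close>

definition annulus :: "real \<Rightarrow> complex set" where
  "annulus r = {z. r \<le> norm z \<and> norm z \<le> 1 / r}"

definition GL2 :: "(complex^2^2) set" where
  "GL2 = {A. invertible A}"

text \<open>\<open>holo_near f K S\<close>: on some open neighbourhood of \<open>K\<close> the map \<open>f\<close> is holomorphic
  with values in \<open>S\<close>.\<close>

definition holo_near ::
    "(complex \<Rightarrow> complex^2^2) \<Rightarrow> complex set \<Rightarrow> (complex^2^2) set \<Rightarrow> bool" where
  "holo_near f K S \<longleftrightarrow> (\<exists>U. open U \<and> K \<subseteq> U \<and>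
     (\<forall>i j. (\<lambda>z. f z $ i $ j) holomorphic_on U) \<and> f ` U \<subseteq> S)"

definition germ_eq :: "(complex \<Rightarrow> complex^2^2) \<Rightarrow> (complex \<Rightarrow> complex^2^2) \<Rightarrow> bool" where
  "germ_eq f g \<longleftrightarrow> (\<exists>r. 0 < r \<and> r < 1 \<and>
     holo_near f (annulus r) UNIV \<and> holo_near g (annulus r) UNIV \<and>
     (\<exists>U. open U \<and> annulus r \<subseteq> U \<and> (\<forall>z\<in>U. f z = g z)))"

lemma annulus_mono: "0 < r \<Longrightarrow> r \<le> s \<Longrightarrow> annulus s \<subseteq> annulus r"
  unfolding annulus_def using frac_le[of 1 1 r s] by auto

lemma holo_near_subset: "holo_near f K S \<Longrightarrow> L \<subseteq> K \<Longrightarrow> holo_near f L S"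
  unfolding holo_near_def by (meson subset_trans)

lemma holo_near_mult:
  assumes "holo_near f K UNIV" "holo_near g K UNIV"
  shows "holo_near (\<lambda>z. f z ** g z) K UNIV"
proof -
  obtain U where U: "open U \<and> K \<subseteq> U \<and> (\<forall>i j. (\<lambda>z. f z $ i $ j) holomorphic_on U) \<and> f ` U \<subseteq> UNIV"
    using assms(1) unfolding holo_near_def ..
  obtain V where V: "open V \<and> K \<subseteq> V \<and> (\<forall>i j. (\<lambda>z. g z $ i $ j) holomorphic_on V) \<and> g ` V \<subseteq> UNIV"
    using assms(2) unfolding holo_near_def ..
  have "(\<lambda>z. f z $ i $ k * g z $ k $ j) holomorphic_on U \<inter> V" for i j k
  proof (rule holomorphic_on_mult)
    show "(\<lambda>z. f z $ i $ k) holomorphic_on U \<inter> V"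
      by (rule holomorphic_on_subset[of _ U]) (simp_all add: U)
    show "(\<lambda>z. g z $ k $ j) holomorphic_on U \<inter> V"
      by (rule holomorphic_on_subset[of _ V]) (simp_all add: V)
  qed
  then have "(\<lambda>z. (f z ** g z) $ i $ j) holomorphic_on U \<inter> V" for i j
    by (simp add: matrix_matrix_mult_def holomorphic_on_sum)
  then show ?thesis
    unfolding holo_near_def using U V by (intro exI[of _ "U \<inter> V"]) (simp add: le_infI1 open_Int)
qed

lemma holo_near_const: "holo_near (\<lambda>z. A) K UNIV"
  unfolding holo_near_def by (auto intro!: exI[of _ UNIV])

lemma germ_eq_const: "germ_eq (\<lambda>z. A) (\<lambda>z. A)"
  unfolding germ_eq_def
  by (intro exI[of _ "1 / 2 :: real"] conjI exI[of _ UNIV] ballI holo_near_const) simp_all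

lemma germ_eqE_common:
  assumes "germ_eq f g" "germ_eq f' g'"
  obtains r U where "0 < r" "r < 1" "open U" "annulus r \<subseteq> U"
    "holo_near f (annulus r) UNIV" "holo_near g (annulus r) UNIV"
    "holo_near f' (annulus r) UNIV" "holo_near g' (annulus r) UNIV"
    "\<And>z. z \<in> U \<Longrightarrow> f z = g z" "\<And>z. z \<in> U \<Longrightarrow> f' z = g' z"
proof -
  obtain r U where 1: "0 < r" "r < 1" "open U" "annulus r \<subseteq> U"
    "holo_near f (annulus r) UNIV" "holo_near g (annulus r) UNIV" "\<And>z. z \<in> U \<Longrightarrow> f z = g z"
    using assms(1) unfolding germ_eq_def by blast
  obtain s V where 2: "0 < s" "s < 1" "open V" "annulus s \<subseteq> V"
    "holo_near f' (annulus s) UNIV" "holo_near g' (annulus s) UNIV" "\<And>z. z \<in> V \<Longrightarrow> f' z = g' z"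
    using assms(2) unfolding germ_eq_def by blast
  have sub: "annulus (max r s) \<subseteq> annulus r" "annulus (max r s) \<subseteq> annulus s"
    using 1(1) 2(1) by (simp_all add: annulus_mono)
  show ?thesis
  proof (rule that[of "max r s" "U \<inter> V"])
    show "0 < max r s" "max r s < 1" "open (U \<inter> V)"
      using 1(1-3) 2(1-3) by auto
    show "annulus (max r s) \<subseteq> U \<inter> V"
      using 1(4) 2(4) sub by blast
  qed (use 1(7) 2(7) in \<open>auto intro: 1(5,6)[THEN holo_near_subset[OF _ sub(1)]]
      2(5,6)[THEN holo_near_subset[OF _ sub(2)]]\<close>)
qed

quotient_type loop = "complex \<Rightarrow> complex^2^2" / partial: germ_eq
proof (rule part_equivpI)
  show "\<exists>f. germ_eq f f"
    using germ_eq_const by blast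
  show "symp germ_eq"
  proof (rule sympI)
    fix f g assume "germ_eq f g"
    then obtain r U where "0 < r" "r < 1" "open U" "annulus r \<subseteq> U"
      "holo_near f (annulus r) UNIV" "holo_near g (annulus r) UNIV"
      "\<And>z. z \<in> U \<Longrightarrow> f z = g z"
      unfolding germ_eq_def by blast
    then show "germ_eq g f"
      unfolding germ_eq_def by (intro exI[of _ r] conjI exI[of _ U] ballI) simp_all
  qed
  show "transp germ_eq"
  proof (rule transpI)
    fix f g h assume "germ_eq f g" "germ_eq g h"
    then obtain r U where "0 < r" "r < 1" "open U" "annulus r \<subseteq> U"
      "holo_near f (annulus r) UNIV" "holo_near h (annulus r) UNIV"
      "\<And>z. z \<in> U \<Longrightarrow> f z = g z" "\<And>z. z \<in> U \<Longrightarrow> g z = h z"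
      by (rule germ_eqE_common) (rule that; assumption)
    then show "germ_eq f h"
      unfolding germ_eq_def by (intro exI[of _ r] conjI exI[of _ U] ballI) simp_all
  qed
qed

lift_definition loop_mult :: "loop \<Rightarrow> loop \<Rightarrow> loop" is "\<lambda>f g z. f z ** g z"
proof -
  fix f f' g g' assume "germ_eq f f'" "germ_eq g g'"
  then obtain r U where "0 < r" "r < 1" "open U" "annulus r \<subseteq> U"
    "holo_near f (annulus r) UNIV" "holo_near f' (annulus r) UNIV"
    "holo_near g (annulus r) UNIV" "holo_near g' (annulus r) UNIV"
    "\<And>z. z \<in> U \<Longrightarrow> f z = f' z" "\<And>z. z \<in> U \<Longrightarrow> g z = g' z"
    by (rule germ_eqE_common) (rule that; assumption)
  then show "germ_eq (\<lambda>z. f z ** g z) (\<lambda>z. f' z ** g' z)"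
    unfolding germ_eq_def
    by (intro exI[of _ r] conjI exI[of _ U] ballI holo_near_mult) simp_all
qed

lift_definition loop_one :: loop is "\<lambda>z. mat 1"
  by (rule germ_eq_const)

text \<open>The coefficient \<open>\<gamma>\<^sub>k\<close> of the Fourier (Laurent) expansion, as the usual integral over the
  unit circle.\<close>

lift_definition loop_coeff :: "loop \<Rightarrow> int \<Rightarrow> complex^2^2" is
  "\<lambda>f k. \<chi> i j. 1 / (2 * of_real pi * \<i>) *
     contour_integral (circlepath 0 1) (\<lambda>z. f z $ i $ j * z powi (- k - 1))"
proof -
  fix f g :: "complex \<Rightarrow> complex^2^2" assume "germ_eq f g"
  then obtain r where r: "0 < r" "r < 1" and eq: "\<And>z. z \<in> annulus r \<Longrightarrow> f z = g z"
    unfolding germ_eq_def by (meson subsetD)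
  have "f z = g z" if "z \<in> path_image (circlepath 0 1)" for z
    using that r by (intro eq) (simp add: annulus_def)
  then have "contour_integral (circlepath 0 1) (\<lambda>z. f z $ i $ j * z powi (- k - 1)) =
      contour_integral (circlepath 0 1) (\<lambda>z. g z $ i $ j * z powi (- k - 1))" for i j k
    by (intro contour_integral_eq) simp
  then show "(\<lambda>k. \<chi> i j. 1 / (2 * of_real pi * \<i>) *
       contour_integral (circlepath 0 1) (\<lambda>z. f z $ i $ j * z powi (- k - 1))) =
     (\<lambda>k. \<chi> i j. 1 / (2 * of_real pi * \<i>) *
       contour_integral (circlepath 0 1) (\<lambda>z. g z $ i $ j * z powi (- k - 1)))"
    by simp
qed

text \<open>The direct limit topology: a set is open iff, for every \<open>r\<close>, its trace on the loops
  holomorphic near \<open>annulus r\<close> is open for uniform convergence on \<open>annulus r\<close>.\<close>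

definition loop_open :: "loop set \<Rightarrow> bool" where
  "loop_open W \<longleftrightarrow> (\<forall>r f. 0 < r \<and> r < 1 \<and> holo_near f (annulus r) UNIV \<and> abs_loop f \<in> W \<longrightarrow>
     (\<exists>\<epsilon>>0. \<forall>h. holo_near h (annulus r) UNIV \<and> (\<forall>z\<in>annulus r. norm (h z - f z) < \<epsilon>) \<longrightarrow>
        abs_loop h \<in> W))"

definition loop_topology :: "loop topology" where
  "loop_topology = topology loop_open"

lemma openin_loop_topology: "openin loop_topology W \<longleftrightarrow> loop_open W"
proof -
  have "loop_open (S \<inter> T)" if S: "loop_open S" and T: "loop_open T" for S T
    unfolding loop_open_def
  proof (intro allI impI, elim conjE)
    fix r f assume r: "0 < (r::real)" "r < 1" "holo_near f (annulus r) UNIV" "abs_loop f \<in> S \<inter> T"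
    obtain d where d: "d > 0" "\<And>h. holo_near h (annulus r) UNIV \<Longrightarrow>
        (\<forall>z\<in>annulus r. norm (h z - f z) < d) \<Longrightarrow> abs_loop h \<in> S"
      using S r unfolding loop_open_def by (meson IntD1)
    obtain e where e: "e > 0" "\<And>h. holo_near h (annulus r) UNIV \<Longrightarrow>
        (\<forall>z\<in>annulus r. norm (h z - f z) < e) \<Longrightarrow> abs_loop h \<in> T"
      using T r unfolding loop_open_def by (meson IntD2)
    show "\<exists>\<epsilon>>0. \<forall>h. holo_near h (annulus r) UNIV \<and> (\<forall>z\<in>annulus r. norm (h z - f z) < \<epsilon>) \<longrightarrow>
        abs_loop h \<in> S \<inter> T"
      using d e by (intro exI[of _ "min d e"]) auto
  qed
  moreover have "loop_open (\<Union>\<K>)" if op: "\<forall>K\<in>\<K>. loop_open K" for \<K>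
    unfolding loop_open_def
  proof (intro allI impI, elim conjE)
    fix r f assume r: "0 < (r::real)" "r < 1" "holo_near f (annulus r) UNIV" "abs_loop f \<in> \<Union>\<K>"
    then obtain K where K: "K \<in> \<K>" "abs_loop f \<in> K" by blast
    then obtain e where "e > 0" "\<And>h. holo_near h (annulus r) UNIV \<Longrightarrow>
        (\<forall>z\<in>annulus r. norm (h z - f z) < e) \<Longrightarrow> abs_loop h \<in> K"
      using op r unfolding loop_open_def by meson
    then show "\<exists>\<epsilon>>0. \<forall>h. holo_near h (annulus r) UNIV \<and> (\<forall>z\<in>annulus r. norm (h z - f z) < \<epsilon>) \<longrightarrow>
        abs_loop h \<in> \<Union>\<K>"
      using K by (intro exI[of _ e]) blast
  qed
  ultimately have "istopology loop_open"
    unfolding istopology_def by blast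
  then show ?thesis
    unfolding loop_topology_def by (simp add: topology_inverse')
qed

section \<open>The loop group and its subgroups\<close>

definition LGL2 :: "loop monoid" where
  "LGL2 = \<lparr>carrier = {abs_loop f | f. \<exists>r. 0 < r \<and> r < 1 \<and> holo_near f (annulus r) GL2},
     mult = loop_mult, one = loop_one\<rparr>"

definition P_plus :: "loop set" where
  "P_plus = {abs_loop f | f. \<exists>r. 0 < r \<and> r < 1 \<and> holo_near f (cball 0 (1 / r)) GL2}"

text \<open>Holomorphy on the neighbourhood \<open>{z. norm z \<ge> r}\<close> of infinity in the projective line is
  expressed in the coordinate \<open>1 / z\<close>.\<close>

definition P_minus :: "loop set" where
  "P_minus = {abs_loop (\<lambda>z. f (1 / z)) | f. \<exists>r. 0 < r \<and> r < 1 \<and> holo_near f (cball 0 (1 / r)) GL2}"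

definition U_plus :: "loop set" where
  "U_plus = {\<gamma> \<in> P_plus. loop_coeff \<gamma> 0 = mat 1}"

definition U_minus :: "loop set" where
  "U_minus = {\<gamma> \<in> P_minus. loop_coeff \<gamma> 0 = mat 1}"

definition big_cell :: "loop set" where
  "big_cell = U_minus <#>\<^bsub>LGL2\<^esub> P_plus"

definition delta :: "int \<times> int \<Rightarrow> loop" where
  "delta m = abs_loop (\<lambda>z. \<chi> a b. if a = b then z powi (if a = 1 then fst m else snd m) else 0)"

definition Points :: "(loop \<times> loop) set" where
  "Points = carrier LGL2 \<times> range delta"

definition Q0 :: "complex^2^2" where
  "Q0 = (\<chi> a b. if a = b then (if a = 1 then - \<i> else \<i>) else 0)"

definition cscale :: "complex \<Rightarrow> complex^2^2 \<Rightarrow> complex^2^2" where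
  "cscale c A = (\<chi> a b. c * A $ a $ b)"

definition mexp :: "complex^2^2 \<Rightarrow> complex^2^2" where
  "mexp A = (\<Sum>n. (1 / fact n) *\<^sub>R (((**) A ^^ n) (mat 1)))"

text \<open>Admissible parameters: \<open>\<Sum> t\<^sub>i z\<^sup>i\<close> converges on \<open>{z. norm z \<le> 1 / r}\<close> for some \<open>r < 1\<close>.\<close>

definition params :: "(nat \<Rightarrow> complex) set" where
  "params = {t. conv_radius t > 1}"

text \<open>\<open>\<gamma>\<^sub>0(t)\<close>, \<open>\<gamma>\<^sub>1(t)\<close> are \<open>gam 0 t\<close>, \<open>gam 1 t\<close>, while \<open>\<gamma>\<^sub>0\<^sup>c(s)\<close>, \<open>\<gamma>\<^sub>1\<^sup>c(s)\<close>
  are \<open>gam_c 1 s\<close>, \<open>gam_c 0 s\<close>: the first argument is the lowest index occurring in the sum, and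
  parameters of smaller index are ignored.\<close>

definition gam :: "nat \<Rightarrow> (nat \<Rightarrow> complex) \<Rightarrow> loop" where
  "gam l t = abs_loop (\<lambda>z. mexp (\<Sum>i. cscale (t (i + l) * z ^ (i + l)) Q0))"

definition gam_c :: "nat \<Rightarrow> (nat \<Rightarrow> complex) \<Rightarrow> loop" where
  "gam_c l s = abs_loop (\<lambda>z. mexp (\<Sum>k. cscale (s (k + l) * z powi (- int (k + l))) Q0))"

definition Gam :: "nat \<Rightarrow> loop set" where
  "Gam l = gam l ` params"

definition Gam0c :: "loop set" where "Gam0c = gam_c 1 ` params"

definition Gam1c :: "loop set" where "Gam1c = gam_c 0 ` params"

section \<open>Data attached to a point\<close>

text \<open>Throughout, \<open>d\<close> stands for \<open>\<delta>(m)\<close>, so that \<open>\<delta>(-m)\<close> is the inverse of \<open>d\<close>;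
  \<open>l\<close> is \<open>0\<close> (AKNS) or \<open>1\<close> (strict AKNS).\<close>

definition conj_loop :: "loop \<Rightarrow> loop \<Rightarrow> loop \<Rightarrow> loop" where
  "conj_loop g d \<gamma> =
     d \<otimes>\<^bsub>LGL2\<^esub> \<gamma> \<otimes>\<^bsub>LGL2\<^esub> g \<otimes>\<^bsub>LGL2\<^esub> inv\<^bsub>LGL2\<^esub> \<gamma> \<otimes>\<^bsub>LGL2\<^esub> inv\<^bsub>LGL2\<^esub> d"

definition Dom :: "nat \<Rightarrow> loop \<Rightarrow> loop \<Rightarrow> loop set" where
  "Dom l g d = {\<gamma> \<in> Gam l. conj_loop g d \<gamma> \<in> big_cell}"

definition BC :: "nat \<Rightarrow> loop \<Rightarrow> loop \<Rightarrow> bool" where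
  "BC l g d \<longleftrightarrow> (\<exists>\<gamma>\<in>Gam l. conj_loop g d \<gamma> \<in> big_cell)"

text \<open>Analyticity in the sense of infinite-dimensional holomorphy: continuity together with
  holomorphy along all complex lines in the coordinates \<open>t\<close>.\<close>

definition analytic_fun :: "nat \<Rightarrow> loop set \<Rightarrow> (loop \<Rightarrow> complex) \<Rightarrow> bool" where
  "analytic_fun l D f \<longleftrightarrow> continuous_map (subtopology loop_topology D) euclidean f \<and>
     (\<forall>t\<in>params. \<forall>s\<in>params. gam l t \<in> D \<longrightarrow>
        (\<lambda>\<zeta>. f (gam l (\<lambda>i. t i + \<zeta> * s i))) analytic_on {0})"

definition Rfun :: "nat \<Rightarrow> loop \<Rightarrow> loop \<Rightarrow> (complex, loop \<Rightarrow> complex) module" where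
  "Rfun l g d = (let D = Dom l g d in
     \<lparr>carrier = {f \<in> extensional D. analytic_fun l D f},
      mult = (\<lambda>f h. \<lambda>\<gamma>\<in>D. f \<gamma> * h \<gamma>), one = (\<lambda>\<gamma>\<in>D. 1),
      zero = (\<lambda>\<gamma>\<in>D. 0), add = (\<lambda>f h. \<lambda>\<gamma>\<in>D. f \<gamma> + h \<gamma>),
      smult = (\<lambda>c f. \<lambda>\<gamma>\<in>D. c * f \<gamma>)\<rparr>)"

text \<open>\<open>\<partial>/\<partial>t\<^sub>i\<close>. The coordinates \<open>t\<close> of a point are unique up to \<open>t\<^sub>0\<close>, which matters only
  modulo \<open>2\<pi>\<close> for \<open>l = 0\<close> and not at all for \<open>l = 1\<close>; the value does not depend on
  the choice.\<close>

definition part_t :: "nat \<Rightarrow> loop \<Rightarrow> loop \<Rightarrow> nat \<Rightarrow> (loop \<Rightarrow> complex) \<Rightarrow> loop \<Rightarrow> complex" where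
  "part_t l g d i f = (\<lambda>\<gamma>\<in>Dom l g d.
     let t = (SOME t. t \<in> params \<and> gam l t = \<gamma>)
     in deriv (\<lambda>\<tau>. f (gam l (t(i := \<tau>)))) (t i))"

definition u_minus :: "loop \<Rightarrow> loop \<Rightarrow> loop \<Rightarrow> loop" where
  "u_minus g d \<gamma> = (THE u. u \<in> U_minus \<and>
     (\<exists>p\<in>P_plus. conj_loop g d \<gamma> = inv\<^bsub>LGL2\<^esub> u \<otimes>\<^bsub>LGL2\<^esub> p))"

definition p_minus :: "loop \<Rightarrow> loop \<Rightarrow> loop \<Rightarrow> loop" where
  "p_minus g d \<gamma> = (THE p. p \<in> P_minus \<and>
     (\<exists>u\<in>U_plus. conj_loop g d \<gamma> = inv\<^bsub>LGL2\<^esub> p \<otimes>\<^bsub>LGL2\<^esub> u))"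

section \<open>The hierarchies\<close>

definition complex_ring :: "complex ring" where
  "complex_ring = \<lparr>carrier = UNIV, mult = (*), one = 1, zero = 0, add = (+)\<rparr>"

definition setting ::
    "nat set \<Rightarrow> (complex, 'r) module \<Rightarrow> (nat \<Rightarrow> 'r \<Rightarrow> 'r) \<Rightarrow> bool" where
  "setting I R D \<longleftrightarrow> Module.algebra complex_ring R \<and>
     (\<forall>i\<in>I. D i \<in> carrier R \<rightarrow> carrier R \<and>
        (\<forall>a\<in>carrier R. \<forall>b\<in>carrier R. D i (a \<oplus>\<^bsub>R\<^esub> b) = D i a \<oplus>\<^bsub>R\<^esub> D i b \<and>
           D i (a \<otimes>\<^bsub>R\<^esub> b) = D i a \<otimes>\<^bsub>R\<^esub> b \<oplus>\<^bsub>R\<^esub> a \<otimes>\<^bsub>R\<^esub> D i b) \<and>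
        (\<forall>c. \<forall>a\<in>carrier R. D i (c \<odot>\<^bsub>R\<^esub> a) = c \<odot>\<^bsub>R\<^esub> D i a)) \<and>
     (\<forall>i\<in>I. \<forall>j\<in>I. \<forall>a\<in>carrier R. D i (D j a) = D j (D i a))"

definition gl2 :: "('r, 'x) ring_scheme \<Rightarrow> ('r^2^2) ring" where
  "gl2 R = \<lparr>carrier = {A. \<forall>a b. A $ a $ b \<in> carrier R},
     mult = (\<lambda>A B. \<chi> a b. \<Oplus>\<^bsub>R\<^esub>c\<in>UNIV. A $ a $ c \<otimes>\<^bsub>R\<^esub> B $ c $ b),
     one = (\<chi> a b. if a = b then \<one>\<^bsub>R\<^esub> else \<zero>\<^bsub>R\<^esub>),
     zero = (\<chi> a b. \<zero>\<^bsub>R\<^esub>),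
     add = (\<lambda>A B. \<chi> a b. A $ a $ b \<oplus>\<^bsub>R\<^esub> B $ a $ b)\<rparr>"

text \<open>\<open>S[z, z\<^sup>-\<^sup>1)\<close>: the function \<open>X\<close> stands for \<open>\<Sum>\<^sub>j X\<^sub>j z\<^sup>j\<close>. The index set in the product is
  finite because both supports are bounded above.\<close>

definition laurent :: "('s, 'x) ring_scheme \<Rightarrow> (int \<Rightarrow> 's) ring" where
  "laurent S = \<lparr>carrier = {X. (\<forall>j. X j \<in> carrier S) \<and> (\<exists>N. \<forall>j>N. X j = \<zero>\<^bsub>S\<^esub>)},
     mult = (\<lambda>X Y n. \<Oplus>\<^bsub>S\<^esub>j\<in>{j. X j \<noteq> \<zero>\<^bsub>S\<^esub> \<and> Y (n - j) \<noteq> \<zero>\<^bsub>S\<^esub>}. X j \<otimes>\<^bsub>S\<^esub> Y (n - j)),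
     one = (\<lambda>j. if j = 0 then \<one>\<^bsub>S\<^esub> else \<zero>\<^bsub>S\<^esub>),
     zero = (\<lambda>j. \<zero>\<^bsub>S\<^esub>),
     add = (\<lambda>X Y j. X j \<oplus>\<^bsub>S\<^esub> Y j)\<rparr>"

type_synonym 'r series = "int \<Rightarrow> 'r^2^2"

abbreviation gl2z :: "(complex, 'r) module \<Rightarrow> 'r series ring" where
  "gl2z R \<equiv> laurent (gl2 R)"

text \<open>\<open>A z\<^sup>k\<close> for a complex matrix \<open>A\<close>.\<close>

definition monomial :: "(complex, 'r) module \<Rightarrow> complex^2^2 \<Rightarrow> int \<Rightarrow> 'r series" where
  "monomial R A k = (\<lambda>j. \<chi> a b. if j = k then A $ a $ b \<odot>\<^bsub>R\<^esub> \<one>\<^bsub>R\<^esub> else \<zero>\<^bsub>R\<^esub>)"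

definition delta_series :: "(complex, 'r) module \<Rightarrow> int \<times> int \<Rightarrow> 'r series" where
  "delta_series R m = (\<lambda>j. \<chi> a b.
     if a = b \<and> j = (if a = 1 then fst m else snd m) then \<one>\<^bsub>R\<^esub> else \<zero>\<^bsub>R\<^esub>)"

definition deriv_series :: "(nat \<Rightarrow> 'r \<Rightarrow> 'r) \<Rightarrow> nat \<Rightarrow> 'r series \<Rightarrow> 'r series" where
  "deriv_series D i X = (\<lambda>j. \<chi> a b. D i (X j $ a $ b))"

definition trunc_ge0 :: "(complex, 'r) module \<Rightarrow> 'r series \<Rightarrow> 'r series" where
  "trunc_ge0 R X = (\<lambda>j. if j \<ge> 0 then X j else \<zero>\<^bsub>gl2 R\<^esub>)"

definition trunc_gt0 :: "(complex, 'r) module \<Rightarrow> 'r series \<Rightarrow> 'r series" where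
  "trunc_gt0 R X = (\<lambda>j. if j > 0 then X j else \<zero>\<^bsub>gl2 R\<^esub>)"

definition commutator :: "(complex, 'r) module \<Rightarrow> 'r series \<Rightarrow> 'r series \<Rightarrow> 'r series" where
  "commutator R X Y = X \<otimes>\<^bsub>gl2z R\<^esub> Y \<ominus>\<^bsub>gl2z R\<^esub> Y \<otimes>\<^bsub>gl2z R\<^esub> X"

definition G_lt0 :: "(complex, 'r) module \<Rightarrow> 'r series set" where
  "G_lt0 R = {h \<in> carrier (gl2z R). h 0 = \<one>\<^bsub>gl2 R\<^esub> \<and> (\<forall>j>0. h j = \<zero>\<^bsub>gl2 R\<^esub>)}"

definition G_le0 :: "(complex, 'r) module \<Rightarrow> 'r series set" where
  "G_le0 R = {h \<in> carrier (gl2z R). h 0 \<in> Units (gl2 R) \<and> (\<forall>j>0. h j = \<zero>\<^bsub>gl2 R\<^esub>)}"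

definition dress ::
    "(complex, 'r) module \<Rightarrow> 'r series \<Rightarrow> 'r series \<Rightarrow> 'r series" where
  "dress R h X = h \<otimes>\<^bsub>gl2z R\<^esub> X \<otimes>\<^bsub>gl2z R\<^esub> inv\<^bsub>gl2z R\<^esub> h"

definition akns_solution ::
    "(complex, 'r) module \<Rightarrow> (nat \<Rightarrow> 'r \<Rightarrow> 'r) \<Rightarrow> 'r series \<Rightarrow> bool" where
  "akns_solution R D Q \<longleftrightarrow> (\<exists>h\<in>G_lt0 R. Q = dress R h (monomial R Q0 0)) \<and>
     (\<forall>i\<ge>0. deriv_series D i Q =
        commutator R (trunc_ge0 R (Q \<otimes>\<^bsub>gl2z R\<^esub> monomial R (mat 1) (int i))) Q)"

definition strict_akns_solution ::
    "(complex, 'r) module \<Rightarrow> (nat \<Rightarrow> 'r \<Rightarrow> 'r) \<Rightarrow> 'r series \<Rightarrow> bool" where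
  "strict_akns_solution R D Z \<longleftrightarrow> (\<exists>h\<in>G_le0 R. Z = dress R h (monomial R Q0 1)) \<and>
     (\<forall>i\<ge>1. deriv_series D i Z =
        commutator R (trunc_gt0 R (Z \<otimes>\<^bsub>gl2z R\<^esub> monomial R (mat 1) (int i - 1))) Z)"

section \<open>Wave matrices\<close>

text \<open>Elements of the free modules \<open>M\<^sub>0\<close> and \<open>M\<^sub>1\<close>: \<open>Osc g\<close> is the formal product \<open>{g(z)}\<psi>\<^sub>0\<close>,
  respectively \<open>{g(z)}\<phi>\<^sub>0\<close>. The module operations are given by the same formulas in both cases;
  the right action is only used for \<open>A = Q\<^sub>0\<close> on \<open>M\<^sub>0\<close> and \<open>A = Q\<^sub>0 z\<close> on \<open>M\<^sub>1\<close>.\<close>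

datatype 'r osc = Osc (osc_coeff: "'r series")

definition osc_lact :: "(complex, 'r) module \<Rightarrow> 'r series \<Rightarrow> 'r osc \<Rightarrow> 'r osc" where
  "osc_lact R X \<psi> = Osc (X \<otimes>\<^bsub>gl2z R\<^esub> osc_coeff \<psi>)"

definition osc_ract :: "(complex, 'r) module \<Rightarrow> 'r osc \<Rightarrow> 'r series \<Rightarrow> 'r osc" where
  "osc_ract R \<psi> A = Osc (osc_coeff \<psi> \<otimes>\<^bsub>gl2z R\<^esub> A)"

definition osc_deriv ::
    "(complex, 'r) module \<Rightarrow> (nat \<Rightarrow> 'r \<Rightarrow> 'r) \<Rightarrow> nat \<Rightarrow> 'r osc \<Rightarrow> 'r osc" where
  "osc_deriv R D i \<psi> = Osc (deriv_series D i (osc_coeff \<psi>) \<oplus>\<^bsub>gl2z R\<^esub>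
     osc_coeff \<psi> \<otimes>\<^bsub>gl2z R\<^esub> monomial R Q0 (int i))"

definition akns_wave ::
    "(complex, 'r) module \<Rightarrow> (nat \<Rightarrow> 'r \<Rightarrow> 'r) \<Rightarrow> int \<times> int \<Rightarrow> 'r osc \<Rightarrow> bool" where
  "akns_wave R D m \<psi> \<longleftrightarrow> (\<exists>h\<in>G_lt0 R. \<psi> = Osc (h \<otimes>\<^bsub>gl2z R\<^esub> delta_series R m) \<and>
     (let Q = dress R h (monomial R Q0 0) in
        osc_lact R Q \<psi> = osc_ract R \<psi> (monomial R Q0 0) \<and>
        (\<forall>i\<ge>0. osc_deriv R D i \<psi> =
           osc_lact R (trunc_ge0 R (Q \<otimes>\<^bsub>gl2z R\<^esub> monomial R (mat 1) (int i))) \<psi>)))"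

definition strict_akns_wave ::
    "(complex, 'r) module \<Rightarrow> (nat \<Rightarrow> 'r \<Rightarrow> 'r) \<Rightarrow> int \<times> int \<Rightarrow> 'r osc \<Rightarrow> bool" where
  "strict_akns_wave R D m \<phi> \<longleftrightarrow> (\<exists>h\<in>G_le0 R. \<phi> = Osc (h \<otimes>\<^bsub>gl2z R\<^esub> delta_series R m) \<and>
     (let Z = dress R h (monomial R Q0 1) in
        osc_lact R Z \<phi> = osc_ract R \<phi> (monomial R Q0 1) \<and>
        (\<forall>i\<ge>1. osc_deriv R D i \<phi> =
           osc_lact R (trunc_gt0 R (Z \<otimes>\<^bsub>gl2z R\<^esub> monomial R (mat 1) (int i - 1))) \<phi>)))"

text \<open>A loop depending on \<open>\<gamma> \<in> D\<close> as the series whose coefficients are the functions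
  on \<open>D\<close> given by its Laurent coefficients.\<close>

definition series_of :: "loop set \<Rightarrow> (loop \<Rightarrow> loop) \<Rightarrow> (loop \<Rightarrow> complex) series" where
  "series_of D u = (\<lambda>j. \<chi> a b. (\<lambda>\<gamma>\<in>D. loop_coeff (u \<gamma>) j $ a $ b))"

definition u_series :: "loop \<Rightarrow> loop \<Rightarrow> (loop \<Rightarrow> complex) series" where
  "u_series g d = series_of (Dom 0 g d) (u_minus g d)"

definition p_series :: "loop \<Rightarrow> loop \<Rightarrow> (loop \<Rightarrow> complex) series" where
  "p_series g d = series_of (Dom 1 g d) (p_minus g d)"

definition Psi :: "loop \<Rightarrow> int \<times> int \<Rightarrow> (loop \<Rightarrow> complex) osc" where
  "Psi g m = (let R = Rfun 0 g (delta m) in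
     Osc (u_series g (delta m) \<otimes>\<^bsub>gl2z R\<^esub> delta_series R m))"

definition Phi :: "loop \<Rightarrow> int \<times> int \<Rightarrow> (loop \<Rightarrow> complex) osc" where
  "Phi g m = (let R = Rfun 1 g (delta m) in
     Osc (p_series g (delta m) \<otimes>\<^bsub>gl2z R\<^esub> delta_series R m))"

definition Qsol :: "loop \<Rightarrow> loop \<Rightarrow> (loop \<Rightarrow> complex) series" where
  "Qsol g d = (let R = Rfun 0 g d in dress R (u_series g d) (monomial R Q0 0))"

definition Zsol :: "loop \<Rightarrow> loop \<Rightarrow> (loop \<Rightarrow> complex) series" where
  "Zsol g d = (let R = Rfun 1 g d in dress R (p_series g d) (monomial R Q0 1))"

end

theory Submission
  imports Defs
begin

text \<open>Both hierarchies are treated at once: with \<open>l = 0\<close> (AKNS) or \<open>l = 1\<close> (strict AKNS) the big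
  cell consists of the products of \<open>Npart l\<close> and \<open>Ppart l\<close>, and the factor in \<open>Npart l\<close> is unique.
  Near a point of the big cell the factors are found from a fixed point equation for the Laurent
  coefficients, which gives sequential openness of the cell and continuity of the factors. Along a
  line \<open>t + \<zeta> s\<close> the equation \<open>\<delta> \<gamma> g \<gamma>\<^sup>-\<^sup>1 \<delta>\<^sup>-\<^sup>1 = u\<^sup>-\<^sup>1 p\<close> is differentiated: splitting
  \<open>u Q\<^sub>0 z\<^sup>i u\<^sup>-\<^sup>1\<close> at degree \<open>l\<close> yields \<open>\<partial>\<^sub>i u = - (u Q\<^sub>0 z\<^sup>i u\<^sup>-\<^sup>1)\<^bsub><l\<^esub> u\<close>, and the equations
  for wave matrices and solutions are algebraic consequences. They are verified after evaluation at
  each \<open>\<gamma>\<close>, where series become matrices over the field of formal Laurent series in \<open>1 / z\<close>.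
  Replacing the point by one of its orbit multiplies \<open>u\<close> on the right by a diagonal loop, which
  commutes with \<open>Q\<^sub>0\<close>.\<close>

section \<open>Laurent coefficients on annuli\<close>

text \<open>The obstacle is analytic: the coefficients of the factor have to be analytic functions,
  and the ring of such functions has to be closed under every
  \<open>\<partial>/\<partial>t_i\<close>, continuity being meant for the direct limit topology on
  germs. The fixed point equation is therefore solved with explicit constants, so that its solution
  equals minus the datum up to a quadratic error. This one estimate gives continuity of the factors
  as well as their derivative along a line, in the role of an implicit function theorem. Parameters
  are not determined by their loop, so differentiation is expressed by right translation with the
  one-parameter subgroups \<open>expo l s\<close>; the value of \<open>part_t\<close> is then
  visibly independent of the chosen \<open>t\<close>. Continuity of a derivative comes from uniform
  convergence on a disc of translations whose radius can be kept fixed along a convergent sequence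
  (\<open>Dom_tube\<close>). On the algebraic side, inverses are definite descriptions, and
  evaluation yields both the candidates and their uniqueness.\<close>

definition ann :: "real \<Rightarrow> complex set" where
  "ann r = {z. r < norm z \<and> norm z < 1 / r}"

lemma open_ann [simp]: "open (ann r)"
proof -
  have "ann r = norm -` {r<..<1/r}" by (auto simp: ann_def)
  then show ?thesis by (simp add: open_vimage continuous_on_norm)
qed

lemma ann_mono: "0 < r \<Longrightarrow> r \<le> s \<Longrightarrow> ann s \<subseteq> ann r"
  unfolding ann_def using frac_le[of 1 1 r s] by auto

lemma annulus_subset_ann: "0 < r \<Longrightarrow> r < s \<Longrightarrow> annulus s \<subseteq> ann r"
  unfolding ann_def annulus_def using frac_less2[of 1 1 r s] by auto

lemma ann_subset_annulus: "ann r \<subseteq> annulus r"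
  by (auto simp: ann_def annulus_def)

lemma sphere_subset_ann: "0 < r \<Longrightarrow> r < 1 \<Longrightarrow> sphere 0 1 \<subseteq> ann r"
  by (auto simp: ann_def)

lemma zero_notin_ann: "0 < r \<Longrightarrow> z \<in> ann r \<Longrightarrow> z \<noteq> 0"
  by (auto simp: ann_def)

lemma compact_annulus: "compact (annulus r)"
proof -
  have "annulus r = cball 0 (1/r) \<inter> (norm -` {r..})" by (auto simp: annulus_def)
  moreover have "closed (norm -` {r..} :: complex set)" by (intro closed_vimage) (auto intro: continuous_on_norm)
  ultimately show ?thesis by (simp add: compact_Int_closed)
qed

lemma inverse_in_ann: "0 < r \<Longrightarrow> z \<in> ann r \<Longrightarrow> 1 / z \<in> ann r"
proof -
  assume r: "0 < r" and z: "z \<in> ann r"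
  have 1: "r < norm z" "norm z < 1 / r" using z by (auto simp: ann_def)
  have "1 / (1/r) < 1 / norm z" using 1 r by (intro divide_strict_left_mono mult_pos_pos) auto
  moreover have "1 / norm z < 1 / r" using 1 r by (intro divide_strict_left_mono mult_pos_pos) auto
  ultimately show "1 / z \<in> ann r" by (simp add: ann_def norm_divide)
qed

text \<open>Compactness puts a uniform \<open>e\<close>-neighbourhood of the closed annulus inside
  \<open>U\<close>, and a point of a slightly larger open annulus is within \<open>e\<close> of its
  radial projection. From here on arbitrary neighbourhoods can be replaced by the concrete sets
  \<open>ann s\<close>.\<close>

lemma open_annulus_enlarge:
  assumes "open U" "annulus r \<subseteq> U" "0 < r" "r < 1"
  obtains s where "0 < s" "s < r" "ann s \<subseteq> U"
proof -
  obtain e where e: "e > 0" "(\<Union>x\<in>annulus r. ball x e) \<subseteq> U"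
    using compact_subset_open_imp_ball_epsilon_subset[OF compact_annulus assms(1,2)] by blast
  have r1: "1 < 1 / r" "r \<le> 1 / r" using assms by (simp_all add: less_imp_le order.trans[of r 1])
  \<comment> \<open>The three lower bounds keep \<open>s\<close> positive, move the inner radius
    inwards by at most \<open>e / 2\<close>, and move the outer radius \<open>1 / s\<close> outwards
    by at most \<open>e / 2\<close>.\<close>
  define s where "s = Max {r / 2, r - e / 2, 1 / (1 / r + e / 2)}"
  have s: "r / 2 \<le> s" "r - e / 2 \<le> s" "1 / (1 / r + e / 2) \<le> s" by (simp_all add: s_def)
  have pos: "0 < 1 / r + e / 2" using e assms by (simp add: add_pos_pos)
  have "1 / (1 / r + e / 2) < 1 / (1 / r)" using e assms pos
    by (intro divide_strict_left_mono mult_pos_pos) auto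
  then have sr: "s < r" using assms e by (auto simp: s_def)
  have s0: "0 < s" using s(1) assms by linarith
  have "1 / s \<le> 1 / (1 / (1 / r + e / 2))" using s(3) s0 pos
    by (intro divide_left_mono mult_pos_pos) auto
  then have s1: "1 / s \<le> 1 / r + e / 2" by simp
  have "z \<in> U" if z: "z \<in> ann s" for z
  proof -
    \<comment> \<open>\<open>c\<close> is the norm of \<open>z\<close> clamped to the closed
      annulus, so \<open>?x\<close> below is the radial projection of \<open>z\<close>.\<close>
    define c where "c = max r (min (norm z) (1 / r))"
    have z0: "norm z > 0" using z s0 by (auto simp: ann_def)
    have zs: "s < norm z" "norm z < 1 / s" using z by (auto simp: ann_def)
    have c: "r \<le> c" "c \<le> 1 / r" "\<bar>c - norm z\<bar> < e" using zs s s1 r1 assms(3,4) e(1) by (auto simp: c_def)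
    let ?x = "of_real (c / norm z) * z"
    have "norm ?x = c" using c assms z0 by (simp add: norm_mult norm_divide)
    then have "?x \<in> annulus r" using c by (auto simp: annulus_def)
    moreover have "?x - z = of_real ((c - norm z) / norm z) * z"
      using z0 by (simp add: field_simps)
    then have "norm (?x - z) = \<bar>(c - norm z) / norm z\<bar> * norm z"
      by (simp only: norm_mult norm_of_real)
    then have "norm (?x - z) = \<bar>c - norm z\<bar>" using z0 by (simp add: abs_divide)
    then have "z \<in> ball ?x e" using c by (simp add: dist_norm)
    ultimately show ?thesis using e(2) by blast
  qed
  then show ?thesis using that[OF s0 sr] by blast
qed

lemma open_cball_enlarge:
  assumes "open U" "cball (0::complex) R \<subseteq> U" "0 < R"
  obtains S where "R < S" "ball 0 S \<subseteq> U"
proof -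
  obtain e where e: "e > 0" "(\<Union>x\<in>cball 0 R. ball x e) \<subseteq> U"
    using compact_subset_open_imp_ball_epsilon_subset[OF compact_cball assms(1,2)] by blast
  have "z \<in> U" if z: "z \<in> ball 0 (R + e)" for z
  proof (cases "norm z \<le> R")
    case True
    then show ?thesis using assms by auto
  next
    case False
    let ?x = "of_real (R / norm z) * z"
    have z0: "norm z > 0" using False assms(3) by linarith
    have "norm ?x = R" using assms z0 by (simp add: norm_mult norm_divide)
    then have "?x \<in> cball 0 R" by auto
    moreover have "?x - z = of_real ((R - norm z) / norm z) * z"
      using z0 by (simp add: field_simps)
    then have "norm (?x - z) = \<bar>(R - norm z) / norm z\<bar> * norm z"
      by (simp only: norm_mult norm_of_real)
    then have "norm (?x - z) = \<bar>R - norm z\<bar>" using z0 by (simp add: abs_divide)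
    then have "z \<in> ball ?x e" using z False by (simp add: dist_norm)
    ultimately show ?thesis using e(2) by blast
  qed
  then show ?thesis using that[of "R + e"] e(1) by (simp add: subset_iff)
qed

text \<open>The linear homotopy between concentric circles moves each point along its ray, and it
  stays in the annulus because the interval of admissible radii is convex.\<close>

lemma circle_deform:
  assumes "f holomorphic_on ann r" "0 < r" "r < \<rho>" "\<rho> < 1 / r"
  shows "contour_integral (circlepath 0 \<rho>) f = contour_integral (circlepath 0 1) f"
proof -
  have r1: "r < 1"
  proof (rule ccontr)
    assume "\<not> r < 1"
    then have "1 / r \<le> 1 / 1" by (intro divide_left_mono) auto
    with assms \<open>\<not> r < 1\<close> show False by auto
  qed
  have "homotopic_loops (ann r) (circlepath 0 \<rho>) (circlepath 0 1)"
  proof (rule homotopic_loops_linear)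
    fix t :: real assume "t \<in> {0..1}"
    show "closed_segment (circlepath 0 \<rho> t) (circlepath 0 1 t) \<subseteq> ann r"
    proof
      fix x assume "x \<in> closed_segment (circlepath 0 \<rho> t) (circlepath 0 1 t)"
      then obtain u where u: "0 \<le> u" "u \<le> 1" and x: "x = (1 - u) *\<^sub>R circlepath 0 \<rho> t + u *\<^sub>R circlepath 0 1 t"
        by (auto simp: closed_segment_def)
      define w where "w = exp (2 * of_real pi * \<i> * of_real t)"
      have w: "norm w = 1" by (simp add: w_def norm_exp_eq_Re)
      have "x = of_real ((1-u)*\<rho> + u) * w"
        unfolding x circlepath w_def[symmetric] by (simp add: scaleR_conv_of_real distrib_right)
      then have nx: "norm x = \<bar>(1-u)*\<rho> + u\<bar>"
        using w by (simp only: norm_mult norm_of_real mult_1_right)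
      have "(1-u)*\<rho> + u*1 \<in> {r<..<1/r}"
        using convexD_alt[of "{r<..<1/r}" \<rho> 1 u] assms r1 u by (auto simp: mult.commute)
      then show "x \<in> ann r" using nx assms by (auto simp: ann_def)
    qed
  qed (auto simp: path_circlepath)
  then show ?thesis
    by (rule Cauchy_theorem_homotopic_loops[OF _ open_ann assms(1)]) auto
qed

text \<open>The same unit circle integral as in \<open>loop_coeff\<close>, but for functions instead
  of germs. Only values on the unit circle enter, which is why agreement or uniform convergence
  there controls all coefficients.\<close>

definition cf :: "(complex \<Rightarrow> complex) \<Rightarrow> int \<Rightarrow> complex" where
  "cf f k = 1 / (2 * of_real pi * \<i>) * contour_integral (circlepath 0 1) (\<lambda>z. f z * z powi (- k - 1))"

lemma cf_circle:
  assumes "f holomorphic_on ann r" "0 < r" "r < \<rho>" "\<rho> < 1 / r"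
  shows "cf f k = 1 / (2 * of_real pi * \<i>) * contour_integral (circlepath 0 \<rho>) (\<lambda>z. f z * z powi (- k - 1))"
  unfolding cf_def
  by (subst circle_deform[OF _ assms(2-)]) (use assms in \<open>auto intro!: holomorphic_intros simp: ann_def\<close>)

text \<open>Cauchy's estimate with a free radius. Taking \<open>\<rho>\<close> above 1 gives decay
  for positive \<open>k\<close>, taking it below 1 gives decay for negative \<open>k\<close>;
  \<open>mcf_bound\<close> combines the two.\<close>

lemma cf_bound_circle:
  assumes "f holomorphic_on ann r" "0 < r" "r < \<rho>" "\<rho> < 1 / r" "\<And>z. norm z = \<rho> \<Longrightarrow> norm (f z) \<le> M"
  shows "norm (cf f k) \<le> M * \<rho> powi (- k)"
proof -
  have \<rho>: "\<rho> > 0" using assms by auto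
  let ?g = "\<lambda>z. f z * z powi (- k - 1)"
  have "?g contour_integrable_on circlepath 0 \<rho>"
    using assms(1-4) \<rho>
    by (intro contour_integrable_holomorphic_simple[where S="ann r"] holomorphic_intros open_ann
      valid_path_circlepath) (auto simp: ann_def)
  moreover have M: "0 \<le> M" using order_trans[OF norm_ge_zero assms(5)[of "of_real \<rho>"]] \<rho> by simp
  ultimately have "norm (contour_integral (circlepath 0 \<rho>) ?g) \<le> (M * \<rho> powi (-k-1)) * (2 * pi * \<rho>)"
    using \<rho> assms(5) by (intro has_contour_integral_bound_circlepath[OF has_contour_integral_integral])
      (auto simp: norm_mult norm_power_int intro!: mult_right_mono)
  then have "norm (cf f k) \<le> 1 / (2*pi) * ((M * \<rho> powi (-k-1)) * (2 * pi * \<rho>))"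
    unfolding cf_circle[OF assms(1-4)] norm_mult by (simp add: norm_divide norm_mult field_simps)
  also have "\<dots> = M * \<rho> powi (- k)"
    using \<rho> power_int_add[of \<rho> "-k-1" 1] by (simp add: field_simps)
  finally show ?thesis .
qed

lemma cf_cong: "(\<And>z. norm z = 1 \<Longrightarrow> f z = g z) \<Longrightarrow> cf f k = cf g k"
  unfolding cf_def by (subst contour_integral_eq[of _ _ "\<lambda>z. g z * z powi (- k - 1)"]) auto

lemma cf_bound:
  assumes "continuous_on (sphere 0 1) f" "\<And>z. norm z = 1 \<Longrightarrow> norm (f z) \<le> M"
  shows "norm (cf f k) \<le> M"
proof -
  let ?g = "\<lambda>z. f z * z powi (- k - 1)"
  have "?g contour_integrable_on circlepath 0 1"
    using assms by (intro contour_integrable_continuous_circlepath continuous_intros) auto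
  moreover have M: "0 \<le> M" using order_trans[OF norm_ge_zero assms(2)[of 1]] by simp
  ultimately have "norm (contour_integral (circlepath 0 1) ?g) \<le> M * (2 * pi * 1)"
    using assms by (intro has_contour_integral_bound_circlepath[OF has_contour_integral_integral])
      (auto simp: norm_mult norm_power_int)
  then show ?thesis
    unfolding cf_def norm_mult by (simp add: norm_divide norm_mult field_simps)
qed

lemma cf_integrable: "continuous_on (sphere 0 1) f \<Longrightarrow> (\<lambda>z. f z * z powi k) contour_integrable_on circlepath 0 1"
    by (intro contour_integrable_continuous_circlepath continuous_intros) auto

lemma cf_add:
  assumes "continuous_on (sphere 0 1) f" "continuous_on (sphere 0 1) g"
  shows "cf (\<lambda>z. f z + g z) k = cf f k + cf g k"
  unfolding cf_def using cf_integrable[OF assms(1)] cf_integrable[OF assms(2)]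
  by (simp add: distrib_right contour_integral_add distrib_left)

lemma cf_cmult: "continuous_on (sphere 0 1) f \<Longrightarrow> cf (\<lambda>z. c * f z) k = c * cf f k"
  unfolding cf_def using cf_integrable[of f]
  by (simp add: mult.assoc contour_integral_lmul)

lemma cf_sum:
  assumes "finite I" "\<And>i. i \<in> I \<Longrightarrow> continuous_on (sphere 0 1) (f i)"
  shows "cf (\<lambda>z. \<Sum>i\<in>I. f i z) k = (\<Sum>i\<in>I. cf (f i) k)"
  unfolding cf_def using assms
  by (simp add: sum_distrib_right contour_integral_sum[OF assms(1)] cf_integrable sum_distrib_left)

lemma cf_shift: "cf (\<lambda>z. f z * z powi n) k = cf f (k - n)"
proof -
  have *: "z powi n * z powi (- k - 1) = z powi (- (k-n) - 1)" if "norm z = 1" for z :: complex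
  proof -
    have "z \<noteq> 0" using that by auto
    then show ?thesis using power_int_add[of z n "- k - 1"] by (simp add: algebra_simps)
  qed
  have "cf (\<lambda>z. f z * z powi n) k = 1 / (2 * of_real pi * \<i>) * contour_integral (circlepath 0 1) (\<lambda>z. f z * z powi (- (k-n) - 1))"
    unfolding cf_def by (rule arg_cong[where f="\<lambda>x. _ * x"], rule contour_integral_eq) 
      (auto simp: mult.assoc * simp del: mult_cancel_left)
  then show ?thesis by (simp add: cf_def)
qed

lemma cf_tendsto:
  assumes "\<And>n. continuous_on (sphere 0 1) (f n)" "uniform_limit (sphere 0 1) f g sequentially"
  shows "(\<lambda>n::nat. cf (f n) k) \<longlonglongrightarrow> cf g k"
proof -
  have g: "continuous_on (sphere 0 1) g"
    by (rule uniform_limit_theorem[OF _ assms(2)]) (simp_all add: assms(1))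
  have 1: "bounded (g ` sphere 0 1)"
    by (intro compact_imp_bounded compact_continuous_image g compact_sphere)
  have 2: "bounded ((\<lambda>z::complex. z powi (-k-1)) ` sphere 0 1)"
    by (intro compact_imp_bounded compact_continuous_image compact_sphere)
       (auto intro!: continuous_intros)
  show ?thesis unfolding cf_def
  proof (intro tendsto_mult_left contour_integral_uniform_limit_circlepath(2) always_eventually allI cf_integrable)
    show "uniform_limit (sphere 0 1) (\<lambda>n z. f n z * z powi (- k - 1)) (\<lambda>z. g z * z powi (- k - 1)) sequentially"
      by (rule uniform_lim_mult[OF assms(2) uniform_limit_const 1 2])
  qed (auto intro: assms(1))
qed

text \<open>For \<open>z\<close> outside the circle the kernel \<open>1 / (w - z)\<close> is minus
  the geometric series of \<open>w^n / z^(n+1)\<close>, uniformly on the circle, so the integral is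
  a limit of combinations of the vanishing moments.\<close>

lemma contour_integral_Cauchy_kernel_zero:
  assumes "0 < s" "continuous_on (sphere 0 s) f" "s < norm z"
    "\<And>n. contour_integral (circlepath 0 s) (\<lambda>w. f w * w ^ n) = 0"
  shows "contour_integral (circlepath 0 s) (\<lambda>w. f w / (w - z)) = 0"
proof -
  let ?q = "s / norm z"
  have z0: "z \<noteq> 0" using assms by auto
  have q: "?q < 1" "0 \<le> ?q" using assms(1,3) z0 by auto
  define c where "c n = - 1 / z ^ Suc n" for n
  \<comment> \<open>Partial sums of the expanded integrand; the relative error of \<open>h N\<close>
    is exactly \<open>(w / z) ^ N\<close>.\<close>
  define h where "h N w = (\<Sum>n<N. f w * w ^ n * c n)" for N w
  have eq: "h N w = f w / (w - z) * (1 - (w / z) ^ N)" if "norm w = s" for N w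
  proof -
    have wz: "w \<noteq> z" using that assms by auto
    have "h N w = - f w / z * (\<Sum>n<N. (w/z)^n)"
      by (simp add: h_def c_def sum_distrib_left power_divide)
    also have "(\<Sum>n<N. (w/z)^n) = (1 - (w/z)^N) / (1 - w/z)"
      using wz z0 by (subst sum_gp_strict) auto
    also have "- f w / z * ((1 - (w/z)^N) / (1 - w/z)) = f w / (w - z) * (1 - (w / z) ^ N)"
      using wz z0 by (simp add: field_simps)
    finally show ?thesis .
  qed
  have "continuous_on (sphere 0 s) (\<lambda>w. f w / (w - z))"
    using assms by (intro continuous_intros) auto
  then have bd: "bounded ((\<lambda>w. f w / (w - z)) ` sphere 0 s)"
    by (intro compact_imp_bounded compact_continuous_image compact_sphere)
  have "uniform_limit (sphere 0 s) (\<lambda>N w. (w/z)^N) (\<lambda>_. 0) sequentially"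
  proof (rule uniform_limitI)
    fix e :: real assume "e > 0"
    have "(\<lambda>N. ?q ^ N) \<longlonglongrightarrow> 0" using q by (intro LIMSEQ_realpow_zero) auto
    then have "\<forall>\<^sub>F N in sequentially. ?q ^ N < e" using \<open>e > 0\<close> by (rule order_tendstoD)
    then show "\<forall>\<^sub>F N in sequentially. \<forall>x\<in>sphere 0 s. dist ((x / z) ^ N) 0 < e"
      by eventually_elim (auto simp: norm_power norm_divide)
  qed
  from bounded_linear.uniform_limit[OF bounded_linear_minus[OF bounded_linear_ident] this]
  have "uniform_limit (sphere 0 s) (\<lambda>N w. - ((w/z)^N)) (\<lambda>_. 0) sequentially" by simp
  from uniform_limit_add[OF uniform_limit_const[where c="\<lambda>_. 1::complex"] this]
  have ul1: "uniform_limit (sphere 0 s) (\<lambda>N w. 1 - (w/z)^N) (\<lambda>_. 1) sequentially" by simp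
  have "uniform_limit (sphere 0 s) (\<lambda>N w. f w / (w - z) * (1 - (w/z)^N)) (\<lambda>w. f w / (w - z) * 1) sequentially"
    by (rule uniform_lim_mult[OF uniform_limit_const ul1 bd]) (auto simp: image_constant_conv)
  then have "uniform_limit (sphere 0 s) (\<lambda>N w. f w / (w - z) * (1 - (w/z)^N)) (\<lambda>w. f w / (w - z)) sequentially"
    by (simp only: mult_1_right)
  then have ul: "uniform_limit (sphere 0 s) h (\<lambda>w. f w / (w - z)) sequentially"
    by (rule uniform_limit_cong'[THEN iffD1, rotated -1]) (auto simp: eq)
  have int: "(\<lambda>w. f w * w ^ n) contour_integrable_on circlepath 0 s" for n
    using assms by (intro contour_integrable_continuous_circlepath continuous_intros) auto
  have hi: "h N contour_integrable_on circlepath 0 s" for N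
    unfolding h_def using int by (intro contour_integrable_sum contour_integrable_rmul) auto
  have "contour_integral (circlepath 0 s) (h N) = 0" for N
    unfolding h_def using int assms(4)
    by (subst contour_integral_sum)
       (simp_all add: contour_integrable_rmul contour_integral_rmul)
  with contour_integral_uniform_limit_circlepath(2)[OF always_eventually ul _ assms(1)] hi
  show ?thesis by (simp add: LIMSEQ_const_iff)
qed

text \<open>The extension is the Cauchy integral over the outer circle. On the annulus, Cauchy's
  formula has an outer and an inner term; the moments of \<open>f\<close> on the inner circle are
  its negative coefficients, so the inner term vanishes.\<close>

lemma laurent_ext:
  assumes "f holomorphic_on ann r" "0 < r" "r < s" "s < 1" "\<And>k. k < 0 \<Longrightarrow> cf f k = 0"
  obtains F where "F holomorphic_on ball 0 (1 / s)" "\<And>z. z \<in> ann s \<Longrightarrow> F z = f z"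
proof -
  define R where "R = 1 / s"
  have R: "R > 1" "R < 1 / r" "s < R" using assms by (auto simp: R_def intro!: divide_strict_left_mono less_trans[of s 1])
  have cont: "continuous_on (ann r) f" using assms(1) by (rule holomorphic_on_imp_continuous_on)
  have subR: "sphere 0 R \<subseteq> ann r" "sphere 0 s \<subseteq> ann r" using R assms by (auto simp: ann_def)
  define G where "G = (\<lambda>z. contour_integral (circlepath 0 R) (\<lambda>u. f u / (u - z)))"
  have "G field_differentiable at z" if "z \<in> ball 0 R" for z
  proof -
    have "continuous_on (path_image (circlepath 0 R)) f"
      using cont subR R by (auto intro: continuous_on_subset)
    moreover have "((\<lambda>u. f u / (u - w) ^ 1) has_contour_integral G w) (circlepath 0 R)" if "w \<in> ball 0 R" for w
      unfolding G_def power_one_right using that R subR cont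
      by (intro has_contour_integral_integral contour_integrable_continuous_circlepath continuous_intros)
        (auto intro: continuous_on_subset)
    ultimately show ?thesis
      using Cauchy_next_derivative_circlepath(2)[of 0 R f 1 G z] that by (auto simp: field_differentiable_def)
  qed
  then have "G holomorphic_on ball 0 R" 
    by (auto simp: holomorphic_on_def intro: field_differentiable_at_within)
  then have 1: "(\<lambda>z. G z / (2 * of_real pi * \<i>)) holomorphic_on ball 0 (1 / s)"
    unfolding R_def[symmetric] by (intro holomorphic_intros) auto
  have 2: "G z / (2 * of_real pi * \<i>) = f z" if z: "z \<in> ann s" for z
  proof -
    have z': "s < norm z" "norm z < R" using z by (auto simp: ann_def R_def)
    have "z \<in> interior (ann r)" using z' R assms(2,3) interior_open[OF open_ann] by (simp add: ann_def)
    \<comment> \<open>With the singularity at \<open>z\<close> removed, \<open>g\<close> is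
      holomorphic on the annulus and has equal integrals over both circles. The constant
      \<open>f z\<close> contributes \<open>2 pi i f z\<close> on the outer circle and nothing on
      the inner one, which does not enclose \<open>z\<close>.\<close>
    define g where "g = (\<lambda>w. if w = z then deriv f z else (f w - f z) / (w - z))"
    have g: "g holomorphic_on ann r" unfolding g_def by (rule pole_lemma) fact+
    have cig: "(\<lambda>u. f u / (u - z)) contour_integrable_on circlepath 0 \<rho>" 
      if "\<rho> = R \<or> \<rho> = s" for \<rho>
      using that z' assms R subR cont
      by (intro contour_integrable_continuous_circlepath continuous_intros) (auto intro: continuous_on_subset)
    have cio: "(\<lambda>u. f z / (u - z)) contour_integrable_on circlepath 0 \<rho>" 
      if "\<rho> = R \<or> \<rho> = s" for \<rho>
      using that z' assms R
      by (intro contour_integrable_continuous_circlepath continuous_intros) auto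
    have split: "contour_integral (circlepath 0 \<rho>) g = 
       contour_integral (circlepath 0 \<rho>) (\<lambda>u. f u / (u - z)) - contour_integral (circlepath 0 \<rho>) (\<lambda>u. f z / (u - z))"
      if "\<rho> = R \<or> \<rho> = s" for \<rho>
    proof -
      have "contour_integral (circlepath 0 \<rho>) g = contour_integral (circlepath 0 \<rho>) (\<lambda>u. f u / (u - z) - f z / (u - z))"
        using that z' assms R by (intro contour_integral_eq) (auto simp: g_def diff_divide_distrib)
      then show ?thesis using contour_integral_diff[OF cig cio] that by simp
    qed
    have "contour_integral (circlepath 0 R) g = contour_integral (circlepath 0 s) g"
      using circle_deform[OF g assms(2), of R] circle_deform[OF g assms(2), of s] R assms by auto
    moreover have "contour_integral (circlepath 0 R) (\<lambda>u. f z / (u - z)) = 2 * of_real pi * \<i> * f z"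
      using z' by (intro contour_integral_unique Cauchy_integral_circlepath_simple) auto
    moreover have "contour_integral (circlepath 0 s) (\<lambda>u. f z / (u - z)) = 0"
      using z' assms by (intro contour_integral_unique Cauchy_theorem_disc_simple[where a=0 and e="norm z"])
        (auto intro!: holomorphic_intros)
    moreover have "contour_integral (circlepath 0 s) (\<lambda>u. f u / (u - z)) = 0"
    proof (rule contour_integral_Cauchy_kernel_zero)
      fix n
      have "cf f (- int n - 1) = 1 / (2 * of_real pi * \<i>) * contour_integral (circlepath 0 s) (\<lambda>z. f z * z powi (int n))"
        using cf_circle[OF assms(1-3)] R by simp
      then show "contour_integral (circlepath 0 s) (\<lambda>w. f w * w ^ n) = 0" using assms(5)[of "- int n - 1"] by simp
    qed (use assms z' cont subR in \<open>auto intro: continuous_on_subset\<close>)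
    ultimately show ?thesis using split[of R] split[of s] by (simp add: G_def)
  qed
  from that[OF 1 2] show ?thesis .
qed

lemma cf_disc_neg:
  assumes "F holomorphic_on ball 0 R" "1 < R" "k < 0"
  shows "cf F k = 0"
proof -
  have "(\<lambda>z. F z * z powi (-k-1)) holomorphic_on ball 0 R"
  proof -
    have "(\<lambda>z. F z * z ^ nat (-k-1)) holomorphic_on ball 0 R" by (intro holomorphic_intros assms)
    moreover have "z powi (-k-1) = z ^ nat (-k-1)" for z :: complex using assms(3) by (simp add: power_int_def)
    ultimately show ?thesis by simp
  qed
  then have "((\<lambda>z. F z * z powi (-k-1)) has_contour_integral 0) (circlepath 0 1)"
    using assms by (intro Cauchy_theorem_disc_simple[where a=0 and e=R]) auto
  then show ?thesis unfolding cf_def by (simp add: contour_integral_unique)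
qed

lemma cf_disc:
  assumes "F holomorphic_on ball 0 R" "1 < R"
  shows "cf F (int n) = fps_nth (fps_expansion F 0) n"
proof -
  have "((\<lambda>u. F u / (u - 0) ^ Suc n) has_contour_integral (2 * pi * \<i>) / fact n * (deriv ^^ n) F 0) (circlepath 0 1)"
    using assms by (intro Cauchy_has_contour_integral_higher_derivative_circlepath holomorphic_on_imp_continuous_on)
      (auto intro: holomorphic_on_subset)
  then have "contour_integral (circlepath 0 1) (\<lambda>z. F z * z powi (- int n - 1)) = (2 * pi * \<i>) / fact n * (deriv ^^ n) F 0"
  proof -
    have "z powi (- int n - 1) = 1 / z ^ Suc n" if "norm z = 1" for z :: complex
    proof -
      have "z powi (- int n - 1) = z powi (- int (Suc n))" by (rule arg_cong) simp
      then show ?thesis by (simp only: power_int_minus power_int_of_nat divide_inverse mult_1)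
    qed
    then have "contour_integral (circlepath 0 1) (\<lambda>z. F z * z powi (- int n - 1)) = contour_integral (circlepath 0 1) (\<lambda>u. F u / (u - 0) ^ Suc n)"
      by (intro contour_integral_eq) (auto simp del: power_Suc)
    then show ?thesis using \<open>(_ has_contour_integral _) _\<close> by (simp only: contour_integral_unique)
  qed
  then show ?thesis unfolding cf_def fps_expansion_def by simp
qed

text \<open>In the angle parameter, \<open>z \<mapsto> 1 / z\<close> is the reflection
  \<open>t \<mapsto> 1 - t\<close> of the unit circle, and the integral over \<open>{0..1}\<close>
  is invariant under it. This transfers facts about discs to loops that are holomorphic near
  infinity.\<close>

lemma cf_inverse_arg:
  shows "cf (\<lambda>z. f (1 / z)) k = cf f (- k)"
proof -
  define e where "e t = exp (2 * of_real pi * \<i> * of_real t)" for t :: real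
  have e0: "e t \<noteq> 0" for t by (simp add: e_def)
  have i: "contour_integral (circlepath 0 1) (\<lambda>z. f z * z powi (- k - 1)) = 
      2 * of_real pi * \<i> * integral {0..1} (\<lambda>t. f (e t) * e t powi (-k))" for f k
  proof -
    have "f (circlepath 0 1 t) * (circlepath 0 1 t) powi (- k - 1) * vector_derivative (circlepath 0 1) (at t)
      = 2 * of_real pi * \<i> * (f (e t) * e t powi (-k))" for t
      using power_int_add[of "e t" "-k-1" 1] e0
      by (simp add: vector_derivative_circlepath) (simp add: circlepath e_def[symmetric])
    then show ?thesis unfolding contour_integral_integral by simp
  qed
  have per: "e (1 - t) = 1 / e t" for t
  proof -
    have "e (1 - t) * e t = 1" by (simp add: e_def exp_add[symmetric] algebra_simps)
    then show ?thesis using e0[of t] by (simp add: field_simps)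
  qed
  define h where "h t = f (e t) * e t powi k" for t
  have "integral {0..1} (\<lambda>t. f (1 / e t) * e t powi (-k)) = integral {0..1} (\<lambda>t. h (1 - t))"
    by (rule integral_cong) (simp add: h_def per power_int_minus power_int_divide_distrib inverse_eq_divide)
  also have "\<dots> = integral {0..1} h"
    using Henstock_Kurzweil_Integration.integral_reflect_real[where b=0 and a="-1" and f="\<lambda>t. h (1 + t)"]
      integral_shift_cbox_plus[of "-1" 0 h 1] by (simp add: o_def)
  finally show ?thesis unfolding cf_def i h_def by simp
qed

section \<open>Holomorphic matrices\<close>

type_synonym mat2 = "complex^2^2"

definition hol2 :: "(complex \<Rightarrow> mat2) \<Rightarrow> complex set \<Rightarrow> bool" where
  "hol2 f U \<longleftrightarrow> (\<forall>i j. (\<lambda>z. f z $ i $ j) holomorphic_on U)"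

definition adj2 :: "mat2 \<Rightarrow> mat2" where
  "adj2 A = (\<chi> i j. if i = j then (if i = 1 then A $ 2 $ 2 else A $ 1 $ 1) else - A $ i $ j)"

text \<open>The adjugate formula makes holomorphy and continuity of inversion visible from the
  entries and the determinant.\<close>

definition inv2 :: "mat2 \<Rightarrow> mat2" where
  "inv2 A = (\<chi> i j. adj2 A $ i $ j / det A)"

lemma mat2_eq_iff: "(A::'a^2^2) = B \<longleftrightarrow> (\<forall>i j. A $ i $ j = B $ i $ j)"
  by (simp add: vec_eq_iff)

lemma GL2_iff: "A \<in> GL2 \<longleftrightarrow> det A \<noteq> 0"
  by (simp add: GL2_def invertible_det_nz)

lemma inv2_mult: 
  assumes "A \<in> GL2"
  shows "A ** inv2 A = mat 1" "inv2 A ** A = mat 1"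
proof -
  have d: "A $ 1 $ 1 * A $ 2 $ 2 - A $ 1 $ 2 * A $ 2 $ 1 \<noteq> 0" using assms by (simp add: GL2_iff det_2)
  show "A ** inv2 A = mat 1" "inv2 A ** A = mat 1" using d
    by (simp_all add: mat2_eq_iff forall_2 matrix_matrix_mult_def sum_2 inv2_def adj2_def det_2 mat_def
       add_divide_distrib[symmetric] diff_divide_distrib[symmetric] mult.commute)
qed

lemma GL2_mult: "A \<in> GL2 \<Longrightarrow> B \<in> GL2 \<Longrightarrow> A ** B \<in> GL2"
  by (simp add: GL2_iff det_mul)

lemma GL2_one [simp]: "mat 1 \<in> GL2"
  by (simp add: GL2_iff)

lemma GL2_inv2: "A \<in> GL2 \<Longrightarrow> inv2 A \<in> GL2"
  using inv2_mult unfolding GL2_def invertible_def by blast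

lemma norm_le_l1_vec: "norm (x::'a::real_normed_vector^'n) \<le> (\<Sum>i\<in>UNIV. norm (x $ i))"
  by (simp add: norm_vec_def L2_set_le_sum)

lemma norm_entry_le: "norm ((A::mat2) $ i $ j) \<le> norm A"
  using Finite_Cartesian_Product.norm_nth_le[of "A $ i" j] Finite_Cartesian_Product.norm_nth_le[of A i] by linarith

lemma norm_le_entries: "norm (A::mat2) \<le> norm (A$1$1) + norm (A$1$2) + norm (A$2$1) + norm (A$2$2)"
proof -
  have "norm A \<le> (\<Sum>i\<in>UNIV. norm (A $ i))" by (rule norm_le_l1_vec)
  also have "\<dots> \<le> (\<Sum>i\<in>UNIV. \<Sum>j\<in>UNIV. norm (A $ i $ j))" by (intro sum_mono norm_le_l1_vec)
  finally show ?thesis by (simp add: sum_2)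
qed

text \<open>A crude entrywise estimate: each entry of the product is at most
  \<open>2 * (norm A * norm B)\<close>, and the norm is at most the sum of four entries. Later
  factors 8 come from here, later factors 4 from \<open>norm_le_entries\<close>.\<close>

lemma norm_mult_le: "norm ((A::mat2) ** B) \<le> 8 * norm A * norm (B::mat2)"
proof -
  have e: "norm ((A ** B) $ i $ j) \<le> 2 * (norm A * norm B)" for i j
  proof -
    have "norm ((A ** B) $ i $ j) \<le> norm (A $ i $ 1 * B $ 1 $ j) + norm (A $ i $ 2 * B $ 2 $ j)"
      by (simp add: matrix_matrix_mult_def sum_2 norm_triangle_ineq)
    also have "\<dots> \<le> norm A * norm B + norm A * norm B"
      unfolding norm_mult by (intro add_mono mult_mono norm_entry_le) auto
    finally show ?thesis by simp
  qed
  have "norm (A ** B) \<le> norm ((A**B)$1$1) + norm ((A**B)$1$2) + norm ((A**B)$2$1) + norm ((A**B)$2$2)"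
    by (rule norm_le_entries)
  then show ?thesis using e[of 1 1] e[of 1 2] e[of 2 1] e[of 2 2] by linarith
qed

lemma bounded_bilinear_matrix_mult: "bounded_bilinear ((**) :: mat2 \<Rightarrow> mat2 \<Rightarrow> mat2)"
proof -
  have 1: "(A + A') ** B = A ** B + A' ** B" "A ** (B + B') = A ** B + A ** B'"
     "(c *\<^sub>R A) ** B = c *\<^sub>R (A ** B)" "A ** (c *\<^sub>R B) = c *\<^sub>R (A ** B)" for A A' B B' :: mat2 and c
    by (simp_all add: mat2_eq_iff matrix_matrix_mult_def sum.distrib distrib_right distrib_left scaleR_sum_right)
  have "norm (A ** B) \<le> norm A * norm B * 8" for A B :: mat2
    using norm_mult_le[of A B] by (simp add: mult_ac)
  then show ?thesis using 1 by unfold_locales blast+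
qed

interpretation mm: bounded_bilinear "(**) :: mat2 \<Rightarrow> mat2 \<Rightarrow> mat2"
  by (rule bounded_bilinear_matrix_mult)

lemma hol2_mult: "hol2 f U \<Longrightarrow> hol2 g U \<Longrightarrow> hol2 (\<lambda>z. f z ** g z) U"
  unfolding hol2_def by (auto simp: matrix_matrix_mult_def intro!: holomorphic_intros)

lemma hol2_const [simp]: "hol2 (\<lambda>z. A) U"
  unfolding hol2_def by auto

lemma hol2_add: "hol2 f U \<Longrightarrow> hol2 g U \<Longrightarrow> hol2 (\<lambda>z. f z + g z) U"
  unfolding hol2_def by (auto intro!: holomorphic_intros)

lemma hol2_diff: "hol2 f U \<Longrightarrow> hol2 g U \<Longrightarrow> hol2 (\<lambda>z. f z - g z) U"
  unfolding hol2_def by (auto intro!: holomorphic_intros)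

lemma hol2_det: "hol2 f U \<Longrightarrow> (\<lambda>z. det (f z)) holomorphic_on U"
  unfolding hol2_def det_2 by (auto intro!: holomorphic_intros)

lemma hol2_inv2: "hol2 f U \<Longrightarrow> f ` U \<subseteq> GL2 \<Longrightarrow> hol2 (\<lambda>z. inv2 (f z)) U"
proof -
  assume f: "hol2 f U" "f ` U \<subseteq> GL2"
  have "(\<lambda>z. adj2 (f z) $ i $ j) holomorphic_on U" for i j
    using f(1) unfolding hol2_def adj2_def
    by (cases "i = j"; cases "i = 1") (auto intro!: holomorphic_intros)
  with f show ?thesis using hol2_det[OF f(1)] unfolding hol2_def inv2_def
    by (auto simp: image_subset_iff GL2_iff intro!: holomorphic_intros)
qed

lemma hol2_subset: "hol2 f U \<Longrightarrow> V \<subseteq> U \<Longrightarrow> hol2 f V"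
  unfolding hol2_def by (meson holomorphic_on_subset)

lemma hol2_cong: "(\<And>z. z \<in> U \<Longrightarrow> f z = g z) \<Longrightarrow> hol2 f U \<longleftrightarrow> hol2 g U"
  unfolding hol2_def by (intro iff_allI holomorphic_cong) auto

lemma hol2_compose: "hol2 f U \<Longrightarrow> h holomorphic_on V \<Longrightarrow> h ` V \<subseteq> U \<Longrightarrow> hol2 (\<lambda>z. f (h z)) V"
  unfolding hol2_def
proof (intro allI)
  fix i j assume "\<forall>i j. (\<lambda>z. f z $ i $ j) holomorphic_on U" "h holomorphic_on V" "h ` V \<subseteq> U"
  then show "(\<lambda>z. f (h z) $ i $ j) holomorphic_on V"
    using holomorphic_on_compose_gen[of h V "\<lambda>z. f z $ i $ j" U] by (simp add: o_def)
qed

lemma hol2_continuous: "hol2 f U \<Longrightarrow> continuous_on U f"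
  unfolding hol2_def continuous_on_def
  by (intro ballI vec_tendstoI) (meson continuous_on_def holomorphic_on_imp_continuous_on)

lemma one_islimpt_sphere: "1 islimpt sphere (0::complex) 1"
proof (rule connected_imp_perfect[rotated])
  have "\<nexists>a. sphere (0::complex) 1 = {a}"
  proof
    assume "\<exists>a. sphere (0::complex) 1 = {a}"
    moreover have "1 \<in> sphere (0::complex) 1" "-1 \<in> sphere (0::complex) 1" by auto
    ultimately show False by (metis one_neq_neg_one singletonD)
  qed
  then show "\<And>a. sphere (0::complex) 1 \<noteq> {a}" by blast
qed (auto simp: connected_sphere)

text \<open>The identity theorem with the unit circle as set of agreement, accumulating at 1. It is
  applied to limits of loops, which are compared on the circle first.\<close>

lemma hol2_identity_ball:
  assumes "hol2 f (ball 0 R)" "hol2 g (ball 0 R)" "1 < R" "\<And>z. norm z = 1 \<Longrightarrow> f z = g z" "z \<in> ball 0 R"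
  shows "f z = g z"
proof -
  have "f z $ i $ j - g z $ i $ j = 0" for i j
  proof (rule analytic_continuation[where f="\<lambda>z. f z $ i $ j - g z $ i $ j" and S="ball 0 R" and U="sphere 0 1" and \<xi>=1])
    show "1 islimpt sphere (0::complex) 1" 
      by (rule one_islimpt_sphere)
  qed (use assms in \<open>auto simp: hol2_def intro!: holomorphic_intros\<close>)
  then show ?thesis by (simp add: mat2_eq_iff)
qed

section \<open>Loops as germs on annuli\<close>

lemma holo_near_hol2: "holo_near f K S \<longleftrightarrow> (\<exists>U. open U \<and> K \<subseteq> U \<and> hol2 f U \<and> f ` U \<subseteq> S)"
  by (simp add: holo_near_def hol2_def)

lemma holo_near_annulusD:
  assumes "holo_near f (annulus r) S" "0 < r" "r < 1"
  obtains s where "0 < s" "s < r" "hol2 f (ann s)" "f ` ann s \<subseteq> S"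
proof -
  obtain U where U: "open U" "annulus r \<subseteq> U" "hol2 f U" "f ` U \<subseteq> S"
    using assms(1) by (auto simp: holo_near_hol2)
  obtain s where "0 < s" "s < r" "ann s \<subseteq> U" using open_annulus_enlarge[OF U(1,2) assms(2,3)] .
  then show ?thesis using that[of s] U hol2_subset[of f U "ann s"] by blast
qed

lemma holo_near_annulusI:
  "hol2 f (ann s) \<Longrightarrow> f ` ann s \<subseteq> S \<Longrightarrow> 0 < s \<Longrightarrow> s < r \<Longrightarrow> holo_near f (annulus r) S"
  unfolding holo_near_hol2 by (rule exI[of _ "ann s"]) (simp add: annulus_subset_ann)

lemma holo_near_cballD:
  assumes "holo_near f (cball 0 (1 / r)) S" "0 < r" "r < 1"
  obtains R where "1 < R" "hol2 f (ball 0 R)" "f ` ball 0 R \<subseteq> S"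
proof -
  obtain U where U: "open U" "cball 0 (1/r) \<subseteq> U" "hol2 f U" "f ` U \<subseteq> S"
    using assms(1) by (auto simp: holo_near_hol2)
  obtain R where "1 / r < R" "ball 0 R \<subseteq> U" using open_cball_enlarge[OF U(1,2)] assms by auto
  moreover have "1 < 1 / r" using assms by simp
  ultimately show ?thesis using that[of R] U hol2_subset[of f U "ball 0 R"] less_trans[of 1 "1/r" R] by blast
qed

lemma holo_near_cballI:
  assumes "hol2 f (ball 0 R)" "f ` ball 0 R \<subseteq> S" "1 < R"
  shows "\<exists>r. 0 < r \<and> r < 1 \<and> holo_near f (cball 0 (1 / r)) S"
proof -
  define r where "r = 2 / (1 + R)"
  have "0 < r" "r < 1" "1 / r < R" using assms by (auto simp: r_def field_simps)
  moreover have "holo_near f (cball 0 (1 / r)) S"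
    unfolding holo_near_hol2 using assms \<open>1 / r < R\<close> by (intro exI[of _ "ball 0 R"]) auto
  ultimately show ?thesis by blast
qed

lemma germ_eqI:
  assumes "hol2 f (ann s)" "hol2 g (ann s)" "\<And>z. z \<in> ann s \<Longrightarrow> f z = g z" "0 < s" "s < 1"
  shows "germ_eq f g"
  unfolding germ_eq_def
proof (intro exI conjI)
  \<comment> \<open>\<open>germ_eq\<close> asks for a closed annulus with a neighbourhood; the
    midpoint of \<open>s\<close> and 1 leaves room inside \<open>ann s\<close>.\<close>
  show "0 < (1 + s) / 2" "(1 + s) / 2 < 1" using assms by auto
  show "holo_near f (annulus ((1 + s) / 2)) UNIV" "holo_near g (annulus ((1 + s) / 2)) UNIV"
    using assms by (auto intro!: holo_near_annulusI[of _ s])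
  show "open (ann s)" by simp
  show "annulus ((1 + s) / 2) \<subseteq> ann s" using assms by (intro annulus_subset_ann) auto
qed (use assms in blast)

lemma germ_eqE:
  assumes "germ_eq f g"
  obtains s where "0 < s" "s < 1" "hol2 f (ann s)" "hol2 g (ann s)" "\<And>z. z \<in> ann s \<Longrightarrow> f z = g z"
proof -
  obtain r U where r: "0 < r" "r < 1" "holo_near f (annulus r) UNIV" "holo_near g (annulus r) UNIV"
    "open U" "annulus r \<subseteq> U" "\<forall>z\<in>U. f z = g z" using assms unfolding germ_eq_def by blast
  obtain s1 where 1: "0 < s1" "s1 < r" "hol2 f (ann s1)" using holo_near_annulusD[OF r(3,1,2)] .
  obtain s2 where 2: "0 < s2" "s2 < r" "hol2 g (ann s2)" using holo_near_annulusD[OF r(4,1,2)] .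
  have "hol2 f (ann r)" "hol2 g (ann r)"
    using 1 2 ann_mono[of s1 r] ann_mono[of s2 r] hol2_subset by auto
  moreover have "z \<in> ann r \<Longrightarrow> f z = g z" for z using r(6,7) ann_subset_annulus by blast
  ultimately show ?thesis using that[OF r(1,2)] by simp
qed

text \<open>Membership in the domain of the partial quotient: \<open>abs_loop f\<close> carries
  information about \<open>f\<close> only under this condition.\<close>

definition isloop :: "(complex \<Rightarrow> mat2) \<Rightarrow> bool" where
  "isloop f \<longleftrightarrow> (\<exists>s. 0 < s \<and> s < 1 \<and> hol2 f (ann s))"

lemma isloopI: "hol2 f (ann s) \<Longrightarrow> 0 < s \<Longrightarrow> s < 1 \<Longrightarrow> isloop f"
  by (auto simp: isloop_def)

lemma isloop_iff: "isloop f \<longleftrightarrow> germ_eq f f"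
proof
  assume "isloop f"
  then obtain s where "0 < s" "s < 1" "hol2 f (ann s)" by (auto simp: isloop_def)
  then show "germ_eq f f" by (intro germ_eqI[of f s]) auto
next
  assume "germ_eq f f"
  then show "isloop f" by (rule germ_eqE) (rule isloopI)
qed

lemma isloop2E:
  assumes "isloop f" "isloop g"
  obtains s where "0 < s" "s < 1" "hol2 f (ann s)" "hol2 g (ann s)"
proof -
  obtain a b where "0 < a" "a < 1" "hol2 f (ann a)" "0 < b" "b < 1" "hol2 g (ann b)"
    using assms by (auto simp: isloop_def)
  moreover from this have "hol2 f (ann (max a b))" "hol2 g (ann (max a b))"
    using ann_mono[of a "max a b"] ann_mono[of b "max a b"] hol2_subset by auto
  ultimately show ?thesis using that[of "max a b"] by auto
qed

lemma isloop_mult: "isloop f \<Longrightarrow> isloop g \<Longrightarrow> isloop (\<lambda>z. f z ** g z)"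
  by (erule (1) isloop2E) (auto intro: isloopI hol2_mult)

lemma abs_loop_eqI:
  assumes "hol2 f (ann s)" "\<And>z. z \<in> ann s \<Longrightarrow> f z = g z" "0 < s" "s < 1"
  shows "abs_loop f = abs_loop g"
proof -
  have "germ_eq f g" using assms hol2_cong[of "ann s" f g] by (intro germ_eqI[of f s]) auto
  moreover have "germ_eq f f" "germ_eq g g" using assms hol2_cong[of "ann s" f g] by (auto intro: germ_eqI[of _ s])
  ultimately show ?thesis using Quotient_rel[OF Quotient_loop, of f g] by simp
qed

lemma abs_loop_eqD:
  assumes "abs_loop f = abs_loop g" "isloop f" "isloop g"
  obtains s where "0 < s" "s < 1" "hol2 f (ann s)" "hol2 g (ann s)" "\<And>z. z \<in> ann s \<Longrightarrow> f z = g z"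
proof -
  have "germ_eq f g" using Quotient_rel[OF Quotient_loop, of f g] assms by (simp add: isloop_iff)
  then show ?thesis using that by (rule germ_eqE)
qed

lemma abs_loop_cases:
  obtains f where "x = abs_loop f" "isloop f"
proof (rule that)
  show "x = abs_loop (rep_loop x)" using Quotient_abs_rep[OF Quotient_loop, of x] by simp
  show "isloop (rep_loop x)" using Quotient_rep_reflp[OF Quotient_loop, of x] by (simp add: isloop_iff)
qed

lemma loop_mult_abs: "isloop f \<Longrightarrow> isloop g \<Longrightarrow> loop_mult (abs_loop f) (abs_loop g) = abs_loop (\<lambda>z. f z ** g z)"
  by (simp add: loop_mult.abs_eq isloop_iff)

lemma LGL2_mult_abs [simp]: 
  "isloop f \<Longrightarrow> isloop g \<Longrightarrow> abs_loop f \<otimes>\<^bsub>LGL2\<^esub> abs_loop g = abs_loop (\<lambda>z. f z ** g z)"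
  by (simp add: LGL2_def loop_mult_abs)

lemma LGL2_one: "\<one>\<^bsub>LGL2\<^esub> = abs_loop (\<lambda>z. mat 1)"
  by (simp add: LGL2_def loop_one_def)

lemma isloop_const [simp]: "isloop (\<lambda>z. A)"
  by (rule isloopI[of _ "1/2"]) auto

lemma carrier_LGL2_iff: "x \<in> carrier LGL2 \<longleftrightarrow> 
   (\<exists>f s. x = abs_loop f \<and> 0 < s \<and> s < 1 \<and> hol2 f (ann s) \<and> f ` ann s \<subseteq> GL2)"
proof
  assume "x \<in> carrier LGL2"
  then obtain f r where "x = abs_loop f" "0 < r" "r < 1" "holo_near f (annulus r) GL2"
    by (auto simp: LGL2_def)
  then show "\<exists>f s. x = abs_loop f \<and> 0 < s \<and> s < 1 \<and> hol2 f (ann s) \<and> f ` ann s \<subseteq> GL2"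
    by (elim holo_near_annulusD) (auto intro!: exI[of _ f])
next
  assume "\<exists>f s. x = abs_loop f \<and> 0 < s \<and> s < 1 \<and> hol2 f (ann s) \<and> f ` ann s \<subseteq> GL2"
  then obtain f s where "x = abs_loop f" "0 < s" "s < 1" "hol2 f (ann s)" "f ` ann s \<subseteq> GL2" by blast
  then have "holo_near f (annulus ((1+s)/2)) GL2" by (intro holo_near_annulusI[of f s]) auto
  then show "x \<in> carrier LGL2" using \<open>x = _\<close> \<open>0 < s\<close> \<open>s < 1\<close>
    by (auto simp: LGL2_def intro!: exI[of _ f] exI[of _ "(1+s)/2"])
qed

lemma carrier_LGL2I: "hol2 f (ann s) \<Longrightarrow> f ` ann s \<subseteq> GL2 \<Longrightarrow> 0 < s \<Longrightarrow> s < 1 \<Longrightarrow> abs_loop f \<in> carrier LGL2"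
  using carrier_LGL2_iff by blast

text \<open>Membership in the group only provides some invertible representative. A given
  representative becomes invertible on the smaller annulus where the two agree.\<close>

lemma carrier_LGL2_abs:
  assumes "abs_loop f \<in> carrier LGL2" "hol2 f (ann r)" "0 < r" "r < 1"
  obtains s where "r \<le> s" "s < 1" "f ` ann s \<subseteq> GL2"
proof -
  obtain g s where g: "abs_loop f = abs_loop g" "0 < s" "s < 1" "hol2 g (ann s)" "g ` ann s \<subseteq> GL2"
    using assms carrier_LGL2_iff by blast
  obtain t where t: "0 < t" "t < 1" "\<And>z. z \<in> ann t \<Longrightarrow> f z = g z"
    using abs_loop_eqD[OF g(1) isloopI[OF assms(2-4)] isloopI[OF g(4,2,3)]] by blast
  have sub: "ann (Max {r,s,t}) \<subseteq> ann t" "ann (Max {r,s,t}) \<subseteq> ann s"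
    using g(2) t(1) by (intro ann_mono; simp)+
  have "f ` ann (Max {r,s,t}) \<subseteq> GL2"
  proof
    fix y assume "y \<in> f ` ann (Max {r,s,t})"
    then obtain z where z: "z \<in> ann (Max {r,s,t})" "y = f z" by blast
    then have "y = g z" "z \<in> ann s" using t(3) sub by auto
    then show "y \<in> GL2" using g(5) by blast
  qed
  then show ?thesis using that[of "Max {r,s,t}"] assms g t by auto
qed

section \<open>The group of loops\<close>

lemma group_LGL2: "group LGL2"
proof (rule groupI)
  fix x y assume "x \<in> carrier LGL2" "y \<in> carrier LGL2"
  then obtain f g s t where f: "x = abs_loop f" "0 < s" "s < 1" "hol2 f (ann s)" "f ` ann s \<subseteq> GL2"
    and g: "y = abs_loop g" "0 < t" "t < 1" "hol2 g (ann t)" "g ` ann t \<subseteq> GL2"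
    unfolding carrier_LGL2_iff by blast
  have sub: "ann (max s t) \<subseteq> ann s" "ann (max s t) \<subseteq> ann t" using f g by (intro ann_mono; simp)+
  have "x \<otimes>\<^bsub>LGL2\<^esub> y = abs_loop (\<lambda>z. f z ** g z)" using f g isloopI by simp
  moreover have "abs_loop (\<lambda>z. f z ** g z) \<in> carrier LGL2" 
    using f g sub
    by (intro carrier_LGL2I[of _ "max s t"] hol2_mult)
      (auto simp: image_subset_iff subset_iff intro!: GL2_mult intro: hol2_subset[unfolded subset_iff])
  ultimately show "x \<otimes>\<^bsub>LGL2\<^esub> y \<in> carrier LGL2" by simp
next
  show "\<one>\<^bsub>LGL2\<^esub> \<in> carrier LGL2"
    unfolding LGL2_one by (rule carrier_LGL2I[of _ "1/2"]) auto
next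
  fix x y z
  obtain f where "x = abs_loop f" "isloop f" by (rule abs_loop_cases)
  moreover obtain g where "y = abs_loop g" "isloop g" by (rule abs_loop_cases)
  moreover obtain h where "z = abs_loop h" "isloop h" by (rule abs_loop_cases)
  ultimately show "x \<otimes>\<^bsub>LGL2\<^esub> y \<otimes>\<^bsub>LGL2\<^esub> z = x \<otimes>\<^bsub>LGL2\<^esub> (y \<otimes>\<^bsub>LGL2\<^esub> z)"
    by (simp add: isloop_mult matrix_mul_assoc)
next
  fix x
  obtain f where "x = abs_loop f" "isloop f" by (rule abs_loop_cases)
  then show "\<one>\<^bsub>LGL2\<^esub> \<otimes>\<^bsub>LGL2\<^esub> x = x" by (simp add: LGL2_one)
next
  fix x assume "x \<in> carrier LGL2"
  then obtain f s where f: "x = abs_loop f" "0 < s" "s < 1" "hol2 f (ann s)" "f ` ann s \<subseteq> GL2"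
    unfolding carrier_LGL2_iff by blast
  have h: "hol2 (\<lambda>z. inv2 (f z)) (ann s)" using f by (intro hol2_inv2)
  show "\<exists>y\<in>carrier LGL2. y \<otimes>\<^bsub>LGL2\<^esub> x = \<one>\<^bsub>LGL2\<^esub>"
  proof (rule bexI)
    show "abs_loop (\<lambda>z. inv2 (f z)) \<in> carrier LGL2" using f h by (intro carrier_LGL2I[of _ s]) (auto intro: GL2_inv2)
    have "abs_loop (\<lambda>z. inv2 (f z) ** f z) = abs_loop (\<lambda>z. mat 1)"
      using f h by (intro abs_loop_eqI[of _ s] hol2_mult) (auto simp: inv2_mult image_subset_iff)
    then show "abs_loop (\<lambda>z. inv2 (f z)) \<otimes>\<^bsub>LGL2\<^esub> x = \<one>\<^bsub>LGL2\<^esub>"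
      using f h isloopI by (simp add: LGL2_one)
  qed
qed

interpretation LG: group LGL2 by (rule group_LGL2)

lemma inv_LGL2_abs:
  assumes "hol2 f (ann s)" "f ` ann s \<subseteq> GL2" "0 < s" "s < 1"
  shows "inv\<^bsub>LGL2\<^esub> abs_loop f = abs_loop (\<lambda>z. inv2 (f z))"
proof -
  have h: "hol2 (\<lambda>z. inv2 (f z)) (ann s)" using assms by (intro hol2_inv2)
  have "abs_loop (\<lambda>z. inv2 (f z)) \<in> carrier LGL2" using assms h by (intro carrier_LGL2I[of _ s]) (auto intro: GL2_inv2)
  moreover have "abs_loop (\<lambda>z. inv2 (f z) ** f z) = abs_loop (\<lambda>z. mat 1)"
    using assms h by (intro abs_loop_eqI[of _ s] hol2_mult) (auto simp: inv2_mult image_subset_iff)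
  then have "abs_loop (\<lambda>z. inv2 (f z)) \<otimes>\<^bsub>LGL2\<^esub> abs_loop f = \<one>\<^bsub>LGL2\<^esub>"
    using assms h isloopI by (simp add: LGL2_one)
  ultimately show ?thesis using LG.inv_equality carrier_LGL2I[OF assms] by blast
qed

text \<open>By compactness the closed disc with a neighbourhood may be traded for an open disc of
  radius \<open>R > 1\<close>, on which power series arguments run without further choices of
  neighbourhoods.\<close>

lemma P_plus_iff: "x \<in> P_plus \<longleftrightarrow> (\<exists>f R. x = abs_loop f \<and> 1 < R \<and> hol2 f (ball 0 R) \<and> f ` ball 0 R \<subseteq> GL2)"
proof
  assume "x \<in> P_plus"
  then obtain f r where f: "x = abs_loop (f)" "0 < r" "r < 1" "holo_near f (cball 0 (1 / r)) GL2"
    unfolding P_plus_def by blast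
  obtain R where "1 < R" "hol2 f (ball 0 R)" "f ` ball 0 R \<subseteq> GL2"
    using holo_near_cballD[OF f(4,2,3)] .
  with f(1) show "\<exists>f R. x = abs_loop (f) \<and> 1 < R \<and> hol2 f (ball 0 R) \<and> f ` ball 0 R \<subseteq> GL2" by blast
next
  assume "\<exists>f R. x = abs_loop (f) \<and> 1 < R \<and> hol2 f (ball 0 R) \<and> f ` ball 0 R \<subseteq> GL2"
  then obtain f R where f: "x = abs_loop (f)" "1 < R" "hol2 f (ball 0 R)" "f ` ball 0 R \<subseteq> GL2" by blast
  then show "x \<in> P_plus" unfolding P_plus_def using holo_near_cballI[OF f(3,4,2)] by blast
qed

lemma P_minus_iff: "x \<in> P_minus \<longleftrightarrow> 
   (\<exists>f R. x = abs_loop (\<lambda>z. f (1 / z)) \<and> 1 < R \<and> hol2 f (ball 0 R) \<and> f ` ball 0 R \<subseteq> GL2)"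
proof
  assume "x \<in> P_minus"
  then obtain f r where f: "x = abs_loop (\<lambda>z. f (1 / z))" "0 < r" "r < 1" "holo_near f (cball 0 (1 / r)) GL2"
    unfolding P_minus_def by blast
  obtain R where "1 < R" "hol2 f (ball 0 R)" "f ` ball 0 R \<subseteq> GL2"
    using holo_near_cballD[OF f(4,2,3)] .
  with f(1) show "\<exists>f R. x = abs_loop (\<lambda>z. f (1 / z)) \<and> 1 < R \<and> hol2 f (ball 0 R) \<and> f ` ball 0 R \<subseteq> GL2" by blast
next
  assume "\<exists>f R. x = abs_loop (\<lambda>z. f (1 / z)) \<and> 1 < R \<and> hol2 f (ball 0 R) \<and> f ` ball 0 R \<subseteq> GL2"
  then obtain f R where f: "x = abs_loop (\<lambda>z. f (1 / z))" "1 < R" "hol2 f (ball 0 R)" "f ` ball 0 R \<subseteq> GL2" by blast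
  then show "x \<in> P_minus" unfolding P_minus_def using holo_near_cballI[OF f(3,4,2)] by blast
qed

lemma hol2_ball_ann:
  assumes "hol2 f (ball 0 R)" "1 / R \<le> s" "0 < R"
  shows "hol2 f (ann s)" "hol2 (\<lambda>z. f (1 / z)) (ann s)"
proof -
  have s: "0 < 1 / R" "1 / R \<le> s" using assms by auto
  have 1: "ann (1 / R) \<subseteq> ball 0 R" by (auto simp: ann_def)
  have sub: "ann s \<subseteq> ann (1 / R)" by (rule ann_mono[OF s])
  then show "hol2 f (ann s)" using 1 assms(1) hol2_subset by blast
  show "hol2 (\<lambda>z. f (1 / z)) (ann s)"
  proof (rule hol2_compose[OF assms(1)])
    show "(\<lambda>z. 1 / z) holomorphic_on ann s"
      using zero_notin_ann[OF s(1)] sub by (auto intro!: holomorphic_intros)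
    show "(\<lambda>z. 1 / z) ` ann s \<subseteq> ball 0 R"
      using inverse_in_ann[OF s(1)] sub 1 by blast
  qed
qed

lemma ball_ann: "z \<in> ann (1 / R) \<Longrightarrow> z \<in> ball 0 R" "0 < R \<Longrightarrow> z \<in> ann (1 / R) \<Longrightarrow> 1 / z \<in> ball 0 R"
  using inverse_in_ann[of "1 / R" z] by (auto simp: ann_def)

lemma loop_coeff_abs: "isloop f \<Longrightarrow> loop_coeff (abs_loop f) k = (\<chi> i j. cf (\<lambda>z. f z $ i $ j) k)"
  by (simp add: loop_coeff.abs_eq isloop_iff cf_def)

text \<open>Taylor coefficients at 0. For a loop written as \<open>f (1 / z)\<close> they are the
  coefficients of \<open>z^(-n)\<close>, so all factors at infinity are handled through functions on
  discs.\<close>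

definition mfps :: "(complex \<Rightarrow> mat2) \<Rightarrow> nat \<Rightarrow> mat2" where
  "mfps f n = (\<chi> i j. fps_nth (fps_expansion (\<lambda>z. f z $ i $ j) 0) n)"

lemma loop_coeff_disc:
  assumes "hol2 f (ball 0 R)" "1 < R"
  shows "loop_coeff (abs_loop f) k = (if k \<ge> 0 then mfps f (nat k) else 0)"
proof -
  have "isloop f" using hol2_ball_ann(1)[OF assms(1), of "1/R"] assms(2) by (intro isloopI[of _ "1/R"]) auto
  moreover have "cf (\<lambda>z. f z $ i $ j) k = (if k \<ge> 0 then mfps f (nat k) $ i $ j else 0)" for i j
    using assms cf_disc_neg[of "\<lambda>z. f z $ i $ j" R k] cf_disc[of "\<lambda>z. f z $ i $ j" R "nat k"]
    by (auto simp: hol2_def mfps_def)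
  ultimately show ?thesis by (simp add: loop_coeff_abs mat2_eq_iff)
qed

lemma loop_coeff_disc_inv:
  assumes "hol2 f (ball 0 R)" "1 < R"
  shows "loop_coeff (abs_loop (\<lambda>z. f (1 / z))) k = (if k \<le> 0 then mfps f (nat (- k)) else 0)"
proof -
  have "isloop (\<lambda>z. f (1 / z))" using hol2_ball_ann(2)[OF assms(1), of "1/R"] assms(2) by (intro isloopI[of _ "1/R"]) auto
  moreover have "cf (\<lambda>z. f (1 / z) $ i $ j) k = (if k \<le> 0 then mfps f (nat (- k)) $ i $ j else 0)" for i j
    using assms cf_disc_neg[of "\<lambda>z. f z $ i $ j" R "-k"] cf_disc[of "\<lambda>z. f z $ i $ j" R "nat (-k)"]
      cf_inverse_arg[of "\<lambda>z. f z $ i $ j" k]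
    by (auto simp: hol2_def mfps_def)
  ultimately show ?thesis by (simp add: loop_coeff_abs mat2_eq_iff)
qed

lemma mfps_0: "mfps f 0 = f 0"
  by (simp add: mfps_def fps_expansion_def mat2_eq_iff)

section \<open>Uniqueness of the factorization\<close>

text \<open>The pair \<open>Npart l\<close>, \<open>Ppart l\<close> is \<open>U_minus\<close>,
  \<open>P_plus\<close> or \<open>P_minus\<close>, \<open>U_plus\<close>: the constant term is
  normalized on exactly one side, which is what makes a factorization unique.\<close>

definition Npart :: "nat \<Rightarrow> loop set" where
  "Npart l = (if l = 0 then U_minus else P_minus)"

definition Ppart :: "nat \<Rightarrow> loop set" where
  "Ppart l = (if l = 0 then P_plus else U_plus)"

lemma Npart_iff: "x \<in> Npart l \<longleftrightarrow>
   (\<exists>f R. x = abs_loop (\<lambda>z. f (1 / z)) \<and> 1 < R \<and> hol2 f (ball 0 R) \<and> f ` ball 0 R \<subseteq> GL2 \<and> (l = 0 \<longrightarrow> f 0 = mat 1))"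
proof -
  have "loop_coeff (abs_loop (\<lambda>z. f (1 / z))) 0 = f 0" if "1 < R" "hol2 f (ball 0 R)" for f R
    using loop_coeff_disc_inv[OF that(2,1)] by (simp add: mfps_0)
  then show ?thesis unfolding Npart_def U_minus_def by (auto simp: P_minus_iff) metis+
qed

lemma Ppart_iff: "x \<in> Ppart l \<longleftrightarrow>
   (\<exists>f R. x = abs_loop f \<and> 1 < R \<and> hol2 f (ball 0 R) \<and> f ` ball 0 R \<subseteq> GL2 \<and> (l \<noteq> 0 \<longrightarrow> f 0 = mat 1))"
proof -
  have "loop_coeff (abs_loop f) 0 = f 0" if "1 < R" "hol2 f (ball 0 R)" for f R
    using loop_coeff_disc[OF that(2,1)] by (simp add: mfps_0)
  then show ?thesis unfolding Ppart_def U_plus_def by (auto simp: P_plus_iff) metis+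
qed

lemma Npart_carrier: "x \<in> Npart l \<Longrightarrow> x \<in> carrier LGL2"
proof -
  assume "x \<in> Npart l"
  then obtain f R where f: "x = abs_loop (\<lambda>z. f (1 / z))" "1 < R" "hol2 f (ball 0 R)" "f ` ball 0 R \<subseteq> GL2"
    unfolding Npart_iff by blast
  have "(\<lambda>z. f (1 / z)) ` ann (1 / R) \<subseteq> GL2" using f ball_ann(2)[of R] by auto
  then show ?thesis unfolding f(1) using f hol2_ball_ann(2)[OF f(3), of "1/R"]
    by (intro carrier_LGL2I[of _ "1/R"]) auto
qed

lemma Ppart_carrier: "x \<in> Ppart l \<Longrightarrow> x \<in> carrier LGL2"
proof -
  assume "x \<in> Ppart l"
  then obtain f R where f: "x = abs_loop f" "1 < R" "hol2 f (ball 0 R)" "f ` ball 0 R \<subseteq> GL2"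
    unfolding Ppart_iff by blast
  have "f ` ann (1 / R) \<subseteq> GL2" using f ball_ann(1)[of _ R] by blast
  then show ?thesis unfolding f(1) using f hol2_ball_ann(1)[OF f(3), of "1/R"]
    by (intro carrier_LGL2I[of _ "1/R"]) auto
qed

lemma Npart_mult: 
  assumes "x \<in> Npart l" "y \<in> Npart l"
  shows "x \<otimes>\<^bsub>LGL2\<^esub> y \<in> Npart l"
proof -
  obtain f R where f: "x = abs_loop (\<lambda>z. f (1 / z))" "1 < R" "hol2 f (ball 0 R)" "f ` ball 0 R \<subseteq> GL2" "l = 0 \<longrightarrow> f 0 = mat 1"
    using assms(1) unfolding Npart_iff by blast
  obtain g S where g: "y = abs_loop (\<lambda>z. g (1 / z))" "1 < S" "hol2 g (ball 0 S)" "g ` ball 0 S \<subseteq> GL2" "l = 0 \<longrightarrow> g 0 = mat 1"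
    using assms(2) unfolding Npart_iff by blast
  have "isloop (\<lambda>z. f (1 / z))" "isloop (\<lambda>z. g (1 / z))"
    using hol2_ball_ann(2)[OF f(3), of "1/R"] hol2_ball_ann(2)[OF g(3), of "1/S"] f g
    by (auto intro: isloopI[of _ "1/R"] isloopI[of _ "1/S"])
  then have "x \<otimes>\<^bsub>LGL2\<^esub> y = abs_loop (\<lambda>z. f (1 / z) ** g (1 / z))" using f g by simp
  moreover have "hol2 (\<lambda>z. f z ** g z) (ball 0 (min R S))"
    using f g by (intro hol2_mult) (auto intro: hol2_subset)
  moreover have "(\<lambda>z. f z ** g z) ` ball 0 (min R S) \<subseteq> GL2" using f(4) g(4) by (auto intro!: GL2_mult simp: image_subset_iff)
  ultimately show ?thesis unfolding Npart_iff using f g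
    by (intro exI[of _ "\<lambda>z. f z ** g z"] exI[of _ "min R S"]) auto
qed

lemma Ppart_mult: 
  assumes "x \<in> Ppart l" "y \<in> Ppart l"
  shows "x \<otimes>\<^bsub>LGL2\<^esub> y \<in> Ppart l"
proof -
  obtain f R where f: "x = abs_loop f" "1 < R" "hol2 f (ball 0 R)" "f ` ball 0 R \<subseteq> GL2" "l \<noteq> 0 \<longrightarrow> f 0 = mat 1"
    using assms(1) unfolding Ppart_iff by blast
  obtain g S where g: "y = abs_loop g" "1 < S" "hol2 g (ball 0 S)" "g ` ball 0 S \<subseteq> GL2" "l \<noteq> 0 \<longrightarrow> g 0 = mat 1"
    using assms(2) unfolding Ppart_iff by blast
  have "isloop f" "isloop g"
    using hol2_ball_ann(1)[OF f(3), of "1/R"] hol2_ball_ann(1)[OF g(3), of "1/S"] f g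
    by (auto intro: isloopI[of _ "1/R"] isloopI[of _ "1/S"])
  then have "x \<otimes>\<^bsub>LGL2\<^esub> y = abs_loop (\<lambda>z. f z ** g z)" using f g by simp
  moreover have "hol2 (\<lambda>z. f z ** g z) (ball 0 (min R S))"
    using f g by (intro hol2_mult) (auto intro: hol2_subset)
  moreover have "(\<lambda>z. f z ** g z) ` ball 0 (min R S) \<subseteq> GL2" using f(4) g(4) by (auto intro!: GL2_mult simp: image_subset_iff)
  ultimately show ?thesis unfolding Ppart_iff using f g
    by (intro exI[of _ "\<lambda>z. f z ** g z"] exI[of _ "min R S"]) auto
qed

lemma inv2_one: "inv2 (mat 1) = mat 1"
  by (simp add: mat2_eq_iff forall_2 inv2_def adj2_def) (simp add: mat_def)

lemma Npart_inv:
  assumes "x \<in> Npart l"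
  shows "inv\<^bsub>LGL2\<^esub> x \<in> Npart l"
proof -
  obtain f R where f: "x = abs_loop (\<lambda>z. f (1 / z))" "1 < R" "hol2 f (ball 0 R)" "f ` ball 0 R \<subseteq> GL2" "l = 0 \<longrightarrow> f 0 = mat 1"
    using assms(1) unfolding Npart_iff by blast
  have "(\<lambda>z. f (1 / z)) ` ann (1 / R) \<subseteq> GL2" using f ball_ann(2)[of R] by auto
  then have "inv\<^bsub>LGL2\<^esub> x = abs_loop (\<lambda>z. inv2 (f (1 / z)))" unfolding f(1)
    using hol2_ball_ann(2)[OF f(3), of "1/R"] f(2) by (intro inv_LGL2_abs[of _ "1/R"]) auto
  then show ?thesis unfolding Npart_iff using f hol2_inv2[OF f(3,4)]
    by (intro exI[of _ "\<lambda>z. inv2 (f z)"] exI[of _ R]) (auto intro: GL2_inv2 simp: inv2_one)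
qed

lemma Ppart_inv:
  assumes "x \<in> Ppart l"
  shows "inv\<^bsub>LGL2\<^esub> x \<in> Ppart l"
proof -
  obtain f R where f: "x = abs_loop f" "1 < R" "hol2 f (ball 0 R)" "f ` ball 0 R \<subseteq> GL2" "l \<noteq> 0 \<longrightarrow> f 0 = mat 1"
    using assms(1) unfolding Ppart_iff by blast
  have "f ` ann (1 / R) \<subseteq> GL2" using f ball_ann(1)[of _ R] by blast
  then have "inv\<^bsub>LGL2\<^esub> x = abs_loop (\<lambda>z. inv2 (f z))" unfolding f(1)
    using hol2_ball_ann(1)[OF f(3), of "1/R"] f(2) by (intro inv_LGL2_abs[of _ "1/R"]) auto
  then show ?thesis unfolding Ppart_iff using f hol2_inv2[OF f(3,4)]
    by (intro exI[of _ "\<lambda>z. inv2 (f z)"] exI[of _ R]) (auto intro: GL2_inv2 simp: inv2_one)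
qed

lemma mfps_eq_const:
  assumes "hol2 f (ball 0 R)" "0 < R" "\<And>n. 0 < n \<Longrightarrow> mfps f n = 0" "z \<in> ball 0 R"
  shows "f z = f 0"
proof -
  have "f z $ i $ j = f 0 $ i $ j" for i j
  proof (rule holomorphic_fun_eq_const_on_connected[of "\<lambda>z. f z $ i $ j" "ball 0 R" 0 z])
    fix n :: nat assume "0 < n"
    then have "mfps f n $ i $ j = 0" using assms(3) by simp
    then show "(deriv ^^ n) (\<lambda>z. f z $ i $ j) 0 = 0" by (simp add: mfps_def fps_expansion_def)
  qed (use assms in \<open>auto simp: hol2_def\<close>)
  then show ?thesis by (simp add: mat2_eq_iff)
qed

text \<open>The coefficients of a loop in both parts are confined to degree 0. Its representative on
  a disc is therefore constant, and whichever side is normalized forces the constant to be the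
  identity.\<close>

lemma Npart_Ppart_trivial:
  assumes "x \<in> Npart l" "x \<in> Ppart l"
  shows "x = \<one>\<^bsub>LGL2\<^esub>"
proof -
  obtain f R where f: "x = abs_loop (\<lambda>z. f (1 / z))" "1 < R" "hol2 f (ball 0 R)" "f ` ball 0 R \<subseteq> GL2" "l = 0 \<longrightarrow> f 0 = mat 1"
    using assms(1) unfolding Npart_iff by blast
  obtain g S where g: "x = abs_loop g" "1 < S" "hol2 g (ball 0 S)" "g ` ball 0 S \<subseteq> GL2" "l \<noteq> 0 \<longrightarrow> g 0 = mat 1"
    using assms(2) unfolding Ppart_iff by blast
  \<comment> \<open>Two computations of the same Laurent coefficient, from infinity on the left and
    from zero on the right.\<close>
  have c: "(if k \<le> 0 then mfps f (nat (- k)) else 0) = (if k \<ge> 0 then mfps g (nat k) else 0)" for k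
    using loop_coeff_disc_inv[OF f(3,2), of k] loop_coeff_disc[OF g(3,2), of k]
    unfolding f(1)[symmetric] g(1)[symmetric] by (rule trans[OF sym])
  have "mfps f n = 0" if "0 < n" for n using c[of "- int n"] that by simp
  then have fc: "f z = f 0" if "z \<in> ball 0 R" for z
    by (intro mfps_eq_const[OF f(3) _ _ that]) (use f(2) in auto)
  have "f 0 = g 0" using c[of 0] by (simp add: mfps_0)
  then have "f 0 = mat 1" using f(5) g(5) by (cases "l = 0") (simp_all only: simp_thms)
  have "abs_loop (\<lambda>z. f (1 / z)) = abs_loop (\<lambda>z. mat 1)"
  proof (rule abs_loop_eqI[of _ "1/R"])
    show "f (1 / z) = mat 1" if "z \<in> ann (1 / R)" for z
      using fc[OF ball_ann(2)[OF _ that]] f(2) \<open>f 0 = mat 1\<close> by simp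
  qed (use f(2) hol2_ball_ann(2)[OF f(3), of "1/R"] in auto)
  then show ?thesis by (simp add: f(1) LGL2_one)
qed

text \<open>Rearranging gives an element \<open>u' u^(-1) = p' p^(-1)\<close> that lies in both
  parts.\<close>

lemma factorization_unique:
  assumes "u \<in> Npart l" "p \<in> Ppart l" "u' \<in> Npart l" "p' \<in> Ppart l"
    "inv\<^bsub>LGL2\<^esub> u \<otimes>\<^bsub>LGL2\<^esub> p = inv\<^bsub>LGL2\<^esub> u' \<otimes>\<^bsub>LGL2\<^esub> p'"
  shows "u = u'"
proof -
  have c: "u \<in> carrier LGL2" "p \<in> carrier LGL2" "u' \<in> carrier LGL2" "p' \<in> carrier LGL2"
    using assms Npart_carrier Ppart_carrier by auto
  have "u' \<otimes>\<^bsub>LGL2\<^esub> (inv\<^bsub>LGL2\<^esub> u \<otimes>\<^bsub>LGL2\<^esub> p) \<otimes>\<^bsub>LGL2\<^esub> inv\<^bsub>LGL2\<^esub> p =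
      u' \<otimes>\<^bsub>LGL2\<^esub> (inv\<^bsub>LGL2\<^esub> u' \<otimes>\<^bsub>LGL2\<^esub> p') \<otimes>\<^bsub>LGL2\<^esub> inv\<^bsub>LGL2\<^esub> p" using assms(5) by simp
  then have eq: "u' \<otimes>\<^bsub>LGL2\<^esub> inv\<^bsub>LGL2\<^esub> u = p' \<otimes>\<^bsub>LGL2\<^esub> inv\<^bsub>LGL2\<^esub> p"
    using c by (simp add: LG.m_assoc LG.inv_solve_left)
  have "u' \<otimes>\<^bsub>LGL2\<^esub> inv\<^bsub>LGL2\<^esub> u = \<one>\<^bsub>LGL2\<^esub>"
    using eq Npart_mult[OF assms(3) Npart_inv[OF assms(1)]] Ppart_mult[OF assms(4) Ppart_inv[OF assms(2)]]
    by (intro Npart_Ppart_trivial[of _ l]) auto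
  then show ?thesis using c by (metis LG.inv_inv LG.inv_closed LG.inv_equality)
qed

lemma const_loop_Ppart: "A \<in> GL2 \<Longrightarrow> abs_loop (\<lambda>z. A) \<in> Ppart 0"
  unfolding Ppart_iff by (intro exI[of _ "\<lambda>z. A"] exI[of _ 2]) auto

text \<open>Multiplying both factors from the left by the inverse \<open>c\<close> of the constant
  term of the unnormalized one leaves \<open>u^(-1) p\<close> unchanged and moves the normalization
  to the other side. So one set serves both hierarchies.\<close>

lemma big_cell_iff: "x \<in> big_cell \<longleftrightarrow> (\<exists>u\<in>Npart l. \<exists>p\<in>Ppart l. x = inv\<^bsub>LGL2\<^esub> u \<otimes>\<^bsub>LGL2\<^esub> p)"
proof -
  have 0: "x \<in> big_cell \<longleftrightarrow> (\<exists>u\<in>Npart 0. \<exists>p\<in>Ppart 0. x = inv\<^bsub>LGL2\<^esub> u \<otimes>\<^bsub>LGL2\<^esub> p)"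
  proof
    assume "x \<in> big_cell"
    then obtain u p where "u \<in> Npart 0" "p \<in> Ppart 0" "x = u \<otimes>\<^bsub>LGL2\<^esub> p"
      by (auto simp: big_cell_def set_mult_def Npart_def Ppart_def)
    then show "\<exists>u\<in>Npart 0. \<exists>p\<in>Ppart 0. x = inv\<^bsub>LGL2\<^esub> u \<otimes>\<^bsub>LGL2\<^esub> p"
      by (intro bexI[of _ "inv\<^bsub>LGL2\<^esub> u"] bexI[of _ p]) (auto intro: Npart_inv simp: Npart_carrier)
  next
    assume "\<exists>u\<in>Npart 0. \<exists>p\<in>Ppart 0. x = inv\<^bsub>LGL2\<^esub> u \<otimes>\<^bsub>LGL2\<^esub> p"
    then obtain u p where "u \<in> Npart 0" "p \<in> Ppart 0" "x = inv\<^bsub>LGL2\<^esub> u \<otimes>\<^bsub>LGL2\<^esub> p" by blast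
    then show "x \<in> big_cell" using Npart_inv[of u 0]
      by (auto simp: big_cell_def set_mult_def Npart_def Ppart_def)
  qed
  show ?thesis
  proof (cases "l = 0")
    case False
    have split1: "\<exists>u'\<in>Npart l. \<exists>p'\<in>Ppart l. x = inv\<^bsub>LGL2\<^esub> u' \<otimes>\<^bsub>LGL2\<^esub> p'"
      if up: "u \<in> Npart 0" "p \<in> Ppart 0" "x = inv\<^bsub>LGL2\<^esub> u \<otimes>\<^bsub>LGL2\<^esub> p" for u p
    proof -
      obtain f R where f: "p = abs_loop f" "1 < R" "hol2 f (ball 0 R)" "f ` ball 0 R \<subseteq> GL2"
        using up(2) unfolding Ppart_iff by blast
      have A: "f 0 \<in> GL2" using f by auto
      define c where "c = abs_loop (\<lambda>z. inv2 (f 0))"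
      have cc: "c \<in> carrier LGL2" "c \<in> Npart l"
        unfolding c_def using const_loop_Ppart[OF GL2_inv2[OF A]] Ppart_carrier False
        by (auto simp: Npart_iff intro!: exI[of _ "\<lambda>z. inv2 (f 0)"] exI[of _ 2] GL2_inv2 A)
      have "isloop f" using hol2_ball_ann(1)[OF f(3), of "1/R"] f by (auto intro: isloopI[of _ "1/R"])
      then have "c \<otimes>\<^bsub>LGL2\<^esub> p = abs_loop (\<lambda>z. inv2 (f 0) ** f z)" unfolding c_def f(1) by simp
      then have "c \<otimes>\<^bsub>LGL2\<^esub> p \<in> Ppart l" unfolding Ppart_iff using f A
        by (intro exI[of _ "\<lambda>z. inv2 (f 0) ** f z"] exI[of _ R]) (auto intro!: hol2_mult GL2_mult GL2_inv2 simp: inv2_mult)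
      moreover have "c \<otimes>\<^bsub>LGL2\<^esub> u \<in> Npart l" 
        using cc up(1) False by (intro Npart_mult) (auto simp: Npart_def U_minus_def)
      moreover have "x = inv\<^bsub>LGL2\<^esub> (c \<otimes>\<^bsub>LGL2\<^esub> u) \<otimes>\<^bsub>LGL2\<^esub> (c \<otimes>\<^bsub>LGL2\<^esub> p)"
        using cc up Npart_carrier[OF up(1)] Ppart_carrier[OF up(2)]
        by (simp add: LG.inv_mult_group LG.m_assoc) (simp add: LG.m_assoc[symmetric])
      ultimately show ?thesis by blast
    qed
    have split2: "\<exists>u'\<in>Npart 0. \<exists>p'\<in>Ppart 0. x = inv\<^bsub>LGL2\<^esub> u' \<otimes>\<^bsub>LGL2\<^esub> p'"
      if up: "u \<in> Npart l" "p \<in> Ppart l" "x = inv\<^bsub>LGL2\<^esub> u \<otimes>\<^bsub>LGL2\<^esub> p" for u p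
    proof -
      obtain f R where f: "u = abs_loop (\<lambda>z. f (1 / z))" "1 < R" "hol2 f (ball 0 R)" "f ` ball 0 R \<subseteq> GL2"
        using up(1) unfolding Npart_iff by blast
      have A: "f 0 \<in> GL2" using f by auto
      define c where "c = abs_loop (\<lambda>z. inv2 (f 0))"
      have cc: "c \<in> carrier LGL2" "c \<in> Ppart 0"
        unfolding c_def using const_loop_Ppart[OF GL2_inv2[OF A]] Ppart_carrier by auto
      have "isloop (\<lambda>z. f (1 / z))" using hol2_ball_ann(2)[OF f(3), of "1/R"] f by (auto intro: isloopI[of _ "1/R"])
      then have "c \<otimes>\<^bsub>LGL2\<^esub> u = abs_loop (\<lambda>z. inv2 (f 0) ** f (1 / z))" unfolding c_def f(1) by simp
      then have "c \<otimes>\<^bsub>LGL2\<^esub> u \<in> Npart 0" unfolding Npart_iff using f A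
        by (intro exI[of _ "\<lambda>z. inv2 (f 0) ** f z"] exI[of _ R]) (auto intro!: hol2_mult GL2_mult GL2_inv2 simp: inv2_mult)
      moreover have "c \<otimes>\<^bsub>LGL2\<^esub> p \<in> Ppart 0" 
        using cc up(2) False by (intro Ppart_mult) (auto simp: Ppart_def U_plus_def)
      moreover have "x = inv\<^bsub>LGL2\<^esub> (c \<otimes>\<^bsub>LGL2\<^esub> u) \<otimes>\<^bsub>LGL2\<^esub> (c \<otimes>\<^bsub>LGL2\<^esub> p)"
        using cc up Npart_carrier[OF up(1)] Ppart_carrier[OF up(2)]
        by (simp add: LG.inv_mult_group LG.m_assoc) (simp add: LG.m_assoc[symmetric])
      ultimately show ?thesis by blast
    qed
    show ?thesis unfolding 0 using split1 split2 by blast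
  qed (simp add: 0)
qed

section \<open>Laurent coefficients of matrix functions on the unit circle\<close>

definition mcf :: "(complex \<Rightarrow> mat2) \<Rightarrow> int \<Rightarrow> mat2" where
  "mcf f k = (\<chi> i j. cf (\<lambda>z. f z $ i $ j) k)"

lemma loop_coeff_mcf: "isloop f \<Longrightarrow> loop_coeff (abs_loop f) k = mcf f k"
  by (simp add: loop_coeff_abs mcf_def)

lemma mcf_disc:
  assumes "hol2 f (ball 0 R)" "1 < R"
  shows "mcf f k = (if k \<ge> 0 then mfps f (nat k) else 0)"
  using loop_coeff_disc[OF assms, of k] hol2_ball_ann(1)[OF assms(1), of "1/R"] assms(2)
  by (subst loop_coeff_mcf[symmetric]) (auto intro!: isloopI[of _ "1/R"])

lemma mcf_disc_inv:
  assumes "hol2 f (ball 0 R)" "1 < R"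
  shows "mcf (\<lambda>z. f (1 / z)) k = (if k \<le> 0 then mfps f (nat (- k)) else 0)"
  using loop_coeff_disc_inv[OF assms, of k] hol2_ball_ann(2)[OF assms(1), of "1/R"] assms(2)
  by (subst loop_coeff_mcf[symmetric]) (auto intro!: isloopI[of _ "1/R"])

lemma continuous_on_entry: "continuous_on S f \<Longrightarrow> continuous_on S (\<lambda>z. (f z :: mat2) $ i $ j)"
  by (intro continuous_on_component)

lemma mcf_add: "continuous_on (sphere 0 1) f \<Longrightarrow> continuous_on (sphere 0 1) g \<Longrightarrow> 
   mcf (\<lambda>z. f z + g z) k = mcf f k + mcf g k"
  by (simp add: mcf_def mat2_eq_iff cf_add continuous_on_entry)

lemma mcf_sum: "finite I \<Longrightarrow> (\<And>i. i \<in> I \<Longrightarrow> continuous_on (sphere 0 1) (f i)) \<Longrightarrow> 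
   mcf (\<lambda>z. \<Sum>i\<in>I. f i z) k = (\<Sum>i\<in>I. mcf (f i) k)"
  by (simp add: mcf_def mat2_eq_iff cf_sum continuous_on_entry sum_component)

lemma mcf_lmult: 
  assumes "continuous_on (sphere 0 1) f"
  shows "mcf (\<lambda>z. A ** f z) k = A ** mcf f k"
proof -
  have "continuous_on (sphere 0 1) (\<lambda>z. c * f z $ i $ j)" for c i j
    by (intro continuous_intros continuous_on_entry assms)
  then show ?thesis
    by (simp add: mcf_def mat2_eq_iff matrix_matrix_mult_def cf_sum cf_cmult[OF continuous_on_entry[OF assms]])
qed

lemma mcf_shift: "mcf (\<lambda>z. cscale (z powi n) (f z)) k = mcf f (k - n)"
  by (simp add: mcf_def mat2_eq_iff cscale_def cf_shift mult.commute[of "_ powi _"])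

lemma norm_cscale: "norm (cscale c A) \<le> 4 * norm c * norm A"
proof -
  have "norm (cscale c A $ i $ j) \<le> norm c * norm A" for i j
    by (auto simp: cscale_def norm_mult intro!: mult_left_mono norm_entry_le)
  note e = this
  show ?thesis using norm_le_entries[of "cscale c A"] e[of 1 1] e[of 1 2] e[of 2 1] e[of 2 2] by simp
qed

lemma cscale_mult: "cscale c A ** B = cscale c (A ** B)" "A ** cscale c B = cscale c (A ** B)"
  by (simp_all add: mat2_eq_iff cscale_def matrix_matrix_mult_def sum_distrib_left mult_ac)

lemma continuous_on_cscale: "continuous_on S c \<Longrightarrow> continuous_on S f \<Longrightarrow> continuous_on S (\<lambda>z. cscale (c z) (f z))"
  unfolding cscale_def by (intro continuous_on_vec_lambda continuous_intros continuous_on_entry)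

lemma mcf_tendsto:
  assumes "\<And>n. continuous_on (sphere 0 1) (f n)" "uniform_limit (sphere 0 1) f g sequentially"
  shows "(\<lambda>n::nat. mcf (f n) k) \<longlonglongrightarrow> mcf g k"
  unfolding mcf_def
proof (intro tendsto_vec_lambda cf_tendsto)
  fix i j
  show "uniform_limit (sphere 0 1) (\<lambda>n z. f n z $ i $ j) (\<lambda>z. g z $ i $ j) sequentially"
    by (intro bounded_linear.uniform_limit[OF bounded_linear_vec_nth] assms)
qed (intro continuous_on_entry assms)

text \<open>A series that converges absolutely on the unit circle may be multiplied by
  \<open>f\<close> term by term, because coefficients are continuous under uniform limits. The
  resulting convolutions are the left sides of the linear equations for the unknown factor.\<close>

lemma mcf_series:
  fixes v :: "nat \<Rightarrow> mat2"
  assumes "summable (\<lambda>n. norm (v n))" "continuous_on (sphere 0 1) f"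
  shows "(\<lambda>n. v n ** mcf f (k - e n)) sums mcf (\<lambda>z. (\<Sum>n. cscale (z powi e n) (v n)) ** f z) k"
proof -
  let ?h = "\<lambda>N z. (\<Sum>n<N. cscale (z powi e n) (v n))"
  have ch: "continuous_on (sphere 0 1) (?h N)" for N
    by (intro continuous_intros continuous_on_cscale) auto
  have ul: "uniform_limit (sphere 0 1) ?h (\<lambda>z. \<Sum>n. cscale (z powi e n) (v n)) sequentially"
  proof (rule Weierstrass_m_test)
    fix n z assume "z \<in> sphere (0::complex) 1"
    then show "norm (cscale (z powi e n) (v n)) \<le> 4 * norm (v n)"
      using norm_cscale[of "z powi e n" "v n"] by (simp add: norm_power_int)
  qed (use assms in \<open>auto intro: summable_mult\<close>)
  have "uniform_limit (sphere 0 1) (\<lambda>N z. ?h N z ** f z) (\<lambda>z. (\<Sum>n. cscale (z powi e n) (v n)) ** f z) sequentially"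
  proof (rule mm.bounded_uniform_limit[OF ul uniform_limit_const])
    show "bounded ((\<lambda>z. \<Sum>n. cscale (z powi e n) (v n)) ` sphere 0 1)" 
      by (intro compact_imp_bounded compact_continuous_image compact_sphere uniform_limit_theorem[OF _ ul] always_eventually allI ch)
        simp
    show "bounded (f ` sphere 0 1)" 
      by (intro compact_imp_bounded compact_continuous_image compact_sphere assms)
  qed
  then have "(\<lambda>N. mcf (\<lambda>z. ?h N z ** f z) k) \<longlonglongrightarrow> mcf (\<lambda>z. (\<Sum>n. cscale (z powi e n) (v n)) ** f z) k"
    by (intro mcf_tendsto mm.continuous_on ch assms)
  moreover have "mcf (\<lambda>z. ?h N z ** f z) k = (\<Sum>n<N. v n ** mcf f (k - e n))" for N
  proof -
    have c: "continuous_on (sphere 0 1) (\<lambda>z. cscale (z powi e n) (v n ** f z))" for n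
      by (intro continuous_on_cscale mm.continuous_on continuous_intros assms) auto
    have "?h N z ** f z = (\<Sum>n<N. cscale (z powi e n) (v n ** f z))" for z
      by (simp add: mm.sum_left cscale_mult)
    then show ?thesis using c by (simp add: mcf_sum mcf_shift mcf_lmult assms)
  qed
  ultimately show ?thesis unfolding sums_def by simp
qed

lemma mcf_const: "mcf (\<lambda>z. A) k = (if k = 0 then A else 0)"
proof -
  have "mcf (\<lambda>z. A) k = (if k \<ge> 0 then mfps (\<lambda>z. A) (nat k) else 0)"
    by (rule mcf_disc[of _ 2]) auto
  moreover have "mfps (\<lambda>z. A) n = (if n = 0 then A else 0)" for n
    by (simp add: mfps_def mat2_eq_iff fps_expansion_def higher_deriv_const)
  ultimately show ?thesis by auto
qed

text \<open>With entries this close, \<open>det A - 1\<close> has norm below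
  \<open>1/4 + 1/4 + 1/16 + 1/16\<close>, hence below 1.\<close>

lemma near_one_GL2:
  assumes "\<And>i j. norm (A $ i $ j - (mat 1 :: mat2) $ i $ j) < 1 / 4"
  shows "A \<in> GL2"
proof -
  define x where "x = A $ 1 $ 1 - 1"
  define y where "y = A $ 2 $ 2 - 1"
  have b: "norm x < 1/4" "norm y < 1/4" "norm (A $ 1 $ 2) < 1/4" "norm (A $ 2 $ 1) < 1/4"
    using assms[of 1 1] assms[of 2 2] assms[of 1 2] assms[of 2 1] by (auto simp: x_def y_def mat_def)
  have "det A = 1 + (x + y + x * y - A $ 1 $ 2 * A $ 2 $ 1)" 
    by (simp add: det_2 x_def y_def algebra_simps)
  moreover have "norm (x + y + x * y - A $ 1 $ 2 * A $ 2 $ 1) < 1"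
  proof -
    have "norm (x * y) \<le> 1/4 * (1/4)" "norm (A $ 1 $ 2 * A $ 2 $ 1) \<le> 1/4 * (1/4)"
      unfolding norm_mult by (intro mult_mono; use b in simp)+
    moreover have "norm (x + y + x * y - A $ 1 $ 2 * A $ 2 $ 1) \<le> norm x + norm y + norm (x * y) + norm (A $ 1 $ 2 * A $ 2 $ 1)"
      by (smt (verit) norm_triangle_ineq norm_triangle_ineq4)
    ultimately show ?thesis using b by simp
  qed
  ultimately have "det A \<noteq> 0" 
    by (metis add_eq_0_iff2 norm_minus_cancel norm_one order_less_irrefl)
  then show ?thesis by (simp add: GL2_iff)
qed

text \<open>Cauchy's estimate on the circle of radius \<open>1 / t\<close> for
  \<open>k \<ge> 0\<close> and of radius \<open>t\<close> for \<open>k < 0\<close>; both lie in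
  \<open>ann r\<close> because \<open>r < t\<close>. The factor 4 sums the entries.\<close>

lemma mcf_bound:
  assumes "hol2 b (ann r)" "0 < r" "r < t" "t < 1" "\<And>z. z \<in> ann r \<Longrightarrow> norm (b z) \<le> M"
  shows "norm (mcf b k) \<le> 4 * M * t ^ nat \<bar>k\<bar>"
proof -
  have "1 / 1 < 1 / t" by (rule frac_less2) (use assms in auto)
  moreover have "1 / t < 1 / r" by (rule frac_less2) (use assms in auto)
  ultimately have t1: "r < 1 / t" "1 / t < 1 / r" "t < 1 / r" using assms by linarith+
  have b: "norm (b z $ i $ j) \<le> M" if "z \<in> ann r" for z i j
    using norm_entry_le assms(5)[OF that] order_trans by blast
  have h: "(\<lambda>z. b z $ i $ j) holomorphic_on ann r" for i j using assms(1) by (simp add: hol2_def)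
  have "norm (mcf b k $ i $ j) \<le> M * t ^ nat \<bar>k\<bar>" for i j
  proof (cases "k \<ge> 0")
    case True
    have "norm (mcf b k $ i $ j) \<le> M * (1 / t) powi (- k)"
      unfolding mcf_def using t1 assms b by (simp, intro cf_bound_circle[OF h]) (auto simp: ann_def)
    also have "(1 / t) powi (- k) = t ^ nat \<bar>k\<bar>" using True by (simp add: power_int_def power_one_over inverse_eq_divide)
    finally show ?thesis .
  next
    case False
    have "norm (mcf b k $ i $ j) \<le> M * t powi (- k)"
      unfolding mcf_def using t1 assms b by (simp, intro cf_bound_circle[OF h]) (auto simp: ann_def)
    also have "t powi (- k) = t ^ nat \<bar>k\<bar>" using False by (simp add: power_int_def)
    finally show ?thesis .
  qed
  note e = this
  show ?thesis using norm_le_entries[of "mcf b k"] e[of 1 1] e[of 1 2] e[of 2 1] e[of 2 2] by simp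
qed

section \<open>Factorization near the identity\<close>

text \<open>The bound does not depend on \<open>n\<close>; this makes a kernel that decays like
  \<open>a^|m - n|\<close> a bounded operator on bounded sequences.\<close>

lemma two_sided_geometric:
  fixes a :: real
  assumes "0 \<le> a" "a < 1"
  shows "summable (\<lambda>m::nat. a ^ nat \<bar>int m - int n\<bar>)" "(\<Sum>m. a ^ nat \<bar>int m - int n\<bar>) \<le> 2 / (1 - a)"
proof -
  let ?f = "\<lambda>m::nat. a ^ nat \<bar>int m - int n\<bar>"
  have sh: "?f (m + n) = a ^ m" for m by simp
  have "summable (\<lambda>m. ?f (m + n))" unfolding sh using assms by (intro summable_geometric) auto
  then show s: "summable ?f" by (subst summable_iff_shift[symmetric, of _ n])
  have "(\<Sum>m. ?f m) = (\<Sum>m. ?f (m + n)) + (\<Sum>m<n. ?f m)" by (rule suminf_split_initial_segment[OF s])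
  also have "(\<Sum>m. ?f (m + n)) = 1 / (1 - a)" unfolding sh using assms by (intro suminf_geometric) auto
  also have "(\<Sum>m<n. ?f m) = (\<Sum>m<n. a ^ Suc m)"
    by (subst sum.nat_diff_reindex[symmetric]) (auto intro!: sum.cong simp: nat_add_distrib)
  also have "\<dots> \<le> (\<Sum>m<n. a ^ m)" using assms by (intro sum_mono power_decreasing) auto
  also have "\<dots> \<le> (\<Sum>m. a ^ m)" using assms by (intro sum_le_suminf summable_geometric) auto
  also have "(\<Sum>m. a ^ m) = 1 / (1 - a)" using assms by (intro suminf_geometric) auto
  finally show "(\<Sum>m. ?f m) \<le> 2 / (1 - a)" by simp
qed

text \<open>The fixed point lives in weighted \<open>\<ell>\<^sup>\<infinity>\<close>, on which convolution with \<open>\<beta>\<close> is bounded.\<close>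

lemma toeplitz_solution:
  fixes \<beta> :: "int \<Rightarrow> mat2" and l :: nat
  assumes \<beta>: "\<And>k. norm (\<beta> k) \<le> M * t ^ nat \<bar>k\<bar>" and q: "0 < t" "t < q" "q < 1"
    and M: "0 \<le> M" "16 / (1 - t / q) * M \<le> 1 / 2" and l: "l \<le> 1"
  obtains v where "\<And>n. norm (v n) \<le> 2 * M * q ^ n"
    "\<And>n. summable (\<lambda>m. v m ** \<beta> (int m - int n))"
    "\<And>n. v n = - \<beta> (int l - 1 - int n) - (\<Sum>m. v m ** \<beta> (int m - int n))"
    "\<And>n. norm (v n + \<beta> (int l - 1 - int n)) \<le> 32 / (1 - t / q) * M\<^sup>2 * q ^ n"
proof -
  \<comment> \<open>With \<open>v n = q^n x n\<close> the decay \<open>t^|k|\<close> of the kernel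
    becomes \<open>(t / q)^|m - n|\<close>, summable because \<open>t < q\<close>;
    \<open>q < 1\<close> will make the power series of \<open>v\<close> converge beyond the unit
    disc. \<open>S\<close> below is 8 from \<open>norm_mult_le\<close> times
    \<open>2 / (1 - a)\<close>.\<close>
  define a where "a = t / q"
  define S where "S = 16 / (1 - a)"
  have a: "0 \<le> a" "a < 1" using q by (auto simp: a_def)
  have S0: "S \<ge> 0" using a by (simp add: S_def)
  have SM: "S * M \<le> 1 / 2" using M(2) by (simp add: S_def a_def)
  \<comment> \<open>For \<open>n \<le> m\<close> the claim is
    \<open>(q t)^d \<le> (t / q)^d\<close>, true since \<open>q \<le> 1\<close>; for
    \<open>m < n\<close> it is an equality because \<open>q a = t\<close>.\<close>
  have weight: "q ^ m * t ^ nat \<bar>int m - int n\<bar> \<le> q ^ n * a ^ nat \<bar>int m - int n\<bar>" for m n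
  proof (cases "n \<le> m")
    case True
    then obtain d where d: "m = n + d" using le_Suc_ex by blast
    have "q * t \<le> a" 
    proof -
      have "q * q \<le> 1" using q by (intro mult_le_one) auto
      then have "t * (q * q) \<le> t * 1" using q by (intro mult_left_mono) auto
      then show ?thesis using q by (simp add: a_def field_simps)
    qed
    then have "(q * t) ^ d \<le> a ^ d" using q by (intro power_mono) auto
    then have "q ^ n * (q * t) ^ d \<le> q ^ n * a ^ d" using q by (intro mult_left_mono) auto
    then show ?thesis using d by (simp add: power_add power_mult_distrib mult_ac)
  next
    case False
    then obtain d where d: "n = m + d" using le_Suc_ex nat_le_linear by blast
    have "q * a = t" using q by (simp add: a_def)
    then have "t ^ d = q ^ d * a ^ d" by (simp add: power_mult_distrib[symmetric])
    then show ?thesis using d by (simp add: power_add)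
  qed
  have tb: "norm ((q ^ m *\<^sub>R y) ** \<beta> (int m - int n)) \<le> 8 * B * M * (q ^ n * a ^ nat \<bar>int m - int n\<bar>)" 
    if "norm y \<le> B" for y :: mat2 and m n B
  proof -
    have B: "0 \<le> B" using that norm_ge_zero order_trans by blast
    have "norm ((q ^ m *\<^sub>R y) ** \<beta> (int m - int n)) \<le> 8 * (q ^ m * norm y) * norm (\<beta> (int m - int n))"
      using norm_mult_le[of "q ^ m *\<^sub>R y" "\<beta> (int m - int n)"] q by simp
    also have "\<dots> \<le> 8 * (q ^ m * B) * (M * t ^ nat \<bar>int m - int n\<bar>)"
      using that q B by (intro mult_mono \<beta> mult_left_mono) auto
    also have "\<dots> = 8 * B * M * (q ^ m * t ^ nat \<bar>int m - int n\<bar>)" by simp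
    also have "\<dots> \<le> 8 * B * M * (q ^ n * a ^ nat \<bar>int m - int n\<bar>)"
      using B M weight[of m n] by (intro mult_left_mono) auto
    finally show ?thesis .
  qed
  have summ: "summable (\<lambda>m. (q ^ m *\<^sub>R y m) ** \<beta> (int m - int n))"
    and sbound: "norm (\<Sum>m. (q ^ m *\<^sub>R y m) ** \<beta> (int m - int n)) \<le> S * B * M * q ^ n"
    if "\<And>m. norm (y m) \<le> B" for y :: "nat \<Rightarrow> mat2" and B n
  proof -
    have B: "0 \<le> B" using that norm_ge_zero order_trans by blast
    have sg: "summable (\<lambda>m. 8 * B * M * (q ^ n * a ^ nat \<bar>int m - int n\<bar>))"
      using two_sided_geometric(1)[OF a] by (intro summable_mult)
    have sn: "summable (\<lambda>m. norm ((q ^ m *\<^sub>R y m) ** \<beta> (int m - int n)))"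
      using tb[OF that] by (intro summable_comparison_test'[OF sg, of 0]) auto
    then show "summable (\<lambda>m. (q ^ m *\<^sub>R y m) ** \<beta> (int m - int n))" by (rule summable_norm_cancel)
    have "norm (\<Sum>m. (q ^ m *\<^sub>R y m) ** \<beta> (int m - int n)) \<le> (\<Sum>m. norm ((q ^ m *\<^sub>R y m) ** \<beta> (int m - int n)))"
      by (rule summable_norm[OF sn])
    also have "\<dots> \<le> (\<Sum>m. 8 * B * M * (q ^ n * a ^ nat \<bar>int m - int n\<bar>))"
      by (intro suminf_le sn sg tb that)
    also have "\<dots> = 8 * B * M * q ^ n * (\<Sum>m. a ^ nat \<bar>int m - int n\<bar>)"
      using two_sided_geometric(1)[OF a] by (subst suminf_mult[symmetric]) (auto simp: mult_ac)
    also have "\<dots> \<le> 8 * B * M * q ^ n * (2 / (1 - a))"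
      using two_sided_geometric(2)[OF a] B M q by (intro mult_left_mono) auto
    finally show "norm (\<Sum>m. (q ^ m *\<^sub>R y m) ** \<beta> (int m - int n)) \<le> S * B * M * q ^ n"
      by (simp add: S_def mult_ac)
  qed
  have \<beta>l: "norm (\<beta> (int l - 1 - int n)) \<le> M * q ^ n" for n
  proof -
    have "t ^ nat \<bar>int l - 1 - int n\<bar> \<le> t ^ n" using q l by (intro power_decreasing) auto
    also have "\<dots> \<le> q ^ n" using q by (intro power_mono) auto
    finally show ?thesis using \<beta>[of "int l - 1 - int n"] M(1) 
      by (meson mult_left_mono order_trans)
  qed
  \<comment> \<open>The required equation for \<open>v\<close>, rewritten for \<open>x\<close> and
    divided by \<open>q^n\<close>; a bounded fixed point of \<open>F\<close> is a solution.\<close>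
  define F where "F y n = - (1 / q ^ n) *\<^sub>R (\<beta> (int l - 1 - int n) + (\<Sum>m. (q ^ m *\<^sub>R y m) ** \<beta> (int m - int n)))" for y :: "nat \<Rightarrow> mat2" and n
  have Fb: "norm (F y n) \<le> M + S * B * M" if "\<And>m. norm (y m) \<le> B" for y B n
  proof -
    have "norm (F y n) = 1 / q ^ n * norm (\<beta> (int l - 1 - int n) + (\<Sum>m. (q ^ m *\<^sub>R y m) ** \<beta> (int m - int n)))"
      using q by (simp add: F_def)
    also have "\<dots> \<le> 1 / q ^ n * (M * q ^ n + S * B * M * q ^ n)"
      using q by (intro mult_left_mono order_trans[OF norm_triangle_ineq] add_mono \<beta>l sbound that) auto
    also have "\<dots> = M + S * B * M" using q by (simp add: field_simps)
    finally show ?thesis .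
  qed
  \<comment> \<open>\<open>S * M \<le> 1 / 2\<close> gives the contraction factor. Boundedness of
    both arguments allows the two series to be subtracted term by term.\<close>
  have lip: "norm (F x n - F y n) \<le> 1 / 2 * B"
    if xy: "\<And>m. norm (x m - y m) \<le> B" and x: "\<And>m. norm (x m) \<le> Bx" and y: "\<And>m. norm (y m) \<le> By"
    for x y n B Bx By
  proof -
    have B: "0 \<le> B" using xy norm_ge_zero order_trans by blast
    have "F x n - F y n = - (1 / q ^ n) *\<^sub>R ((\<Sum>m. (q ^ m *\<^sub>R x m) ** \<beta> (int m - int n)) - (\<Sum>m. (q ^ m *\<^sub>R y m) ** \<beta> (int m - int n)))"
      by (simp add: F_def algebra_simps)
    also have "(\<Sum>m. (q ^ m *\<^sub>R x m) ** \<beta> (int m - int n)) - (\<Sum>m. (q ^ m *\<^sub>R y m) ** \<beta> (int m - int n)) =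
       (\<Sum>m. (q ^ m *\<^sub>R (x m - y m)) ** \<beta> (int m - int n))"
      using summ[OF x, where n=n] summ[OF y, where n=n]
      by (subst suminf_diff) (auto simp: scaleR_diff_right mm.diff_left)
    finally have "norm (F x n - F y n) = 1 / q ^ n * norm (\<Sum>m. (q ^ m *\<^sub>R (x m - y m)) ** \<beta> (int m - int n))"
      using q by simp
    also have "\<dots> \<le> 1 / q ^ n * (S * B * M * q ^ n)"
      using q by (intro mult_left_mono sbound xy) auto
    also have "\<dots> = S * M * B" using q by simp
    also have "\<dots> \<le> 1 / 2 * B" using SM B by (intro mult_right_mono) auto
    finally show ?thesis .
  qed
  \<comment> \<open>Picard iteration from zero. The bound \<open>2 * M\<close> is preserved since
    \<open>M + S * (2 * M) * M \<le> 2 * M\<close>.\<close>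
  define Y where "Y k = (F ^^ k) (\<lambda>_. 0)" for k
  have YS: "Y (Suc k) = F (Y k)" for k by (simp add: Y_def)
  have Yb: "norm (Y k m) \<le> 2 * M" for k m
  proof (induction k arbitrary: m)
    case (Suc k)
    have "norm (Y (Suc k) m) \<le> M + S * (2 * M) * M" unfolding YS by (rule Fb) (rule Suc)
    also have "\<dots> \<le> 2 * M" using mult_right_mono[OF SM M(1)] by simp
    finally show ?case .
  qed (use M in \<open>simp add: Y_def\<close>)
  have Yd: "norm (Y (Suc k) m - Y k m) \<le> 2 * M * (1 / 2) ^ k" for k m
  proof (induction k arbitrary: m)
    case 0
    show ?case using Yb[of 1 m] by (simp add: Y_def)
  next
    case (Suc k)
    show ?case using lip[OF Suc Yb Yb, where n=m] unfolding YS by simp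
  qed
  define x where "x m = (\<Sum>k. Y (Suc k) m - Y k m)" for m
  have geo: "summable (\<lambda>k. 2 * M * (1 / 2 :: real) ^ k)" by (intro summable_mult summable_geometric) simp
  have sY: "summable (\<lambda>k. norm (Y (Suc k) m - Y k m))" for m
    by (rule summable_comparison_test'[OF geo, of 0]) (use Yd in auto)
  have tail: "norm (x m - Y N m) \<le> 4 * M * (1 / 2) ^ N" for m N
  proof -
    have "x m - Y N m = (\<Sum>k. Y (Suc (k + N)) m - Y (k + N) m)"
    proof -
      have "(\<Sum>k<N. Y (Suc k) m - Y k m) = Y N m" by (subst sum_lessThan_telescope) (simp add: Y_def)
      then show ?thesis unfolding x_def
        using suminf_split_initial_segment[OF summable_norm_cancel[OF sY[of m]], of N] by simp
    qed
    also have "norm \<dots> \<le> (\<Sum>k. norm (Y (Suc (k + N)) m - Y (k + N) m))"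
      using summable_ignore_initial_segment[OF sY[of m], of N] by (intro summable_norm) simp
    also have "\<dots> \<le> (\<Sum>k. 2 * M * (1 / 2) ^ (k + N))"
      using summable_ignore_initial_segment[OF sY[of m], of N] summable_ignore_initial_segment[OF geo, of N]
      by (intro suminf_le Yd) auto
    also have "\<dots> = (\<Sum>k. 2 * M * (1 / 2) ^ N * (1 / 2) ^ k)" by (simp add: power_add mult_ac)
    also have "\<dots> = 2 * M * (1 / 2) ^ N * 2" 
      by (subst suminf_mult) (auto simp: suminf_geometric intro: summable_geometric)
    finally show ?thesis by simp
  qed
  have Ylim: "(\<lambda>N. Y N m) \<longlonglongrightarrow> x m" for m
  proof (rule LIM_zero_cancel, rule Lim_null_comparison)
    show "\<forall>\<^sub>F N in sequentially. norm (Y N m - x m) \<le> 4 * M * (1 / 2) ^ N"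
      using tail by (simp add: norm_minus_commute)
    show "(\<lambda>N. 4 * M * (1 / 2) ^ N) \<longlonglongrightarrow> (0::real)"
      by (intro tendsto_mult_right_zero LIMSEQ_realpow_zero) auto
  qed
  have nx': "norm (x m) \<le> 2 * M" for m
    by (rule Lim_norm_ubound[OF _ Ylim]) (auto simp: Yb)
  have fx: "x n = F x n" for n
  proof (rule LIMSEQ_unique)
    show "(\<lambda>N. Y (Suc N) n) \<longlonglongrightarrow> x n" by (rule LIMSEQ_Suc[OF Ylim])
    show "(\<lambda>N. Y (Suc N) n) \<longlonglongrightarrow> F x n"
    proof (rule LIM_zero_cancel, rule Lim_null_comparison)
      show "\<forall>\<^sub>F N in sequentially. norm (Y (Suc N) n - F x n) \<le> 1 / 2 * (4 * M * (1 / 2) ^ N)"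
        unfolding YS using tail by (intro always_eventually allI lip[OF _ Yb nx']) (simp add: norm_minus_commute)
      show "(\<lambda>N. 1 / 2 * (4 * M * (1 / 2) ^ N)) \<longlonglongrightarrow> (0::real)"
        by (intro tendsto_mult_right_zero LIMSEQ_realpow_zero) auto
    qed
  qed
  define v where "v n = q ^ n *\<^sub>R x n" for n
  have v: "v n = - \<beta> (int l - 1 - int n) - (\<Sum>m. v m ** \<beta> (int m - int n))" for n
    unfolding v_def by (subst fx) (use q in \<open>simp add: F_def\<close>)
  show ?thesis
  proof (rule that[of v])
    show "norm (v n) \<le> 2 * M * q ^ n" for n
      using nx'[of n] q by (simp add: v_def mult.commute mult_right_mono)
    show "summable (\<lambda>m. v m ** \<beta> (int m - int n))" for n unfolding v_def by (rule summ[OF nx'])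
    show "v n = - \<beta> (int l - 1 - int n) - (\<Sum>m. v m ** \<beta> (int m - int n))" for n by (rule v)
    \<comment> \<open>By the equation, \<open>v n\<close> differs from its datum only by the
      convolution, which is at most \<open>S * (2 * M) * M\<close> in the weighted norm. This
      quadratic bound later produces the derivative of the factor.\<close>
    show "norm (v n + \<beta> (int l - 1 - int n)) \<le> 32 / (1 - t / q) * M\<^sup>2 * q ^ n" for n
    proof -
      have "norm (v n + \<beta> (int l - 1 - int n)) = norm (\<Sum>m. v m ** \<beta> (int m - int n))"
        by (subst v) simp
      also have "\<dots> \<le> S * (2 * M) * M * q ^ n" unfolding v_def by (rule sbound[OF nx'])
      finally show ?thesis by (simp add: S_def a_def power2_eq_square mult_ac)
    qed
  qed
qed

lemma summable_cscale_powers: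
  fixes v :: "nat \<Rightarrow> mat2"
  assumes "\<And>n. norm (v n) \<le> B * q ^ n" "0 < q" "norm x < 1 / q"
  shows "summable (\<lambda>n. norm (cscale (x ^ n) (v n)))" "norm (\<Sum>n. cscale (x ^ n) (v n)) \<le> 4 * B / (1 - q * norm x)"
proof -
  have B: "0 \<le> B" using order_trans[OF norm_ge_zero assms(1)[of 0]] by simp
  have qx: "q * norm x < 1" using assms by (simp add: field_simps)
  have 1: "norm (cscale (x ^ n) (v n)) \<le> 4 * B * (q * norm x) ^ n" for n
  proof -
    have "norm (cscale (x ^ n) (v n)) \<le> 4 * norm x ^ n * norm (v n)" using norm_cscale[of "x ^ n" "v n"] by (simp add: norm_power)
    also have "\<dots> \<le> 4 * norm x ^ n * (B * q ^ n)" by (intro mult_left_mono assms) auto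
    finally show ?thesis by (simp add: power_mult_distrib mult_ac)
  qed
  have 2: "(\<lambda>n. 4 * B * (q * norm x) ^ n) sums (4 * B * (1 / (1 - q * norm x)))"
    using qx assms(2) by (intro sums_mult geometric_sums) auto
  show s: "summable (\<lambda>n. norm (cscale (x ^ n) (v n)))"
    by (rule summable_comparison_test'[OF sums_summable[OF 2], of 0]) (use 1 in auto)
  have "norm (\<Sum>n. cscale (x ^ n) (v n)) \<le> (\<Sum>n. norm (cscale (x ^ n) (v n)))" by (rule summable_norm[OF s])
  also have "\<dots> \<le> (\<Sum>n. 4 * B * (q * norm x) ^ n)" by (intro suminf_le 1 s sums_summable[OF 2])
  also have "\<dots> = 4 * B / (1 - q * norm x)" using sums_unique[OF 2] by simp
  finally show "norm (\<Sum>n. cscale (x ^ n) (v n)) \<le> 4 * B / (1 - q * norm x)" .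
qed

lemma bounded_linear_cscale: "bounded_linear (cscale c)"
proof (rule bounded_linear_intro[where K="4 * norm c"])
  show "norm (cscale c A) \<le> norm A * (4 * norm c)" for A using norm_cscale[of c A] by (simp add: mult_ac)
qed (simp_all add: mat2_eq_iff cscale_def algebra_simps)

lemma mcf_cong: "(\<And>z. norm z = 1 \<Longrightarrow> f z = g z) \<Longrightarrow> mcf f k = mcf g k"
  unfolding mcf_def by (auto simp: mat2_eq_iff intro!: cf_cong)

lemma hol2_power_series:
  fixes v :: "nat \<Rightarrow> mat2"
  assumes "\<And>n. norm (v n) \<le> B * q ^ n" "0 < q"
  shows "hol2 (\<lambda>x. \<Sum>n. cscale (x ^ n) (v n)) (ball 0 (1 / q))"
  unfolding hol2_def
proof (intro allI)
  fix i j
  have s: "summable (\<lambda>n. cscale (x ^ n) (v n))" if "x \<in> ball 0 (1 / q)" for x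
    using summable_cscale_powers(1)[of v B q x] assms that by (simp add: summable_norm_cancel)
  show "(\<lambda>x. (\<Sum>n. cscale (x ^ n) (v n)) $ i $ j) holomorphic_on ball 0 (1 / q)"
  proof (rule power_series_holomorphic)
    fix w assume w: "w \<in> ball (0::complex) (1 / q)"
    have "(\<lambda>n. cscale (w ^ n) (v n) $ i $ j) sums ((\<Sum>n. cscale (w ^ n) (v n)) $ i $ j)"
      by (intro bounded_linear.sums[OF bounded_linear_vec_nth] summable_sums s w)
    then show "(\<lambda>n. v n $ i $ j * (w - 0) ^ n) sums ((\<Sum>n. cscale (w ^ n) (v n)) $ i $ j)"
      by (simp add: cscale_def mult.commute)
  qed
qed

text \<open>Maximum modulus on a circle that lies in the annulus and encloses \<open>z\<close>.
  Closeness to the identity on the annulus thus spreads to the disc, and with it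
  invertibility.\<close>

lemma disc_bound_from_annulus:
  assumes "f holomorphic_on ball 0 (1 / s)" "0 < s" "s < 1" "\<And>z. z \<in> ann s \<Longrightarrow> norm (f z) \<le> B" "z \<in> ball 0 (1 / s)"
  shows "norm (f z) \<le> B"
proof -
  have s1: "1 < 1 / s" using assms by simp
  define \<rho> where "\<rho> = (max 1 (norm z) + 1 / s) / 2"
  have \<rho>: "norm z < \<rho>" "1 < \<rho>" "\<rho> < 1 / s" using s1 assms(5) by (auto simp: \<rho>_def)
  have sub: "cball 0 \<rho> \<subseteq> ball 0 (1 / s)" using \<rho> by auto
  show ?thesis
  proof (rule maximum_modulus_frontier[of f "cball 0 \<rho>"])
    show "f holomorphic_on interior (cball 0 \<rho>)" 
      by (rule holomorphic_on_subset[OF assms(1) order_trans[OF interior_subset sub]])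
    show "continuous_on (closure (cball 0 \<rho>)) f"
      using assms(1) sub by (auto intro: holomorphic_on_imp_continuous_on holomorphic_on_subset continuous_on_subset)
    show "norm (f z) \<le> B" if "z \<in> frontier (cball 0 \<rho>)" for z
      using that \<rho> assms by (intro assms(4)) (auto simp: ann_def)
  qed (use \<rho> in auto)
qed

lemma norm_near_one_GL2: "norm (A - mat 1) < 1 / 4 \<Longrightarrow> A \<in> GL2"
proof (rule near_one_GL2)
  fix i j assume "norm (A - mat 1) < 1 / 4"
  then show "norm (A $ i $ j - (mat 1 :: mat2) $ i $ j) < 1 / 4"
    using norm_entry_le[of "A - mat 1" i j] by simp
qed

lemma laurent_ext_matrix:
  assumes "hol2 f (ann r)" "0 < r" "r < s" "s < 1" "\<And>k. k < 0 \<Longrightarrow> mcf f k = 0"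
  obtains F where "hol2 F (ball 0 (1 / s))" "\<And>z. z \<in> ann s \<Longrightarrow> F z = f z"
proof -
  have "\<exists>F. F holomorphic_on ball 0 (1 / s) \<and> (\<forall>z\<in>ann s. F z = f z $ i $ j)" for i j
  proof -
    have c: "cf (\<lambda>z. f z $ i $ j) k = 0" if "k < 0" for k
      using assms(5)[OF that] by (simp add: mcf_def mat2_eq_iff)
    have h: "(\<lambda>z. f z $ i $ j) holomorphic_on ann r" using assms(1) unfolding hol2_def by blast
    show ?thesis
    proof (rule laurent_ext[OF h assms(2-4) c])
      fix F assume F: "F holomorphic_on ball 0 (1 / s)" "\<And>z. z \<in> ann s \<Longrightarrow> F z = f z $ i $ j"
      show ?thesis by (intro exI[of _ F] conjI ballI F)
    qed
  qed
  then obtain F where F: "\<And>i j. F i j holomorphic_on ball 0 (1 / s) \<and> (\<forall>z\<in>ann s. F i j z = f z $ i $ j)" by metis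
  show ?thesis
    by (rule that[of "\<lambda>z. \<chi> i j. F i j z"]) (use F in \<open>auto simp: hol2_def mat2_eq_iff\<close>)
qed

text \<open>One seeks \<open>w (1 / z) = 1 + (sum of v n z^(l - 1 - n))\<close> such that
  \<open>w (1 / z) (1 + b)\<close> has no coefficient below degree \<open>l\<close> apart from an
  identity in degree 0; these conditions are the system of \<open>toeplitz_solution\<close>. The
  constants and the radius are independent of \<open>b\<close>, and the linear and quadratic bounds
  serve continuity and differentiability.\<close>

lemma perturbation:
  fixes l :: nat
  assumes "0 < r" "r < 1" "l \<le> 1"
  obtains \<epsilon> C s where "0 < \<epsilon>" "0 \<le> C" "r < s" "s < 1"
    "\<And>b M. hol2 b (ann r) \<Longrightarrow> (\<And>z. z \<in> ann r \<Longrightarrow> norm (b z) \<le> M) \<Longrightarrow> M \<le> \<epsilon> \<Longrightarrow>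
      \<exists>w p. hol2 w (ball 0 (1 / s)) \<and> w ` ball 0 (1 / s) \<subseteq> GL2 \<and> (l = 0 \<longrightarrow> w 0 = mat 1) \<and>
        hol2 p (ball 0 (1 / s)) \<and> p ` ball 0 (1 / s) \<subseteq> GL2 \<and> (l \<noteq> 0 \<longrightarrow> p 0 = mat 1) \<and>
        (\<forall>z\<in>ann s. w (1 / z) ** (mat 1 + b z) = p z) \<and>
        (\<forall>n. norm (mfps w n - (if n = 0 then mat 1 else 0)) \<le> C * M) \<and>
        (\<forall>n. - int n < int l \<longrightarrow> norm (mfps w n - (if n = 0 then mat 1 else 0) + mcf b (- int n)) \<le> C * M\<^sup>2)"
proof -
  \<comment> \<open>The radii are nested as \<open>r < t < q < s0 < s < 1\<close>: \<open>t\<close>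
    governs the decay of the coefficients of \<open>b\<close>, \<open>q\<close> the weight of the
    solution, \<open>ann s0\<close> carries the product \<open>f\<close>, and the discs of radius
    \<open>1 / s\<close> carry both factors.\<close>
  define q where "q = (r + 1) / 2"
  define t where "t = (r + q) / 2"
  define s0 where "s0 = (q + 1) / 2"
  define s where "s = (s0 + 1) / 2"
  have ineq: "r < t" "t < q" "q < s0" "s0 < s" "s < 1" "0 < t" "0 < q" "0 < s0" "0 < s" "q < 1" "t < 1" "s0 < 1"
  proof -
    have "r < q" "q < 1" using assms by (auto simp: q_def)
    moreover from this have "r < t" "t < q" by (auto simp: t_def)
    moreover have "q < s0" "s0 < 1" using \<open>q < 1\<close> by (auto simp: s0_def)
    moreover from this have "s0 < s" "s < 1" by (auto simp: s_def)
    ultimately show "r < t" "t < q" "q < s0" "s0 < s" "s < 1" "0 < t" "0 < q" "0 < s0" "0 < s" "q < 1" "t < 1" "s0 < 1"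
      using assms by linarith+
  qed
  \<comment> \<open>\<open>C1 * M\<close> will bound \<open>w - 1\<close> and \<open>C2 * M\<close>
    will bound \<open>w (1 + b) - 1\<close>. The coefficients of \<open>b\<close> are bounded by
    \<open>4 * M\<close>, so the bounds of \<open>toeplitz_solution\<close> become 8 and 512, both
    absorbed in \<open>C\<close>. The choice of \<open>\<epsilon>\<close> makes the map a
    contraction and keeps \<open>C2 * M\<close> at most 1/8.\<close>
  define S where "S = 16 / (1 - t / q)"
  define K where "K = 128 / (1 - q / s0)"
  define C1 where "C1 = K / s0"
  define C2 where "C2 = C1 + 1 + 8 * C1"
  define C where "C = Max {8, 512 / (1 - t / q)}"
  define \<epsilon> where "\<epsilon> = Min {1, 1 / (8 * S), 1 / (8 * C2)}"
  have pos: "0 < S" "0 < K" "0 < C1" "0 < C2"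
  proof -
    show "0 < S" "0 < K" using ineq by (auto simp: S_def K_def)
    then show "0 < C1" "0 < C2" using ineq by (auto simp: C1_def C2_def intro!: add_pos_pos divide_pos_pos)
  qed
  have eps: "0 < \<epsilon>" "\<epsilon> \<le> 1" "\<epsilon> \<le> 1 / (8 * S)" "\<epsilon> \<le> 1 / (8 * C2)" using pos by (auto simp: \<epsilon>_def)
  have C: "0 \<le> C" "8 \<le> C" "512 / (1 - t / q) \<le> C" by (auto simp: C_def)
  have main: "\<exists>w p. hol2 w (ball 0 (1 / s)) \<and> w ` ball 0 (1 / s) \<subseteq> GL2 \<and> (l = 0 \<longrightarrow> w 0 = mat 1) \<and>
        hol2 p (ball 0 (1 / s)) \<and> p ` ball 0 (1 / s) \<subseteq> GL2 \<and> (l \<noteq> 0 \<longrightarrow> p 0 = mat 1) \<and>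
        (\<forall>z\<in>ann s. w (1 / z) ** (mat 1 + b z) = p z) \<and>
        (\<forall>n. norm (mfps w n - (if n = 0 then mat 1 else 0)) \<le> C * M) \<and>
        (\<forall>n. - int n < int l \<longrightarrow> norm (mfps w n - (if n = 0 then mat 1 else 0) + mcf b (- int n)) \<le> C * M\<^sup>2)"
    if b: "hol2 b (ann r)" and bM: "\<And>z. z \<in> ann r \<Longrightarrow> norm (b z) \<le> M" and M: "M \<le> \<epsilon>" for b M
  proof -
    have M0: "0 \<le> M" using order_trans[OF norm_ge_zero bM[of 1]] assms by (simp add: ann_def)
    have M1: "M \<le> 1" using M eps by simp
    have M4: "0 \<le> 4 * M" using M0 by simp
    define \<beta> where "\<beta> = mcf b"
    have \<beta>: "norm (\<beta> k) \<le> (4 * M) * t ^ nat \<bar>k\<bar>" for k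
      unfolding \<beta>_def using ineq assms by (intro mcf_bound[OF b assms(1) _ _ bM]) auto
    have SM: "16 / (1 - t / q) * (4 * M) \<le> 1 / 2"
    proof -
      have "S * (4 * M) \<le> S * (4 * (1 / (8 * S)))" using M eps pos by (intro mult_left_mono) auto
      also have "S * (4 * (1 / (8 * S))) = 1 / 2" using pos by simp
      finally show ?thesis by (simp only: S_def)
    qed
    obtain v where v: "\<And>n. norm (v n) \<le> 2 * (4 * M) * q ^ n"
        "\<And>n. summable (\<lambda>m. v m ** \<beta> (int m - int n))"
        "\<And>n. v n = - \<beta> (int l - 1 - int n) - (\<Sum>m. v m ** \<beta> (int m - int n))"
        "\<And>n. norm (v n + \<beta> (int l - 1 - int n)) \<le> 32 / (1 - t / q) * (4 * M)\<^sup>2 * q ^ n"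
      using toeplitz_solution[OF \<beta> ineq(6,2,10) M4 SM assms(3)] by blast
    define V where "V x = (\<Sum>n. cscale (x ^ n) (v n))" for x
    \<comment> \<open>The power \<open>1 - l\<close> shifts exponents: for \<open>l = 0\<close> the
      constant term of \<open>w\<close> stays the identity, for \<open>l = 1\<close> it may
      vary.\<close>
    define w where "w x = mat 1 + cscale (x ^ (1 - l)) (V x)" for x
    have hV: "hol2 V (ball 0 (1 / q))" unfolding V_def by (rule hol2_power_series[OF v(1) ineq(7)])
    have hw: "hol2 w (ball 0 (1 / q))"
      using hV unfolding hol2_def w_def cscale_def by (auto intro!: holomorphic_intros)
    have subs: "ball 0 (1 / s0) \<subseteq> ball (0::complex) (1 / q)" "ball 0 (1 / s) \<subseteq> ball (0::complex) (1 / s0)"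
      using ineq by (auto intro!: subset_ball frac_le)
    have wb: "norm (w x - mat 1) \<le> C1 * M" if x: "x \<in> ball 0 (1 / s0)" for x
    proof -
      have "q * norm x \<le> q / s0" using x ineq by (simp add: field_simps)
      moreover have "q / s0 < 1" using ineq by simp
      ultimately have "32 * M / (1 - q * norm x) \<le> 32 * M / (1 - q / s0)"
        using M0 by (intro divide_left_mono mult_pos_pos) auto
      moreover have "norm (V x) \<le> 4 * (2 * (4 * M)) / (1 - q * norm x)"
        unfolding V_def using x subs ineq by (intro summable_cscale_powers v) auto
      ultimately have VV: "norm (V x) \<le> 32 * M / (1 - q / s0)" by simp
      have "1 \<le> 1 / s0" using ineq by simp
      then have "norm (x ^ (1 - l)) \<le> 1 / s0" using x assms(3) by (cases l) (auto simp: norm_power)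
      then have "4 * norm (x ^ (1 - l)) * norm (V x) \<le> 4 * (1 / s0) * (32 * M / (1 - q / s0))"
        using VV ineq by (intro mult_mono) auto
      then show ?thesis using norm_cscale[of "x ^ (1 - l)" "V x"]
        by (simp add: w_def C1_def K_def mult_ac)
    qed
    have C1M: "C1 * M \<le> C2 * M" using M0 pos by (auto simp: C2_def intro!: mult_right_mono)
    have C2M: "C2 * M < 1 / 4"
    proof -
      have "C2 * M \<le> C2 * (1 / (8 * C2))" using M eps pos by (intro mult_left_mono) auto
      then show ?thesis using pos by simp
    qed
    define f where "f z = w (1 / z) ** (mat 1 + b z)" for z
    have hw': "hol2 (\<lambda>z. w (1 / z)) (ann s0)" using hol2_ball_ann(2)[OF hw, of s0] ineq by simp
    have hb: "hol2 (\<lambda>z. mat 1 + b z) (ann r)" by (intro hol2_add b) auto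
    have ann0: "ann s0 \<subseteq> ann r" "ann s \<subseteq> ann s0" using ineq assms by (intro ann_mono; simp)+
    have hf: "hol2 f (ann s0)" unfolding f_def using hb ann0 by (intro hol2_mult hw') (auto intro: hol2_subset)
    have sph: "sphere 0 1 \<subseteq> ann s0" using ineq by (auto simp: ann_def)
    have cb: "continuous_on (sphere 0 1) (\<lambda>z. mat 1 + b z)" "continuous_on (sphere 0 1) b"
      using hol2_continuous[OF hb] hol2_continuous[OF b] continuous_on_subset sph ann0(1) by blast+
    have sv: "summable (\<lambda>n. norm (v n))"
      by (rule summable_comparison_test'[of "\<lambda>n. 2 * (4 * M) * q ^ n" 0]) 
        (use v(1) ineq in \<open>auto intro!: summable_mult summable_geometric\<close>)
    have mcf1: "mcf (\<lambda>z. mat 1 + b z) k = (if k = 0 then mat 1 else 0) + \<beta> k" for k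
      using cb(2) by (simp add: mcf_add mcf_const \<beta>_def)
    have wexp: "w x = mat 1 + (\<Sum>n. cscale (x powi (int n + 1 - int l)) (v n))" if "norm x = 1" for x
    proof -
      have x: "x \<noteq> 0" "norm x < 1 / q" using that ineq by auto
      have "cscale (x ^ (1 - l)) (V x) = (\<Sum>n. cscale (x ^ (1 - l)) (cscale (x ^ n) (v n)))"
        unfolding V_def
        by (rule bounded_linear.suminf[OF bounded_linear_cscale
              summable_norm_cancel[OF summable_cscale_powers(1)[OF v(1) ineq(7) x(2)]]])
      also have "\<dots> = (\<Sum>n. cscale (x powi (int n + 1 - int l)) (v n))"
      proof (rule arg_cong[where f=suminf], rule ext)
        fix n
        have "x powi (int n + 1 - int l) = x powi int (1 - l) * x powi int n"
          using x assms(3) by (subst power_int_add[symmetric]) (auto simp: of_nat_diff algebra_simps)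
        then show "cscale (x ^ (1 - l)) (cscale (x ^ n) (v n)) = cscale (x powi (int n + 1 - int l)) (v n)"
          by (simp add: cscale_def mat2_eq_iff mult.assoc)
      qed
      finally show ?thesis by (simp add: w_def)
    qed
    have cw: "mcf w k = (if k = 0 then mat 1 else 0) + (if k \<ge> 1 - int l then v (nat (k - 1 + int l)) else 0)" for k
    proof -
      let ?W = "\<lambda>z. (\<Sum>n. cscale (z powi (int n + 1 - int l)) (v n)) ** mat 1"
      have "(\<lambda>n. v n ** mcf (\<lambda>z. mat 1) (k - (int n + 1 - int l))) sums mcf ?W k"
        by (rule mcf_series[OF sv]) auto
      moreover have "v n ** mcf (\<lambda>z. mat 1) (k - (int n + 1 - int l)) =
         (if n = nat (k - 1 + int l) then (if k \<ge> 1 - int l then v n else 0) else 0)" for n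
        using assms(3) by (auto simp: mcf_const)
      ultimately have "(\<lambda>n. if n = nat (k - 1 + int l) then (if k \<ge> 1 - int l then v n else 0) else 0) sums mcf ?W k"
        by simp
      from sums_unique2[OF this sums_single]
      have "mcf ?W k = (if k \<ge> 1 - int l then v (nat (k - 1 + int l)) else 0)" .
      moreover have "mcf w k = mcf (\<lambda>z. mat 1 + (w z - mat 1)) k" by simp
      moreover have "\<dots> = mcf (\<lambda>z. mat 1) k + mcf (\<lambda>z. w z - mat 1) k"
        using hw subs ineq by (intro mcf_add continuous_intros hol2_continuous) (auto intro!: hol2_subset[of w "ball 0 (1/q)"])
      moreover have "mcf (\<lambda>z. w z - mat 1) k = mcf ?W k" by (rule mcf_cong) (simp add: wexp)
      ultimately show ?thesis by (simp add: mcf_const)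
    qed
    \<comment> \<open>Here the fixed point equation is spent: every coefficient of \<open>f\<close>
      in a degree below \<open>l\<close> vanishes, except for the identity in degree 0, which is
      reached only for \<open>l = 1\<close> and \<open>N = 0\<close>.\<close>
    have cfj: "mcf f (int l - 1 - int N) = (if int l - 1 - int N = 0 then mat 1 else 0)" for N
    proof -
      let ?j = "int l - 1 - int N"
      let ?G = "\<lambda>z. (\<Sum>n. cscale (z powi (int l - 1 - int n)) (v n)) ** (mat 1 + b z)"
      have "(\<lambda>n. v n ** mcf (\<lambda>z. mat 1 + b z) (?j - (int l - 1 - int n))) sums mcf ?G ?j"
        by (rule mcf_series[OF sv cb(1)])
      moreover have "v n ** mcf (\<lambda>z. mat 1 + b z) (?j - (int l - 1 - int n)) =
         (if n = N then v n else 0) + v n ** \<beta> (int n - int N)" for n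
        by (auto simp: mcf1 mm.add_right)
      moreover have "(\<lambda>n. (if n = N then v n else 0) + v n ** \<beta> (int n - int N)) sums (v N + (\<Sum>n. v n ** \<beta> (int n - int N)))"
        by (intro sums_add sums_single summable_sums v(2))
      ultimately have G: "mcf ?G ?j = v N + (\<Sum>n. v n ** \<beta> (int n - int N))"
        using sums_unique2 by simp
      have fG: "f z - (mat 1 + b z) = ?G z" if "norm z = 1" for z
      proof -
        have "(1 / z) powi (int n + 1 - int l) = z powi (int l - 1 - int n)" for n
          using power_int_minus[of z "int n + 1 - int l"]
          by (simp add: power_int_divide_distrib inverse_eq_divide diff_diff_eq add.commute)
        then have "w (1 / z) = mat 1 + (\<Sum>n. cscale (z powi (int l - 1 - int n)) (v n))"
          using wexp[of "1 / z"] that by (simp add: norm_divide)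
        then show ?thesis by (simp add: f_def mm.add_left)
      qed
      have "mcf f ?j = mcf (\<lambda>z. (mat 1 + b z) + (f z - (mat 1 + b z))) ?j" by simp
      also have "\<dots> = mcf (\<lambda>z. mat 1 + b z) ?j + mcf (\<lambda>z. f z - (mat 1 + b z)) ?j"
        using hf sph cb by (intro mcf_add continuous_intros cb hol2_continuous) (auto intro!: hol2_subset[of f "ann s0"])
      also have "mcf (\<lambda>z. f z - (mat 1 + b z)) ?j = mcf ?G ?j" by (rule mcf_cong) (simp only: fG)
      finally show ?thesis unfolding G mcf1 using v(3)[of N] by simp
    qed
    have fneg: "mcf f k = 0" if "k < 0" for k
      using cfj[of "nat (int l - 1 - k)"] that assms(3) by auto
    obtain p where p: "hol2 p (ball 0 (1 / s))" "\<And>z. z \<in> ann s \<Longrightarrow> p z = f z"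
      using laurent_ext_matrix[OF hf _ _ _ fneg, of s] ineq by auto
    have fb: "norm (f z - mat 1) \<le> C2 * M" if "z \<in> ann s" for z
    proof -
      have z: "norm (w (1 / z) - mat 1) \<le> C1 * M" "norm (b z) \<le> M"
        using wb[of "1 / z"] bM[of z] that ann0 ball_ann(2)[of "1/s0" z] ineq by auto
      have "f z - mat 1 = (w (1 / z) - mat 1) + b z + (w (1 / z) - mat 1) ** b z"
        by (simp add: f_def mm.add_right mm.diff_left)
      also have "norm \<dots> \<le> norm (w (1 / z) - mat 1) + norm (b z) + 8 * norm (w (1 / z) - mat 1) * norm (b z)"
        by (intro order_trans[OF norm_triangle_ineq] add_mono norm_triangle_ineq norm_mult_le)
      also have "\<dots> \<le> C1 * M + M + 8 * (C1 * M) * 1"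
        using z M0 M1 pos by (intro add_mono mult_mono) auto
      finally show ?thesis by (simp add: C2_def algebra_simps)
    qed
    \<comment> \<open>\<open>p\<close> agrees with \<open>f\<close> on \<open>ann s\<close>, where
      \<open>f\<close> is near the identity, so \<open>p\<close> is near the identity on the whole
      disc.\<close>
    have pGL: "p z \<in> GL2" if "z \<in> ball 0 (1 / s)" for z
    proof (rule near_one_GL2)
      fix i j
      have "norm (p z $ i $ j - (mat 1 :: mat2) $ i $ j) \<le> C2 * M"
      proof (rule disc_bound_from_annulus[OF _ _ _ _ that])
        show "(\<lambda>z. p z $ i $ j - (mat 1 :: mat2) $ i $ j) holomorphic_on ball 0 (1 / s)"
          using p(1) by (auto simp: hol2_def intro!: holomorphic_intros)
        fix z assume z: "z \<in> ann s"
        show "norm (p z $ i $ j - (mat 1 :: mat2) $ i $ j) \<le> C2 * M"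
          using norm_entry_le[of "p z - mat 1" i j] fb[OF z] p(2)[OF z] by simp
      qed (use ineq in auto)
      then show "norm (p z $ i $ j - (mat 1 :: mat2) $ i $ j) < 1 / 4" using C2M by simp
    qed
    have wGL: "w x \<in> GL2" if "x \<in> ball 0 (1 / s)" for x
      using wb[of x] that subs C1M C2M by (intro norm_near_one_GL2) auto
    have s1: "1 < 1 / s" using ineq by simp
    have hws: "hol2 w (ball 0 (1 / s))" using hol2_subset[OF hw] subs by blast
    have p0: "p 0 = mat 1" if "l \<noteq> 0"
    proof -
      have "mcf p 0 = mcf f 0" unfolding mcf_def using p(2) ineq
        by (simp add: mat2_eq_iff) (auto intro!: cf_cong simp: ann_def)
      then show ?thesis using mcf_disc[OF p(1) s1, of 0] cfj[of 0] that assms(3) by (cases "l = 1") (auto simp: mfps_0)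
    qed
    \<comment> \<open>Index shift between \<open>v\<close> and the Taylor coefficients of
      \<open>w\<close>: for \<open>l = 0\<close> coefficient \<open>n \<ge> 1\<close> is
      \<open>v (n - 1)\<close>, for \<open>l = 1\<close> coefficient \<open>n\<close> is
      \<open>v n\<close> plus the identity at 0.\<close>
    have mw: "mfps w n - (if n = 0 then mat 1 else 0) = (if - int n < int l then v (n + l - 1) else 0)" for n
    proof -
      have "mfps w n = mcf w (int n)" using mcf_disc[OF hws s1, of "int n"] by simp
      moreover have "nat (int n - 1 + int l) = n + l - 1" by linarith
      ultimately show ?thesis using cw[of "int n"] by auto
    qed
    have q1: "q ^ n \<le> 1" for n using ineq by (intro power_le_one) auto
    have e1: "norm (v n) \<le> C * M" for n
    proof -
      have "norm (v n) \<le> 2 * (4 * M) * 1" by (rule order_trans[OF v(1)]) (use q1 M0 in \<open>intro mult_left_mono, auto\<close>)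
      also have "\<dots> \<le> C * M" using C(2) M0 mult_right_mono[of 8 C M] by simp
      finally show ?thesis .
    qed
    have e2: "norm (v n + \<beta> (int l - 1 - int n)) \<le> C * M\<^sup>2" for n
    proof -
      have "norm (v n + \<beta> (int l - 1 - int n)) \<le> 32 / (1 - t / q) * (4 * M)\<^sup>2 * 1"
        by (rule order_trans[OF v(4)]) (use q1 ineq in \<open>intro mult_left_mono, auto\<close>)
      also have "\<dots> = 512 / (1 - t / q) * M\<^sup>2" by (simp add: power_mult_distrib)
      also have "\<dots> \<le> C * M\<^sup>2" using C(3) by (intro mult_right_mono) auto
      finally show ?thesis .
    qed
    show ?thesis
    proof (intro exI conjI allI ballI impI)
      show "norm (mfps w n - (if n = 0 then mat 1 else 0)) \<le> C * M" for n
        unfolding mw using e1[of "n + l - 1"] C M0 by auto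
      show "norm (mfps w n - (if n = 0 then mat 1 else 0) + mcf b (- int n)) \<le> C * M\<^sup>2" if "- int n < int l" for n
      proof -
        have "int l - 1 - int (n + l - 1) = - int n" using that by linarith
        then show ?thesis unfolding mw using e2[of "n + l - 1"] that by (simp add: \<beta>_def)
      qed
    qed (use hws wGL pGL p p0 f_def in \<open>auto simp: w_def cscale_def mat2_eq_iff\<close>)
  qed
  show ?thesis by (rule that[of \<epsilon> C s]) (use eps C ineq main in auto)
qed

section \<open>The diagonal loops\<close>

text \<open>Closed form of \<open>exp (c Q0)\<close>, by \<open>mexp_Q0\<close>; it replaces the
  power series \<open>mexp\<close> in all computations.\<close>

definition dg :: "complex \<Rightarrow> mat2" where
  "dg c = (\<chi> a b. if a = b then exp (if a = 1 then - \<i> * c else \<i> * c) else 0)"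

definition ddg :: "int \<times> int \<Rightarrow> complex \<Rightarrow> mat2" where
  "ddg m z = (\<chi> a b. if a = b then z powi (if a = 1 then fst m else snd m) else 0)"

lemma dg_add: "dg (c + c') = dg c ** dg c'"
  by (auto simp: dg_def mat2_eq_iff forall_2 matrix_matrix_mult_def sum_2 exp_add[symmetric] algebra_simps)

lemma dg_0 [simp]: "dg 0 = mat 1"
  by (auto simp: dg_def mat2_eq_iff mat_def)

lemma dg_minus: "dg c ** dg (- c) = mat 1" "dg (- c) ** dg c = mat 1"
  using dg_add[of c "-c"] dg_add[of "-c" c] by auto

lemma dg_GL2 [simp]: "dg c \<in> GL2"
  using dg_minus unfolding GL2_def invertible_def by blast

lemma inv2_unique: "A \<in> GL2 \<Longrightarrow> A ** B = mat 1 \<Longrightarrow> inv2 A = B"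
  by (metis inv2_mult(2) matrix_mul_assoc matrix_mul_lid matrix_mul_rid)

lemma inv2_dg [simp]: "inv2 (dg c) = dg (- c)"
  by (intro inv2_unique) (auto simp: dg_minus)

lemma dg_Q0: "dg c ** Q0 = Q0 ** dg c"
  by (auto simp: dg_def Q0_def mat2_eq_iff forall_2 matrix_matrix_mult_def sum_2)

lemma dg_ddg: "dg c ** ddg m z = ddg m z ** dg c"
  by (auto simp: dg_def ddg_def mat2_eq_iff forall_2 matrix_matrix_mult_def sum_2)

lemma ddg_add: "z \<noteq> 0 \<Longrightarrow> ddg (m + m') z = ddg m z ** ddg m' z"
  by (auto simp: ddg_def mat2_eq_iff forall_2 matrix_matrix_mult_def sum_2 power_int_add)

lemma ddg_0 [simp]: "ddg 0 z = mat 1"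
  by (auto simp: ddg_def mat2_eq_iff mat_def)

lemma ddg_minus: "z \<noteq> 0 \<Longrightarrow> ddg m z ** ddg (- m) z = mat 1" "z \<noteq> 0 \<Longrightarrow> ddg (- m) z ** ddg m z = mat 1"
  using ddg_add[of z m "-m"] ddg_add[of z "-m" m] by auto

lemma ddg_GL2: "z \<noteq> 0 \<Longrightarrow> ddg m z \<in> GL2"
  using ddg_minus unfolding GL2_def invertible_def by blast

lemma inv2_ddg: "z \<noteq> 0 \<Longrightarrow> inv2 (ddg m z) = ddg (- m) z"
  by (intro inv2_unique) (auto simp: ddg_minus ddg_GL2)

lemma ddg_scalar: "ddg (k, k) z ** A = A ** ddg (k, k) z"
  by (auto simp: ddg_def mat2_eq_iff forall_2 matrix_matrix_mult_def sum_2)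

lemma hol2_ddg:
  assumes "0 \<notin> U"
  shows "hol2 (ddg m) U"
proof -
  have "(\<lambda>z. ddg m z $ i $ j) holomorphic_on U" for i j
    using assms by (cases "i = j") (auto simp: ddg_def intro!: holomorphic_intros)
  then show ?thesis by (simp add: hol2_def)
qed

lemma hol2_dg:
  assumes "f holomorphic_on U"
  shows "hol2 (\<lambda>z. dg (f z)) U"
proof -
  have "(\<lambda>z. dg (f z) $ i $ j) holomorphic_on U" for i j
    using assms by (cases "i = j"; cases "i = 1") (auto simp: dg_def intro!: holomorphic_intros)
  then show ?thesis by (simp add: hol2_def)
qed

section \<open>Exponentials of \<open>Q0\<close> and parameter series\<close>

lemma sums_mat2I:
  fixes f :: "nat \<Rightarrow> mat2"
  shows "(\<And>i j. (\<lambda>n. f n $ i $ j) sums (A $ i $ j)) \<Longrightarrow> f sums A"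
  unfolding sums_def by (intro vec_tendstoI) (simp add: sum_component)

lemma mexp_Q0: "mexp (cscale c Q0) = dg c"
proof -
  have p: "((**) (cscale c Q0) ^^ n) (mat 1) = (\<chi> a b. if a = b then (if a = 1 then - \<i> * c else \<i> * c) ^ n else 0)" for n
    by (induction n) (auto simp: mat2_eq_iff forall_2 matrix_matrix_mult_def sum_2 mat_def cscale_def Q0_def)
  have "(\<lambda>n. (1 / fact n) *\<^sub>R (((**) (cscale c Q0) ^^ n) (mat 1))) sums dg c"
  proof (rule sums_mat2I)
    fix i j :: 2
    show "(\<lambda>n. ((1 / fact n) *\<^sub>R ((**) (cscale c Q0) ^^ n) (mat 1)) $ i $ j) sums dg c $ i $ j"
      using exp_converges[of "if i = 1 then - \<i> * c else \<i> * c"]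
      by (cases "i = j") (auto simp: p dg_def divide_inverse)
  qed
  then show ?thesis unfolding mexp_def by (rule sums_unique[symmetric])
qed

definition tf :: "nat \<Rightarrow> (nat \<Rightarrow> complex) \<Rightarrow> complex \<Rightarrow> complex" where
  "tf l t z = (\<Sum>i. t (i + l) * z ^ (i + l))"

lemma params_radius:
  assumes "t \<in> params"
  obtains R where "1 < R" "ereal R \<le> conv_radius t"
proof -
  have "ereal 1 < conv_radius t" using assms by (simp add: params_def one_ereal_def)
  then obtain R where "ereal 1 < ereal R" "ereal R < conv_radius t" using ereal_dense2 by blast
  then show ?thesis using that[of R] by auto
qed

lemma params_summable:
  fixes t :: "nat \<Rightarrow> complex"
  assumes "ereal R \<le> conv_radius t" "z \<in> ball 0 R"
  shows "summable (\<lambda>i. t (i + l) * z ^ (i + l))"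
proof -
  have "summable (\<lambda>i. t i * z ^ i)"
  proof (rule summable_in_conv_radius)
    show "ereal (norm z) < conv_radius t" using assms by (auto intro: less_le_trans[of _ "ereal R"])
  qed
  then show ?thesis by (subst summable_iff_shift[of "\<lambda>i. t i * z ^ i" l])
qed

lemma tf_split: 
  assumes "ereal R \<le> conv_radius t" "z \<in> ball 0 R"
  shows "tf l t z = (\<Sum>i. t i * z ^ i) - (\<Sum>i<l. t i * z ^ i)"
  unfolding tf_def using params_summable[OF assms, of 0]
  by (subst suminf_minus_initial_segment) auto

lemma tf_holomorphic:
  assumes "ereal R \<le> conv_radius t"
  shows "tf l t holomorphic_on ball 0 R"
proof -
  have "(\<lambda>z. (\<Sum>i. t i * z ^ i) - (\<Sum>i<l. t i * z ^ i)) holomorphic_on ball 0 R"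
  proof (intro holomorphic_intros)
    show "(\<lambda>z. \<Sum>i. t i * z ^ i) holomorphic_on ball 0 R"
    proof (rule power_series_holomorphic)
      show "(\<lambda>n. t n * (w - 0) ^ n) sums (\<Sum>i. t i * w ^ i)" if "w \<in> ball 0 R" for w
        using params_summable[OF assms that, of 0] by (simp add: summable_sums)
    qed
  qed
  then show ?thesis using tf_split[OF assms] by (subst holomorphic_cong[OF refl]) auto
qed

lemma mexp_gam:
  assumes "summable c"
  shows "mexp (\<Sum>i. cscale (c i) Q0) = dg (\<Sum>i. c i)"
proof -
  have "(\<lambda>i. cscale (c i) Q0) sums cscale (\<Sum>i. c i) Q0"
    using assms by (intro sums_mat2I) (auto simp: cscale_def intro!: sums_mult2 summable_sums)
  then show ?thesis using sums_unique mexp_Q0 by metis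
qed

lemma gam_eq:
  assumes "t \<in> params"
  shows "gam l t = abs_loop (\<lambda>z. dg (tf l t z))"
proof -
  obtain R where R: "1 < R" "ereal R \<le> conv_radius t" using params_radius[OF assms] .
  have e: "mexp (\<Sum>i. cscale (t (i + l) * z ^ (i + l)) Q0) = dg (tf l t z)" if "z \<in> ball 0 R" for z
    unfolding tf_def by (rule mexp_gam[OF params_summable[OF R(2) that]])
  have h: "hol2 (\<lambda>z. dg (tf l t z)) (ann (1 / R))"
    using hol2_ball_ann(1)[OF hol2_dg[OF tf_holomorphic[OF R(2)]], of "1/R"] R by auto
  show ?thesis unfolding gam_def
    by (rule abs_loop_eqI[symmetric, OF h]) (use e ball_ann(1)[of _ R] R in auto)
qed

lemma gam_c_eq:
  assumes "t \<in> params"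
  shows "gam_c l t = abs_loop (\<lambda>z. dg (tf l t (1 / z)))"
proof -
  obtain R where R: "1 < R" "ereal R \<le> conv_radius t" using params_radius[OF assms] .
  have e: "mexp (\<Sum>i. cscale (t (i + l) * z powi (- int (i + l))) Q0) = dg (tf l t (1 / z))" if "1 / z \<in> ball 0 R" for z
  proof -
    have "z powi (- int k) = (1 / z) ^ k" for k by (simp add: power_int_minus power_one_over inverse_eq_divide)
    then show ?thesis unfolding tf_def using mexp_gam[OF params_summable[OF R(2) that, of l]] by (simp del: of_nat_add)
  qed
  have h: "hol2 (\<lambda>z. dg (tf l t (1 / z))) (ann (1 / R))"
    using hol2_ball_ann(2)[OF hol2_dg[OF tf_holomorphic[OF R(2)]], of "1/R"] R by auto
  show ?thesis unfolding gam_c_def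
    by (rule abs_loop_eqI[symmetric, OF h]) (use e ball_ann(2)[of R] R in auto)
qed

definition unitv :: "nat \<Rightarrow> nat \<Rightarrow> complex" where
  "unitv i = (\<lambda>j. if j = i then 1 else 0)"

lemma params_add: "t \<in> params \<Longrightarrow> s \<in> params \<Longrightarrow> (\<lambda>i. t i + c * s i) \<in> params"
proof -
  assume ts: "t \<in> params" "s \<in> params"
  have "conv_radius (\<lambda>i. c * s i) > 1" using ts
    by (cases "c = 0") (auto simp: params_def conv_radius_cmult_left)
  then have "min (conv_radius t) (conv_radius (\<lambda>i. c * s i)) > 1" using ts by (simp add: params_def)
  then show ?thesis 
    unfolding params_def mem_Collect_eq by (rule less_le_trans[OF _ conv_radius_add_ge])
qed

lemma params_unitv: "unitv i \<in> params"
proof -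
  have "conv_radius (unitv i) = \<infinity>"
  proof (rule conv_radius_inftyI'')
    fix z :: complex
    show "summable (\<lambda>n. unitv i n * z ^ n)"
      by (rule summable_finite[of "{i}"]) (auto simp: unitv_def)
  qed
  then show ?thesis by (simp add: params_def)
qed

lemma tf_unitv: "l \<le> i \<Longrightarrow> tf l (unitv i) z = z ^ i"
proof -
  assume "l \<le> i"
  have "(\<lambda>k. if k = i - l then z ^ (k + l) else 0) sums z ^ (i - l + l)" by (rule sums_single)
  moreover have "(\<lambda>k. if k = i - l then z ^ (k + l) else 0) = (\<lambda>k. unitv i (k + l) * z ^ (k + l))"
    using \<open>l \<le> i\<close> by (auto simp: unitv_def fun_eq_iff)
  ultimately show ?thesis unfolding tf_def using \<open>l \<le> i\<close> by (simp add: sums_iff)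
qed

lemma tf_add:
  assumes "ereal R \<le> conv_radius t" "ereal R \<le> conv_radius s" "z \<in> ball 0 R"
  shows "tf l (\<lambda>i. t i + c * s i) z = tf l t z + c * tf l s z"
proof -
  have 1: "summable (\<lambda>i. t (i + l) * z ^ (i + l))" "summable (\<lambda>i. s (i + l) * z ^ (i + l))"
    using assms by (auto intro: params_summable)
  show ?thesis unfolding tf_def
    using 1 by (simp add: distrib_right mult.assoc suminf_add[symmetric] suminf_mult summable_mult)
qed

lemma inv2_GL2_continuous: "continuous_on GL2 inv2"
proof -
  have d: "continuous_on GL2 (\<lambda>A. det A)" unfolding det_2 by (intro continuous_intros continuous_on_entry)
  have "continuous_on GL2 (\<lambda>A. adj2 A $ i $ j)" for i j
    unfolding adj2_def by (cases "i = j"; cases "i = 1") (auto intro!: continuous_intros continuous_on_entry)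
  then show ?thesis unfolding inv2_def
    by (intro continuous_on_vec_lambda continuous_on_divide d) (auto simp: GL2_iff)
qed

lemma open_GL2: "open GL2"
proof -
  have "GL2 = (\<lambda>A. det A) -` (- {0})" by (auto simp: GL2_iff)
  moreover have "continuous_on UNIV (\<lambda>A::mat2. det A)" unfolding det_2 by (intro continuous_intros continuous_on_entry)
  ultimately show ?thesis using open_vimage[of "- {0::complex}" "\<lambda>A::mat2. det A"] by (metis open_delete open_UNIV Compl_eq_Diff_UNIV)
qed

lemma uniform_limit_inv2:
  assumes "compact K" "continuous_on K f" "f ` K \<subseteq> GL2" "uniform_limit K h f F"
  shows "uniform_limit K (\<lambda>n z. inv2 (h n z)) (\<lambda>z. inv2 (f z)) F" "\<forall>\<^sub>F n in F. h n ` K \<subseteq> GL2"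
proof -
  have "compact (f ` K)" using assms by (intro compact_continuous_image)
  then obtain e where e: "e > 0" "(\<Union>x\<in>f ` K. ball x e) \<subseteq> GL2"
    using compact_subset_open_imp_ball_epsilon_subset[OF _ open_GL2 assms(3)] by blast
  \<comment> \<open>Compact because it is the sum of the compact image and a closed ball.\<close>
  define N where "N = (\<Union>x\<in>f ` K. cball x (e/2))"
  have "N = {x + y |x y. x \<in> f ` K \<and> y \<in> cball 0 (e/2)}"
  proof (intro equalityI subsetI)
    fix z assume "z \<in> N"
    then obtain x where "x \<in> K" "norm (z - f x) \<le> e/2" by (auto simp: N_def dist_norm norm_minus_commute)
    moreover have "z = f x + (z - f x)" by simp
    ultimately show "z \<in> {x + y |x y. x \<in> f ` K \<and> y \<in> cball 0 (e/2)}" by fastforce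
  next
    fix z assume "z \<in> {x + y |x y. x \<in> f ` K \<and> y \<in> cball 0 (e/2)}"
    then obtain x y where "x \<in> f ` K" "norm y \<le> e/2" "z = x + y" by auto
    then have "x \<in> f ` K" "z \<in> cball x (e/2)" by (simp_all add: dist_norm)
    then show "z \<in> N" unfolding N_def by blast
  qed
  then have cN: "compact N" using compact_sums[OF \<open>compact (f ` K)\<close> compact_cball, of 0 "e/2"] by (simp only:)
  have NG: "N \<subseteq> GL2"
  proof
    fix z assume "z \<in> N"
    then obtain x where "x \<in> K" "z \<in> ball (f x) e" using e(1) by (auto simp: N_def)
    then show "z \<in> GL2" using e(2) by blast
  qed
  have ev: "\<forall>\<^sub>F n in F. \<forall>y\<in>K. h n y \<in> N"
    using uniform_limitD[OF assms(4), of "e/2"] e(1)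
    by (auto simp: N_def dist_commute elim!: eventually_mono intro: less_imp_le)
  show "uniform_limit K (\<lambda>n z. inv2 (h n z)) (\<lambda>z. inv2 (f z)) F"
    by (rule uniform_limit_compose_uniformly_continuous_on[OF assms(4) _ ev compact_imp_closed[OF cN]])
       (intro compact_uniformly_continuous cN continuous_on_subset[OF inv2_GL2_continuous NG])
  show "\<forall>\<^sub>F n in F. h n ` K \<subseteq> GL2" using ev NG by (auto elim!: eventually_mono)
qed

text \<open>Common form of \<open>u_minus\<close> (for \<open>l = 0\<close>) and
  \<open>p_minus\<close> (for \<open>l = 1\<close>), see \<open>u_minus_um\<close>.\<close>

definition um :: "nat \<Rightarrow> loop \<Rightarrow> loop \<Rightarrow> loop \<Rightarrow> loop" where
  "um l g d \<gamma> = (THE u. u \<in> Npart l \<and> (\<exists>p\<in>Ppart l. conj_loop g d \<gamma> = inv\<^bsub>LGL2\<^esub> u \<otimes>\<^bsub>LGL2\<^esub> p))"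

lemma um_eqI:
  assumes "u \<in> Npart l" "p \<in> Ppart l" "conj_loop g d \<gamma> = inv\<^bsub>LGL2\<^esub> u \<otimes>\<^bsub>LGL2\<^esub> p"
  shows "um l g d \<gamma> = u"
  unfolding um_def
proof (rule the_equality)
  fix u' assume "u' \<in> Npart l \<and> (\<exists>p\<in>Ppart l. conj_loop g d \<gamma> = inv\<^bsub>LGL2\<^esub> u' \<otimes>\<^bsub>LGL2\<^esub> p)"
  then show "u' = u" using factorization_unique[of u' l _ u p] assms by auto
qed (use assms in blast)

lemma um_factor:
  assumes "conj_loop g d \<gamma> \<in> big_cell"
  obtains p where "um l g d \<gamma> \<in> Npart l" "p \<in> Ppart l" "conj_loop g d \<gamma> = inv\<^bsub>LGL2\<^esub> (um l g d \<gamma>) \<otimes>\<^bsub>LGL2\<^esub> p"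
proof -
  obtain u p where "u \<in> Npart l" "p \<in> Ppart l" "conj_loop g d \<gamma> = inv\<^bsub>LGL2\<^esub> u \<otimes>\<^bsub>LGL2\<^esub> p"
    using assms unfolding big_cell_iff[of _ l] by blast
  then show ?thesis using that um_eqI by metis
qed

lemma u_minus_um: "u_minus g d = um 0 g d" "p_minus g d = um 1 g d"
  by (simp_all add: fun_eq_iff u_minus_def p_minus_def um_def Npart_def Ppart_def)

lemma delta_ddg: "delta m = abs_loop (ddg m)"
  by (simp add: delta_def ddg_def[abs_def])

lemma ddg_ann: "0 < r \<Longrightarrow> hol2 (ddg m) (ann r)" "0 < r \<Longrightarrow> ddg m ` ann r \<subseteq> GL2"
  by (auto simp: ann_def intro!: hol2_ddg ddg_GL2)

lemma delta_carrier [simp]: "delta m \<in> carrier LGL2"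
  unfolding delta_ddg by (rule carrier_LGL2I[of _ "1/2"]) (use ddg_ann[of "1/2"] in auto)

lemma conj_loop_abs:
  assumes "hol2 h (ann r)" "h ` ann r \<subseteq> GL2" "hol2 G (ann r)" "0 < r" "r < 1"
  shows "conj_loop (abs_loop G) (delta m) (abs_loop h) = 
    abs_loop (\<lambda>z. ddg m z ** h z ** G z ** inv2 (h z) ** inv2 (ddg m z))"
proof -
  note D = ddg_ann[OF assms(4), of m]
  have i: "isloop (ddg m)" "isloop h" "isloop G" "isloop (\<lambda>z. inv2 (h z))" "isloop (\<lambda>z. inv2 (ddg m z))"
    using assms D by (auto intro!: isloopI[of _ r] hol2_inv2)
  have "inv\<^bsub>LGL2\<^esub> abs_loop h = abs_loop (\<lambda>z. inv2 (h z))" "inv\<^bsub>LGL2\<^esub> delta m = abs_loop (\<lambda>z. inv2 (ddg m z))"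
    unfolding delta_ddg by (rule inv_LGL2_abs[OF assms(1,2,4,5)], rule inv_LGL2_abs[OF D assms(4,5)])
  then show ?thesis unfolding conj_loop_def delta_ddg using i by (simp add: isloop_mult)
qed

lemma mfps_mult:
  assumes "hol2 f (ball 0 R)" "hol2 g (ball 0 R)" "0 < R"
  shows "mfps (\<lambda>x. f x ** g x) n = (\<Sum>k\<le>n. mfps f k ** mfps g (n - k))"
proof -
  have e: "(\<lambda>x. f x $ i $ j) has_fps_expansion fps_expansion (\<lambda>x. f x $ i $ j) 0"
     "(\<lambda>x. g x $ i $ j) has_fps_expansion fps_expansion (\<lambda>x. g x $ i $ j) 0" for i j
    using assms by (auto simp: hol2_def intro!: has_fps_expansion_fps_expansion[of "ball 0 R"])
  have "fps_expansion (\<lambda>x. (f x ** g x) $ i $ j) 0 = 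
      (\<Sum>k\<in>UNIV. fps_expansion (\<lambda>x. f x $ i $ k) 0 * fps_expansion (\<lambda>x. g x $ k $ j) 0)" for i j
  proof -
    have "(\<lambda>x. (f x ** g x) $ i $ j) has_fps_expansion 
      (\<Sum>k\<in>UNIV. fps_expansion (\<lambda>x. f x $ i $ k) 0 * fps_expansion (\<lambda>x. g x $ k $ j) 0)"
      using e by (auto simp: matrix_matrix_mult_def sum_2 intro!: has_fps_expansion_add has_fps_expansion_mult)
    then show ?thesis by (rule fps_expansion_eqI)
  qed
  then show ?thesis
    by (simp add: mfps_def mat2_eq_iff matrix_matrix_mult_def sum_component fps_sum_nth fps_mult_nth sum_2
      atLeast0AtMost sum.distrib)
qed

section \<open>Openness of the big cell\<close>

text \<open>If the conjugate of the base loop factors as \<open>u0^(-1) p0\<close>, then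
  \<open>u0\<close> times the conjugate for \<open>h\<close> times \<open>p0^(-1)\<close> is the
  identity at the base loop and close to it nearby. \<open>bfun\<close> is the deviation to which
  \<open>perturbation\<close> is applied.\<close>

definition bfun :: "(complex \<Rightarrow> mat2) \<Rightarrow> (complex \<Rightarrow> mat2) \<Rightarrow> (complex \<Rightarrow> mat2) \<Rightarrow> int \<times> int \<Rightarrow> (complex \<Rightarrow> mat2) \<Rightarrow> complex \<Rightarrow> mat2" where
  "bfun u0 p0 G m h z = u0 (1 / z) ** (ddg m z ** h z ** G z ** inv2 (h z) ** inv2 (ddg m z)) ** inv2 (p0 z) - mat 1"

text \<open>What \<open>perturbation\<close> yields for a loop \<open>x\<close> near the base: its
  factor is \<open>w u0\<close>, where \<open>w\<close> is the identity up to order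
  \<open>M\<close>, and the identity minus the part of \<open>b\<close> below degree
  \<open>l\<close> up to order \<open>M^2\<close>.\<close>

definition near_factor :: "nat \<Rightarrow> loop \<Rightarrow> loop \<Rightarrow> (complex \<Rightarrow> mat2) \<Rightarrow> real \<Rightarrow> (complex \<Rightarrow> mat2) \<Rightarrow> loop \<Rightarrow> real \<Rightarrow> bool" where
  "near_factor l g d u0 C b x M \<longleftrightarrow> conj_loop g d x \<in> big_cell \<and>
     (\<exists>w \<rho>. 1 < \<rho> \<and> hol2 w (ball 0 \<rho>) \<and> hol2 u0 (ball 0 \<rho>) \<and> um l g d x = abs_loop (\<lambda>z. w (1 / z) ** u0 (1 / z)) \<and>
       (\<forall>n. norm (mfps w n - (if n = 0 then mat 1 else 0)) \<le> C * M) \<and>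
       (\<forall>n. - int n < int l \<longrightarrow> norm (mfps w n - (if n = 0 then mat 1 else 0) + mcf b (- int n)) \<le> C * M\<^sup>2) \<and>
       (l = 0 \<longrightarrow> mfps w 0 = mat 1))"

lemma image_subset_mono: "f ` U \<subseteq> S \<Longrightarrow> V \<subseteq> U \<Longrightarrow> f ` V \<subseteq> S"
  by blast

text \<open>With \<open>1 + b = U c P0^(-1)\<close> and \<open>W (1 + b) = P\<close>, the products
  \<open>W U\<close> and \<open>P P0\<close> are the two factors of \<open>c\<close>.\<close>

lemma factor_pointwise:
  assumes "W \<in> GL2" "U \<in> GL2" "P0 \<in> GL2" "W ** (U ** c ** inv2 P0) = P"
  shows "inv2 (W ** U) ** (P ** P0) = (c :: mat2)"
proof -
  have "P ** P0 = W ** U ** c"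
    using assms(3,4) inv2_mult(2)[OF assms(3)] by (metis matrix_mul_assoc matrix_mul_rid)
  then show ?thesis using inv2_mult(2)[OF GL2_mult[OF assms(1,2)]] by (simp add: matrix_mul_assoc)
qed

text \<open>A base factorization together with constants valid for all nearby \<open>h\<close> at
  once. Everything is holomorphic on \<open>ann r1\<close>, while estimates are made on the smaller
  \<open>ann r'\<close>, since the closed annulus of radius \<open>r'\<close> is compact in
  \<open>ann r1\<close>.\<close>

definition local_data ::
    "nat \<Rightarrow> loop \<Rightarrow> int \<times> int \<Rightarrow> (complex \<Rightarrow> mat2) \<Rightarrow> real \<Rightarrow> real \<Rightarrow> real \<Rightarrow> real \<Rightarrow> real \<Rightarrow> real \<Rightarrow>
     (complex \<Rightarrow> mat2) \<Rightarrow> (complex \<Rightarrow> mat2) \<Rightarrow> (complex \<Rightarrow> mat2) \<Rightarrow> bool" where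
  "local_data l g m f r r1 r' \<epsilon> C R G u0 p0 \<longleftrightarrow>
    (r < r1 \<and> r1 < r' \<and> r' < 1 \<and> 0 < \<epsilon> \<and> 0 \<le> C \<and> 1 < R \<and> 1 / R \<le> r1) \<and>
    (hol2 G (ann r1) \<and> G ` ann r1 \<subseteq> GL2 \<and> f ` ann r1 \<subseteq> GL2) \<and>
    (hol2 u0 (ball 0 R) \<and> u0 ` ball 0 R \<subseteq> GL2 \<and> hol2 p0 (ball 0 R) \<and> p0 ` ball 0 R \<subseteq> GL2) \<and>
    (l \<noteq> 0 \<longrightarrow> p0 0 = mat 1) \<and>
    um l g (delta m) (abs_loop f) = abs_loop (\<lambda>z. u0 (1 / z)) \<and>
    (\<forall>z\<in>ann r1. bfun u0 p0 G m f z = 0) \<and>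
    (\<forall>h. hol2 h (ann r1) \<longrightarrow> h ` ann r1 \<subseteq> GL2 \<longrightarrow> hol2 (bfun u0 p0 G m h) (ann r1)) \<and>
    (\<forall>h M. hol2 h (ann r') \<longrightarrow> h ` ann r' \<subseteq> GL2 \<longrightarrow>
       (\<forall>z\<in>ann r'. norm (bfun u0 p0 G m h z) \<le> M) \<longrightarrow> M \<le> \<epsilon> \<longrightarrow>
       near_factor l g (delta m) u0 C (bfun u0 p0 G m h) (abs_loop h) M)"

lemma local_dataD:
  assumes "local_data l g m f r r1 r' \<epsilon> C R G u0 p0"
  shows "r < r1" "r1 < r'" "r' < 1" "0 < \<epsilon>" "0 \<le> C" "1 < R" "1 / R \<le> r1"
    "hol2 G (ann r1)" "G ` ann r1 \<subseteq> GL2" "f ` ann r1 \<subseteq> GL2"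
    "hol2 u0 (ball 0 R)" "u0 ` ball 0 R \<subseteq> GL2" "hol2 p0 (ball 0 R)" "p0 ` ball 0 R \<subseteq> GL2"
    "l \<noteq> 0 \<Longrightarrow> p0 0 = mat 1"
    "um l g (delta m) (abs_loop f) = abs_loop (\<lambda>z. u0 (1 / z))"
    "\<And>z. z \<in> ann r1 \<Longrightarrow> bfun u0 p0 G m f z = 0"
    "\<And>h. hol2 h (ann r1) \<Longrightarrow> h ` ann r1 \<subseteq> GL2 \<Longrightarrow> hol2 (bfun u0 p0 G m h) (ann r1)"
    "\<And>h M. hol2 h (ann r') \<Longrightarrow> h ` ann r' \<subseteq> GL2 \<Longrightarrow> (\<And>z. z \<in> ann r' \<Longrightarrow> norm (bfun u0 p0 G m h z) \<le> M) \<Longrightarrow> M \<le> \<epsilon> \<Longrightarrow>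
       near_factor l g (delta m) u0 C (bfun u0 p0 G m h) (abs_loop h) M"
  using assms unfolding local_data_def by simp_all

text \<open>Representatives of \<open>g\<close>, of the base loop and of its two factors are brought
  to one annulus. Factoring \<open>1 + bfun\<close> by \<open>perturbation\<close> and multiplying
  back by \<open>u0\<close> and \<open>p0\<close> factors the conjugate of every nearby
  loop.\<close>

lemma local_factorization:
  assumes l: "l \<le> 1" and f: "abs_loop f \<in> carrier LGL2" "hol2 f (ann r)" "0 < r" "r < 1"
    and g: "g \<in> carrier LGL2" and bc: "conj_loop g (delta m) (abs_loop f) \<in> big_cell"
  shows "\<exists>r1 r' \<epsilon> C R G u0 p0. local_data l g m f r r1 r' \<epsilon> C R G u0 p0"
proof -
  obtain s where s: "r \<le> s" "s < 1" "f ` ann s \<subseteq> GL2" using carrier_LGL2_abs[OF f] .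
  obtain G t where G: "g = abs_loop G" "0 < t" "t < 1" "hol2 G (ann t)" "G ` ann t \<subseteq> GL2"
    using g unfolding carrier_LGL2_iff by blast
  obtain p where p: "um l g (delta m) (abs_loop f) \<in> Npart l" "p \<in> Ppart l"
    "conj_loop g (delta m) (abs_loop f) = inv\<^bsub>LGL2\<^esub> (um l g (delta m) (abs_loop f)) \<otimes>\<^bsub>LGL2\<^esub> p"
    using um_factor[OF bc] .
  obtain u0 R1 where u0: "um l g (delta m) (abs_loop f) = abs_loop (\<lambda>z. u0 (1 / z))" "1 < R1" "hol2 u0 (ball 0 R1)" 
     "u0 ` ball 0 R1 \<subseteq> GL2" "l = 0 \<longrightarrow> u0 0 = mat 1" using p(1) unfolding Npart_iff by blast
  obtain p0 R2 where p0: "p = abs_loop p0" "1 < R2" "hol2 p0 (ball 0 R2)" 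
     "p0 ` ball 0 R2 \<subseteq> GL2" "l \<noteq> 0 \<longrightarrow> p0 0 = mat 1" using p(2) unfolding Ppart_iff by blast
  define R where "R = min R1 R2"
  have R: "1 < R" using u0 p0 by (simp add: R_def)
  have sub: "ball 0 R \<subseteq> ball (0::complex) R1" "ball 0 R \<subseteq> ball (0::complex) R2" by (auto simp: R_def)
  have u1: "hol2 u0 (ball 0 R)" "u0 ` ball 0 R \<subseteq> GL2" and p1: "hol2 p0 (ball 0 R)" "p0 ` ball 0 R \<subseteq> GL2"
    using u0 p0 sub hol2_subset by blast+
  \<comment> \<open>The largest radius, hence the smallest annulus: on \<open>ann a\<close> all of
    \<open>f\<close>, \<open>G\<close>, \<open>u0 (1 / z)\<close> and \<open>p0\<close> are
    holomorphic and invertible.\<close>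
  define a where "a = Max {s, t, 1 / R}"
  have a: "s \<le> a" "t \<le> a" "1 / R \<le> a" "a < 1" "0 < a" using s G R f by (auto simp: a_def)
  have fa: "hol2 f (ann a)" "f ` ann a \<subseteq> GL2" and Ga: "hol2 G (ann a)" "G ` ann a \<subseteq> GL2"
  proof -
    have "ann a \<subseteq> ann r" "ann a \<subseteq> ann s" "ann a \<subseteq> ann t" using a s(1) f(3) G(2) by (intro ann_mono; simp)+
    note S = this
    show "hol2 f (ann a)" by (rule hol2_subset[OF f(2) S(1)])
    show "f ` ann a \<subseteq> GL2" by (rule image_subset_mono[OF s(3) S(2)])
    show "hol2 G (ann a)" by (rule hol2_subset[OF G(4) S(3)])
    show "G ` ann a \<subseteq> GL2" by (rule image_subset_mono[OF G(5) S(3)])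
  qed
  have inb: "z \<in> ball 0 R" "1 / z \<in> ball 0 R" if "z \<in> ann a" for z
    using that ann_mono[of "1/R" a] a R ball_ann(1)[of z R] ball_ann(2)[of R z] by auto
  have z0: "z \<noteq> 0" if "z \<in> ann a" for z using that a zero_notin_ann by blast
  let ?c = "\<lambda>h z. ddg m z ** h z ** G z ** inv2 (h z) ** inv2 (ddg m z)"
  note D = ddg_ann[OF a(5), of m]
  have uz: "hol2 (\<lambda>z. u0 (1 / z)) (ann a)" "(\<lambda>z. u0 (1 / z)) ` ann a \<subseteq> GL2"
    using hol2_ball_ann(2)[OF u1(1) a(3)] R u1(2) inb by auto
  have pz: "hol2 p0 (ann a)" "p0 ` ann a \<subseteq> GL2"
    using hol2_ball_ann(1)[OF p1(1) a(3)] R p1(2) inb by auto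
  have hc: "hol2 (?c h) (ann b)" if "hol2 h (ann b)" "h ` ann b \<subseteq> GL2" "a \<le> b" for h b
  proof -
    have s: "ann b \<subseteq> ann a" using ann_mono[OF a(5) that(3)] .
    have "hol2 (\<lambda>z. inv2 (ddg m z)) (ann b)" by (rule hol2_subset[OF hol2_inv2[OF D] s])
    then show ?thesis by (intro hol2_mult hol2_inv2 that(1,2) hol2_subset[OF Ga(1) s] hol2_subset[OF D(1) s]
        image_subset_mono[OF D(2) s])
  qed
  have "conj_loop g (delta m) (abs_loop f) = abs_loop (?c f)"
    unfolding G(1) using fa Ga(1) a by (intro conj_loop_abs) auto
  moreover have "conj_loop g (delta m) (abs_loop f) = abs_loop (\<lambda>z. inv2 (u0 (1 / z)) ** p0 z)"
    unfolding p(3) u0(1) p0(1) using inv_LGL2_abs[OF uz a(5,4)] uz pz a hol2_inv2[OF uz] isloopI by simp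
  ultimately have eq: "abs_loop (?c f) = abs_loop (\<lambda>z. inv2 (u0 (1 / z)) ** p0 z)" by simp
  have il: "isloop (?c f)" "isloop (\<lambda>z. inv2 (u0 (1 / z)) ** p0 z)"
    using hc[OF fa] hol2_mult[OF hol2_inv2[OF uz] pz(1)] a by (auto intro: isloopI)
  obtain a2 where a2: "0 < a2" "a2 < 1" "\<And>z. z \<in> ann a2 \<Longrightarrow> ?c f z = inv2 (u0 (1 / z)) ** p0 z"
    using abs_loop_eqD[OF eq il] by blast
  \<comment> \<open>Moving beyond \<open>a2\<close> as well turns the equality of germs into a
    pointwise equality on \<open>ann r1\<close>.\<close>
  define r1 where "r1 = (max a a2 + 1) / 2"
  define r' where "r' = (r1 + 1) / 2"
  have r1: "a < r1" "a2 < r1" "r1 < 1" "r1 < r'" "r' < 1" using a a2 by (auto simp: r1_def r'_def)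
  obtain \<epsilon> C \<sigma> where pert: "0 < \<epsilon>" "0 \<le> C" "r' < \<sigma>" "\<sigma> < 1"
    "\<And>b M. hol2 b (ann r') \<Longrightarrow> (\<And>z. z \<in> ann r' \<Longrightarrow> norm (b z) \<le> M) \<Longrightarrow> M \<le> \<epsilon> \<Longrightarrow>
      \<exists>w p. hol2 w (ball 0 (1 / \<sigma>)) \<and> w ` ball 0 (1 / \<sigma>) \<subseteq> GL2 \<and> (l = 0 \<longrightarrow> w 0 = mat 1) \<and>
        hol2 p (ball 0 (1 / \<sigma>)) \<and> p ` ball 0 (1 / \<sigma>) \<subseteq> GL2 \<and> (l \<noteq> 0 \<longrightarrow> p 0 = mat 1) \<and>
        (\<forall>z\<in>ann \<sigma>. w (1 / z) ** (mat 1 + b z) = p z) \<and>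
        (\<forall>n. norm (mfps w n - (if n = 0 then mat 1 else 0)) \<le> C * M) \<and>
        (\<forall>n. - int n < int l \<longrightarrow> norm (mfps w n - (if n = 0 then mat 1 else 0) + mcf b (- int n)) \<le> C * M\<^sup>2)"
  proof -
    have "0 < r'" using r1 a by simp
    from perturbation[OF this r1(5) l] show ?thesis using that by blast
  qed
  have sub1: "ann r1 \<subseteq> ann a" "ann r1 \<subseteq> ann a2" "ann r' \<subseteq> ann a" "ann \<sigma> \<subseteq> ann r'"
    using r1 a a2 pert by (intro ann_mono; simp)+
  have hb: "hol2 (bfun u0 p0 G m h) (ann b)" if "hol2 h (ann b)" "h ` ann b \<subseteq> GL2" "a \<le> b" for h b
  proof -
    have "ann b \<subseteq> ann a" using ann_mono[OF a(5) that(3)] .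
    then have "hol2 (\<lambda>z. u0 (1 / z)) (ann b)" "hol2 (\<lambda>z. inv2 (p0 z)) (ann b)" using uz(1) hol2_inv2[OF pz] hol2_subset by blast+
    then show ?thesis unfolding bfun_def 
      by (intro hol2_diff hol2_const) (rule hol2_mult[OF hol2_mult[OF _ hc[OF that]]])
  qed
  have NF: "near_factor l g (delta m) u0 C (bfun u0 p0 G m h) (abs_loop h) M"
    if h: "hol2 h (ann r')" "h ` ann r' \<subseteq> GL2" "\<And>z. z \<in> ann r' \<Longrightarrow> norm (bfun u0 p0 G m h z) \<le> M" "M \<le> \<epsilon>" for h M
  proof -
    let ?b = "bfun u0 p0 G m h"
    have "hol2 ?b (ann r')" using hb[OF h(1,2)] r1 by simp
    from pert(5)[OF this h(3,4)] obtain w p where wp: "hol2 w (ball 0 (1 / \<sigma>))" "w ` ball 0 (1 / \<sigma>) \<subseteq> GL2" "l = 0 \<longrightarrow> w 0 = mat 1"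
        "hol2 p (ball 0 (1 / \<sigma>))" "p ` ball 0 (1 / \<sigma>) \<subseteq> GL2" "l \<noteq> 0 \<longrightarrow> p 0 = mat 1"
        "\<forall>z\<in>ann \<sigma>. w (1 / z) ** (mat 1 + ?b z) = p z" and
        est: "\<forall>n. norm (mfps w n - (if n = 0 then mat 1 else 0)) \<le> C * M"
        "\<forall>n. - int n < int l \<longrightarrow> norm (mfps w n - (if n = 0 then mat 1 else 0) + mcf ?b (- int n)) \<le> C * M\<^sup>2" by blast
    have \<sigma>: "0 < \<sigma>" "1 < 1 / \<sigma>" "1 / R \<le> \<sigma>" using pert r1 a by auto
    define \<rho> where "\<rho> = 1 / \<sigma>"
    have \<rho>: "1 < \<rho>" "\<rho> \<le> R" "1 / \<rho> = \<sigma>" using \<sigma> R by (auto simp: \<rho>_def field_simps)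
    have sb: "ball 0 \<rho> \<subseteq> ball (0::complex) R" using \<rho> by (auto)
    define u' where "u' = (\<lambda>x. w x ** u0 x)"
    define p' where "p' = (\<lambda>x. p x ** p0 x)"
    have u': "hol2 u' (ball 0 \<rho>)" "u' ` ball 0 \<rho> \<subseteq> GL2" and p': "hol2 p' (ball 0 \<rho>)" "p' ` ball 0 \<rho> \<subseteq> GL2"
      using wp u1 p1 sb hol2_subset[OF u1(1) sb] hol2_subset[OF p1(1) sb] unfolding u'_def p'_def \<rho>_def
      by (auto intro!: hol2_mult GL2_mult simp: image_subset_iff)
    have N: "abs_loop (\<lambda>z. u' (1 / z)) \<in> Npart l"
      unfolding Npart_iff using u' \<rho> wp u0 by (intro exI[of _ u'] exI[of _ \<rho>]) (auto simp: u'_def)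
    have P: "abs_loop p' \<in> Ppart l"
      unfolding Ppart_iff using p' \<rho> wp p0 by (intro exI[of _ p'] exI[of _ \<rho>]) (auto simp: p'_def)
    have u'a: "hol2 (\<lambda>z. u' (1 / z)) (ann \<sigma>)" "(\<lambda>z. u' (1 / z)) ` ann \<sigma> \<subseteq> GL2"
      using hol2_ball_ann(2)[OF u'(1), of \<sigma>] u'(2) ball_ann(2)[of \<rho>] \<rho> by auto
    have p'a: "hol2 p' (ann \<sigma>)" using hol2_ball_ann(1)[OF p'(1), of \<sigma>] \<rho> by auto
    have "conj_loop g (delta m) (abs_loop h) = abs_loop (?c h)"
      unfolding G(1) using h r1 a hol2_subset[OF Ga(1) sub1(3)] by (intro conj_loop_abs[of _ r']) auto
    also have "\<dots> = abs_loop (\<lambda>z. inv2 (u' (1 / z)) ** p' z)"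
    proof (rule abs_loop_eqI[of _ \<sigma>, symmetric])
      show "hol2 (\<lambda>z. inv2 (u' (1 / z)) ** p' z) (ann \<sigma>)" using u'a p'a by (intro hol2_mult hol2_inv2)
      fix z assume z: "z \<in> ann \<sigma>"
      have za: "z \<in> ann a" using z sub1 by auto
      have zb: "1 / z \<in> ball 0 (1 / \<sigma>)" using ball_ann(2)[of \<rho> z] z \<rho> \<sigma>(1) unfolding \<rho>_def by simp
      show "inv2 (u' (1 / z)) ** p' z = ?c h z"
        unfolding u'_def p'_def
      proof (rule factor_pointwise)
        show "w (1 / z) \<in> GL2" "u0 (1 / z) \<in> GL2" "p0 z \<in> GL2" using wp(2) zb uz(2) pz(2) za by auto
        show "w (1 / z) ** (u0 (1 / z) ** ?c h z ** inv2 (p0 z)) = p z" 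
          using wp(7) z by (simp add: bfun_def)
      qed
    qed (use \<sigma> pert in auto)
    also have "\<dots> = inv\<^bsub>LGL2\<^esub> (abs_loop (\<lambda>z. u' (1 / z))) \<otimes>\<^bsub>LGL2\<^esub> abs_loop p'"
      using inv_LGL2_abs[OF u'a \<sigma>(1) pert(4)] u'a p'a \<sigma> pert hol2_inv2[OF u'a] isloopI by simp
    finally have cj: "conj_loop g (delta m) (abs_loop h) = inv\<^bsub>LGL2\<^esub> (abs_loop (\<lambda>z. u' (1 / z))) \<otimes>\<^bsub>LGL2\<^esub> abs_loop p'" .
    have "conj_loop g (delta m) (abs_loop h) \<in> big_cell" unfolding big_cell_iff[of _ l] using N P cj by blast
    moreover have "um l g (delta m) (abs_loop h) = abs_loop (\<lambda>z. u' (1 / z))" using um_eqI[OF N P cj] .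
    ultimately show ?thesis
      unfolding near_factor_def using \<rho>(1) est wp(1,3) hol2_subset[OF u1(1) sb]
      by (intro conjI exI[of _ w] exI[of _ \<rho>]) (simp_all add: u'_def \<rho>_def mfps_0)
  qed
  have B0: "bfun u0 p0 G m f z = 0" if z: "z \<in> ann r1" for z
  proof -
    have "z \<in> ann a" using z sub1(1) by blast
    then have g1: "u0 (1 / z) \<in> GL2" "p0 z \<in> GL2" using uz(2) pz(2) by auto
    have "?c f z = inv2 (u0 (1 / z)) ** p0 z" using a2(3) z sub1 by blast
    then show ?thesis
      unfolding bfun_def using inv2_mult[OF g1(1)] inv2_mult[OF g1(2)]
      by (simp add: matrix_mul_assoc)
  qed
  have HB: "hol2 (bfun u0 p0 G m h) (ann r1)" if "hol2 h (ann r1)" "h ` ann r1 \<subseteq> GL2" for h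
    using hb that r1 by simp
  have GL: "f ` ann r1 \<subseteq> GL2" "G ` ann r1 \<subseteq> GL2" "hol2 G (ann r1)"
    by (rule image_subset_mono[OF fa(2) sub1(1)], rule image_subset_mono[OF Ga(2) sub1(1)],
        rule hol2_subset[OF Ga(1) sub1(1)])
  have num: "r < r1" "1 / R \<le> r1" using r1 a s by auto
  show ?thesis
    unfolding local_data_def
    by (intro exI[of _ r1] exI[of _ r'] exI[of _ \<epsilon>] exI[of _ C] exI[of _ R] exI[of _ G] exI[of _ u0] exI[of _ p0]
          conjI allI impI ballI NF B0 HB GL num r1 R pert(1,2) u1 p1 u0(1) p0(5)[rule_format]) blast+
qed

lemma near_factor_coeff:
  assumes "near_factor l g d u0 C b x M"
  shows "\<exists>W. (\<forall>j. loop_coeff (um l g d x) j = (if j \<le> 0 then \<Sum>k\<le>nat (-j). W k ** mfps u0 (nat (-j) - k) else 0)) \<and>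
    (\<forall>n. norm (W n - (if n = 0 then mat 1 else 0)) \<le> C * M) \<and>
    (\<forall>n. - int n < int l \<longrightarrow> norm (W n - (if n = 0 then mat 1 else 0) + mcf b (- int n)) \<le> C * M\<^sup>2) \<and>
    (l = 0 \<longrightarrow> W 0 = mat 1)"
proof -
  obtain w \<rho> where w: "1 < \<rho>" "hol2 w (ball 0 \<rho>)" "hol2 u0 (ball 0 \<rho>)" "um l g d x = abs_loop (\<lambda>z. w (1 / z) ** u0 (1 / z))"
    and est: "\<forall>n. norm (mfps w n - (if n = 0 then mat 1 else 0)) \<le> C * M"
       "\<forall>n. - int n < int l \<longrightarrow> norm (mfps w n - (if n = 0 then mat 1 else 0) + mcf b (- int n)) \<le> C * M\<^sup>2"
       "l = 0 \<longrightarrow> mfps w 0 = mat 1"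
    using assms unfolding near_factor_def by blast
  have "loop_coeff (um l g d x) j = (if j \<le> 0 then \<Sum>k\<le>nat (-j). mfps w k ** mfps u0 (nat (-j) - k) else 0)" for j
    unfolding w(4) using loop_coeff_disc_inv[OF hol2_mult[OF w(2,3)] w(1), of j] mfps_mult[OF w(2,3)] w(1) by simp
  then show ?thesis using est by (intro exI[of _ "mfps w"]) simp
qed

lemma sum_delta_mat:
  fixes A :: "nat \<Rightarrow> mat2"
  shows "(\<Sum>k\<le>n. (if k = 0 then mat 1 else 0) ** A (n - k)) = A n"
proof -
  have "(\<Sum>k\<le>n. (if k = 0 then mat 1 else 0) ** A (n - k)) = (\<Sum>k\<in>{0}. (if k = 0 then mat 1 else 0) ** A (n - k))"
    by (rule sum.mono_neutral_right) auto
  then show ?thesis by simp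
qed

text \<open>Only finitely many coefficients of \<open>u0\<close> enter degree \<open>j\<close>, so
  the constant depends on \<open>j\<close> and the base point but not on \<open>x\<close>.\<close>

lemma near_factor_continuity:
  assumes "near_factor l g d u0 C b x M" "hol2 u0 (ball 0 R)" "1 < R" "0 \<le> C" "0 \<le> M"
  shows "norm (loop_coeff (um l g d x) j - loop_coeff (abs_loop (\<lambda>z. u0 (1 / z))) j) \<le> 8 * C * (\<Sum>k\<le>nat (- j). norm (mfps u0 (nat (- j) - k))) * M"
proof (cases "j \<le> 0")
  case True
  obtain W where W: "\<And>j. loop_coeff (um l g d x) j = (if j \<le> 0 then \<Sum>k\<le>nat (-j). W k ** mfps u0 (nat (-j) - k) else 0)"
    "\<And>n. norm (W n - (if n = 0 then mat 1 else 0)) \<le> C * M"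
    using near_factor_coeff[OF assms(1)] by blast
  let ?n = "nat (- j)"
  have "loop_coeff (um l g d x) j - loop_coeff (abs_loop (\<lambda>z. u0 (1 / z))) j = (\<Sum>k\<le>?n. W k ** mfps u0 (?n - k)) - mfps u0 ?n"
    using True by (simp add: W(1) loop_coeff_disc_inv[OF assms(2,3)])
  also have "\<dots> = (\<Sum>k\<le>?n. W k ** mfps u0 (?n - k)) - (\<Sum>k\<le>?n. (if k = 0 then mat 1 else 0) ** mfps u0 (?n - k))"
    by (rule arg_cong2[OF refl sum_delta_mat[symmetric], where f="(-)"])
  also have "\<dots> = (\<Sum>k\<le>?n. (W k - (if k = 0 then mat 1 else 0)) ** mfps u0 (?n - k))"
    by (simp only: sum_subtractf[symmetric] mm.diff_left)
  also have "norm \<dots> \<le> (\<Sum>k\<le>?n. 8 * (C * M) * norm (mfps u0 (?n - k)))"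
    by (intro order_trans[OF norm_sum] sum_mono order_trans[OF norm_mult_le] mult_mono W(2)) (use assms in auto)
  finally show ?thesis by (simp add: sum_distrib_left mult_ac)
next
  case False
  obtain W where W: "\<And>j. loop_coeff (um l g d x) j = (if j \<le> 0 then \<Sum>k\<le>nat (-j). W k ** mfps u0 (nat (-j) - k) else 0)"
    using near_factor_coeff[OF assms(1)] by blast
  have "loop_coeff (um l g d x) j - loop_coeff (abs_loop (\<lambda>z. u0 (1 / z))) j = 0"
    using False by (simp add: W loop_coeff_disc_inv[OF assms(2,3)])
  then show ?thesis using assms by (simp add: sum_nonneg)
qed

lemma hol2_bounded: "hol2 f (ann r) \<Longrightarrow> 0 < r \<Longrightarrow> r < s \<Longrightarrow> bounded (f ` annulus s)"
  by (intro compact_imp_bounded compact_continuous_image compact_annulus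
     continuous_on_subset[OF hol2_continuous annulus_subset_ann])

lemma holo_near_annulus_ann:
  assumes "holo_near f (annulus r) S" "0 < r" "r < 1"
  shows "hol2 f (ann r)"
proof -
  obtain s where s: "0 < s" "s < r" "hol2 f (ann s)" using holo_near_annulusD[OF assms] .
  show ?thesis by (rule hol2_subset[OF s(3) ann_mono]) (use s in auto)
qed

text \<open>Uniform convergence passes through products and inverses to \<open>bfun\<close> on the
  compact annulus \<open>r'\<close>, where the limit is 0. Hence the smallness parameter in
  \<open>near_factor\<close> may be taken arbitrarily small.\<close>

lemma big_cell_sequential:
  assumes l: "l \<le> 1" and g: "g \<in> carrier LGL2" and r: "0 < r" "r < 1"
    and f: "holo_near f (annulus r) UNIV" and h: "\<And>n. holo_near (h n) (annulus r) UNIV"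
    and lim: "uniform_limit (annulus r) h f sequentially"
    and x: "abs_loop f \<in> carrier LGL2" "conj_loop g (delta m) (abs_loop f) \<in> big_cell"
  shows "\<forall>\<^sub>F n in sequentially. conj_loop g (delta m) (abs_loop (h n)) \<in> big_cell"
    "(\<lambda>n. loop_coeff (um l g (delta m) (abs_loop (h n))) j) \<longlonglongrightarrow> loop_coeff (um l g (delta m) (abs_loop f)) j"
proof -
  note hr = holo_near_annulus_ann[OF _ r]
  obtain r1 r' \<epsilon> C R G u0 p0 where "local_data l g m f r r1 r' \<epsilon> C R G u0 p0"
    using local_factorization[OF l x(1) hr[OF f] r g x(2)] by blast
  note o = local_dataD[OF this]
  have r1: "0 < r1" using r o by simp
  let ?K = "annulus r'"
  have K: "?K \<subseteq> ann r1" "ann r' \<subseteq> ?K" "ann r1 \<subseteq> annulus r" "ann r' \<subseteq> ann r"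
    using annulus_subset_ann[OF r1 o(2)] ann_subset_annulus ann_mono[of r r1] ann_subset_annulus[of r] ann_mono[of r r'] r o(1,2)
    by auto
  have f1: "hol2 f (ann r1)" using hr[OF f] ann_mono[of r r1] r o(1) hol2_subset by auto
  note D = ddg_ann[OF r1, of m]
  have bd: "bounded (F ` ?K)" if "hol2 F (ann r1)" for F using hol2_bounded[OF that r1 o(2)] .
  have limK: "uniform_limit ?K h f sequentially"
    by (rule uniform_limit_on_subset[OF lim order_trans[OF K(1,3)]])
  have cf: "continuous_on ?K f" "f ` ?K \<subseteq> GL2"
    using continuous_on_subset[OF hol2_continuous[OF f1] K(1)] image_subset_mono[OF o(10) K(1)] by auto
  note li = uniform_limit_inv2[OF compact_annulus cf limK]
  have ui: "hol2 (\<lambda>z. u0 (1 / z)) (ann r1)" "hol2 (\<lambda>z. inv2 (p0 z)) (ann r1)" "hol2 (\<lambda>z. inv2 (ddg m z)) (ann r1)" "hol2 (\<lambda>z. inv2 (f z)) (ann r1)"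
    using hol2_ball_ann(2)[OF o(11,7)] hol2_ball_ann(1)[OF hol2_inv2[OF o(13,14)] o(7)] o(6) hol2_inv2[OF D] hol2_inv2[OF f1 o(10)] by auto
  have "uniform_limit ?K (\<lambda>n z. bfun u0 p0 G m (h n) z) (\<lambda>z. bfun u0 p0 G m f z) sequentially"
    unfolding bfun_def
    by (intro uniform_limit_minus uniform_limit_const mm.bounded_uniform_limit li(1) limK
         bd hol2_mult ui f1 D(1) o(8))
  then have "uniform_limit ?K (\<lambda>n z. bfun u0 p0 G m (h n) z) (\<lambda>z. 0) sequentially"
    by (rule uniform_limit_cong'[THEN iffD1, rotated -1]) (use o(17) K(1) in auto)
  then have bev: "\<forall>\<^sub>F n in sequentially. \<forall>z\<in>?K. norm (bfun u0 p0 G m (h n) z) < e" if "e > 0" for e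
    using uniform_limitD[OF \<open>uniform_limit ?K _ (\<lambda>z. 0) sequentially\<close> that] by simp
  have nf: "\<forall>\<^sub>F n in sequentially. near_factor l g (delta m) u0 C (bfun u0 p0 G m (h n)) (abs_loop (h n)) e"
    if e: "0 < e" "e \<le> \<epsilon>" for e
    using bev[OF e(1)] li(2)
  proof eventually_elim
    case (elim n)
    show ?case
    proof (rule o(19)[OF _ _ _ e(2)])
      show "hol2 (h n) (ann r')" using hol2_subset[OF hr[OF h] K(4)] .
      show "h n ` ann r' \<subseteq> GL2" by (rule image_subset_mono[OF elim(2) K(2)])
    qed (use elim(1) K(2) in \<open>auto intro: less_imp_le\<close>)
  qed
  show "\<forall>\<^sub>F n in sequentially. conj_loop g (delta m) (abs_loop (h n)) \<in> big_cell"
    using nf[OF o(4) order_refl] by eventually_elim (simp add: near_factor_def)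
  show "(\<lambda>n. loop_coeff (um l g (delta m) (abs_loop (h n))) j) \<longlonglongrightarrow> loop_coeff (um l g (delta m) (abs_loop f)) j"
  proof (rule tendstoI)
    fix e :: real assume e: "e > 0"
    define B where "B = 8 * C * (\<Sum>k\<le>nat (- j). norm (mfps u0 (nat (- j) - k)))"
    have B: "B \<ge> 0" using o(5) by (auto simp: B_def intro!: mult_nonneg_nonneg sum_nonneg)
    \<comment> \<open>\<open>B + 1\<close> instead of \<open>B\<close> covers the case
      \<open>B = 0\<close>.\<close>
    define d where "d = min \<epsilon> (e / (2 * (B + 1)))"
    have d: "0 < d" "d \<le> \<epsilon>" using e o(4) B by (auto simp: d_def)
    have "B * d \<le> B * (e / (2 * (B + 1)))" using B by (intro mult_left_mono) (auto simp: d_def)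
    also have "\<dots> \<le> (B + 1) * (e / (2 * (B + 1)))" using B e by (intro mult_right_mono) auto
    also have "\<dots> = e / 2"
    proof -
      have "B + 1 \<noteq> 0" using B by linarith
      then show ?thesis by (simp add: divide_simps)
    qed
    also have "\<dots> < e" using e by simp
    finally have Bd: "B * d < e" .
    show "\<forall>\<^sub>F n in sequentially. dist (loop_coeff (um l g (delta m) (abs_loop (h n))) j) (loop_coeff (um l g (delta m) (abs_loop f)) j) < e"
      using nf[OF d]
    proof eventually_elim
      case (elim n)
      from near_factor_continuity[OF this o(11,6,5), of j] d(1) Bd
      show ?case unfolding o(16) dist_norm B_def by simp
    qed
  qed
qed

section \<open>First order variation of the factors\<close>

text \<open>Cauchy's inequality on discs of radius 1/2 bounds the second derivative by
  \<open>2 B / (1/2)^2 = 8 B\<close>. The second estimate adds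
  \<open>norm (deriv \<phi> 0) \<le> B\<close> and uses \<open>norm z \<le> 1/2\<close> to turn the
  quadratic term into \<open>4 B norm z\<close>.\<close>

lemma taylor_first_order:
  assumes "\<phi> holomorphic_on ball 0 2" "\<And>z. norm z \<le> 1 \<Longrightarrow> norm (\<phi> z) \<le> B" "\<phi> 0 = 0" "norm z \<le> 1 / 2"
  shows "norm (\<phi> z - deriv \<phi> 0 * z) \<le> 8 * B * (norm z)\<^sup>2" "norm (\<phi> z) \<le> 5 * B * norm z"
proof -
  have B: "0 \<le> B" using order_trans[OF norm_ge_zero assms(2)[of 0]] by simp
  have c: "continuous_on A \<phi>" if "A \<subseteq> ball 0 2" for A
    using continuous_on_subset[OF holomorphic_on_imp_continuous_on[OF assms(1)] that] .
  have h: "(deriv ^^ k) \<phi> holomorphic_on ball 0 2" for k using assms(1) by (intro holomorphic_higher_deriv) auto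
  have d2: "norm ((deriv ^^ 2) \<phi> x) \<le> 8 * B" if "x \<in> cball 0 (1/2)" for x
  proof -
    have "norm ((deriv ^^ 2) \<phi> x) \<le> fact 2 * B / (1/2) ^ 2"
    proof (rule Cauchy_inequality)
      have sub: "cball x (1 / 2) \<subseteq> ball 0 2"
      proof
        fix y assume "y \<in> cball x (1 / 2)"
        then have "norm y \<le> norm x + 1 / 2" using norm_triangle_sub[of y x] by (simp add: dist_norm norm_minus_commute)
        then show "y \<in> ball 0 2" using that by simp
      qed
      show "continuous_on (cball x (1 / 2)) \<phi>" by (rule c[OF sub])
      show "\<phi> holomorphic_on ball x (1 / 2)"
        by (rule holomorphic_on_subset[OF assms(1) order_trans[OF ball_subset_cball sub]])
      show "norm (\<phi> y) \<le> B" if "norm (x - y) = 1 / 2" for y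
        using that \<open>x \<in> _\<close> norm_triangle_ineq4[of x "x - y"] by (intro assms(2)) auto
    qed simp
    then show ?thesis by (simp add: power2_eq_square)
  qed
  have "norm ((deriv ^^ 0) \<phi> z - (\<Sum>i\<le>1. (deriv ^^ i) \<phi> 0 * (z - 0) ^ i / fact i)) \<le> 8 * B * norm (z - 0) ^ Suc 1 / fact 1"
  proof (rule complex_Taylor[of "cball 0 (1/2)" 1 "\<lambda>i. (deriv ^^ i) \<phi>"])
    show "((deriv ^^ i) \<phi> has_field_derivative (deriv ^^ Suc i) \<phi> x) (at x within cball 0 (1/2))"
      if "x \<in> cball 0 (1/2)" for i x
      using holomorphic_derivI[OF h[of i], of x] that by (auto intro: DERIV_subset)
  qed (use assms d2 in \<open>auto simp: numeral_2_eq_2\<close>)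
  then show 1: "norm (\<phi> z - deriv \<phi> 0 * z) \<le> 8 * B * (norm z)\<^sup>2"
    by (simp add: assms(3) power2_eq_square)
  have "norm ((deriv ^^ 1) \<phi> 0) \<le> fact 1 * B / 1 ^ 1"
    by (rule Cauchy_inequality) (use assms c[of "cball 0 1"] in \<open>auto intro: holomorphic_on_subset simp: subset_iff\<close>)
  then have "norm (deriv \<phi> 0 * z) \<le> B * norm z" by (simp add: norm_mult mult_right_mono)
  moreover have "8 * B * (norm z)\<^sup>2 \<le> 8 * B * (norm z * (1 / 2))" 
    unfolding power2_eq_square using B assms(4) by (intro mult_left_mono) auto
  ultimately show "norm (\<phi> z) \<le> 5 * B * norm z" 
    using 1 norm_triangle_sub[of "\<phi> z" "deriv \<phi> 0 * z"] by simp
qed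

definition mder :: "(complex \<Rightarrow> mat2) \<Rightarrow> mat2 \<Rightarrow> complex \<Rightarrow> bool" where
  "mder F D z \<longleftrightarrow> (\<forall>i j. ((\<lambda>z. F z $ i $ j) has_field_derivative D $ i $ j) (at z))"

lemma mder_const: "mder (\<lambda>z. A) 0 z"
  by (simp add: mder_def)

lemma mder_mult: "mder F D z \<Longrightarrow> mder G E z \<Longrightarrow> mder (\<lambda>z. F z ** G z) (D ** G z + F z ** E) z"
  unfolding mder_def matrix_matrix_mult_def sum_2
  by (auto intro!: derivative_eq_intros simp: algebra_simps)

lemma mder_diff: "mder F D z \<Longrightarrow> mder G E z \<Longrightarrow> mder (\<lambda>z. F z - G z) (D - E) z"
  unfolding mder_def by (auto intro!: derivative_eq_intros)

lemma mder_dg: "mder (\<lambda>z. dg (z * c)) (cscale c Q0) 0"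
  unfolding mder_def
proof (intro allI)
  fix i j :: 2
  show "((\<lambda>z. dg (z * c) $ i $ j) has_field_derivative cscale c Q0 $ i $ j) (at 0)"
    by (cases "i = j"; cases "i = 1") (auto simp: dg_def cscale_def Q0_def intro!: derivative_eq_intros)
qed

lemma quadratic_imp_mder:
  assumes "0 < \<rho>" "\<And>\<zeta>. norm \<zeta> \<le> \<rho> \<Longrightarrow> norm (F \<zeta> - F 0 - cscale \<zeta> Y) \<le> K * (norm \<zeta>)\<^sup>2"
  shows "mder F Y 0"
  unfolding mder_def
proof (intro allI)
  fix i j
  let ?q = "\<lambda>h. (F (0 + h) $ i $ j - F 0 $ i $ j) / h"
  have "(\<lambda>h. ?q h - Y $ i $ j) \<midarrow>0\<rightarrow> 0"
  proof (rule Lim_null_comparison)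
    have "\<forall>\<^sub>F h in at 0. h \<noteq> 0 \<and> norm h < \<rho>" 
      using assms(1) by (auto simp: eventually_at intro!: exI[of _ \<rho>])
    then show "\<forall>\<^sub>F h in at 0. norm (?q h - Y $ i $ j) \<le> K * norm h"
    proof eventually_elim
      case (elim h)
      have "?q h - Y $ i $ j = (F h - F 0 - cscale h Y) $ i $ j / h"
        using elim by (simp add: cscale_def diff_divide_distrib)
      then have "norm (?q h - Y $ i $ j) \<le> norm (F h - F 0 - cscale h Y) / norm h"
        using norm_entry_le[of "F h - F 0 - cscale h Y" i j] by (simp only: norm_divide divide_right_mono norm_ge_zero)
      also have "\<dots> \<le> K * (norm h)\<^sup>2 / norm h" using assms(2)[of h] elim by (intro divide_right_mono) auto
      finally show ?case using elim by (simp add: power2_eq_square)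
    qed
    show "((\<lambda>h. K * norm h) \<longlongrightarrow> 0) (at 0)" by (auto intro!: tendsto_eq_intros)
  qed
  then show "((\<lambda>z. F z $ i $ j) has_field_derivative Y $ i $ j) (at 0)"
    unfolding DERIV_def by (rule LIM_zero_cancel)
qed

text \<open>The product rule at 0, where both exponentials are the identity: each of them
  contributes one term, and the remaining factors cancel against their inverses.\<close>

lemma conj_dg_derivative:
  assumes "U \<in> GL2" "P \<in> GL2"
  shows "mder (\<lambda>\<zeta>. U ** dg (\<zeta> * c) ** inv2 U ** P ** dg (\<zeta> * - c) ** inv2 P - mat 1)
    (U ** cscale c Q0 ** inv2 U - P ** cscale c Q0 ** inv2 P) 0"
proof -
  let ?D = "(((((0 ** dg (0 * c) + U ** cscale c Q0) ** inv2 U + U ** dg (0 * c) ** 0) ** P + U ** dg (0 * c) ** inv2 U ** 0) ** dg (0 * - c) +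
      U ** dg (0 * c) ** inv2 U ** P ** cscale (- c) Q0) ** inv2 P + U ** dg (0 * c) ** inv2 U ** P ** dg (0 * - c) ** 0) - 0"
  have "mder (\<lambda>\<zeta>. U ** dg (\<zeta> * c) ** inv2 U ** P ** dg (\<zeta> * - c) ** inv2 P - mat 1) ?D 0"
    by (intro mder_diff mder_mult mder_const mder_dg)
  moreover have "cscale (- c) Q0 = - cscale c Q0" by (simp add: cscale_def mat2_eq_iff)
  moreover have "U ** cscale c Q0 ** inv2 U ** P ** inv2 P = U ** cscale c Q0 ** inv2 U"
    using inv2_mult[OF assms(2)] by (metis matrix_mul_assoc matrix_mul_rid)
  ultimately show ?thesis using inv2_mult[OF assms(1)] inv2_mult[OF assms(2)]
    by (simp add: mm.zero_left mm.zero_right mm.add_left mm.minus_right mm.minus_left mm.diff_left)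
qed

text \<open>Diagonal matrices commute, so the increment \<open>e\<close> of the exponent can be
  carried past \<open>ddg m z\<close> to the outside; the new conjugate is the old one conjugated by
  \<open>dg e\<close>.\<close>

lemma conj_shift:
  assumes "z \<noteq> 0"
  shows "ddg m z ** dg (T + e) ** G ** inv2 (dg (T + e)) ** inv2 (ddg m z) =
    dg e ** (ddg m z ** dg T ** G ** inv2 (dg T) ** inv2 (ddg m z)) ** dg (- e)"
proof -
  have 1: "ddg m z ** dg (T + e) = dg e ** (ddg m z ** dg T)"
    using dg_add[of e T] by (simp add: add.commute matrix_mul_assoc dg_ddg)
  have "dg (- (T + e)) = dg (- T) ** dg (- e)" using dg_add[of "- T" "- e"] by simp
  then have 2: "inv2 (dg (T + e)) ** inv2 (ddg m z) = (inv2 (dg T) ** inv2 (ddg m z)) ** dg (- e)"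
    unfolding inv2_dg inv2_ddg[OF assms] by (simp only: matrix_mul_assoc[symmetric] dg_ddg[of "- e"])
  have "ddg m z ** dg (T + e) ** G ** inv2 (dg (T + e)) ** inv2 (ddg m z) =
     (ddg m z ** dg (T + e)) ** G ** (inv2 (dg (T + e)) ** inv2 (ddg m z))"
    by (simp add: matrix_mul_assoc del: inv2_dg)
  also have "\<dots> = dg e ** (ddg m z ** dg T ** G ** inv2 (dg T) ** inv2 (ddg m z)) ** dg (- e)"
    unfolding 1 2 by (simp only: matrix_mul_assoc)
  finally show ?thesis .
qed

lemma continuous_dg: "continuous_on A f \<Longrightarrow> continuous_on A (\<lambda>x. dg (f x))"
proof -
  assume f: "continuous_on A f"
  have "continuous_on A (\<lambda>x. dg (f x) $ i $ j)" for i j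
    by (cases "i = j"; cases "i = 1") (auto simp: dg_def intro!: continuous_intros f)
  then show ?thesis by (subst vec_lambda_eta[symmetric], intro continuous_on_vec_lambda, subst vec_lambda_eta[symmetric], intro continuous_on_vec_lambda)
qed

lemma mcf_norm_le:
  assumes "continuous_on (sphere 0 1) f" "\<And>z. norm z = 1 \<Longrightarrow> norm (f z) \<le> M"
  shows "norm (mcf f k) \<le> 4 * M"
proof -
  have e: "norm (mcf f k $ i $ j) \<le> M" for i j
    unfolding mcf_def using assms(2) 
    by simp (intro cf_bound continuous_on_entry assms(1), meson norm_entry_le order_trans)
  show ?thesis using norm_le_entries[of "mcf f k"] e[of 1 1] e[of 1 2] e[of 2 1] e[of 2 2] by simp
qed

lemma mcf_cscale: "continuous_on (sphere 0 1) f \<Longrightarrow> mcf (\<lambda>z. cscale c (f z)) k = cscale c (mcf f k)"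
  by (simp add: mcf_def cscale_def mat2_eq_iff cf_cmult continuous_on_entry)

lemma cscale_simps: "cscale c (A + B) = cscale c A + cscale c B" "cscale c (A - B) = cscale c A - cscale c B"
   "cscale c (- A) = - cscale c A" "cscale c 0 = 0" "cscale 0 A = 0"
   "cscale c (\<Sum>i\<in>I. A' i) = (\<Sum>i\<in>I. cscale c (A' i))"
  by (simp_all add: cscale_def mat2_eq_iff algebra_simps sum_component sum_distrib_left)

text \<open>Since the base conjugate equals \<open>u0^(-1) p0\<close>, the loop \<open>G\<close>
  disappears, and along a line \<open>bfun\<close> is an explicit expression in \<open>u0\<close>,
  \<open>p0\<close> and the increment.\<close>

lemma bfun_line:
  assumes "z \<noteq> 0" "u0 (1 / z) \<in> GL2" "p0 z \<in> GL2" "bfun u0 p0 G m (\<lambda>z. dg (T z)) z = 0"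
  shows "bfun u0 p0 G m (\<lambda>z. dg (T z + e z)) z =
    u0 (1 / z) ** dg (e z) ** inv2 (u0 (1 / z)) ** p0 z ** dg (- e z) ** inv2 (p0 z) - mat 1"
proof -
  let ?c = "ddg m z ** dg (T z) ** G z ** inv2 (dg (T z)) ** inv2 (ddg m z)"
  have "u0 (1 / z) ** ?c ** inv2 (p0 z) = mat 1" using assms(4) by (simp add: bfun_def)
  then have c: "?c = inv2 (u0 (1 / z)) ** p0 z" 
  proof -
    have "inv2 (u0 (1 / z)) ** (u0 (1 / z) ** ?c ** inv2 (p0 z)) ** p0 z =
        (inv2 (u0 (1 / z)) ** u0 (1 / z)) ** ?c ** (inv2 (p0 z) ** p0 z)" by (simp only: matrix_mul_assoc)
    then show ?thesis using \<open>u0 (1 / z) ** ?c ** inv2 (p0 z) = mat 1\<close>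
      by (simp only: inv2_mult(2)[OF assms(2)] inv2_mult(2)[OF assms(3)] matrix_mul_lid matrix_mul_rid)
  qed
  show ?thesis unfolding bfun_def conj_shift[OF assms(1)] c by (simp only: matrix_mul_assoc)
qed

text \<open>Continuity on the compact product of the unit disc and \<open>K\<close> gives one bound
  \<open>B\<close> for all \<open>z\<close>, so the entrywise Taylor estimates are uniform on
  \<open>K\<close>. Four entries turn their constants 5 and 8 into 20 and 32.\<close>

lemma dg_line_bounds:
  fixes K :: "complex set"
  assumes K: "compact K" and U: "continuous_on K U" "U ` K \<subseteq> GL2" and P: "continuous_on K P" "P ` K \<subseteq> GL2"
    and S: "continuous_on K S"
  shows "\<exists>B\<ge>0. \<forall>z\<in>K. \<forall>\<zeta>. norm \<zeta> \<le> 1/2 \<longrightarrow>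
     norm (U z ** dg (\<zeta> * S z) ** inv2 (U z) ** P z ** dg (- (\<zeta> * S z)) ** inv2 (P z) - mat 1) \<le> 20 * B * norm \<zeta> \<and>
     norm (U z ** dg (\<zeta> * S z) ** inv2 (U z) ** P z ** dg (- (\<zeta> * S z)) ** inv2 (P z) - mat 1 -
       cscale \<zeta> (U z ** cscale (S z) Q0 ** inv2 (U z) - P z ** cscale (S z) Q0 ** inv2 (P z))) \<le> 32 * B * (norm \<zeta>)\<^sup>2"
proof -
  let ?b = "\<lambda>\<zeta> z. U z ** dg (\<zeta> * S z) ** inv2 (U z) ** P z ** dg (- (\<zeta> * S z)) ** inv2 (P z) - mat 1"
  have i: "continuous_on K (\<lambda>z. inv2 (U z))" "continuous_on K (\<lambda>z. inv2 (P z))"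
    using U P by (auto intro: continuous_on_compose2[OF inv2_GL2_continuous])
  note sn = continuous_on_compose2[OF _ continuous_on_snd[OF continuous_on_id], of K]
  have "continuous_on (cball 0 1 \<times> K) (\<lambda>x. ?b (fst x) (snd x))"
    by (intro continuous_intros mm.continuous_on continuous_dg sn[OF U(1)] sn[OF P(1)] sn[OF S] sn[OF i(1)] sn[OF i(2)]) auto
  then have "bounded ((\<lambda>x. ?b (fst x) (snd x)) ` (cball 0 1 \<times> K))"
    using K by (intro compact_imp_bounded compact_continuous_image compact_Times compact_cball)
  then obtain B where "\<forall>y\<in>(\<lambda>x. ?b (fst x) (snd x)) ` (cball 0 1 \<times> K). norm y \<le> B" unfolding bounded_iff ..
  then have B: "norm (?b (fst x) (snd x)) \<le> B" if "x \<in> cball 0 1 \<times> K" for x using that by blast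
  define B' where "B' = max B 0"
  have B': "norm (?b \<zeta> z) \<le> B'" if "z \<in> K" "norm \<zeta> \<le> 1" for \<zeta> z
    using B[of "(\<zeta>, z)"] that by (simp add: B'_def)
  show ?thesis
  proof (intro exI[of _ B'] conjI ballI allI impI)
    fix z \<zeta> assume z: "z \<in> K" "norm (\<zeta>::complex) \<le> 1 / 2"
    let ?X = "U z ** cscale (S z) Q0 ** inv2 (U z) - P z ** cscale (S z) Q0 ** inv2 (P z)"
    have md: "mder (\<lambda>\<zeta>. ?b \<zeta> z) ?X 0"
      using conj_dg_derivative[of "U z" "P z" "S z"] U P z by (simp add: image_subset_iff)
    have "hol2 (\<lambda>\<zeta>. ?b \<zeta> z) UNIV" 
      by (intro hol2_diff hol2_mult hol2_const hol2_dg holomorphic_intros)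
    then have h: "(\<lambda>\<zeta>. ?b \<zeta> z $ i $ j) holomorphic_on ball 0 2" for i j
      using holomorphic_on_subset[OF _ subset_UNIV] by (simp only: hol2_def)
    have z0: "?b 0 z $ i $ j = 0" for i j
      using inv2_mult[of "U z"] inv2_mult[of "P z"] U P z by (simp add: image_subset_iff)
    have bb: "norm (?b \<zeta> z $ i $ j) \<le> B'" if "norm \<zeta> \<le> 1" for \<zeta> i j
      using norm_entry_le B'[OF z(1) that] by (rule order_trans)
    have dd: "deriv (\<lambda>\<zeta>. ?b \<zeta> z $ i $ j) 0 = ?X $ i $ j" for i j
      using md unfolding mder_def by (intro DERIV_imp_deriv) blast
    note t1 = taylor_first_order(2)[OF h bb z0 z(2)]
    have t2: "norm ((?b \<zeta> z - cscale \<zeta> ?X) $ i $ j) \<le> 8 * B' * (norm \<zeta>)\<^sup>2" for i j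
      using taylor_first_order(1)[OF h bb z0 z(2), of i j] unfolding dd by (simp add: cscale_def mult.commute)
    show "norm (?b \<zeta> z) \<le> 20 * B' * norm \<zeta>"
      using norm_le_entries[of "?b \<zeta> z"] t1[of 1 1] t1[of 1 2] t1[of 2 1] t1[of 2 2] by linarith
    show "norm (?b \<zeta> z - cscale \<zeta> ?X) \<le> 32 * B' * (norm \<zeta>)\<^sup>2"
      using norm_le_entries[of "?b \<zeta> z - cscale \<zeta> ?X"] t2[of 1 1] t2[of 1 2] t2[of 2 1] t2[of 2 2] by linarith
  qed (simp add: B'_def)
qed

text \<open>The coefficient of \<open>z^(-k)\<close> in \<open>u0 S Q0 u0^(-1)\<close>, the first
  order change that the left factor has to compensate.\<close>

definition lcoef :: "(complex \<Rightarrow> mat2) \<Rightarrow> (complex \<Rightarrow> complex) \<Rightarrow> nat \<Rightarrow> mat2" where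
  "lcoef u0 S k = mcf (\<lambda>z. u0 (1 / z) ** cscale (S z) Q0 ** inv2 (u0 (1 / z))) (- int k)"

lemma gam_line:
  assumes "t \<in> params" "s \<in> params"
  obtains R where "1 < R" "tf l t holomorphic_on ball 0 R" "tf l s holomorphic_on ball 0 R"
    "\<And>\<zeta>. gam l (\<lambda>i. t i + \<zeta> * s i) = abs_loop (\<lambda>z. dg (tf l t z + \<zeta> * tf l s z))"
proof -
  obtain R1 where R1: "1 < R1" "ereal R1 \<le> conv_radius t" using params_radius[OF assms(1)] .
  obtain R2 where R2: "1 < R2" "ereal R2 \<le> conv_radius s" using params_radius[OF assms(2)] .
  define R where "R = min R1 R2"
  have R: "1 < R" "ereal R \<le> conv_radius t" "ereal R \<le> conv_radius s"
    using R1 R2 by (auto simp: R_def min_def intro: order_trans[of _ "ereal R1"] order_trans[of _ "ereal R2"])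
  have hol: "tf l t holomorphic_on ball 0 R" "tf l s holomorphic_on ball 0 R" using tf_holomorphic R by auto
  have "gam l (\<lambda>i. t i + \<zeta> * s i) = abs_loop (\<lambda>z. dg (tf l t z + \<zeta> * tf l s z))" for \<zeta>
    unfolding gam_eq[OF params_add[OF assms]]
  proof (rule abs_loop_eqI[of _ "1/R", symmetric])
    show "hol2 (\<lambda>z. dg (tf l t z + \<zeta> * tf l s z)) (ann (1/R))"
      using R hol by (intro hol2_ball_ann(1)[of _ R] hol2_dg holomorphic_intros) auto
    fix z assume "z \<in> ann (1/R)"
    then show "dg (tf l t z + \<zeta> * tf l s z) = dg (tf l (\<lambda>i. t i + \<zeta> * s i) z)"
      using tf_add[OF R(2,3) ball_ann(1)] by simp
  qed (use R in auto)
  then show ?thesis using that R hol by blast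
qed

lemma tf_at_0: "0 < l \<Longrightarrow> tf l s 0 = 0"
  by (simp add: tf_def power_0_left)

text \<open>The term with \<open>p0\<close> extends to a disc and so has no negative coefficients;
  for \<open>l = 1\<close> its constant coefficient vanishes too, because \<open>S 0 = 0\<close>.
  This is where starting the parameter sum at index \<open>l\<close> matters.\<close>

lemma lcoef_eq:
  assumes u0: "hol2 (\<lambda>z. u0 (1 / z)) (ann a)" "(\<lambda>z. u0 (1 / z)) ` ann a \<subseteq> GL2" and a: "0 < a" "a < 1"
    and p0: "hol2 p0 (ball 0 R)" "p0 ` ball 0 R \<subseteq> GL2" and S: "S holomorphic_on ball 0 R" "0 < l \<Longrightarrow> S 0 = 0"
    and R: "1 < R" and k: "- int k < int l" "l \<le> 1"
  shows "mcf (\<lambda>z. u0 (1 / z) ** cscale (S z) Q0 ** inv2 (u0 (1 / z)) - p0 z ** cscale (S z) Q0 ** inv2 (p0 z)) (- int k) = lcoef u0 S k"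
proof -
  let ?A = "\<lambda>z. u0 (1 / z) ** cscale (S z) Q0 ** inv2 (u0 (1 / z))"
  let ?P = "\<lambda>z. p0 z ** cscale (S z) Q0 ** inv2 (p0 z)"
  have cs: "hol2 (\<lambda>z. cscale (S z) Q0) U" if "S holomorphic_on U" for U
    using that unfolding hol2_def cscale_def by (auto intro!: holomorphic_intros)
  have sp: "sphere 0 1 \<subseteq> ann a" "sphere 0 1 \<subseteq> ball (0::complex) R" using sphere_subset_ann[OF a] R by auto
  have A: "continuous_on (sphere 0 1) ?A"
  proof -
    have "continuous_on (sphere 0 1) (\<lambda>z. u0 (1 / z))" "continuous_on (sphere 0 1) (\<lambda>z. inv2 (u0 (1 / z)))"
      using continuous_on_subset[OF hol2_continuous[OF u0(1)] sp(1)] continuous_on_subset[OF hol2_continuous[OF hol2_inv2[OF u0]] sp(1)] by auto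
    moreover have "continuous_on (sphere 0 1) (\<lambda>z. cscale (S z) Q0)"
      using continuous_on_subset[OF hol2_continuous[OF cs[OF S(1)]] sp(2)] .
    ultimately show ?thesis by (intro mm.continuous_on)
  qed
  have hP: "hol2 ?P (ball 0 R)" by (intro hol2_mult hol2_inv2 p0 cs S)
  have P: "continuous_on (sphere 0 1) (\<lambda>z. - ?P z)"
    by (intro continuous_intros continuous_on_subset[OF hol2_continuous[OF hP] sp(2)])
  have mP: "mcf ?P (- int k) = 0"
  proof (cases "k = 0")
    case True
    then have "0 < l" using k by simp
    then have "?P 0 = 0" using S(2) by (simp add: cscale_simps mm.zero_left mm.zero_right)
    then show ?thesis using mcf_disc[OF hP R, of 0] True by (simp add: mfps_0)
  next
    case False
    then show ?thesis using mcf_disc[OF hP R, of "- int k"] by simp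
  qed
  have "mcf (\<lambda>z. - ?P z) (- int k) = - mcf ?P (- int k)"
  proof -
    have "cscale (-1) A = - A" for A by (simp add: cscale_def mat2_eq_iff)
    then show ?thesis using mcf_cscale[OF continuous_on_subset[OF hol2_continuous[OF hP] sp(2)], of "-1" "- int k"] by simp
  qed
  then have "mcf (\<lambda>z. ?A z + - ?P z) (- int k) = mcf ?A (- int k)"
    using mcf_add[OF A P, of "- int k"] mP by simp
  then show ?thesis by (simp add: lcoef_def)
qed

text \<open>Along the line \<open>bfun\<close> is \<open>\<zeta> X\<close> up to a quadratic error,
  uniformly on an annulus. The quadratic estimate in \<open>near_factor\<close> then says that the
  coefficients of \<open>w\<close> are those of the identity minus \<open>\<zeta>\<close> times
  \<open>lcoef\<close>, up to order two, and multiplication by \<open>u0\<close> gives the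
  derivative of the factor.\<close>

lemma line_derivative:
  assumes l: "l \<le> 1" and g: "g \<in> carrier LGL2" and ts: "t \<in> params" "s \<in> params"
    and bc: "conj_loop g (delta m) (gam l t) \<in> big_cell"
  shows "\<exists>u0 R. 1 < R \<and> hol2 u0 (ball 0 R) \<and> u0 ` ball 0 R \<subseteq> GL2 \<and> um l g (delta m) (gam l t) = abs_loop (\<lambda>z. u0 (1 / z)) \<and>
    (\<forall>\<^sub>F \<zeta> in nhds 0. conj_loop g (delta m) (gam l (\<lambda>i. t i + \<zeta> * s i)) \<in> big_cell) \<and>
    (\<forall>n. mder (\<lambda>\<zeta>. loop_coeff (um l g (delta m) (gam l (\<lambda>i. t i + \<zeta> * s i))) (- int n))
       (- (\<Sum>k\<le>n. if - int k < int l then lcoef u0 (tf l s) k ** mfps u0 (n - k) else 0)) 0)"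
proof -
  obtain R0 where R0: "1 < R0" "tf l t holomorphic_on ball 0 R0" "tf l s holomorphic_on ball 0 R0"
    "\<And>\<zeta>. gam l (\<lambda>i. t i + \<zeta> * s i) = abs_loop (\<lambda>z. dg (tf l t z + \<zeta> * tf l s z))"
    using gam_line[OF ts] by metis
  define r where "r = 1 / R0"
  have r: "0 < r" "r < 1" using R0 by (auto simp: r_def)
  let ?T = "tf l t" and ?S = "tf l s"
  let ?h = "\<lambda>\<zeta> z. dg (?T z + \<zeta> * ?S z)"
  let ?f = "\<lambda>z. dg (?T z)"
  have hh: "hol2 (?h \<zeta>) (ann r)" for \<zeta>
    using R0 by (intro hol2_ball_ann(1)[of _ R0] hol2_dg holomorphic_intros) (auto simp: r_def)
  have hf: "hol2 ?f (ann r)" using hh[of 0] by simp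
  have fa: "gam l t = abs_loop ?f" using R0(4)[of 0] by simp
  have fc: "abs_loop ?f \<in> carrier LGL2" by (rule carrier_LGL2I[OF hf _ r]) auto
  obtain r1 r' \<epsilon> C R G u0 p0 where "local_data l g m ?f r r1 r' \<epsilon> C R G u0 p0"
    using local_factorization[OF l fc hf r g bc[unfolded fa]] by blast
  note o = local_dataD[OF this]
  have r1: "0 < r1" "r1 < 1" "0 < r'" using r o(1-3) by auto
  let ?K = "annulus r'"
  have K: "?K \<subseteq> ann r1" "ann r' \<subseteq> ?K" "ann r' \<subseteq> ann r" "ann r1 \<subseteq> ann r" "ann r \<subseteq> ball 0 R0" "ann r1 \<subseteq> ann (1 / R)" "ann r1 \<subseteq> ball 0 R"
  proof -
    show "?K \<subseteq> ann r1" by (rule annulus_subset_ann[OF r1(1) o(2)])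
    show "ann r' \<subseteq> ?K" by (rule ann_subset_annulus)
    show "ann r' \<subseteq> ann r" "ann r1 \<subseteq> ann r" "ann r1 \<subseteq> ann (1 / R)" using r o(1,2,6,7) by (intro ann_mono; simp)+
    show "ann r \<subseteq> ball 0 R0" unfolding r_def by (rule subsetI, erule ball_ann(1))
    show "ann r1 \<subseteq> ball 0 R" using \<open>ann r1 \<subseteq> ann (1 / R)\<close> ball_ann(1)[of _ R] by blast
  qed
  have uz: "hol2 (\<lambda>z. u0 (1 / z)) (ann r1)" "(\<lambda>z. u0 (1 / z)) ` ann r1 \<subseteq> GL2"
  proof -
    show "hol2 (\<lambda>z. u0 (1 / z)) (ann r1)" using hol2_ball_ann(2)[OF o(11,7)] o(6) by simp
    have "1 / z \<in> ball 0 R" if "z \<in> ann r1" for z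
      by (rule ball_ann(2)) (use o(6) that K(6) in auto)
    then show "(\<lambda>z. u0 (1 / z)) ` ann r1 \<subseteq> GL2" using o(12) by blast
  qed
  have pz: "hol2 p0 (ann r1)" "p0 ` ann r1 \<subseteq> GL2"
    using hol2_ball_ann(1)[OF o(13,7)] o(6) image_subset_mono[OF o(14) K(7)] by simp_all
  have cu: "continuous_on ?K (\<lambda>z. u0 (1 / z))" "(\<lambda>z. u0 (1 / z)) ` ?K \<subseteq> GL2"
    "continuous_on ?K p0" "p0 ` ?K \<subseteq> GL2"
    using continuous_on_subset[OF hol2_continuous[OF uz(1)] K(1)] image_subset_mono[OF uz(2) K(1)]
      continuous_on_subset[OF hol2_continuous[OF pz(1)] K(1)] image_subset_mono[OF pz(2) K(1)] by auto
  have cS: "continuous_on ?K ?S"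
    using continuous_on_subset[OF holomorphic_on_imp_continuous_on[OF R0(3)]] K(1,4,5) by blast
  let ?X = "\<lambda>z. u0 (1 / z) ** cscale (?S z) Q0 ** inv2 (u0 (1 / z)) - p0 z ** cscale (?S z) Q0 ** inv2 (p0 z)"
  obtain B where B: "B \<ge> 0" and bd: "\<And>z \<zeta>. z \<in> ?K \<Longrightarrow> norm \<zeta> \<le> 1/2 \<Longrightarrow>
     norm (u0 (1 / z) ** dg (\<zeta> * ?S z) ** inv2 (u0 (1 / z)) ** p0 z ** dg (- (\<zeta> * ?S z)) ** inv2 (p0 z) - mat 1) \<le> 20 * B * norm \<zeta> \<and>
     norm (u0 (1 / z) ** dg (\<zeta> * ?S z) ** inv2 (u0 (1 / z)) ** p0 z ** dg (- (\<zeta> * ?S z)) ** inv2 (p0 z) - mat 1 -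
       cscale \<zeta> (?X z)) \<le> 32 * B * (norm \<zeta>)\<^sup>2"
    using dg_line_bounds[OF compact_annulus cu cS] by blast
  let ?b = "\<lambda>\<zeta>. bfun u0 p0 G m (?h \<zeta>)"
  have beq: "?b \<zeta> z = u0 (1 / z) ** dg (\<zeta> * ?S z) ** inv2 (u0 (1 / z)) ** p0 z ** dg (- (\<zeta> * ?S z)) ** inv2 (p0 z) - mat 1"
    if "z \<in> ann r1" for z \<zeta>
  proof (rule bfun_line)
    show "z \<noteq> 0" using that r1 zero_notin_ann by blast
    show "u0 (1 / z) \<in> GL2" "p0 z \<in> GL2" using that uz(2) pz(2) by auto
  qed (rule o(17)[OF that])
  have b1: "norm (?b \<zeta> z) \<le> 20 * B * norm \<zeta>" and b2: "norm (?b \<zeta> z - cscale \<zeta> (?X z)) \<le> 32 * B * (norm \<zeta>)\<^sup>2"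
    if "z \<in> ?K" "norm \<zeta> \<le> 1/2" for z \<zeta>
    using bd[OF that] beq[of z \<zeta>] that(1) K(1) by auto
  \<comment> \<open>Within 1/2 the Taylor bounds hold; the second term makes
    \<open>20 * B * norm \<zeta>\<close> at most \<open>\<epsilon>\<close>, with \<open>+ 1\<close>
    covering \<open>B = 0\<close>.\<close>
  define \<rho> where "\<rho> = min (1/2) (\<epsilon> / (20 * B + 1))"
  have \<rho>: "0 < \<rho>" "\<rho> \<le> 1/2" using o(4) B min.cobounded1[of "1/2" "\<epsilon> / (20 * B + 1)"] by (simp_all only: \<rho>_def) simp
  have nf: "near_factor l g (delta m) u0 C (?b \<zeta>) (gam l (\<lambda>i. t i + \<zeta> * s i)) (20 * B * norm \<zeta>)"
    if \<zeta>: "norm \<zeta> \<le> \<rho>" for \<zeta>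
    unfolding R0(4)
  proof (rule o(19))
    show "hol2 (?h \<zeta>) (ann r')" by (rule hol2_subset[OF hh K(3)])
    show "norm (?b \<zeta> z) \<le> 20 * B * norm \<zeta>" if "z \<in> ann r'" for z
      using b1[of z \<zeta>] that \<zeta> \<rho> K(2) by auto
    have "20 * B * norm \<zeta> \<le> (20 * B + 1) * (\<epsilon> / (20 * B + 1))"
      using \<zeta> B by (intro mult_mono) (auto simp: \<rho>_def)
    then show "20 * B * norm \<zeta> \<le> \<epsilon>" using B by simp
  qed auto
  have sph: "sphere 0 1 \<subseteq> ?K" using r1 o(3) by (auto simp: annulus_def)
  have cX: "continuous_on (sphere 0 1) ?X"
  proof -
    have "hol2 (\<lambda>z. cscale (?S z) Q0) (ball 0 R0)"
      using R0(3) unfolding hol2_def cscale_def by (auto intro!: holomorphic_intros)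
    then have "hol2 (\<lambda>z. cscale (?S z) Q0) (ann r1)" using hol2_subset K(4,5) by (meson order_trans)
    then have "hol2 ?X (ann r1)" by (intro hol2_diff hol2_mult hol2_inv2 uz pz)
    then show ?thesis using continuous_on_subset[OF hol2_continuous] sph K(1) by (meson order_trans)
  qed
  have cb: "continuous_on (sphere 0 1) (?b \<zeta>)" for \<zeta>
  proof -
    have "hol2 (?b \<zeta>) (ann r1)" by (intro o(18) hol2_subset[OF hh K(4)]) auto
    then show ?thesis using continuous_on_subset[OF hol2_continuous] sph K(1) by (meson order_trans)
  qed
  have lc: "mcf ?X (- int k) = lcoef u0 ?S k" if "- int k < int l" for k
  proof (rule lcoef_eq[where a=r1 and R="min R R0" and l=l])
    show "hol2 p0 (ball 0 (min R R0))" "p0 ` ball 0 (min R R0) \<subseteq> GL2"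
      by (rule hol2_subset[OF o(13)] image_subset_mono[OF o(14)], rule subset_ball, simp)+
    show "?S holomorphic_on ball 0 (min R R0)" using R0(3) by (rule holomorphic_on_subset) auto
  qed (use uz r1 o(6) R0(1) that l tf_at_0 in auto)
  have lb: "norm (mcf (?b \<zeta>) (- int k) - cscale \<zeta> (lcoef u0 ?S k)) \<le> 128 * B * (norm \<zeta>)\<^sup>2"
    if "- int k < int l" "norm \<zeta> \<le> \<rho>" for k \<zeta>
  proof -
    have cc: "continuous_on (sphere 0 1) (\<lambda>z. ?b \<zeta> z - cscale \<zeta> (?X z))" "continuous_on (sphere 0 1) (\<lambda>z. cscale \<zeta> (?X z))"
      by (intro continuous_intros continuous_on_cscale cb cX)+
    have "mcf (?b \<zeta>) (- int k) = mcf (\<lambda>z. (?b \<zeta> z - cscale \<zeta> (?X z)) + cscale \<zeta> (?X z)) (- int k)" by simp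
    also have "\<dots> = mcf (\<lambda>z. ?b \<zeta> z - cscale \<zeta> (?X z)) (- int k) + cscale \<zeta> (lcoef u0 ?S k)"
      unfolding mcf_add[OF cc] mcf_cscale[OF cX] lc[OF that(1)] ..
    finally have "mcf (?b \<zeta>) (- int k) - cscale \<zeta> (lcoef u0 ?S k) = mcf (\<lambda>z. ?b \<zeta> z - cscale \<zeta> (?X z)) (- int k)" by simp
    moreover have "norm (mcf (\<lambda>z. ?b \<zeta> z - cscale \<zeta> (?X z)) (- int k)) \<le> 4 * (32 * B * (norm \<zeta>)\<^sup>2)"
      using b2[of _ \<zeta>] that(2) \<rho> sph by (intro mcf_norm_le cc) auto
    ultimately show ?thesis by simp
  qed
  have bc': "\<forall>\<^sub>F \<zeta> in nhds 0. conj_loop g (delta m) (gam l (\<lambda>i. t i + \<zeta> * s i)) \<in> big_cell"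
    unfolding eventually_nhds_metric using \<rho> nf by (intro exI[of _ \<rho>]) (auto simp: near_factor_def)
  have "mder (\<lambda>\<zeta>. loop_coeff (um l g (delta m) (gam l (\<lambda>i. t i + \<zeta> * s i))) (- int n))
       (- (\<Sum>k\<le>n. if - int k < int l then lcoef u0 ?S k ** mfps u0 (n - k) else 0)) 0" for n
  proof (rule quadratic_imp_mder[OF \<rho>(1)])
    fix \<zeta> :: complex assume \<zeta>: "norm \<zeta> \<le> \<rho>"
    let ?F = "\<lambda>\<zeta>. loop_coeff (um l g (delta m) (gam l (\<lambda>i. t i + \<zeta> * s i))) (- int n)"
    let ?Y = "- (\<Sum>k\<le>n. if - int k < int l then lcoef u0 ?S k ** mfps u0 (n - k) else 0)"
    let ?K = "\<Sum>k\<le>n. 8 * (C * (20 * B)\<^sup>2 + 128 * B) * norm (mfps u0 (n - k))"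
    obtain W where W: "\<And>j. loop_coeff (um l g (delta m) (gam l (\<lambda>i. t i + \<zeta> * s i))) j = (if j \<le> 0 then \<Sum>k\<le>nat (-j). W k ** mfps u0 (nat (-j) - k) else 0)"
      "\<And>n. - int n < int l \<Longrightarrow> norm (W n - (if n = 0 then mat 1 else 0) + mcf (?b \<zeta>) (- int n)) \<le> C * (20 * B * norm \<zeta>)\<^sup>2"
      "l = 0 \<Longrightarrow> W 0 = mat 1"
      using near_factor_coeff[OF nf[OF \<zeta>]] by auto
    \<comment> \<open>The error of \<open>W\<close> against its first order expansion. It is of
      order two by the estimate of \<open>near_factor\<close> together with the Taylor bound
      \<open>lb\<close> for the coefficients of \<open>bfun\<close>.\<close>
    define E where "E k = W k - (if k = 0 then mat 1 else 0) + (if - int k < int l then cscale \<zeta> (lcoef u0 ?S k) else 0)" for k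
    have F0: "?F 0 = mfps u0 n"
      using loop_coeff_disc_inv[OF o(11,6), of "- int n"] o(16) fa by simp
    have "?F \<zeta> - ?F 0 - cscale \<zeta> ?Y = (\<Sum>k\<le>n. W k ** mfps u0 (n - k)) - (\<Sum>k\<le>n. (if k = 0 then mat 1 else 0) ** mfps u0 (n - k)) 
        + (\<Sum>k\<le>n. (if - int k < int l then cscale \<zeta> (lcoef u0 ?S k) else 0) ** mfps u0 (n - k))"
      unfolding F0 W(1) sum_delta_mat 
      by (simp add: cscale_simps cscale_mult if_distrib[where f="cscale \<zeta>"] if_distrib[where f="\<lambda>x. x ** _"] mm.zero_left cong: if_cong)
    also have "\<dots> = (\<Sum>k\<le>n. E k ** mfps u0 (n - k))"
      by (simp only: E_def mm.diff_left mm.add_left sum.distrib sum_subtractf)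
    finally have eq: "?F \<zeta> - ?F 0 - cscale \<zeta> ?Y = (\<Sum>k\<le>n. E k ** mfps u0 (n - k))" .
    have En: "norm (E k) \<le> (C * (20 * B)\<^sup>2 + 128 * B) * (norm \<zeta>)\<^sup>2" for k
    proof (cases "- int k < int l")
      case True
      have "E k = (W k - (if k = 0 then mat 1 else 0) + mcf (?b \<zeta>) (- int k)) - (mcf (?b \<zeta>) (- int k) - cscale \<zeta> (lcoef u0 ?S k))"
        using True by (simp add: E_def)
      also have "norm \<dots> \<le> C * (20 * B * norm \<zeta>)\<^sup>2 + 128 * B * (norm \<zeta>)\<^sup>2"
        by (intro order_trans[OF norm_triangle_ineq4] add_mono W(2)[OF True] lb[OF True \<zeta>])
      finally show ?thesis by (simp add: algebra_simps power_mult_distrib)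
    next
      case False
      \<comment> \<open>The only excluded index is \<open>k = 0\<close> for \<open>l = 0\<close>,
        where the normalization fixes the coefficient exactly.\<close>
      then have "k = 0" "l = 0" by linarith+
      then have "E k = 0" using W(3) by (simp add: E_def)
      then show ?thesis using o(5) B by simp
    qed
    have "norm (\<Sum>k\<le>n. E k ** mfps u0 (n - k)) \<le> (\<Sum>k\<le>n. 8 * ((C * (20 * B)\<^sup>2 + 128 * B) * (norm \<zeta>)\<^sup>2) * norm (mfps u0 (n - k)))"
      using o(5) B by (intro order_trans[OF norm_sum] sum_mono order_trans[OF norm_mult_le] mult_mono En) auto
    also have "\<dots> = ?K * (norm \<zeta>)\<^sup>2" 
      unfolding sum_distrib_right by (intro sum.cong refl) (simp only: mult_ac)
    finally show "norm (?F \<zeta> - ?F 0 - cscale \<zeta> ?Y) \<le> ?K * (norm \<zeta>)\<^sup>2" unfolding eq .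
  qed
  then show ?thesis using bc' o(6,11,12,16) fa by (intro exI[of _ u0] exI[of _ R]) auto
qed

section \<open>Analytic functions on the parameter domain\<close>

lemma gam_carrier: "t \<in> params \<Longrightarrow> gam l t \<in> carrier LGL2"
proof -
  assume t: "t \<in> params"
  obtain R where R: "1 < R" "ereal R \<le> conv_radius t" using params_radius[OF t] .
  show ?thesis unfolding gam_eq[OF t]
    using R hol2_ball_ann(1)[OF hol2_dg[OF tf_holomorphic[OF R(2)]], of "1/R" l] by (intro carrier_LGL2I[of _ "1/R"]) auto
qed

section \<open>Sequential closedness of the parameter loops\<close>

lemma scalar_identity_ball:
  assumes "f holomorphic_on ball 0 R" "g holomorphic_on ball 0 R" "1 < R" "\<And>z. norm z = 1 \<Longrightarrow> f z = g z" "z \<in> ball 0 R"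
  shows "f z = (g z :: complex)"
proof -
  have "(\<chi> i j. f z) = ((\<chi> i j. g z) :: mat2)"
    by (rule hol2_identity_ball[of "\<lambda>z. \<chi> i j. f z" R "\<lambda>z. \<chi> i j. g z" z]) (use assms in \<open>auto simp: hol2_def\<close>)
  then show ?thesis by (simp add: vec_eq_iff)
qed

text \<open>The Taylor coefficients of \<open>\<psi>\<close> have radius of convergence at least
  \<open>R > 1\<close>, hence are admissible parameters. Since \<open>l \<le> 1\<close>, at most the
  coefficient \<open>\<psi> 0\<close> is ignored, and it is zero in that case.\<close>

lemma log_params:
  assumes "\<psi> holomorphic_on ball 0 R" "1 < R" "l \<le> 1" "0 < l \<Longrightarrow> \<psi> 0 = 0"
  obtains t where "t \<in> params" "\<And>z. z \<in> ball 0 R \<Longrightarrow> tf l t z = \<psi> z"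
proof
  define t where "t = fps_nth (fps_expansion \<psi> 0)"
  have h: "\<psi> holomorphic_on eball 0 (ereal R)" using assms(1) by simp
  have c: "ereal R \<le> conv_radius t" using conv_radius_fps_expansion[OF h] by (simp add: t_def fps_conv_radius_def)
  show "t \<in> params" using less_le_trans[OF _ c, of 1] assms(2) by (simp add: params_def one_ereal_def)
  fix z assume z: "z \<in> ball (0::complex) R"
  have "(\<Sum>i. t i * z ^ i) = \<psi> z"
    using eval_fps_expansion[OF h, of z] z by (simp add: eval_fps_def t_def)
  moreover have "(\<Sum>i<l. t i * z ^ i) = 0"
    using assms(3,4) by (cases "l = 0") (auto simp: t_def fps_expansion_def le_Suc_eq)
  ultimately show "tf l t z = \<psi> z" using tf_split[OF c z, of l] by simp
qed

text \<open>The limit inherits vanishing negative coefficients, diagonal form and determinant 1. It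
  therefore extends to a disc, where its lower diagonal entry has no zero and admits a holomorphic
  logarithm. Closedness is what makes sequences sufficient to test continuity on
  \<open>Dom\<close>.\<close>

lemma Gam_closed:
  assumes l: "l \<le> 1" and r: "0 < r" "r < 1"
    and f: "holo_near f (annulus r) UNIV" and h: "\<And>n. holo_near (h n) (annulus r) UNIV"
    and lim: "uniform_limit (annulus r) h f sequentially"
    and G: "\<And>n. abs_loop (h n) \<in> Gam l"
  shows "abs_loop f \<in> Gam l"
proof -
  note hr = holo_near_annulus_ann[OF _ r]
  have sph: "sphere 0 1 \<subseteq> annulus r" "sphere 0 1 \<subseteq> ann r" using sphere_subset_ann[OF r] ann_subset_annulus by auto
  have ul: "uniform_limit (sphere 0 1) h f sequentially" by (rule uniform_limit_on_subset[OF lim sph(1)])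
  have ch: "continuous_on (sphere 0 1) (h n)" for n
    using continuous_on_subset[OF hol2_continuous[OF hr[OF h]] sph(2)] .
  have pt: "(\<lambda>n. h n z $ i $ j) \<longlonglongrightarrow> f z $ i $ j" if "norm z = 1" for z i j
    using tendsto_uniform_limitI[OF ul, of z] that by (intro tendsto_vec_nth) auto
  have "\<exists>\<phi> R. 1 < R \<and> \<phi> holomorphic_on ball 0 R \<and> (\<forall>z. norm z = 1 \<longrightarrow> h n z = dg (\<phi> z)) \<and> (0 < l \<longrightarrow> \<phi> 0 = 0)" for n
  proof -
    obtain t where t: "t \<in> params" "abs_loop (h n) = gam l t" using G[of n] by (auto simp: Gam_def)
    obtain R where R: "1 < R" "ereal R \<le> conv_radius t" using params_radius[OF t(1)] .
    have hd: "hol2 (\<lambda>z. dg (tf l t z)) (ann (1/R))"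
      using hol2_ball_ann(1)[OF hol2_dg[OF tf_holomorphic[OF R(2)]], of "1/R"] R by auto
    have i: "isloop (h n)" "isloop (\<lambda>z. dg (tf l t z))" using hr[OF h] r hd R by (auto intro: isloopI)
    have "\<And>z. norm z = 1 \<Longrightarrow> h n z = dg (tf l t z)"
    proof -
      obtain s where "0 < s" "s < 1" "\<And>z. z \<in> ann s \<Longrightarrow> h n z = dg (tf l t z)"
        using abs_loop_eqD[OF t(2)[unfolded gam_eq[OF t(1)]] i] by blast
      then show "\<And>z. norm z = 1 \<Longrightarrow> h n z = dg (tf l t z)" using sphere_subset_ann[of s] by auto
    qed
    then show ?thesis using R(1) tf_holomorphic[OF R(2), of l] tf_at_0[of l t]
      by (intro exI[of _ "tf l t"] exI[of _ R]) auto
  qed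
  then obtain \<phi> R where \<phi>: "\<And>n. 1 < R n" "\<And>n. \<phi> n holomorphic_on ball 0 (R n)" 
    "\<And>n z. norm z = 1 \<Longrightarrow> h n z = dg (\<phi> n z)" "\<And>n. 0 < l \<Longrightarrow> \<phi> n 0 = 0" by metis
  have mh: "mcf (h n) k = (if k \<ge> 0 then mfps (\<lambda>z. dg (\<phi> n z)) (nat k) else 0)" for n k
    using mcf_disc[OF hol2_dg[OF \<phi>(2)] \<phi>(1)] mcf_cong[of "h n" "\<lambda>z. dg (\<phi> n z)" k] \<phi>(3) by simp
  have mneg: "mcf f k = 0" if "k < 0" for k
    using mcf_tendsto[OF ch ul, of k] that by (simp add: mh LIMSEQ_const_iff)
  have m0: "mcf f 0 = mat 1" if "0 < l"
    using mcf_tendsto[OF ch ul, of 0] that \<phi>(4) by (simp add: mh mfps_0 LIMSEQ_const_iff)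
  define s where "s = (r + 1) / 2"
  have s: "r < s" "s < 1" "0 < s" "1 < 1 / s" using r by (auto simp: s_def)
  obtain F where F: "hol2 F (ball 0 (1/s))" "\<And>z. z \<in> ann s \<Longrightarrow> F z = f z"
    using laurent_ext_matrix[OF hr[OF f] r(1) s(1,2) mneg] by blast
  have Ff: "F z = f z" if "norm z = 1" for z using F(2)[of z] that s by (auto simp: ann_def)
  have hF: "(\<lambda>z. F z $ i $ j) holomorphic_on ball 0 (1/s)" for i j using F(1) by (simp add: hol2_def)
  have off: "F z $ i $ j = 0" if "z \<in> ball 0 (1/s)" "i \<noteq> j" for z i j
  proof (rule scalar_identity_ball[OF hF holomorphic_on_const s(4) _ that(1)])
    fix z :: complex assume z: "norm z = 1"
    have "(\<lambda>n. h n z $ i $ j) \<longlonglongrightarrow> 0" using \<phi>(3)[OF z] that(2) by (simp add: dg_def)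
    then show "F z $ i $ j = 0" using LIMSEQ_unique[OF pt[OF z]] Ff[OF z] by simp
  qed
  have diag: "F z $ 1 $ 1 * F z $ 2 $ 2 = 1" if "z \<in> ball 0 (1/s)" for z
  proof (rule scalar_identity_ball[OF holomorphic_on_mult[OF hF hF] holomorphic_on_const s(4) _ that])
    fix z :: complex assume z: "norm z = 1"
    have "(\<lambda>n. h n z $ 1 $ 1 * h n z $ 2 $ 2) \<longlonglongrightarrow> f z $ 1 $ 1 * f z $ 2 $ 2" by (intro tendsto_mult pt z)
    moreover have "h n z $ 1 $ 1 * h n z $ 2 $ 2 = 1" for n
      unfolding \<phi>(3)[OF z] by (simp add: dg_def exp_add[symmetric])
    ultimately show "F z $ 1 $ 1 * F z $ 2 $ 2 = 1" using Ff[OF z] by (simp add: LIMSEQ_const_iff)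
  qed
  have nz: "F z $ 2 $ 2 \<noteq> 0" if "z \<in> ball 0 (1/s)" for z using diag[OF that] by auto
  obtain \<psi> where \<psi>: "\<psi> holomorphic_on ball 0 (1/s)" "\<And>z. z \<in> ball 0 (1/s) \<Longrightarrow> exp (\<psi> z) = F z $ 2 $ 2"
    by (rule holomorphic_logarithm_exists[of "ball 0 (1/s)" "\<lambda>z. F z $ 2 $ 2" 0]) (use hF nz s in auto)
  \<comment> \<open>Solves \<open>exp (\<i> * \<theta> z) = F z $ 2 $ 2\<close>. For
    \<open>l = 1\<close> the value \<open>\<psi> 0\<close> is subtracted to get
    \<open>\<theta> 0 = 0\<close>; this does not change the exponential, as
    \<open>exp (\<psi> 0) = 1\<close>.\<close>
  define \<theta> where "\<theta> z = - \<i> * (\<psi> z - (if l = 0 then 0 else \<psi> 0))" for z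
  have e0: "exp (\<psi> 0) = 1" if "0 < l"
  proof -
    have "mcf F 0 = mcf f 0" by (rule mcf_cong) (rule Ff)
    then have "F 0 = mat 1" using mcf_disc[OF F(1) s(4), of 0] m0[OF that] by (simp add: mfps_0)
    then show ?thesis using \<psi>(2)[of 0] s by (simp add: mat_def)
  qed
  have \<theta>: "\<theta> holomorphic_on ball 0 (1/s)" unfolding \<theta>_def using \<psi>(1) by (intro holomorphic_intros)
  obtain t where t: "t \<in> params" "\<And>z. z \<in> ball 0 (1/s) \<Longrightarrow> tf l t z = \<theta> z"
    using log_params[OF \<theta> s(4) l] by (auto simp: \<theta>_def)
  have e22: "exp (\<i> * \<theta> z) = F z $ 2 $ 2" if "z \<in> ball 0 (1/s)" for z
  proof -
    have "\<i> * \<theta> z = \<psi> z - (if l = 0 then 0 else \<psi> 0)" by (simp add: \<theta>_def algebra_simps)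
    then show ?thesis using \<psi>(2)[OF that] e0 by (simp add: exp_diff)
  qed
  have Fdg: "F z = dg (\<theta> z)" if z: "z \<in> ball 0 (1/s)" for z
  proof -
    have "exp (- (\<i> * \<theta> z)) = F z $ 1 $ 1" 
      using diag[OF z] e22[OF z] nz[OF z] by (simp add: exp_minus field_simps)
    then show ?thesis using off[OF z] e22[OF z] by (simp add: mat2_eq_iff forall_2 dg_def)
  qed
  have "abs_loop f = abs_loop (\<lambda>z. dg (tf l t z))"
  proof (rule abs_loop_eqI[of _ s])
    show "hol2 f (ann s)" using hol2_subset[OF hr[OF f] ann_mono] r s by simp
    show "f z = dg (tf l t z)" if "z \<in> ann s" for z
      using F(2)[OF that] Fdg[of z] t(2)[of z] ball_ann(1)[of z "1/s"] that s by simp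
  qed (use s in auto)
  then show ?thesis using t(1) unfolding Gam_def by (intro image_eqI[of _ _ t]) (simp_all add: gam_eq)
qed

section \<open>Separately holomorphic functions of two variables\<close>

lemma difference_quotient_bound:
  assumes "\<phi> holomorphic_on ball 0 (2 * \<sigma>)" "0 < \<sigma>" "\<And>z. norm z \<le> \<sigma> \<Longrightarrow> norm (\<phi> z) \<le> B" "0 < norm a" "norm a \<le> \<sigma> / 2"
  shows "norm ((\<phi> a - \<phi> 0) / a - deriv \<phi> 0) \<le> 16 * B / \<sigma>\<^sup>2 * norm a"
proof -
  \<comment> \<open>Rescaled to the unit disc and made zero at the centre. Subtracting
    \<open>\<phi> 0\<close> doubles the bound, so the constant 8 of
    \<open>taylor_first_order\<close> becomes 16.\<close>
  define \<theta> where "\<theta> z = \<phi> (of_real \<sigma> * z) - \<phi> 0" for z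
  have B: "0 \<le> B" using order_trans[OF norm_ge_zero assms(3)[of 0]] assms(2) by simp
  have sub: "(\<lambda>z::complex. of_real \<sigma> * z) ` ball 0 2 \<subseteq> ball 0 (2 * \<sigma>)"
    using assms(2) by (auto simp: norm_mult)
  have h: "\<theta> holomorphic_on ball 0 2" unfolding \<theta>_def
    using holomorphic_on_compose_gen[OF _ assms(1) sub] by (auto simp: o_def intro!: holomorphic_intros)
  have b: "norm (\<theta> z) \<le> 2 * B" if "norm z \<le> 1" for z
  proof -
    have "norm (of_real \<sigma> * z) \<le> \<sigma>" using that assms(2) by (simp add: norm_mult)
    then have "norm (\<phi> (of_real \<sigma> * z)) \<le> B" "norm (\<phi> 0) \<le> B" using assms(2,3) by auto
    then show ?thesis unfolding \<theta>_def using norm_triangle_ineq4[of "\<phi> (of_real \<sigma> * z)" "\<phi> 0"] by simp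
  qed
  have d: "deriv \<theta> 0 = of_real \<sigma> * deriv \<phi> 0"
  proof (rule DERIV_imp_deriv)
    have "(\<phi> has_field_derivative deriv \<phi> 0) (at (of_real \<sigma> * 0))"
      using holomorphic_derivI[OF assms(1) open_ball, of 0] assms(2) by simp
    then have "((\<lambda>z. \<phi> (of_real \<sigma> * z)) has_field_derivative deriv \<phi> 0 * of_real \<sigma>) (at 0)"
      by (rule DERIV_chain2) (auto intro!: derivative_eq_intros)
    then show "(\<theta> has_field_derivative of_real \<sigma> * deriv \<phi> 0) (at 0)"
      unfolding \<theta>_def by (auto intro!: derivative_eq_intros)
  qed
  define z where "z = a / of_real \<sigma>"
  have "norm z = norm a / \<sigma>" using assms(2) by (simp add: z_def norm_divide)
  also have "\<dots> \<le> \<sigma> / 2 / \<sigma>" using assms(2,5) by (intro divide_right_mono) auto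
  finally have z: "norm z \<le> 1 / 2" using assms(2) by simp
  have za: "of_real \<sigma> * z = a" "a \<noteq> 0" using assms(2,4) by (auto simp: z_def)
  have "norm (\<theta> z - deriv \<theta> 0 * z) \<le> 8 * (2 * B) * (norm z)\<^sup>2"
    by (rule taylor_first_order(1)[OF h b _ z(1)]) (simp_all add: \<theta>_def)
  moreover have "\<theta> z - deriv \<theta> 0 * z = ((\<phi> a - \<phi> 0) / a - deriv \<phi> 0) * a"
  proof -
    have "deriv \<theta> 0 * z = deriv \<phi> 0 * a" unfolding d za(1)[symmetric] by simp
    then show ?thesis unfolding left_diff_distrib[of "_ / a"] using za by (simp add: \<theta>_def)
  qed
  ultimately have "norm ((\<phi> a - \<phi> 0) / a - deriv \<phi> 0) * norm a \<le> 16 * B * (norm z)\<^sup>2" by (simp add: norm_mult)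
  also have "norm z = norm a / \<sigma>" using assms(2) by (simp add: z_def norm_divide)
  finally have "norm ((\<phi> a - \<phi> 0) / a - deriv \<phi> 0) * norm a \<le> (16 * B / \<sigma>\<^sup>2 * norm a) * norm a"
    by (simp add: power2_eq_square)
  then show ?thesis using assms(4) by (simp only: mult_le_cancel_right_pos)
qed

text \<open>Models a function on a plane spanned by two directions of translation. Joint continuity
  supplies one bound for all slices, which makes the difference quotients converge
  uniformly.\<close>

definition separately_holomorphic :: "(complex \<Rightarrow> complex \<Rightarrow> complex) \<Rightarrow> real \<Rightarrow> bool" where
  "separately_holomorphic G \<rho> \<longleftrightarrow> 0 < \<rho> \<and>
     continuous_on (ball 0 \<rho> \<times> ball 0 \<rho>) (\<lambda>x. G (fst x) (snd x)) \<and>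
     (\<forall>\<tau>\<in>ball 0 \<rho>. (\<lambda>\<zeta>. G \<zeta> \<tau>) holomorphic_on ball 0 \<rho>) \<and>
     (\<forall>\<zeta>\<in>ball 0 \<rho>. (\<lambda>\<tau>. G \<zeta> \<tau>) holomorphic_on ball 0 \<rho>)"

lemma separately_holomorphicD:
  assumes "separately_holomorphic G \<rho>"
  shows "0 < \<rho>" "continuous_on (ball 0 \<rho> \<times> ball 0 \<rho>) (\<lambda>x. G (fst x) (snd x))"
    "\<And>\<tau>. \<tau> \<in> ball 0 \<rho> \<Longrightarrow> (\<lambda>\<zeta>. G \<zeta> \<tau>) holomorphic_on ball 0 \<rho>"
    "\<And>\<zeta>. \<zeta> \<in> ball 0 \<rho> \<Longrightarrow> (\<lambda>\<tau>. G \<zeta> \<tau>) holomorphic_on ball 0 \<rho>"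
  using assms unfolding separately_holomorphic_def by blast+

lemma separately_holomorphic_swap:
  assumes "separately_holomorphic G \<rho>"
  shows "separately_holomorphic (\<lambda>\<zeta> \<tau>. G \<tau> \<zeta>) \<rho>"
proof -
  note sh = separately_holomorphicD[OF assms]
  have "continuous_on (ball 0 \<rho> \<times> ball 0 \<rho>) (\<lambda>x. (\<lambda>x. G (fst x) (snd x)) (snd x, fst x))"
    by (rule continuous_on_compose2[OF sh(2)]) (auto intro!: continuous_intros)
  then have "continuous_on (ball 0 \<rho> \<times> ball 0 \<rho>) (\<lambda>x. G (snd x) (fst x))" by simp
  then show ?thesis unfolding separately_holomorphic_def using sh(1,3,4) by blast
qed

text \<open>A concrete null sequence of nonzero increments; the factor 1/8 keeps it inside the range
  \<open>\<rho> / 4\<close> of \<open>difference_quotient_bound\<close> with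
  \<open>\<sigma> = \<rho> / 2\<close>.\<close>

definition step :: "real \<Rightarrow> nat \<Rightarrow> complex" where
  "step \<rho> n = of_real (\<rho> / 8 / Suc n)"

lemma step_props:
  assumes rho: "0 < \<rho>"
  shows "step \<rho> n \<noteq> 0" "norm (step \<rho> n) \<le> \<rho> / 8" "step \<rho> n \<in> ball 0 \<rho>" "(\<lambda>n. norm (step \<rho> n)) \<longlonglongrightarrow> 0" "step \<rho> \<longlonglongrightarrow> 0"
proof -
  show "step \<rho> n \<noteq> 0" using rho by (simp add: step_def del: of_nat_Suc)
  have n: "norm (step \<rho> n) = \<rho> / 8 / Suc n" for n using rho by (simp add: step_def norm_divide del: of_nat_Suc)
  have "\<rho> / 8 / real (Suc n) \<le> \<rho> / 8 / 1" using rho by (intro divide_left_mono) auto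
  then show 2: "norm (step \<rho> n) \<le> \<rho> / 8" by (simp only: n div_by_1)
  then show "step \<rho> n \<in> ball 0 \<rho>" using rho by simp
  have "(\<lambda>n. \<rho> / 8 * inverse (real (Suc n))) \<longlonglongrightarrow> \<rho> / 8 * 0"
    by (intro tendsto_mult_left LIMSEQ_inverse_real_of_nat)
  then show "(\<lambda>n. norm (step \<rho> n)) \<longlonglongrightarrow> 0" by (simp only: n divide_inverse mult_zero_right)
  then show "step \<rho> \<longlonglongrightarrow> 0" by (rule tendsto_norm_zero_cancel)
qed

text \<open>The remainder constant depends only on a bound of \<open>G\<close> on a compact bidisc,
  so the quotients in \<open>\<tau>\<close> converge at the same rate for all
  \<open>\<zeta>\<close>.\<close>

lemma quotients_uniform:
  assumes "separately_holomorphic G \<rho>"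
  shows "uniform_limit (ball 0 (\<rho>/2)) (\<lambda>n \<zeta>. (G \<zeta> (step \<rho> n) - G \<zeta> 0) / step \<rho> n) (\<lambda>\<zeta>. deriv (G \<zeta>) 0) sequentially"
proof -
  note sh = separately_holomorphicD[OF assms]
  note rho = sh(1) and step_props = step_props[OF sh(1)]
  have "compact (cball (0::complex) (\<rho>/2) \<times> cball (0::complex) (\<rho>/2))" by (intro compact_Times compact_cball)
  moreover have "cball (0::complex) (\<rho>/2) \<times> cball (0::complex) (\<rho>/2) \<subseteq> ball 0 \<rho> \<times> ball 0 \<rho>" using rho by auto
  ultimately have "bounded ((\<lambda>x. G (fst x) (snd x)) ` (cball 0 (\<rho>/2) \<times> cball 0 (\<rho>/2)))"
    by (intro compact_imp_bounded compact_continuous_image continuous_on_subset[OF sh(2)])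
  then obtain B where "\<forall>y\<in>(\<lambda>x. G (fst x) (snd x)) ` (cball 0 (\<rho>/2) \<times> cball 0 (\<rho>/2)). norm y \<le> B" unfolding bounded_iff ..
  then have B: "norm (G \<zeta> \<tau>) \<le> B" if "\<zeta> \<in> cball 0 (\<rho>/2)" "\<tau> \<in> cball 0 (\<rho>/2)" for \<zeta> \<tau> using that by fastforce
  define K where "K = 16 * B / (\<rho>/2)\<^sup>2"
  have est: "norm ((G \<zeta> (step \<rho> n) - G \<zeta> 0) / step \<rho> n - deriv (G \<zeta>) 0) \<le> K * norm (step \<rho> n)" if "\<zeta> \<in> ball 0 (\<rho>/2)" for \<zeta> n
    unfolding K_def
  proof (rule difference_quotient_bound)
    show "G \<zeta> holomorphic_on ball 0 (2 * (\<rho> / 2))" using sh(4)[of \<zeta>] that rho by simp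
    show "norm (step \<rho> n) \<le> \<rho> / 2 / 2" using step_props(2)[of n] rho by simp
  qed (use that rho step_props(1,3) B in auto)
  show ?thesis
  proof (rule uniform_limitI)
    fix e :: real assume e: "e > 0"
    have "(\<lambda>n. K * norm (step \<rho> n)) \<longlonglongrightarrow> K * 0" by (intro tendsto_mult_left step_props)
    then have "\<forall>\<^sub>F n in sequentially. K * norm (step \<rho> n) < e" using e by (intro order_tendstoD) auto
    then show "\<forall>\<^sub>F n in sequentially. \<forall>x\<in>ball 0 (\<rho>/2). dist ((G x (step \<rho> n) - G x 0) / step \<rho> n) (deriv (G x) 0) < e"
    proof eventually_elim
      case (elim n)
      then show ?case unfolding dist_norm using le_less_trans[OF est] by blast
    qed
  qed
qed

lemma quotient_holomorphic:
  assumes "separately_holomorphic G \<rho>"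
  shows "(\<lambda>\<zeta>. (G \<zeta> (step \<rho> n) - G \<zeta> 0) / step \<rho> n) holomorphic_on ball 0 (\<rho>/2)"
proof -
  note sh = separately_holomorphicD[OF assms]
  note rho = sh(1) and step_props = step_props[OF sh(1)]
  have "ball 0 (\<rho>/2) \<subseteq> ball (0::complex) \<rho>" using rho by auto
  then show ?thesis using sh(3)[OF step_props(3)] sh(3)[of 0] rho step_props(1)
    by (intro holomorphic_intros) (auto intro: holomorphic_on_subset)
qed

lemma partial_holomorphic:
  assumes "separately_holomorphic G \<rho>"
  shows "(\<lambda>\<zeta>. deriv (G \<zeta>) 0) holomorphic_on ball 0 (\<rho>/2)"
proof (rule holomorphic_uniform_sequence)
  show "(\<lambda>\<zeta>. (G \<zeta> (step \<rho> n) - G \<zeta> 0) / step \<rho> n) holomorphic_on ball 0 (\<rho>/2)" for n by (rule quotient_holomorphic[OF assms])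
  fix x assume "x \<in> ball (0::complex) (\<rho>/2)"
  then obtain d where "0 < d" "cball x d \<subseteq> ball 0 (\<rho>/2)" using open_contains_cball[THEN iffD1, OF open_ball] by blast
  then show "\<exists>d>0. cball x d \<subseteq> ball 0 (\<rho>/2) \<and> uniform_limit (cball x d) (\<lambda>n \<zeta>. (G \<zeta> (step \<rho> n) - G \<zeta> 0) / step \<rho> n) (\<lambda>\<zeta>. deriv (G \<zeta>) 0) sequentially"
    using uniform_limit_on_subset[OF quotients_uniform[OF assms]] by blast
qed simp

text \<open>Derivatives in \<open>\<zeta>\<close> of the uniformly convergent quotients tend to the
  derivative of their limit. The same numbers are difference quotients of the other partial
  derivative, which is holomorphic by symmetry.\<close>

lemma mixed_partials:
  assumes "separately_holomorphic G \<rho>"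
  shows "deriv (\<lambda>\<zeta>. deriv (G \<zeta>) 0) 0 = deriv (\<lambda>\<tau>. deriv (\<lambda>\<zeta>. G \<zeta> \<tau>) 0) 0"
proof (rule LIMSEQ_unique)
  note sh = separately_holomorphicD[OF assms]
  note rho = sh(1) and step_props = step_props[OF sh(1)]
  have "(\<lambda>n. (deriv ^^ 1) (\<lambda>\<zeta>. (G \<zeta> (step \<rho> n) - G \<zeta> 0) / step \<rho> n) 0) \<longlonglongrightarrow> (deriv ^^ 1) (\<lambda>\<zeta>. deriv (G \<zeta>) 0) 0"
    by (rule higher_deriv_complex_uniform_limit[OF quotients_uniform[OF assms] always_eventually]) 
       (use rho quotient_holomorphic[OF assms] in auto)
  then show "(\<lambda>n. deriv (\<lambda>\<zeta>. (G \<zeta> (step \<rho> n) - G \<zeta> 0) / step \<rho> n) 0) \<longlonglongrightarrow> deriv (\<lambda>\<zeta>. deriv (G \<zeta>) 0) 0" by simp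
  define P where "P \<tau> = deriv (\<lambda>\<zeta>. G \<zeta> \<tau>) 0" for \<tau>
  have "P holomorphic_on ball 0 (\<rho>/2)" unfolding P_def
    by (rule partial_holomorphic[OF separately_holomorphic_swap[OF assms]])
  then have "(P has_field_derivative deriv P 0) (at 0)" using rho by (intro holomorphic_derivI) auto
  then have "(\<lambda>h. (P (0 + h) - P 0) / h) \<midarrow>0\<rightarrow> deriv P 0" by (simp only: DERIV_def)
  then have "(\<lambda>n. (P (0 + step \<rho> n) - P 0) / step \<rho> n) \<longlonglongrightarrow> deriv P 0"
    by (rule filterlim_compose) (use step_props(1,5) in \<open>auto simp: filterlim_at\<close>)
  moreover have "deriv (\<lambda>\<zeta>. (G \<zeta> (step \<rho> n) - G \<zeta> 0) / step \<rho> n) 0 = (P (0 + step \<rho> n) - P 0) / step \<rho> n" for n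
  proof (rule DERIV_imp_deriv)
    have "((\<lambda>\<zeta>. G \<zeta> \<tau>) has_field_derivative P \<tau>) (at 0)" if "\<tau> \<in> ball 0 \<rho>" for \<tau>
      unfolding P_def using sh(3)[OF that] rho by (intro holomorphic_derivI) auto
    from this[OF step_props(3)] this[of 0] rho
    show "((\<lambda>\<zeta>. (G \<zeta> (step \<rho> n) - G \<zeta> 0) / step \<rho> n) has_field_derivative (P (0 + step \<rho> n) - P 0) / step \<rho> n) (at 0)"
      using step_props(1) by (auto intro!: derivative_eq_intros simp: field_simps)
  qed
  ultimately show "(\<lambda>n. deriv (\<lambda>\<zeta>. (G \<zeta> (step \<rho> n) - G \<zeta> 0) / step \<rho> n) 0) \<longlonglongrightarrow> deriv (\<lambda>\<tau>. deriv (\<lambda>\<zeta>. G \<zeta> \<tau>) 0) 0"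
    by (simp only: P_def[abs_def])
qed

section \<open>Sequential description of the topology of loops\<close>

lemma loop_openI:
  assumes "\<And>r f h. \<lbrakk>0 < r; r < 1; holo_near f (annulus r) UNIV; \<And>n. holo_near (h n) (annulus r) UNIV;
    uniform_limit (annulus r) h f sequentially; abs_loop f \<in> W\<rbrakk> \<Longrightarrow> \<exists>n. abs_loop (h n) \<in> W"
  shows "loop_open W"
  unfolding loop_open_def
proof (intro allI impI, elim conjE, rule ccontr)
  fix r f assume r: "0 < r" "r < 1" "holo_near f (annulus r) UNIV" "abs_loop f \<in> W"
    and neg: "\<not> (\<exists>\<epsilon>>0. \<forall>h. holo_near h (annulus r) UNIV \<and> (\<forall>z\<in>annulus r. norm (h z - f z) < \<epsilon>) \<longrightarrow> abs_loop h \<in> W)"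
  \<comment> \<open>If no radius works, the radii \<open>1 / (n + 1)\<close> supply loops outside
    \<open>W\<close> that converge uniformly to \<open>f\<close> on one annulus, contrary to the
    sequential hypothesis.\<close>
  have "\<exists>h. holo_near h (annulus r) UNIV \<and> (\<forall>z\<in>annulus r. norm (h z - f z) < 1 / real (Suc n)) \<and> abs_loop h \<notin> W" for n
  proof -
    have "0 < 1 / real (Suc n)" by simp
    with neg show ?thesis by blast
  qed
  then obtain h where h: "\<And>n. holo_near (h n) (annulus r) UNIV"
      "\<And>n z. z \<in> annulus r \<Longrightarrow> norm (h n z - f z) < 1 / real (Suc n)" "\<And>n. abs_loop (h n) \<notin> W" by metis
  have "uniform_limit (annulus r) h f sequentially"
  proof (rule uniform_limitI)
    fix e :: real assume "e > 0"
    have "(\<lambda>n. inverse (real (Suc n))) \<longlonglongrightarrow> 0" by (rule LIMSEQ_inverse_real_of_nat)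
    then have "\<forall>\<^sub>F n in sequentially. inverse (real (Suc n)) < e" using \<open>e > 0\<close> by (rule order_tendstoD)
    then show "\<forall>\<^sub>F n in sequentially. \<forall>x\<in>annulus r. dist (h n x) (f x) < e"
    proof eventually_elim
      case (elim n)
      then show ?case using h(2)[of _ n] unfolding dist_norm inverse_eq_divide by (meson less_trans)
    qed
  qed
  from assms[OF r(1-3) h(1) this r(4)] h(3) show False by blast
qed

lemma loop_openD:
  assumes "loop_open W" "0 < r" "r < 1" "holo_near f (annulus r) UNIV" "\<And>n. holo_near (h n) (annulus r) UNIV"
    "uniform_limit (annulus r) h f sequentially" "abs_loop f \<in> W"
  shows "\<forall>\<^sub>F n in sequentially. abs_loop (h n) \<in> W"
proof -
  have "0 < r \<and> r < 1 \<and> holo_near f (annulus r) UNIV \<and> abs_loop f \<in> W" using assms by blast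
  then obtain e where e: "e > 0" "\<forall>h. holo_near h (annulus r) UNIV \<and> (\<forall>z\<in>annulus r. norm (h z - f z) < e) \<longrightarrow> abs_loop h \<in> W"
    using assms(1) unfolding loop_open_def by meson
  have "\<forall>\<^sub>F n in sequentially. \<forall>x\<in>annulus r. dist (h n x) (f x) < e" by (rule uniform_limitD[OF assms(6) e(1)])
  then show ?thesis by eventually_elim (use e(2) assms(5) in \<open>simp add: dist_norm\<close>)
qed

definition scont :: "loop set \<Rightarrow> (loop \<Rightarrow> complex) \<Rightarrow> bool" where
  "scont D F \<longleftrightarrow> (\<forall>r f h. 0 < r \<longrightarrow> r < 1 \<longrightarrow> holo_near f (annulus r) UNIV \<longrightarrow> (\<forall>n. holo_near (h n) (annulus r) UNIV) \<longrightarrow>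
     uniform_limit (annulus r) h f sequentially \<longrightarrow> abs_loop f \<in> D \<longrightarrow> (\<forall>n. abs_loop (h n) \<in> D) \<longrightarrow>
     (\<lambda>n. F (abs_loop (h n))) \<longlonglongrightarrow> F (abs_loop f))"

lemma uniform_limit_subseq:
  assumes "uniform_limit A h f sequentially" "filterlim \<sigma> at_top sequentially"
  shows "uniform_limit A (\<lambda>n::nat. h (\<sigma> n)) f sequentially"
  unfolding uniform_limit_iff
proof (intro allI impI)
  fix e :: real assume "e > 0"
  from uniform_limitD[OF assms(1) this] assms(2)
  show "\<forall>\<^sub>F n in sequentially. \<forall>x\<in>A. dist (h (\<sigma> n) x) (f x) < e"
    by (rule eventually_compose_filterlim)
qed

lemma continuous_imp_scont:
  assumes "continuous_map (subtopology loop_topology D) euclidean F"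
  shows "scont D F"
  unfolding scont_def
proof (intro allI impI)
  fix r f h assume a: "0 < r" "r < 1" "holo_near f (annulus r) UNIV" "\<forall>n. holo_near (h n) (annulus r) UNIV"
    "uniform_limit (annulus r) h f sequentially" "abs_loop f \<in> D" "\<forall>n. abs_loop (h n) \<in> D"
  have top: "topspace loop_topology = UNIV"
  proof -
    have "loop_open UNIV" by (rule loop_openI) simp
    then have "openin loop_topology UNIV" by (simp add: openin_loop_topology)
    then show ?thesis using openin_subset by blast
  qed
  show "(\<lambda>n. F (abs_loop (h n))) \<longlonglongrightarrow> F (abs_loop f)"
  proof (rule topological_tendstoI)
    fix V assume V: "open V" "F (abs_loop f) \<in> V"
    have "openin (subtopology loop_topology D) {x \<in> topspace (subtopology loop_topology D). F x \<in> V}"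
      using assms V(1) unfolding continuous_map_def by auto
    then obtain W where W: "loop_open W" "{x \<in> D. F x \<in> V} = W \<inter> D"
      unfolding openin_subtopology openin_loop_topology by (auto simp: top)
    have "abs_loop f \<in> W" using W(2) V(2) a(6) by blast
    from loop_openD[OF W(1) a(1-3) _ a(5) this] a(4)
    have "\<forall>\<^sub>F n in sequentially. abs_loop (h n) \<in> W" by blast
    then show "\<forall>\<^sub>F n in sequentially. F (abs_loop (h n)) \<in> V"
      by eventually_elim (use W(2) a(7) in blast)
  qed
qed

text \<open>Sequential continuity on each annulus suffices for the direct limit topology because the
  trace of the domain is relatively open in a sequentially closed set.\<close>

lemma scont_imp_continuous:
  assumes "scont D F" "D \<subseteq> C"
    and closed: "\<And>r f h. \<lbrakk>0 < r; r < 1; holo_near f (annulus r) UNIV; \<And>n. holo_near (h n) (annulus r) UNIV;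
      uniform_limit (annulus r) h f sequentially; \<And>n. abs_loop (h n) \<in> C\<rbrakk> \<Longrightarrow> abs_loop f \<in> C"
    and opn: "\<And>r f h. \<lbrakk>0 < r; r < 1; holo_near f (annulus r) UNIV; \<And>n. holo_near (h n) (annulus r) UNIV;
      uniform_limit (annulus r) h f sequentially; abs_loop f \<in> D; \<And>n. abs_loop (h n) \<in> C\<rbrakk> \<Longrightarrow>
      \<forall>\<^sub>F n in sequentially. abs_loop (h n) \<in> D"
  shows "continuous_map (subtopology loop_topology D) euclidean F"
  unfolding continuous_map_def
proof (intro conjI ballI allI impI)
  fix V :: "complex set" assume "openin euclidean V"
  then have V: "open V" by simp
  \<comment> \<open>Loops outside \<open>C\<close> belong to \<open>W\<close> without condition. In
    this way \<open>W\<close> is open in the whole space although the domain is only relatively open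
    in \<open>C\<close>, and its trace on \<open>D\<close> is the preimage of
    \<open>V\<close>.\<close>
  define W where "W = {x. x \<in> C \<longrightarrow> x \<in> D \<and> F x \<in> V}"
  have "loop_open W"
  proof (rule loop_openI, rule ccontr)
    fix r f h assume a: "0 < r" "r < 1" "holo_near f (annulus r) UNIV" "\<And>n. holo_near (h n) (annulus r) UNIV"
      "uniform_limit (annulus r) h f sequentially" "abs_loop f \<in> W" and neg: "\<not> (\<exists>n. abs_loop (h n) \<in> W)"
    have hC: "abs_loop (h n) \<in> C" for n using neg by (auto simp: W_def)
    have "abs_loop f \<in> C" by (rule closed[OF a(1-5) hC])
    then have f: "abs_loop f \<in> D" "F (abs_loop f) \<in> V" using a(6) by (auto simp: W_def)
    have "\<forall>\<^sub>F n in sequentially. abs_loop (h n) \<in> D" by (rule opn[OF a(1-5) f(1) hC])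
    then obtain N where N: "\<And>n. n \<ge> N \<Longrightarrow> abs_loop (h n) \<in> D" by (auto simp: eventually_sequentially)
    have "uniform_limit (annulus r) (\<lambda>n. h (n + N)) f sequentially"
      by (rule uniform_limit_subseq[OF a(5) filterlim_add_const_nat_at_top])
    then have "(\<lambda>n. F (abs_loop (h (n + N)))) \<longlonglongrightarrow> F (abs_loop f)"
      using assms(1) a(1-4) f(1) N unfolding scont_def by simp
    from topological_tendstoD[OF this V f(2)]
    obtain n where "F (abs_loop (h (n + N))) \<in> V" by (auto simp: eventually_sequentially)
    then have "abs_loop (h (n + N)) \<in> W" using N[of "n + N"] by (simp add: W_def)
    then show False using neg by blast
  qed
  then have o: "openin loop_topology W" by (simp add: openin_loop_topology)
  have "{x \<in> topspace (subtopology loop_topology D). F x \<in> V} = W \<inter> D"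
  proof -
    have "x \<in> topspace loop_topology" if "x \<in> W" for x using openin_subset[OF o] that by blast
    then show ?thesis using assms(2) by (auto simp: W_def)
  qed
  then show "openin (subtopology loop_topology D) {x \<in> topspace (subtopology loop_topology D). F x \<in> V}"
    unfolding openin_subtopology using o by blast
qed simp

lemma joint_uniform_limit:
  fixes F :: "'a::metric_space \<Rightarrow> complex \<Rightarrow> mat2"
  assumes "compact C" "compact K" "continuous_on (C \<times> K) (\<lambda>x. F (fst x) (snd x))"
    "x \<longlonglongrightarrow> y" "\<And>n. x n \<in> C" "y \<in> C"
  shows "uniform_limit K (\<lambda>n. F (x n)) (F y) sequentially"
proof (rule uniform_limitI)
  fix e :: real assume e: "e > 0"
  have "uniformly_continuous_on (C \<times> K) (\<lambda>x. F (fst x) (snd x))"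
    by (intro compact_uniformly_continuous assms(3) compact_Times assms(1,2))
  then obtain d where d: "d > 0" "\<And>a b. a \<in> C \<times> K \<Longrightarrow> b \<in> C \<times> K \<Longrightarrow> dist b a < d \<Longrightarrow> dist (F (fst b) (snd b)) (F (fst a) (snd a)) < e"
    using e unfolding uniformly_continuous_on_def by metis
  have "\<forall>\<^sub>F n in sequentially. dist (x n) y < d" using assms(4) d(1) by (rule tendstoD)
  then show "\<forall>\<^sub>F n in sequentially. \<forall>z\<in>K. dist (F (x n) z) (F y z) < e"
  proof eventually_elim
    case (elim n)
    show ?case
    proof
      fix z assume z: "z \<in> K"
      have "dist (x n, z) (y, z) < d" using elim by (simp add: dist_Pair_Pair)
      then show "dist (F (x n) z) (F y z) < e" using d(2)[of "(y, z)" "(x n, z)"] z assms(5,6) by simp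
    qed
  qed
qed

lemma uniform_limit_dg_mult:
  fixes K :: "complex set" and h :: "nat \<Rightarrow> complex \<Rightarrow> mat2" and f :: "complex \<Rightarrow> mat2"
  assumes "uniform_limit K h f sequentially" "bounded (f ` K)" "compact K" "continuous_on K S" "\<zeta> \<longlonglongrightarrow> \<zeta>0"
  shows "uniform_limit K (\<lambda>n z. h n z ** dg (\<zeta> n * S z)) (\<lambda>z. f z ** dg (\<zeta>0 * S z)) sequentially"
proof -
  obtain B where B: "\<And>n. norm (\<zeta> n) \<le> B" using convergent_imp_bounded[OF assms(5)] by (auto simp: bounded_iff)
  then have B0: "norm \<zeta>0 \<le> B" using assms(5) Lim_norm_ubound[OF _ assms(5), of B] by simp
  have sn: "continuous_on (cball 0 B \<times> K) (\<lambda>x. S (snd x))"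
    by (rule continuous_on_compose2[OF assms(4)]) (auto intro: continuous_intros)
  have c: "continuous_on (cball 0 B \<times> K) (\<lambda>x. dg (fst x * S (snd x)))"
    by (intro continuous_dg continuous_intros sn)
  have "uniform_limit K (\<lambda>n z. dg (\<zeta> n * S z)) (\<lambda>z. dg (\<zeta>0 * S z)) sequentially"
    by (rule joint_uniform_limit[OF compact_cball assms(3), where F="\<lambda>\<zeta> z. dg (\<zeta> * S z)"]) (use c assms(5) B B0 in auto)
  then show ?thesis
    by (rule mm.bounded_uniform_limit[OF assms(1)])
       (intro compact_imp_bounded compact_continuous_image assms continuous_dg continuous_intros, rule assms(2))
qed

text \<open>Convergence on one annulus for suitable representatives, stated for germs so that later
  arguments need not mention radii.\<close>

inductive loop_lim :: "(nat \<Rightarrow> loop) \<Rightarrow> loop \<Rightarrow> bool" where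
  lim: "\<lbrakk>0 < r; r < 1; holo_near f (annulus r) UNIV; \<And>n. holo_near (h n) (annulus r) UNIV;
     uniform_limit (annulus r) h f sequentially\<rbrakk> \<Longrightarrow> loop_lim (\<lambda>n. abs_loop (h n)) (abs_loop f)"

lemmas loop_limI = loop_lim.lim

lemma loop_limE:
  assumes "loop_lim x y"
  obtains r f h where "0 < r" "r < 1" "holo_near f (annulus r) UNIV" "\<forall>n. holo_near (h n) (annulus r) UNIV"
    "uniform_limit (annulus r) h f sequentially" "y = abs_loop f" "x = (\<lambda>n. abs_loop (h n))"
  using assms
proof cases
  case (lim r f h)
  show ?thesis by (rule that[OF lim(3,4,5) allI[OF lim(6)] lim(7,2,1)])
qed

lemma gam_line_ex:
  assumes "t \<in> params" "s \<in> params"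
  shows "\<exists>R. 1 < R \<and> tf l t holomorphic_on ball 0 R \<and> tf l s holomorphic_on ball 0 R \<and>
    (\<forall>\<zeta>. gam l (\<lambda>i. t i + \<zeta> * s i) = abs_loop (\<lambda>z. dg (tf l t z + \<zeta> * tf l s z)))"
proof (rule gam_line[OF assms, of l])
  fix R assume a: "1 < R" "tf l t holomorphic_on ball 0 R" "tf l s holomorphic_on ball 0 R"
    "\<And>\<zeta>. gam l (\<lambda>i. t i + \<zeta> * s i) = abs_loop (\<lambda>z. dg (tf l t z + \<zeta> * tf l s z))"
  show ?thesis by (intro exI[of _ R] conjI allI a)
qed

lemma scont_loop_lim:
  "scont D F \<longleftrightarrow> (\<forall>x y. loop_lim x y \<longrightarrow> y \<in> D \<longrightarrow> (\<forall>n. x n \<in> D) \<longrightarrow> (\<lambda>n. F (x n)) \<longlonglongrightarrow> F y)"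
proof
  assume s: "scont D F"
  show "\<forall>x y. loop_lim x y \<longrightarrow> y \<in> D \<longrightarrow> (\<forall>n. x n \<in> D) \<longrightarrow> (\<lambda>n. F (x n)) \<longlonglongrightarrow> F y"
  proof (intro allI impI)
    fix x y assume a: "loop_lim x y" "y \<in> D" "\<forall>n. x n \<in> D"
    show "(\<lambda>n. F (x n)) \<longlonglongrightarrow> F y"
      using a(1)
    proof cases
      case (lim r f h)
      show ?thesis unfolding lim(1,2)
        by (rule s[unfolded scont_def, rule_format, OF lim(3-7)]) (use a(2,3) lim(1,2) in auto)
    qed
  qed
next
  assume "\<forall>x y. loop_lim x y \<longrightarrow> y \<in> D \<longrightarrow> (\<forall>n. x n \<in> D) \<longrightarrow> (\<lambda>n. F (x n)) \<longlonglongrightarrow> F y"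
  then show "scont D F" unfolding scont_def by (simp add: loop_limI)
qed

lemma loop_lim_subseq:
  assumes "loop_lim x y" "filterlim \<sigma> at_top sequentially"
  shows "loop_lim (\<lambda>n. x (\<sigma> n)) y"
proof -
  obtain r f h where p: "0 < r" "r < 1" "holo_near f (annulus r) UNIV" "\<forall>n. holo_near (h n) (annulus r) UNIV"
      "uniform_limit (annulus r) h f sequentially" "y = abs_loop f" "x = (\<lambda>n. abs_loop (h n))"
    using loop_limE[OF assms(1)] .
  have "uniform_limit (annulus r) (\<lambda>n. h (\<sigma> n)) f sequentially" by (rule uniform_limit_subseq[OF p(5) assms(2)])
  then show ?thesis unfolding p(6,7) by (rule loop_limI[OF p(1-3) p(4)[rule_format]])
qed

lemma loop_lim_const: "loop_lim (\<lambda>n. y) y"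
proof -
  obtain f where f: "y = abs_loop f" "isloop f" by (rule abs_loop_cases)
  then obtain s where s: "0 < s" "s < 1" "hol2 f (ann s)" by (auto simp: isloop_def)
  define r where "r = (1 + s) / 2"
  have "0 < r" "r < 1" "s < r" using s by (auto simp: r_def)
  moreover have "holo_near f (annulus r) UNIV" by (rule holo_near_annulusI[OF s(3)]) (use s \<open>s < r\<close> in auto)
  ultimately show ?thesis unfolding f(1) by (intro loop_limI[of r]) (auto intro: uniform_limit_const)
qed

section \<open>Translation by one-parameter subgroups\<close>

definition expo :: "nat \<Rightarrow> (nat \<Rightarrow> complex) \<Rightarrow> complex \<Rightarrow> loop" where
  "expo l s \<zeta> = gam l (\<lambda>i. \<zeta> * s i)"

lemma params_scale: "s \<in> params \<Longrightarrow> (\<lambda>i. \<zeta> * s i) \<in> params"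
  using params_add[of "\<lambda>i. \<zeta> * s i" s 0] by (cases "\<zeta> = 0") (auto simp: params_def conv_radius_cmult_left)

lemma expo_eq:
  assumes "s \<in> params"
  shows "\<exists>R. 1 < R \<and> tf l s holomorphic_on ball 0 R \<and> (\<forall>\<zeta>. expo l s \<zeta> = abs_loop (\<lambda>z. dg (\<zeta> * tf l s z)))"
proof -
  obtain R where "1 < R \<and> tf l (\<lambda>i. 0 * s i) holomorphic_on ball 0 R \<and> tf l s holomorphic_on ball 0 R \<and>
    (\<forall>\<zeta>. gam l (\<lambda>i. 0 * s i + \<zeta> * s i) = abs_loop (\<lambda>z. dg (tf l (\<lambda>i. 0 * s i) z + \<zeta> * tf l s z)))"
    using gam_line_ex[OF params_scale[OF assms] assms, of l 0] ..
  moreover have "tf l (\<lambda>i. 0 * s i) z = 0" for z by (simp add: tf_def)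
  ultimately show ?thesis by (intro exI[of _ R]) (simp add: expo_def)
qed

lemma loop_lim_expo:
  assumes x: "loop_lim x y" and z: "\<zeta> \<longlonglongrightarrow> \<zeta>0" and s: "s \<in> params"
  shows "loop_lim (\<lambda>n. x n \<otimes>\<^bsub>LGL2\<^esub> expo l s (\<zeta> n)) (y \<otimes>\<^bsub>LGL2\<^esub> expo l s \<zeta>0)"
proof -
  obtain r f h where p: "0 < r" "r < 1" "holo_near f (annulus r) UNIV" "\<forall>n. holo_near (h n) (annulus r) UNIV"
      "uniform_limit (annulus r) h f sequentially" "y = abs_loop f" "x = (\<lambda>n. abs_loop (h n))"
    using loop_limE[OF x] .
  obtain R where R': "1 < R \<and> tf l s holomorphic_on ball 0 R \<and> (\<forall>\<zeta>. expo l s \<zeta> = abs_loop (\<lambda>z. dg (\<zeta> * tf l s z)))"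
    using expo_eq[OF s, of l] ..
  then have R: "1 < R" "tf l s holomorphic_on ball 0 R" "\<And>\<zeta>. expo l s \<zeta> = abs_loop (\<lambda>z. dg (\<zeta> * tf l s z))" by blast+
  \<comment> \<open>At least \<open>r\<close>, for the convergence of the sequence, and above
    \<open>1 / R\<close>, so that the closed annulus lies in the disc of the exponent.\<close>
  define r' where "r' = max r ((1 + 1 / R) / 2)"
  have R1: "1 / R < 1" using R(1) by simp
  then have r': "0 < r'" "r' < 1" "r \<le> r'" "1 / R < r'" using p(1,2) by (auto simp: r'_def max_def)
  have hf: "hol2 f (ann r)" "hol2 (h n) (ann r)" for n using holo_near_annulus_ann[OF _ p(1,2)] p(3,4) by auto
  have E: "hol2 (\<lambda>z. dg (c * tf l s z)) (ann (1/R))" for c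
    by (rule hol2_ball_ann(1)[OF hol2_dg]) (use R in \<open>auto intro!: holomorphic_intros\<close>)
  have isE: "isloop (\<lambda>z. dg (c * tf l s z))" for c by (rule isloopI[OF E]) (use R in auto)
  have isf: "isloop f" "isloop (h n)" for n using hf p(1,2) isloopI by blast+
  have nE: "holo_near (\<lambda>z. dg (c * tf l s z)) (annulus r') UNIV" for c
    by (rule holo_near_annulusI[OF E]) (use R r' in auto)
  have sub: "annulus r' \<subseteq> annulus r" by (rule annulus_mono[OF p(1) r'(3)])
  have nf: "holo_near f (annulus r') UNIV" "holo_near (h n) (annulus r') UNIV" for n
    using holo_near_subset[OF _ sub] p(3,4) by auto
  have cf: "continuous_on (annulus r') f"
  proof -
    obtain a where a: "0 < a" "a < r'" "hol2 f (ann a)" using holo_near_annulusD[OF nf(1) r'(1,2)] .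
    show ?thesis by (rule continuous_on_subset[OF hol2_continuous[OF a(3)]]) (use annulus_subset_ann a in auto)
  qed
  have ub: "annulus r' \<subseteq> ball 0 R"
  proof -
    have "annulus r' \<subseteq> ann (1/R)" by (rule annulus_subset_ann) (use R r' in auto)
    then show ?thesis using ball_ann(1) by blast
  qed
  have "uniform_limit (annulus r') (\<lambda>n z. h n z ** dg (\<zeta> n * tf l s z)) (\<lambda>z. f z ** dg (\<zeta>0 * tf l s z)) sequentially"
  proof (rule uniform_limit_dg_mult[OF _ _ compact_annulus _ z])
    show "uniform_limit (annulus r') h f sequentially" by (rule uniform_limit_on_subset[OF p(5) sub])
    show "bounded (f ` annulus r')" by (intro compact_imp_bounded compact_continuous_image cf compact_annulus)
    show "continuous_on (annulus r') (tf l s)" using holomorphic_on_imp_continuous_on[OF R(2)] ub continuous_on_subset by blast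
  qed
  moreover have "holo_near (\<lambda>z. f z ** dg (\<zeta>0 * tf l s z)) (annulus r') UNIV" by (rule holo_near_mult[OF nf(1) nE])
  moreover have "holo_near (\<lambda>z. h n z ** dg (\<zeta> n * tf l s z)) (annulus r') UNIV" for n by (rule holo_near_mult[OF nf(2) nE])
  moreover have "y \<otimes>\<^bsub>LGL2\<^esub> expo l s \<zeta>0 = abs_loop (\<lambda>z. f z ** dg (\<zeta>0 * tf l s z))"
    using p(6) R(3) isf isE by simp
  moreover have "x n \<otimes>\<^bsub>LGL2\<^esub> expo l s (\<zeta> n) = abs_loop (\<lambda>z. h n z ** dg (\<zeta> n * tf l s z))" for n
    using p(7) R(3) isf isE by simp
  ultimately show ?thesis using loop_limI[OF r'(1,2)] by simp
qed

lemma expo_carrier: "s \<in> params \<Longrightarrow> expo l s \<zeta> \<in> carrier LGL2"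
  unfolding expo_def by (intro gam_carrier params_scale)

text \<open>A line in the coordinates is an orbit of right translations of the loop itself, so
  difference quotients along it depend on the loop and not on the coordinates that represent
  it.\<close>

lemma gam_add_expo:
  assumes "t \<in> params" "s \<in> params"
  shows "gam l (\<lambda>i. t i + \<zeta> * s i) = gam l t \<otimes>\<^bsub>LGL2\<^esub> expo l s \<zeta>"
proof -
  obtain R where "1 < R \<and> tf l t holomorphic_on ball 0 R \<and> tf l s holomorphic_on ball 0 R \<and>
    (\<forall>\<zeta>. gam l (\<lambda>i. t i + \<zeta> * s i) = abs_loop (\<lambda>z. dg (tf l t z + \<zeta> * tf l s z)))"
    using gam_line_ex[OF assms, of l] ..
  then have R: "1 < R" "tf l t holomorphic_on ball 0 R" "tf l s holomorphic_on ball 0 R"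
    "\<And>\<zeta>. gam l (\<lambda>i. t i + \<zeta> * s i) = abs_loop (\<lambda>z. dg (tf l t z + \<zeta> * tf l s z))" by blast+
  have R': "expo l s \<zeta> = abs_loop (\<lambda>z. dg (\<zeta> * tf l s z))" for \<zeta>
    using expo_eq[OF assms(2), of l] by blast
  have "isloop (\<lambda>z. dg (tf l t z))" "isloop (\<lambda>z. dg (\<zeta> * tf l s z))"
    by (rule isloopI[OF hol2_ball_ann(1)[OF hol2_dg, of _ R "1/R"]]; use R in \<open>auto intro!: holomorphic_intros\<close>)+
  then show ?thesis using R(4)[of \<zeta>] by (simp add: gam_eq[OF assms(1)] R' dg_add)
qed

lemma Gam_expo:
  assumes "\<gamma> \<in> Gam l" "s \<in> params"
  shows "\<gamma> \<otimes>\<^bsub>LGL2\<^esub> expo l s \<zeta> \<in> Gam l"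
proof -
  obtain t where t: "t \<in> params" "\<gamma> = gam l t" using assms(1) unfolding Gam_def by blast
  show ?thesis unfolding Gam_def t(2) gam_add_expo[OF t(1) assms(2), symmetric] by (intro imageI params_add t assms)
qed

lemma expo_add:
  assumes "s \<in> params"
  shows "expo l s (\<zeta> + \<eta>) = expo l s \<zeta> \<otimes>\<^bsub>LGL2\<^esub> expo l s \<eta>"
  using gam_add_expo[OF params_scale[OF assms] assms, of l \<zeta> \<eta>] by (simp add: expo_def distrib_right)

lemma expo_0: "s \<in> params \<Longrightarrow> expo l s 0 = \<one>\<^bsub>LGL2\<^esub>"
proof -
  assume "s \<in> params"
  then have "expo l s 0 = abs_loop (\<lambda>z. dg (0 * tf l s z))" using expo_eq[of s l] by blast
  then show ?thesis by (simp add: LGL2_one)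
qed

lemma expo_commute:
  assumes "s \<in> params" "t \<in> params"
  shows "expo l s \<zeta> \<otimes>\<^bsub>LGL2\<^esub> expo l t \<eta> = expo l t \<eta> \<otimes>\<^bsub>LGL2\<^esub> expo l s \<zeta>"
proof -
  have "expo l s \<zeta> \<otimes>\<^bsub>LGL2\<^esub> expo l t \<eta> = gam l (\<lambda>i. \<zeta> * s i + \<eta> * t i)"
    using gam_add_expo[OF params_scale[OF assms(1)] assms(2), of l \<zeta> \<eta>] by (simp add: expo_def)
  also have "\<dots> = gam l (\<lambda>i. \<eta> * t i + \<zeta> * s i)" by (simp add: add.commute)
  also have "\<dots> = expo l t \<eta> \<otimes>\<^bsub>LGL2\<^esub> expo l s \<zeta>"
    using gam_add_expo[OF params_scale[OF assms(2)] assms(1), of l \<eta> \<zeta>] by (simp add: expo_def)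
  finally show ?thesis .
qed

lemma Gam_carrier: "\<gamma> \<in> Gam l \<Longrightarrow> \<gamma> \<in> carrier LGL2"
  unfolding Gam_def using gam_carrier by blast

lemma Dom_Gam: "\<gamma> \<in> Dom l g d \<Longrightarrow> \<gamma> \<in> Gam l"
  by (simp add: Dom_def)

lemma Dom_carrier: "\<gamma> \<in> Dom l g d \<Longrightarrow> \<gamma> \<in> carrier LGL2"
  using Gam_carrier Dom_Gam by blast

lemma Dom_loop_lim:
  assumes l: "l \<le> 1" and g: "g \<in> carrier LGL2" and x: "loop_lim x y" "y \<in> Dom l g (delta m)"
  shows "(\<And>n. x n \<in> Gam l) \<Longrightarrow> \<forall>\<^sub>F n in sequentially. x n \<in> Dom l g (delta m)"
    "(\<lambda>n. loop_coeff (um l g (delta m) (x n)) j) \<longlonglongrightarrow> loop_coeff (um l g (delta m) y) j"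
proof -
  obtain r f h where p: "0 < r" "r < 1" "holo_near f (annulus r) UNIV" "\<forall>n. holo_near (h n) (annulus r) UNIV"
      "uniform_limit (annulus r) h f sequentially" "y = abs_loop f" "x = (\<lambda>n. abs_loop (h n))"
    using loop_limE[OF x(1)] .
  have y: "abs_loop f \<in> carrier LGL2" "conj_loop g (delta m) (abs_loop f) \<in> big_cell"
    using x(2) Dom_carrier p(6) by (auto simp: Dom_def)
  note b = big_cell_sequential[OF l g p(1-3) _ p(5) y]
  show "(\<lambda>n. loop_coeff (um l g (delta m) (x n)) j) \<longlonglongrightarrow> loop_coeff (um l g (delta m) y) j"
    using b(2)[of j, OF p(4)[rule_format]] p(6,7) by simp
  show "\<forall>\<^sub>F n in sequentially. x n \<in> Dom l g (delta m)" if "\<And>n. x n \<in> Gam l"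
    using b(1)[OF p(4)[rule_format]] p(7) that by (simp add: Dom_def)
qed

text \<open>If no common radius worked for almost all \<open>n\<close>, one could pick indices
  tending to infinity and increments tending to 0 whose translates leave the domain. These
  translates converge to \<open>y\<close>, against sequential openness.\<close>

lemma Dom_tube:
  assumes l: "l \<le> 1" and g: "g \<in> carrier LGL2" and x: "loop_lim x y" "y \<in> Dom l g (delta m)" "\<And>n. x n \<in> Gam l"
    and s: "s \<in> params" "s' \<in> params"
  shows "\<exists>\<rho>>0. \<forall>\<^sub>F n in sequentially. \<forall>\<zeta>\<in>cball 0 \<rho>. \<forall>\<tau>\<in>cball 0 \<rho>. 
    x n \<otimes>\<^bsub>LGL2\<^esub> expo l s \<zeta> \<otimes>\<^bsub>LGL2\<^esub> expo l s' \<tau> \<in> Dom l g (delta m)"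
proof (rule ccontr)
  define B where "B n \<rho> \<longleftrightarrow> (\<forall>\<zeta>\<in>cball 0 \<rho>. \<forall>\<tau>\<in>cball 0 \<rho>. 
    x n \<otimes>\<^bsub>LGL2\<^esub> expo l s \<zeta> \<otimes>\<^bsub>LGL2\<^esub> expo l s' \<tau> \<in> Dom l g (delta m))" for n \<rho>
  assume neg0: "\<not> ?thesis"
  have neg: "\<not> (\<exists>\<rho>>0. \<forall>\<^sub>F n in sequentially. B n \<rho>)" unfolding B_def by (rule neg0)
  have ex: "\<exists>n\<ge>k. \<not> B n (inverse (real (Suc k)))" for k :: nat
  proof (rule ccontr)
    assume "\<not> ?thesis"
    then have "\<forall>\<^sub>F n in sequentially. B n (inverse (real (Suc k)))" by (intro eventually_sequentiallyI[of k]) blast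
    moreover have "0 < inverse (real (Suc k))" by simp
    ultimately show False using neg by blast
  qed
  have "\<exists>n \<zeta> \<tau>. n \<ge> k \<and> norm \<zeta> \<le> inverse (real (Suc k)) \<and> norm \<tau> \<le> inverse (real (Suc k)) \<and> 
     x n \<otimes>\<^bsub>LGL2\<^esub> expo l s \<zeta> \<otimes>\<^bsub>LGL2\<^esub> expo l s' \<tau> \<notin> Dom l g (delta m)" for k :: nat
  proof -
    obtain n where n: "n \<ge> k" "\<not> B n (inverse (real (Suc k)))" using ex[of k] by blast
    then obtain \<zeta> \<tau> where "\<zeta> \<in> cball 0 (inverse (real (Suc k)))" "\<tau> \<in> cball 0 (inverse (real (Suc k)))"
      "x n \<otimes>\<^bsub>LGL2\<^esub> expo l s \<zeta> \<otimes>\<^bsub>LGL2\<^esub> expo l s' \<tau> \<notin> Dom l g (delta m)" unfolding B_def by blast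
    then show ?thesis using n(1) unfolding mem_cball_0 by blast
  qed
  then obtain \<sigma> \<zeta> \<tau> where a: "\<And>k. \<sigma> k \<ge> k" "\<And>k. norm (\<zeta> k) \<le> inverse (real (Suc k))" "\<And>k. norm (\<tau> k) \<le> inverse (real (Suc k))"
     "\<And>k. x (\<sigma> k) \<otimes>\<^bsub>LGL2\<^esub> expo l s (\<zeta> k) \<otimes>\<^bsub>LGL2\<^esub> expo l s' (\<tau> k) \<notin> Dom l g (delta m)" by metis
  have sg: "filterlim \<sigma> at_top sequentially" by (rule filterlim_at_top_mono[OF filterlim_ident]) (use a(1) in auto)
  have "\<zeta> \<longlonglongrightarrow> 0" by (rule Lim_null_comparison[OF always_eventually LIMSEQ_inverse_real_of_nat]) (use a(2) in blast)
  moreover have "\<tau> \<longlonglongrightarrow> 0" by (rule Lim_null_comparison[OF always_eventually LIMSEQ_inverse_real_of_nat]) (use a(3) in blast)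
  ultimately have z: "\<zeta> \<longlonglongrightarrow> 0" "\<tau> \<longlonglongrightarrow> 0" .
  have yc: "y \<in> carrier LGL2" by (rule Dom_carrier[OF x(2)])
  have e: "y \<otimes>\<^bsub>LGL2\<^esub> expo l s 0 \<otimes>\<^bsub>LGL2\<^esub> expo l s' 0 = y" using yc s by (simp add: expo_0)
  have "loop_lim (\<lambda>k. x (\<sigma> k) \<otimes>\<^bsub>LGL2\<^esub> expo l s (\<zeta> k) \<otimes>\<^bsub>LGL2\<^esub> expo l s' (\<tau> k)) (y \<otimes>\<^bsub>LGL2\<^esub> expo l s 0 \<otimes>\<^bsub>LGL2\<^esub> expo l s' 0)"
    by (intro loop_lim_expo loop_lim_subseq[OF x(1) sg] z s)
  then have "\<forall>\<^sub>F k in sequentially. x (\<sigma> k) \<otimes>\<^bsub>LGL2\<^esub> expo l s (\<zeta> k) \<otimes>\<^bsub>LGL2\<^esub> expo l s' (\<tau> k) \<in> Dom l g (delta m)"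
    unfolding e by (rule Dom_loop_lim(1)[OF l g _ x(2)]) (intro Gam_expo x(3) s)
  then show False using a(4) by (auto simp: eventually_sequentially)
qed

section \<open>Analytic functions and directional derivatives\<close>

definition analytic_on_Dom :: "nat \<Rightarrow> loop set \<Rightarrow> (loop \<Rightarrow> complex) \<Rightarrow> bool" where
  "analytic_on_Dom l D F \<longleftrightarrow> scont D F \<and> (\<forall>\<gamma>\<in>D. \<forall>s\<in>params. (\<lambda>\<zeta>. F (\<gamma> \<otimes>\<^bsub>LGL2\<^esub> expo l s \<zeta>)) analytic_on {0})"

text \<open>Closedness of \<open>Gam l\<close> and relative sequential openness of the domain
  upgrade sequential continuity to continuity; lines become translations by
  \<open>gam_add_expo\<close>.\<close>

lemma analytic_fun_iff:
  assumes l: "l \<le> 1" and g: "g \<in> carrier LGL2" 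
  shows "analytic_fun l (Dom l g (delta m)) F \<longleftrightarrow> analytic_on_Dom l (Dom l g (delta m)) F"
proof -
  let ?D = "Dom l g (delta m)"
  have "continuous_map (subtopology loop_topology ?D) euclidean F \<longleftrightarrow> scont ?D F"
  proof
    assume "scont ?D F"
    then show "continuous_map (subtopology loop_topology ?D) euclidean F"
    proof (rule scont_imp_continuous)
      show "?D \<subseteq> Gam l" using Dom_Gam by blast
      show "abs_loop f \<in> Gam l" if "0 < r" "r < 1" "holo_near f (annulus r) UNIV" "\<And>n. holo_near (h n) (annulus r) UNIV"
        "uniform_limit (annulus r) h f sequentially" "\<And>n. abs_loop (h n) \<in> Gam l" for r f h
        by (rule Gam_closed[OF l that])
      show "\<forall>\<^sub>F n in sequentially. abs_loop (h n) \<in> ?D" if "0 < r" "r < 1" "holo_near f (annulus r) UNIV" "\<And>n. holo_near (h n) (annulus r) UNIV"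
        "uniform_limit (annulus r) h f sequentially" "abs_loop f \<in> ?D" "\<And>n. abs_loop (h n) \<in> Gam l" for r f h
      proof (rule Dom_loop_lim(1)[OF l g _ that(6,7)])
        show "loop_lim (\<lambda>n. abs_loop (h n)) (abs_loop f)" by (rule loop_limI[OF that(1-5)])
      qed
    qed
  qed (rule continuous_imp_scont)
  moreover have "(\<forall>t\<in>params. \<forall>s\<in>params. gam l t \<in> ?D \<longrightarrow> (\<lambda>\<zeta>. F (gam l (\<lambda>i. t i + \<zeta> * s i))) analytic_on {0}) \<longleftrightarrow>
    (\<forall>\<gamma>\<in>?D. \<forall>s\<in>params. (\<lambda>\<zeta>. F (\<gamma> \<otimes>\<^bsub>LGL2\<^esub> expo l s \<zeta>)) analytic_on {0})" (is "?L \<longleftrightarrow> ?R")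
  proof
    assume L: ?L
    show ?R
    proof (intro ballI)
      fix \<gamma> s assume a: "\<gamma> \<in> ?D" "s \<in> params"
      then obtain t where t: "t \<in> params" "\<gamma> = gam l t" using Dom_Gam unfolding Gam_def by blast
      then have "(\<lambda>\<zeta>. F (gam l (\<lambda>i. t i + \<zeta> * s i))) analytic_on {0}" using L a by blast
      then show "(\<lambda>\<zeta>. F (\<gamma> \<otimes>\<^bsub>LGL2\<^esub> expo l s \<zeta>)) analytic_on {0}" unfolding gam_add_expo[OF t(1) a(2)] t(2) .
    qed
  next
    assume R: ?R
    show ?L
    proof (intro ballI impI)
      fix t s assume a: "t \<in> params" "s \<in> params" "gam l t \<in> ?D"
      then show "(\<lambda>\<zeta>. F (gam l (\<lambda>i. t i + \<zeta> * s i))) analytic_on {0}" using R unfolding gam_add_expo[OF a(1,2)] by blast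
    qed
  qed
  ultimately show ?thesis unfolding analytic_fun_def analytic_on_Dom_def by blast
qed

definition ldiff :: "nat \<Rightarrow> (nat \<Rightarrow> complex) \<Rightarrow> (loop \<Rightarrow> complex) \<Rightarrow> loop \<Rightarrow> complex" where
  "ldiff l s F \<gamma> = deriv (\<lambda>\<zeta>. F (\<gamma> \<otimes>\<^bsub>LGL2\<^esub> expo l s \<zeta>)) 0"

text \<open>Whichever \<open>t\<close> the choice operator returns, changing its coordinate
  \<open>i\<close> is translation by \<open>expo l (unitv i)\<close>. The derivative therefore does
  not depend on the choice.\<close>

lemma part_t_ldiff:
  assumes "\<gamma> \<in> Dom l g d"
  shows "part_t l g d i F \<gamma> = ldiff l (unitv i) F \<gamma>"
proof -
  define t where "t = (SOME t. t \<in> params \<and> gam l t = \<gamma>)"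
  have "\<exists>t. t \<in> params \<and> gam l t = \<gamma>" using Dom_Gam[OF assms] unfolding Gam_def by blast
  then have t: "t \<in> params" "gam l t = \<gamma>" unfolding t_def by (rule someI2_ex; blast)+
  have u: "t(i := t i + \<zeta>) = (\<lambda>j. t j + \<zeta> * unitv i j)" for \<zeta> by (auto simp: unitv_def)
  have "part_t l g d i F \<gamma> = deriv (\<lambda>\<tau>. F (gam l (t(i := \<tau>)))) (t i)"
    using assms by (simp add: part_t_def t_def Let_def)
  also have "\<dots> = deriv (\<lambda>\<zeta>. F (gam l (t(i := t i + \<zeta>)))) 0" by (subst deriv_shift_0) (simp add: o_def)
  also have "\<dots> = ldiff l (unitv i) F \<gamma>" unfolding u gam_add_expo[OF t(1) params_unitv] t(2) ldiff_def ..
  finally show ?thesis .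
qed

lemma expo_mult_add:
  assumes "\<gamma> \<in> carrier LGL2" "s \<in> params"
  shows "\<gamma> \<otimes>\<^bsub>LGL2\<^esub> expo l s \<zeta> \<otimes>\<^bsub>LGL2\<^esub> expo l s \<eta> = \<gamma> \<otimes>\<^bsub>LGL2\<^esub> expo l s (\<zeta> + \<eta>)"
  using assms by (simp add: expo_add expo_carrier LG.m_assoc)

lemma expo_mult_commute:
  assumes "\<gamma> \<in> carrier LGL2" "s \<in> params" "s' \<in> params"
  shows "\<gamma> \<otimes>\<^bsub>LGL2\<^esub> expo l s \<zeta> \<otimes>\<^bsub>LGL2\<^esub> expo l s' \<eta> = \<gamma> \<otimes>\<^bsub>LGL2\<^esub> expo l s' \<eta> \<otimes>\<^bsub>LGL2\<^esub> expo l s \<zeta>"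
  using assms expo_commute[OF assms(2,3), of l \<zeta> \<eta>] by (simp add: expo_carrier LG.m_assoc)

lemma Dom_plane:
  assumes "l \<le> 1" "g \<in> carrier LGL2" "\<gamma> \<in> Dom l g (delta m)" "s \<in> params" "s' \<in> params"
  obtains \<rho> where "0 < \<rho>" "\<forall>\<zeta>\<in>cball 0 \<rho>. \<forall>\<tau>\<in>cball 0 \<rho>. 
    \<gamma> \<otimes>\<^bsub>LGL2\<^esub> expo l s \<zeta> \<otimes>\<^bsub>LGL2\<^esub> expo l s' \<tau> \<in> Dom l g (delta m)"
proof -
  obtain \<rho> where "0 < \<rho>" "\<forall>\<^sub>F n::nat in sequentially. \<forall>\<zeta>\<in>cball 0 \<rho>. \<forall>\<tau>\<in>cball 0 \<rho>. 
    \<gamma> \<otimes>\<^bsub>LGL2\<^esub> expo l s \<zeta> \<otimes>\<^bsub>LGL2\<^esub> expo l s' \<tau> \<in> Dom l g (delta m)"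
    using Dom_tube[OF assms(1,2) loop_lim_const assms(3) Dom_Gam[OF assms(3)] assms(4,5)] by blast
  then show ?thesis using that[of \<rho>] by simp
qed

lemma Dom_line:
  assumes "l \<le> 1" "g \<in> carrier LGL2" "\<gamma> \<in> Dom l g (delta m)" "s \<in> params"
  obtains \<rho> where "0 < \<rho>" "\<forall>\<zeta>\<in>cball 0 \<rho>. \<gamma> \<otimes>\<^bsub>LGL2\<^esub> expo l s \<zeta> \<in> Dom l g (delta m)"
proof -
  obtain \<rho> where r: "0 < \<rho>" "\<forall>\<zeta>\<in>cball 0 \<rho>. \<forall>\<tau>\<in>cball 0 \<rho>. 
    \<gamma> \<otimes>\<^bsub>LGL2\<^esub> expo l s \<zeta> \<otimes>\<^bsub>LGL2\<^esub> expo l s \<tau> \<in> Dom l g (delta m)" using Dom_plane[OF assms assms(4)] .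
  have "\<gamma> \<otimes>\<^bsub>LGL2\<^esub> expo l s \<zeta> \<in> Dom l g (delta m)" if "\<zeta> \<in> cball 0 \<rho>" for \<zeta>
    using r(2)[rule_format, OF that, of 0] r(1) expo_mult_add[OF Dom_carrier[OF assms(3)] assms(4), of l \<zeta> 0] by simp
  then show ?thesis by (intro that[OF r(1)] ballI)
qed

lemma eventually_Dom_line:
  assumes "l \<le> 1" "g \<in> carrier LGL2" "\<gamma> \<in> Dom l g (delta m)" "s \<in> params"
  shows "\<forall>\<^sub>F \<zeta> in nhds 0. \<gamma> \<otimes>\<^bsub>LGL2\<^esub> expo l s \<zeta> \<in> Dom l g (delta m)"
proof -
  obtain \<rho> where r: "0 < \<rho>" "\<forall>\<zeta>\<in>cball 0 \<rho>. \<gamma> \<otimes>\<^bsub>LGL2\<^esub> expo l s \<zeta> \<in> Dom l g (delta m)"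
    using Dom_line[OF assms] .
  have "\<forall>\<^sub>F \<zeta> in nhds 0. \<zeta> \<in> ball (0::complex) \<rho>" using r(1) by (intro eventually_nhds_in_open) auto
  then show ?thesis by eventually_elim (use r(2) in auto)
qed

lemma analytic_on_Dom_cong:
  assumes lg: "l \<le> 1" "g \<in> carrier LGL2" and F: "analytic_on_Dom l (Dom l g (delta m)) F"
    and eq: "\<And>\<gamma>. \<gamma> \<in> Dom l g (delta m) \<Longrightarrow> F \<gamma> = F' \<gamma>"
  shows "analytic_on_Dom l (Dom l g (delta m)) F'"
  unfolding analytic_on_Dom_def
proof (intro conjI ballI)
  show "scont (Dom l g (delta m)) F'" using F eq unfolding analytic_on_Dom_def scont_loop_lim by simp
  fix \<gamma> s assume a: "\<gamma> \<in> Dom l g (delta m)" "s \<in> params"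
  have ev: "\<forall>\<^sub>F \<zeta> in nhds 0. F (\<gamma> \<otimes>\<^bsub>LGL2\<^esub> expo l s \<zeta>) = F' (\<gamma> \<otimes>\<^bsub>LGL2\<^esub> expo l s \<zeta>)"
    using eventually_Dom_line[OF lg a] by eventually_elim (rule eq)
  have "(\<lambda>\<zeta>. F (\<gamma> \<otimes>\<^bsub>LGL2\<^esub> expo l s \<zeta>)) analytic_on {0}" using F a unfolding analytic_on_Dom_def by blast
  then show "(\<lambda>\<zeta>. F' (\<gamma> \<otimes>\<^bsub>LGL2\<^esub> expo l s \<zeta>)) analytic_on {0}"
    by (rule analytic_at_cong[OF ev refl, THEN iffD1])
qed

lemma ldiff_cong:
  assumes lg: "l \<le> 1" "g \<in> carrier LGL2" and a: "\<gamma> \<in> Dom l g (delta m)" "s \<in> params"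
    and eq: "\<And>\<gamma>. \<gamma> \<in> Dom l g (delta m) \<Longrightarrow> F \<gamma> = F' \<gamma>"
  shows "ldiff l s F \<gamma> = ldiff l s F' \<gamma>"
proof -
  have "\<forall>\<^sub>F \<zeta> in nhds 0. F (\<gamma> \<otimes>\<^bsub>LGL2\<^esub> expo l s \<zeta>) = F' (\<gamma> \<otimes>\<^bsub>LGL2\<^esub> expo l s \<zeta>)"
    using eventually_Dom_line[OF lg a] by eventually_elim (rule eq)
  then show ?thesis unfolding ldiff_def by (rule deriv_cong_ev) simp
qed

text \<open>Differentiability at 0 of each translated line is moved to the point
  \<open>\<zeta>\<close> by the group law, so pointwise information at 0 yields holomorphy on a
  whole set.\<close>

lemma holomorphic_lineI:
  assumes "\<And>\<zeta>. \<zeta> \<in> U \<Longrightarrow> (\<lambda>\<eta>. F (\<gamma> \<otimes>\<^bsub>LGL2\<^esub> expo l s \<zeta> \<otimes>\<^bsub>LGL2\<^esub> expo l s \<eta>)) field_differentiable (at 0)" "\<gamma> \<in> carrier LGL2" "s \<in> params"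
  shows "(\<lambda>\<zeta>. F (\<gamma> \<otimes>\<^bsub>LGL2\<^esub> expo l s \<zeta>)) holomorphic_on U"
  unfolding holomorphic_on_def
proof
  fix \<zeta> assume z: "\<zeta> \<in> U"
  have "(\<lambda>\<eta>. F (\<gamma> \<otimes>\<^bsub>LGL2\<^esub> expo l s (\<zeta> + \<eta>))) field_differentiable (at 0)"
    using assms(1)[OF z] unfolding expo_mult_add[OF assms(2,3)] .
  then have "(\<lambda>\<eta>. F (\<gamma> \<otimes>\<^bsub>LGL2\<^esub> expo l s (\<zeta> + \<eta>))) field_differentiable (at ((\<lambda>x. x - \<zeta>) \<zeta>))" by simp
  moreover have "(\<lambda>x. x - \<zeta>) field_differentiable (at \<zeta>)"
    by (intro field_differentiable_diff field_differentiable_ident field_differentiable_const)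
  ultimately have "((\<lambda>\<eta>. F (\<gamma> \<otimes>\<^bsub>LGL2\<^esub> expo l s (\<zeta> + \<eta>))) \<circ> (\<lambda>x. x - \<zeta>)) field_differentiable (at \<zeta>)"
    by (rule field_differentiable_compose[rotated])
  then show "(\<lambda>\<zeta>. F (\<gamma> \<otimes>\<^bsub>LGL2\<^esub> expo l s \<zeta>)) field_differentiable (at \<zeta> within U)"
    by (simp add: o_def field_differentiable_at_within)
qed

lemma holomorphic_line:
  assumes F: "analytic_on_Dom l D F" and s: "s \<in> params" and g: "\<gamma> \<in> carrier LGL2"
    and U: "\<And>\<zeta>. \<zeta> \<in> U \<Longrightarrow> \<gamma> \<otimes>\<^bsub>LGL2\<^esub> expo l s \<zeta> \<in> D"
  shows "(\<lambda>\<zeta>. F (\<gamma> \<otimes>\<^bsub>LGL2\<^esub> expo l s \<zeta>)) holomorphic_on U"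
proof (rule holomorphic_lineI[OF _ g s])
  fix \<zeta> assume "\<zeta> \<in> U"
  then have "(\<lambda>\<eta>. F (\<gamma> \<otimes>\<^bsub>LGL2\<^esub> expo l s \<zeta> \<otimes>\<^bsub>LGL2\<^esub> expo l s \<eta>)) analytic_on {0}"
    using F U s unfolding analytic_on_Dom_def by blast
  then show "(\<lambda>\<eta>. F (\<gamma> \<otimes>\<^bsub>LGL2\<^esub> expo l s \<zeta> \<otimes>\<^bsub>LGL2\<^esub> expo l s \<eta>)) field_differentiable (at 0)"
    by (rule analytic_on_imp_differentiable_at) simp
qed

text \<open>Joint continuity follows from continuity of translation in both parameters; holomorphy
  in the first variable uses that the two translations commute.\<close>

lemma separately_holomorphic_plane:
  assumes F: "analytic_on_Dom l D F" and s: "s \<in> params" "s' \<in> params" and g: "\<gamma> \<in> carrier LGL2" and r: "0 < \<rho>"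
    and U: "\<And>\<zeta> \<tau>. \<zeta> \<in> ball 0 \<rho> \<Longrightarrow> \<tau> \<in> ball 0 \<rho> \<Longrightarrow> \<gamma> \<otimes>\<^bsub>LGL2\<^esub> expo l s \<zeta> \<otimes>\<^bsub>LGL2\<^esub> expo l s' \<tau> \<in> D"
  shows "separately_holomorphic (\<lambda>\<zeta> \<tau>. F (\<gamma> \<otimes>\<^bsub>LGL2\<^esub> expo l s \<zeta> \<otimes>\<^bsub>LGL2\<^esub> expo l s' \<tau>)) \<rho>"
  unfolding separately_holomorphic_def
proof (intro conjI ballI r)
  show "continuous_on (ball 0 \<rho> \<times> ball 0 \<rho>) (\<lambda>x. F (\<gamma> \<otimes>\<^bsub>LGL2\<^esub> expo l s (fst x) \<otimes>\<^bsub>LGL2\<^esub> expo l s' (snd x)))"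
    unfolding continuous_on_sequentially
  proof (intro allI ballI impI, elim conjE)
    fix x a assume a: "a \<in> ball (0::complex) \<rho> \<times> ball (0::complex) \<rho>" "\<forall>n::nat. x n \<in> ball 0 \<rho> \<times> ball 0 \<rho>" "x \<longlonglongrightarrow> a"
    have "loop_lim (\<lambda>n. \<gamma> \<otimes>\<^bsub>LGL2\<^esub> expo l s (fst (x n)) \<otimes>\<^bsub>LGL2\<^esub> expo l s' (snd (x n))) (\<gamma> \<otimes>\<^bsub>LGL2\<^esub> expo l s (fst a) \<otimes>\<^bsub>LGL2\<^esub> expo l s' (snd a))"
      by (intro loop_lim_expo loop_lim_const tendsto_fst tendsto_snd a s)
    moreover have "\<gamma> \<otimes>\<^bsub>LGL2\<^esub> expo l s (fst a) \<otimes>\<^bsub>LGL2\<^esub> expo l s' (snd a) \<in> D" using a(1) by (intro U) auto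
    moreover have "\<gamma> \<otimes>\<^bsub>LGL2\<^esub> expo l s (fst (x n)) \<otimes>\<^bsub>LGL2\<^esub> expo l s' (snd (x n)) \<in> D" for n
      using a(2)[rule_format, of n] by (intro U) auto
    ultimately show "((\<lambda>x. F (\<gamma> \<otimes>\<^bsub>LGL2\<^esub> expo l s (fst x) \<otimes>\<^bsub>LGL2\<^esub> expo l s' (snd x))) \<circ> x) \<longlonglongrightarrow>
        F (\<gamma> \<otimes>\<^bsub>LGL2\<^esub> expo l s (fst a) \<otimes>\<^bsub>LGL2\<^esub> expo l s' (snd a))"
      using F unfolding analytic_on_Dom_def scont_loop_lim o_def by blast
  qed
  fix \<tau> assume t: "\<tau> \<in> ball (0::complex) \<rho>"
  show "(\<lambda>\<zeta>. F (\<gamma> \<otimes>\<^bsub>LGL2\<^esub> expo l s \<zeta> \<otimes>\<^bsub>LGL2\<^esub> expo l s' \<tau>)) holomorphic_on ball 0 \<rho>"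
    unfolding expo_mult_commute[OF g s] using U t
    by (intro holomorphic_line[OF F s(1)]) (simp_all add: g s expo_carrier expo_mult_commute[OF g s])
  show "(\<lambda>\<zeta>. F (\<gamma> \<otimes>\<^bsub>LGL2\<^esub> expo l s \<tau> \<otimes>\<^bsub>LGL2\<^esub> expo l s' \<zeta>)) holomorphic_on ball 0 \<rho>"
    using U t by (intro holomorphic_line[OF F s(2)]) (simp_all add: g s expo_carrier)
qed

lemma ldiff_commute:
  assumes lg: "l \<le> 1" "g \<in> carrier LGL2" and F: "analytic_on_Dom l (Dom l g (delta m)) F"
    and a: "\<gamma> \<in> Dom l g (delta m)" "s \<in> params" "s' \<in> params"
  shows "ldiff l s (ldiff l s' F) \<gamma> = ldiff l s' (ldiff l s F) \<gamma>"
proof -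
  note gc = Dom_carrier[OF a(1)]
  obtain \<rho> where r: "0 < \<rho>" "\<forall>\<zeta>\<in>cball 0 \<rho>. \<forall>\<tau>\<in>cball 0 \<rho>. 
    \<gamma> \<otimes>\<^bsub>LGL2\<^esub> expo l s \<zeta> \<otimes>\<^bsub>LGL2\<^esub> expo l s' \<tau> \<in> Dom l g (delta m)" using Dom_plane[OF lg a] .
  have "separately_holomorphic (\<lambda>\<zeta> \<tau>. F (\<gamma> \<otimes>\<^bsub>LGL2\<^esub> expo l s \<zeta> \<otimes>\<^bsub>LGL2\<^esub> expo l s' \<tau>)) \<rho>"
    by (rule separately_holomorphic_plane[OF F a(2,3) gc r(1)]) (rule r(2)[rule_format]; simp)
  from mixed_partials[OF this] show ?thesis unfolding ldiff_def expo_mult_commute[OF gc a(3,2)] .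
qed

text \<open>A failure of uniformity would give parameters in the compact disc with a subsequence
  tending to some \<open>z\<close>. Along it the values at the sequence and at the limit both tend
  to the value at \<open>y\<close> translated by \<open>z\<close>, so their distance cannot stay
  bounded below.\<close>

lemma loop_lim_uniform:
  assumes F: "scont D F" and x: "loop_lim x y" and s: "s \<in> params"
    and D: "\<And>n \<zeta>. \<zeta> \<in> cball 0 \<rho> \<Longrightarrow> x n \<otimes>\<^bsub>LGL2\<^esub> expo l s \<zeta> \<in> D" "\<And>\<zeta>. \<zeta> \<in> cball 0 \<rho> \<Longrightarrow> y \<otimes>\<^bsub>LGL2\<^esub> expo l s \<zeta> \<in> D"
  shows "uniform_limit (cball 0 \<rho>) (\<lambda>n \<zeta>. F (x n \<otimes>\<^bsub>LGL2\<^esub> expo l s \<zeta>)) (\<lambda>\<zeta>. F (y \<otimes>\<^bsub>LGL2\<^esub> expo l s \<zeta>)) sequentially"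
proof (rule ccontr)
  define far where "far e n \<zeta> \<longleftrightarrow> \<not> dist (F (x n \<otimes>\<^bsub>LGL2\<^esub> expo l s \<zeta>)) (F (y \<otimes>\<^bsub>LGL2\<^esub> expo l s \<zeta>)) < e" for e n \<zeta>
  assume neg: "\<not> ?thesis"
  have "\<not> (\<forall>e>0. \<forall>\<^sub>F n in sequentially. \<forall>\<zeta>\<in>cball 0 \<rho>. \<not> far e n \<zeta>)"
    unfolding far_def not_not by (rule neg[unfolded uniform_limit_iff])
  then obtain e where e: "e > 0" "\<not> (\<forall>\<^sub>F n in sequentially. \<forall>\<zeta>\<in>cball 0 \<rho>. \<not> far e n \<zeta>)" by blast
  have "\<exists>n \<zeta>. n \<ge> k \<and> \<zeta> \<in> cball 0 \<rho> \<and> far e n \<zeta>" for k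
  proof (rule ccontr)
    assume "\<not> ?thesis"
    then have "\<forall>\<^sub>F n in sequentially. \<forall>\<zeta>\<in>cball 0 \<rho>. \<not> far e n \<zeta>"
      by (intro eventually_sequentiallyI[of k]) blast
    with e(2) show False ..
  qed
  then obtain \<sigma> \<zeta> where a: "\<And>k. \<sigma> k \<ge> k" "\<And>k::nat. \<zeta> k \<in> cball 0 \<rho>" "\<And>k. far e (\<sigma> k) (\<zeta> k)" by metis
  obtain z q where q: "z \<in> cball 0 \<rho>" "strict_mono q" "(\<zeta> \<circ> q) \<longlonglongrightarrow> z"
    using compact_cball[of "0::complex" \<rho>, unfolded compact_def, THEN spec, of \<zeta>] a(2) by blast
  have sg: "filterlim (\<lambda>k. \<sigma> (q k)) at_top sequentially"
    by (rule filterlim_at_top_mono[OF filterlim_ident always_eventually], rule allI, rule order_trans[OF seq_suble[OF q(2)] a(1)])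
  have z: "(\<lambda>k. \<zeta> (q k)) \<longlonglongrightarrow> z" using q(3) by (simp add: o_def)
  have "(\<lambda>k. F (x (\<sigma> (q k)) \<otimes>\<^bsub>LGL2\<^esub> expo l s (\<zeta> (q k)))) \<longlonglongrightarrow> F (y \<otimes>\<^bsub>LGL2\<^esub> expo l s z)"
    by (rule F[unfolded scont_loop_lim, rule_format, OF loop_lim_expo[OF loop_lim_subseq[OF x sg] z s]]) (rule D(1) D(2), rule q a(2))+
  moreover have "(\<lambda>k. F (y \<otimes>\<^bsub>LGL2\<^esub> expo l s (\<zeta> (q k)))) \<longlonglongrightarrow> F (y \<otimes>\<^bsub>LGL2\<^esub> expo l s z)"
    by (rule F[unfolded scont_loop_lim, rule_format, OF loop_lim_expo[OF loop_lim_const z s]]) (rule D(2), rule q a(2))+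
  ultimately have "(\<lambda>k. dist (F (x (\<sigma> (q k)) \<otimes>\<^bsub>LGL2\<^esub> expo l s (\<zeta> (q k)))) (F (y \<otimes>\<^bsub>LGL2\<^esub> expo l s (\<zeta> (q k))))) \<longlonglongrightarrow> 
      dist (F (y \<otimes>\<^bsub>LGL2\<^esub> expo l s z)) (F (y \<otimes>\<^bsub>LGL2\<^esub> expo l s z))" by (rule tendsto_dist)
  then have "(\<lambda>k. dist (F (x (\<sigma> (q k)) \<otimes>\<^bsub>LGL2\<^esub> expo l s (\<zeta> (q k)))) (F (y \<otimes>\<^bsub>LGL2\<^esub> expo l s (\<zeta> (q k))))) \<longlonglongrightarrow> 0" by simp
  from order_tendstoD(2)[OF this e(1)] obtain k where
    "dist (F (x (\<sigma> (q k)) \<otimes>\<^bsub>LGL2\<^esub> expo l s (\<zeta> (q k)))) (F (y \<otimes>\<^bsub>LGL2\<^esub> expo l s (\<zeta> (q k)))) < e"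
    unfolding eventually_sequentially by blast
  with a(3)[of "q k"] show False unfolding far_def by blast
qed

text \<open>On a common disc of translations the functions converge uniformly, and derivatives at 0
  of uniformly convergent holomorphic functions converge.\<close>

lemma ldiff_scont:
  assumes lg: "l \<le> 1" "g \<in> carrier LGL2" and F: "analytic_on_Dom l (Dom l g (delta m)) F" and s: "s \<in> params"
  shows "scont (Dom l g (delta m)) (ldiff l s F)"
  unfolding scont_loop_lim
proof (intro allI impI)
  let ?D = "Dom l g (delta m)"
  fix x y assume x: "loop_lim x y" "y \<in> ?D" "\<forall>n. x n \<in> ?D"
  have xG: "x n \<in> Gam l" for n using x(3) Dom_Gam by blast
  have zero: "\<gamma> \<otimes>\<^bsub>LGL2\<^esub> expo l s \<zeta> \<otimes>\<^bsub>LGL2\<^esub> expo l s 0 = \<gamma> \<otimes>\<^bsub>LGL2\<^esub> expo l s \<zeta>" if "\<gamma> \<in> ?D" for \<gamma> \<zeta>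
    using expo_mult_add[OF Dom_carrier[OF that] s, of l \<zeta> 0] by simp
  obtain a where a: "0 < a" "\<forall>\<^sub>F n in sequentially. \<forall>\<zeta>\<in>cball 0 a. \<forall>\<tau>\<in>cball 0 a. 
    x n \<otimes>\<^bsub>LGL2\<^esub> expo l s \<zeta> \<otimes>\<^bsub>LGL2\<^esub> expo l s \<tau> \<in> ?D" using Dom_tube[OF lg x(1,2) xG s s] by blast
  then obtain N where N: "\<And>n \<zeta> \<tau>. n \<ge> N \<Longrightarrow> \<zeta> \<in> cball 0 a \<Longrightarrow> \<tau> \<in> cball 0 a \<Longrightarrow> 
    x n \<otimes>\<^bsub>LGL2\<^esub> expo l s \<zeta> \<otimes>\<^bsub>LGL2\<^esub> expo l s \<tau> \<in> ?D" unfolding eventually_sequentially by blast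
  obtain b where b: "0 < b" "\<forall>\<zeta>\<in>cball 0 b. y \<otimes>\<^bsub>LGL2\<^esub> expo l s \<zeta> \<in> ?D"
    using Dom_line[OF lg x(2) s] .
  define \<rho> where "\<rho> = min a b"
  have r: "0 < \<rho>" "\<rho> \<le> a" "\<rho> \<le> b" using a(1) b(1) by (auto simp: \<rho>_def)
  \<comment> \<open>\<open>Dom_tube\<close> concerns two translations; here the second one is taken
    with parameter 0.\<close>
  have Dx: "x (n + N) \<otimes>\<^bsub>LGL2\<^esub> expo l s \<zeta> \<in> ?D" if "\<zeta> \<in> cball 0 \<rho>" for n \<zeta>
    using N[of "n + N" \<zeta> 0] that r zero[of "x (n + N)" \<zeta>] x(3) by simp
  have Dy: "y \<otimes>\<^bsub>LGL2\<^esub> expo l s \<zeta> \<in> ?D" if "\<zeta> \<in> cball 0 \<rho>" for \<zeta> using b(2) that r by simp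
  have "scont ?D F" using F by (simp add: analytic_on_Dom_def)
  from loop_lim_uniform[OF this loop_lim_subseq[OF x(1) filterlim_add_const_nat_at_top[of N]] s Dx Dy]
  have u: "uniform_limit (ball 0 \<rho>) (\<lambda>n \<zeta>. F (x (n + N) \<otimes>\<^bsub>LGL2\<^esub> expo l s \<zeta>)) (\<lambda>\<zeta>. F (y \<otimes>\<^bsub>LGL2\<^esub> expo l s \<zeta>)) sequentially"
    by (rule uniform_limit_on_subset) auto
  have h: "(\<lambda>\<zeta>. F (x (n + N) \<otimes>\<^bsub>LGL2\<^esub> expo l s \<zeta>)) holomorphic_on ball 0 \<rho>" for n
    by (rule holomorphic_line[OF F s Dom_carrier[OF x(3)[rule_format]]]) (rule Dx, simp)
  have "(\<lambda>n. (deriv ^^ 1) (\<lambda>\<zeta>. F (x (n + N) \<otimes>\<^bsub>LGL2\<^esub> expo l s \<zeta>)) 0) \<longlonglongrightarrow> (deriv ^^ 1) (\<lambda>\<zeta>. F (y \<otimes>\<^bsub>LGL2\<^esub> expo l s \<zeta>)) 0"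
    by (rule higher_deriv_complex_uniform_limit[OF u]) (use r(1) h in auto)
  then have "(\<lambda>n. ldiff l s F (x (n + N))) \<longlonglongrightarrow> ldiff l s F y" by (simp add: ldiff_def)
  then show "(\<lambda>n. ldiff l s F (x n)) \<longlonglongrightarrow> ldiff l s F y" by (rule LIMSEQ_offset)
qed

text \<open>Analyticity along \<open>s'\<close> of the derivative along \<open>s\<close> is
  holomorphy of a partial derivative on the plane of both directions.\<close>

lemma ldiff_analytic:
  assumes lg: "l \<le> 1" "g \<in> carrier LGL2" and F: "analytic_on_Dom l (Dom l g (delta m)) F" and s: "s \<in> params"
  shows "analytic_on_Dom l (Dom l g (delta m)) (ldiff l s F)"
  unfolding analytic_on_Dom_def
proof (intro conjI ballI ldiff_scont lg F s)
  fix \<gamma> s' assume a: "\<gamma> \<in> Dom l g (delta m)" "s' \<in> params"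
  obtain \<rho> where r: "0 < \<rho>" "\<forall>\<zeta>\<in>cball 0 \<rho>. \<forall>\<tau>\<in>cball 0 \<rho>. 
    \<gamma> \<otimes>\<^bsub>LGL2\<^esub> expo l s' \<zeta> \<otimes>\<^bsub>LGL2\<^esub> expo l s \<tau> \<in> Dom l g (delta m)" using Dom_plane[OF lg a s] .
  have "separately_holomorphic (\<lambda>\<zeta> \<tau>. F (\<gamma> \<otimes>\<^bsub>LGL2\<^esub> expo l s' \<zeta> \<otimes>\<^bsub>LGL2\<^esub> expo l s \<tau>)) \<rho>"
    by (rule separately_holomorphic_plane[OF F a(2) s Dom_carrier[OF a(1)] r(1)]) (rule r(2)[rule_format]; simp)
  from partial_holomorphic[OF this]
  have "(\<lambda>\<zeta>. ldiff l s F (\<gamma> \<otimes>\<^bsub>LGL2\<^esub> expo l s' \<zeta>)) holomorphic_on ball 0 (\<rho>/2)" by (simp add: ldiff_def)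
  then show "(\<lambda>\<zeta>. ldiff l s F (\<gamma> \<otimes>\<^bsub>LGL2\<^esub> expo l s' \<zeta>)) analytic_on {0}"
    unfolding analytic_at using r(1) by (intro exI[of _ "ball 0 (\<rho>/2)"]) simp
qed

section \<open>The algebra of analytic functions and its derivations\<close>

lemma Rfun_simps:
  "carrier (Rfun l g d) = {f \<in> extensional (Dom l g d). analytic_fun l (Dom l g d) f}"
  "f \<otimes>\<^bsub>Rfun l g d\<^esub> h = (\<lambda>\<gamma>\<in>Dom l g d. f \<gamma> * h \<gamma>)"
  "f \<oplus>\<^bsub>Rfun l g d\<^esub> h = (\<lambda>\<gamma>\<in>Dom l g d. f \<gamma> + h \<gamma>)"
  "\<one>\<^bsub>Rfun l g d\<^esub> = (\<lambda>\<gamma>\<in>Dom l g d. 1)" "\<zero>\<^bsub>Rfun l g d\<^esub> = (\<lambda>\<gamma>\<in>Dom l g d. 0)"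
  "c \<odot>\<^bsub>Rfun l g d\<^esub> f = (\<lambda>\<gamma>\<in>Dom l g d. c * f \<gamma>)"
  by (simp_all add: Rfun_def Let_def)

lemma Rfun_carrier_iff:
  assumes "l \<le> 1" "g \<in> carrier LGL2"
  shows "f \<in> carrier (Rfun l g (delta m)) \<longleftrightarrow> f \<in> extensional (Dom l g (delta m)) \<and> analytic_on_Dom l (Dom l g (delta m)) f"
  by (simp add: Rfun_simps analytic_fun_iff[OF assms])

lemma restrict_in_Rfun:
  assumes "l \<le> 1" "g \<in> carrier LGL2" "analytic_on_Dom l (Dom l g (delta m)) F"
  shows "(\<lambda>\<gamma>\<in>Dom l g (delta m). F \<gamma>) \<in> carrier (Rfun l g (delta m))"
  unfolding Rfun_carrier_iff[OF assms(1,2)] using analytic_on_Dom_cong[OF assms] by simp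

lemma scontD: "scont D F \<Longrightarrow> loop_lim x y \<Longrightarrow> y \<in> D \<Longrightarrow> (\<And>n. x n \<in> D) \<Longrightarrow> (\<lambda>n. F (x n)) \<longlonglongrightarrow> F y"
  unfolding scont_loop_lim by blast

lemma scontI: "(\<And>x y. loop_lim x y \<Longrightarrow> y \<in> D \<Longrightarrow> (\<And>n. x n \<in> D) \<Longrightarrow> (\<lambda>n. F (x n)) \<longlonglongrightarrow> F y) \<Longrightarrow> scont D F"
  unfolding scont_loop_lim by blast

lemma analytic_on_Dom_const: "analytic_on_Dom l D (\<lambda>\<gamma>. c)"
  unfolding analytic_on_Dom_def by (auto intro: scontI)

lemma analytic_on_Dom_add:
  assumes "analytic_on_Dom l D F" "analytic_on_Dom l D H"
  shows "analytic_on_Dom l D (\<lambda>\<gamma>. F \<gamma> + H \<gamma>)"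
  unfolding analytic_on_Dom_def
proof (intro conjI ballI)
  show "scont D (\<lambda>\<gamma>. F \<gamma> + H \<gamma>)"
    by (rule scontI) (use assms in \<open>auto simp: analytic_on_Dom_def intro!: tendsto_add scontD\<close>)
qed (use assms in \<open>auto simp: analytic_on_Dom_def intro!: analytic_on_add\<close>)

lemma analytic_on_Dom_mult:
  assumes "analytic_on_Dom l D F" "analytic_on_Dom l D H"
  shows "analytic_on_Dom l D (\<lambda>\<gamma>. F \<gamma> * H \<gamma>)"
  unfolding analytic_on_Dom_def
proof (intro conjI ballI)
  show "scont D (\<lambda>\<gamma>. F \<gamma> * H \<gamma>)"
    by (rule scontI) (use assms in \<open>auto simp: analytic_on_Dom_def intro!: tendsto_mult scontD\<close>)
qed (use assms in \<open>auto simp: analytic_on_Dom_def intro!: analytic_on_mult\<close>)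

lemma analytic_on_Dom_inverse:
  assumes "analytic_on_Dom l D F" "\<And>\<gamma>. \<gamma> \<in> D \<Longrightarrow> F \<gamma> \<noteq> 0" "D \<subseteq> carrier LGL2"
  shows "analytic_on_Dom l D (\<lambda>\<gamma>. inverse (F \<gamma>))"
  unfolding analytic_on_Dom_def
proof (intro conjI ballI)
  show "scont D (\<lambda>\<gamma>. inverse (F \<gamma>))"
    by (rule scontI) (use assms in \<open>auto simp: analytic_on_Dom_def intro!: tendsto_inverse scontD\<close>)
  fix \<gamma> s assume a: "\<gamma> \<in> D" "s \<in> params"
  have "\<gamma> \<in> carrier LGL2" using a(1) assms(3) by blast
  then have "F (\<gamma> \<otimes>\<^bsub>LGL2\<^esub> expo l s 0) \<noteq> 0" using assms(2)[OF a(1)] a(2) by (simp add: expo_0)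
  then show "(\<lambda>\<zeta>. inverse (F (\<gamma> \<otimes>\<^bsub>LGL2\<^esub> expo l s \<zeta>))) analytic_on {0}"
    using assms(1) a by (intro analytic_on_inverse) (auto simp: analytic_on_Dom_def)
qed

lemma Rfun_cring:
  assumes lg: "l \<le> 1" "g \<in> carrier LGL2"
  shows "cring (Rfun l g (delta m))"
proof -
  note C = restrict_in_Rfun[OF lg, of m] and I = Rfun_carrier_iff[OF lg, of _ m]
  let ?R = "Rfun l g (delta m)"
  have ext: "(\<lambda>\<gamma>\<in>Dom l g (delta m). f \<gamma>) = f" if "f \<in> carrier ?R" for f
    using that unfolding I by (intro extensional_restrict) blast
  have ab: "abelian_group ?R"
  proof (rule abelian_groupI)
    show "x \<oplus>\<^bsub>?R\<^esub> y \<in> carrier ?R" if "x \<in> carrier ?R" "y \<in> carrier ?R" for x y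
      unfolding Rfun_simps(3) by (rule C[OF analytic_on_Dom_add]) (use that I in blast)+
    show "\<zero>\<^bsub>?R\<^esub> \<in> carrier ?R" unfolding Rfun_simps(5) by (rule C[OF analytic_on_Dom_const])
    show "x \<oplus>\<^bsub>?R\<^esub> y \<oplus>\<^bsub>?R\<^esub> z = x \<oplus>\<^bsub>?R\<^esub> (y \<oplus>\<^bsub>?R\<^esub> z)" for x y z
      unfolding Rfun_simps(3) by (rule restrict_ext) simp
    show "x \<oplus>\<^bsub>?R\<^esub> y = y \<oplus>\<^bsub>?R\<^esub> x" for x y unfolding Rfun_simps(3) by (rule restrict_ext) simp
    show "\<zero>\<^bsub>?R\<^esub> \<oplus>\<^bsub>?R\<^esub> x = x" if "x \<in> carrier ?R" for x
      by (subst ext[OF that, symmetric], unfold Rfun_simps(3,5), rule restrict_ext) simp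
    show "\<exists>y\<in>carrier ?R. y \<oplus>\<^bsub>?R\<^esub> x = \<zero>\<^bsub>?R\<^esub>" if "x \<in> carrier ?R" for x
    proof
      show "(\<lambda>\<gamma>\<in>Dom l g (delta m). (-1) * x \<gamma>) \<in> carrier ?R"
        by (rule C[OF analytic_on_Dom_mult[OF analytic_on_Dom_const]]) (use that I in blast)
      show "(\<lambda>\<gamma>\<in>Dom l g (delta m). (-1) * x \<gamma>) \<oplus>\<^bsub>?R\<^esub> x = \<zero>\<^bsub>?R\<^esub>"
        unfolding Rfun_simps(3,5) by (rule restrict_ext) simp
    qed
  qed
  have cm: "Group.comm_monoid ?R"
  proof (rule comm_monoidI)
    show "x \<otimes>\<^bsub>?R\<^esub> y \<in> carrier ?R" if "x \<in> carrier ?R" "y \<in> carrier ?R" for x y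
      unfolding Rfun_simps(2) by (rule C[OF analytic_on_Dom_mult]) (use that I in blast)+
    show "\<one>\<^bsub>?R\<^esub> \<in> carrier ?R" unfolding Rfun_simps(4) by (rule C[OF analytic_on_Dom_const])
    show "x \<otimes>\<^bsub>?R\<^esub> y \<otimes>\<^bsub>?R\<^esub> z = x \<otimes>\<^bsub>?R\<^esub> (y \<otimes>\<^bsub>?R\<^esub> z)" for x y z
      unfolding Rfun_simps(2) by (rule restrict_ext) simp
    show "x \<otimes>\<^bsub>?R\<^esub> y = y \<otimes>\<^bsub>?R\<^esub> x" for x y unfolding Rfun_simps(2) by (rule restrict_ext) simp
    show "\<one>\<^bsub>?R\<^esub> \<otimes>\<^bsub>?R\<^esub> x = x" if "x \<in> carrier ?R" for x
      by (subst ext[OF that, symmetric], unfold Rfun_simps(2,4), rule restrict_ext) simp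
  qed
  show ?thesis
  proof (rule cringI[OF ab cm])
    show "(x \<oplus>\<^bsub>?R\<^esub> y) \<otimes>\<^bsub>?R\<^esub> z = x \<otimes>\<^bsub>?R\<^esub> z \<oplus>\<^bsub>?R\<^esub> y \<otimes>\<^bsub>?R\<^esub> z" for x y z
      unfolding Rfun_simps(2,3) by (rule restrict_ext) (simp add: distrib_right)
  qed
qed

lemma cring_complex_ring: "cring complex_ring"
proof (rule cringI)
  show "abelian_group complex_ring"
  proof (rule abelian_groupI)
    show "\<exists>y\<in>carrier complex_ring. y \<oplus>\<^bsub>complex_ring\<^esub> x = \<zero>\<^bsub>complex_ring\<^esub>" for x
      by (rule bexI[of _ "- x"]) (simp_all add: complex_ring_def)
  qed (simp_all add: complex_ring_def)
  show "Group.comm_monoid complex_ring" by (rule comm_monoidI) (simp_all add: complex_ring_def)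
qed (simp add: complex_ring_def distrib_right)

lemma smult_in_Rfun:
  assumes lg: "l \<le> 1" "g \<in> carrier LGL2" and x: "x \<in> carrier (Rfun l g (delta m))"
  shows "c \<odot>\<^bsub>Rfun l g (delta m)\<^esub> x \<in> carrier (Rfun l g (delta m))"
  unfolding Rfun_simps(6)
  by (rule restrict_in_Rfun[OF lg analytic_on_Dom_mult[OF analytic_on_Dom_const]]) (use x Rfun_carrier_iff[OF lg] in blast)

lemma Rfun_algebra:
  assumes lg: "l \<le> 1" "g \<in> carrier LGL2"
  shows "Module.algebra complex_ring (Rfun l g (delta m))"
proof (rule algebraI[OF cring_complex_ring Rfun_cring[OF lg]])
  let ?R = "Rfun l g (delta m)"
  show "c \<odot>\<^bsub>?R\<^esub> x \<in> carrier ?R" if "x \<in> carrier ?R" for c x by (rule smult_in_Rfun[OF lg that])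
  show "\<one>\<^bsub>complex_ring\<^esub> \<odot>\<^bsub>?R\<^esub> x = x" if "x \<in> carrier ?R" for x
  proof -
    have "(\<lambda>\<gamma>\<in>Dom l g (delta m). x \<gamma>) = x" using that unfolding Rfun_carrier_iff[OF lg] by (intro extensional_restrict) blast
    then show ?thesis by (simp add: Rfun_simps(6) complex_ring_def)
  qed
  show "(a \<oplus>\<^bsub>complex_ring\<^esub> b) \<odot>\<^bsub>?R\<^esub> x = a \<odot>\<^bsub>?R\<^esub> x \<oplus>\<^bsub>?R\<^esub> b \<odot>\<^bsub>?R\<^esub> x" for a b x
    unfolding Rfun_simps(3,6) by (rule restrict_ext) (simp add: complex_ring_def distrib_right)
  show "a \<odot>\<^bsub>?R\<^esub> (x \<oplus>\<^bsub>?R\<^esub> y) = a \<odot>\<^bsub>?R\<^esub> x \<oplus>\<^bsub>?R\<^esub> a \<odot>\<^bsub>?R\<^esub> y" for a x y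
    unfolding Rfun_simps(3,6) by (rule restrict_ext) (simp add: distrib_left)
  show "(a \<otimes>\<^bsub>complex_ring\<^esub> b) \<odot>\<^bsub>?R\<^esub> x = a \<odot>\<^bsub>?R\<^esub> (b \<odot>\<^bsub>?R\<^esub> x)" for a b x
    unfolding Rfun_simps(6) by (rule restrict_ext) (simp add: complex_ring_def)
  show "(a \<odot>\<^bsub>?R\<^esub> x) \<otimes>\<^bsub>?R\<^esub> y = a \<odot>\<^bsub>?R\<^esub> (x \<otimes>\<^bsub>?R\<^esub> y)" for a x y
    unfolding Rfun_simps(2,6) by (rule restrict_ext) simp
qed

lemma ldiff_rules:
  assumes F: "analytic_on_Dom l (Dom l g d) F" and H: "analytic_on_Dom l (Dom l g d) H"
    and a: "\<gamma> \<in> Dom l g d" "s \<in> params"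
  shows "ldiff l s (\<lambda>\<gamma>. F \<gamma> + H \<gamma>) \<gamma> = ldiff l s F \<gamma> + ldiff l s H \<gamma>"
    "ldiff l s (\<lambda>\<gamma>. F \<gamma> * H \<gamma>) \<gamma> = ldiff l s F \<gamma> * H \<gamma> + F \<gamma> * ldiff l s H \<gamma>"
    "ldiff l s (\<lambda>\<gamma>. c * F \<gamma>) \<gamma> = c * ldiff l s F \<gamma>"
proof -
  have z: "\<gamma> \<otimes>\<^bsub>LGL2\<^esub> expo l s 0 = \<gamma>" using Dom_carrier[OF a(1)] a(2) by (simp add: expo_0)
  have "(\<lambda>\<zeta>. F (\<gamma> \<otimes>\<^bsub>LGL2\<^esub> expo l s \<zeta>)) analytic_on {0}" using F a unfolding analytic_on_Dom_def by blast
  then have f: "(\<lambda>\<zeta>. F (\<gamma> \<otimes>\<^bsub>LGL2\<^esub> expo l s \<zeta>)) field_differentiable (at 0)" by (rule analytic_on_imp_differentiable_at) simp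
  have "(\<lambda>\<zeta>. H (\<gamma> \<otimes>\<^bsub>LGL2\<^esub> expo l s \<zeta>)) analytic_on {0}" using H a unfolding analytic_on_Dom_def by blast
  then have h: "(\<lambda>\<zeta>. H (\<gamma> \<otimes>\<^bsub>LGL2\<^esub> expo l s \<zeta>)) field_differentiable (at 0)" by (rule analytic_on_imp_differentiable_at) simp
  show "ldiff l s (\<lambda>\<gamma>. F \<gamma> + H \<gamma>) \<gamma> = ldiff l s F \<gamma> + ldiff l s H \<gamma>" unfolding ldiff_def using f h by (rule deriv_add)
  show "ldiff l s (\<lambda>\<gamma>. F \<gamma> * H \<gamma>) \<gamma> = ldiff l s F \<gamma> * H \<gamma> + F \<gamma> * ldiff l s H \<gamma>"
    unfolding ldiff_def deriv_mult[OF f h] z by simp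
  show "ldiff l s (\<lambda>\<gamma>. c * F \<gamma>) \<gamma> = c * ldiff l s F \<gamma>" unfolding ldiff_def using f by (rule deriv_cmult)
qed

lemma part_t_restrict: "part_t l g d i F = (\<lambda>\<gamma>\<in>Dom l g d. ldiff l (unitv i) F \<gamma>)"
proof
  fix \<gamma> show "part_t l g d i F \<gamma> = (\<lambda>\<gamma>\<in>Dom l g d. ldiff l (unitv i) F \<gamma>) \<gamma>"
    by (cases "\<gamma> \<in> Dom l g d") (simp_all add: part_t_ldiff, simp add: part_t_def)
qed

lemma Rfun_setting:
  assumes lg: "l \<le> 1" "g \<in> carrier LGL2"
  shows "setting I (Rfun l g (delta m)) (part_t l g (delta m))"
  unfolding setting_def
proof (intro conjI Rfun_algebra lg ballI allI)
  let ?R = "Rfun l g (delta m)" and ?D = "Dom l g (delta m)" and ?P = "part_t l g (delta m)"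
  note an = Rfun_carrier_iff[OF lg, THEN iffD1, THEN conjunct2]
  fix i
  note u = params_unitv[of i]
  \<comment> \<open>Elements of the ring are restricted to the domain. A short piece of every line
    stays inside it, so the restriction does not affect the derivative.\<close>
  have unres: "ldiff l (unitv i) (\<lambda>\<gamma>\<in>?D. F \<gamma>) \<gamma> = ldiff l (unitv i) F \<gamma>" if "\<gamma> \<in> ?D" for F \<gamma> i
    by (rule ldiff_cong[OF lg that params_unitv]) simp
  show "?P i \<in> carrier ?R \<rightarrow> carrier ?R"
    unfolding part_t_restrict by (intro funcsetI restrict_in_Rfun lg ldiff_analytic an u)
  show "?P i (a \<oplus>\<^bsub>?R\<^esub> b) = ?P i a \<oplus>\<^bsub>?R\<^esub> ?P i b" if "a \<in> carrier ?R" "b \<in> carrier ?R" for a b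
    unfolding part_t_restrict Rfun_simps(3)
  proof (rule restrict_ext)
    fix \<gamma> assume g: "\<gamma> \<in> ?D"
    show "ldiff l (unitv i) (\<lambda>\<gamma>\<in>?D. a \<gamma> + b \<gamma>) \<gamma> = (\<lambda>\<gamma>\<in>?D. ldiff l (unitv i) a \<gamma>) \<gamma> + (\<lambda>\<gamma>\<in>?D. ldiff l (unitv i) b \<gamma>) \<gamma>"
      unfolding unres[OF g] ldiff_rules(1)[OF an[OF that(1)] an[OF that(2)] g u] using g by simp
  qed
  show "?P i (a \<otimes>\<^bsub>?R\<^esub> b) = ?P i a \<otimes>\<^bsub>?R\<^esub> b \<oplus>\<^bsub>?R\<^esub> a \<otimes>\<^bsub>?R\<^esub> ?P i b" if "a \<in> carrier ?R" "b \<in> carrier ?R" for a b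
    unfolding part_t_restrict Rfun_simps(2,3)
  proof (rule restrict_ext)
    fix \<gamma> assume g: "\<gamma> \<in> ?D"
    show "ldiff l (unitv i) (\<lambda>\<gamma>\<in>?D. a \<gamma> * b \<gamma>) \<gamma> = (\<lambda>\<gamma>\<in>?D. (\<lambda>\<gamma>\<in>?D. ldiff l (unitv i) a \<gamma>) \<gamma> * b \<gamma>) \<gamma> + (\<lambda>\<gamma>\<in>?D. a \<gamma> * (\<lambda>\<gamma>\<in>?D. ldiff l (unitv i) b \<gamma>) \<gamma>) \<gamma>"
      unfolding unres[OF g] ldiff_rules(2)[OF an[OF that(1)] an[OF that(2)] g u] using g by simp
  qed
  show "?P i (c \<odot>\<^bsub>?R\<^esub> a) = c \<odot>\<^bsub>?R\<^esub> ?P i a" if "a \<in> carrier ?R" for a c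
    unfolding part_t_restrict Rfun_simps(6)
  proof (rule restrict_ext)
    fix \<gamma> assume g: "\<gamma> \<in> ?D"
    show "ldiff l (unitv i) (\<lambda>\<gamma>\<in>?D. c * a \<gamma>) \<gamma> = c * (\<lambda>\<gamma>\<in>?D. ldiff l (unitv i) a \<gamma>) \<gamma>"
      unfolding unres[OF g] ldiff_rules(3)[OF an[OF that(1)] an[OF that(1)] g u] using g by simp
  qed
  show "?P i (?P j a) = ?P j (?P i a)" if "a \<in> carrier ?R" for a j
    unfolding part_t_restrict
  proof (rule restrict_ext)
    fix \<gamma> assume g: "\<gamma> \<in> ?D"
    show "ldiff l (unitv i) (\<lambda>\<gamma>\<in>?D. ldiff l (unitv j) a \<gamma>) \<gamma> = ldiff l (unitv j) (\<lambda>\<gamma>\<in>?D. ldiff l (unitv i) a \<gamma>) \<gamma>"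
      unfolding unres[OF g] by (rule ldiff_commute[OF lg an[OF that] g u params_unitv])
  qed
qed

section \<open>Analyticity of the coefficients of the factor\<close>

lemma um_derivative:
  assumes lg: "l \<le> 1" "g \<in> carrier LGL2" and a: "\<gamma> \<in> Dom l g (delta m)" "s \<in> params"
  shows "\<exists>u0 R. 1 < R \<and> hol2 u0 (ball 0 R) \<and> u0 ` ball 0 R \<subseteq> GL2 \<and> um l g (delta m) \<gamma> = abs_loop (\<lambda>z. u0 (1 / z)) \<and>
    (\<forall>n. mder (\<lambda>\<zeta>. loop_coeff (um l g (delta m) (\<gamma> \<otimes>\<^bsub>LGL2\<^esub> expo l s \<zeta>)) (- int n))
       (- (\<Sum>k\<le>n. if - int k < int l then lcoef u0 (tf l s) k ** mfps u0 (n - k) else 0)) 0)"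
proof -
  obtain t where t: "t \<in> params" "\<gamma> = gam l t" using Dom_Gam[OF a(1)] unfolding Gam_def by blast
  have bc: "conj_loop g (delta m) (gam l t) \<in> big_cell" using a(1) t(2) by (simp add: Dom_def)
  from line_derivative[OF lg t(1) a(2) bc] show ?thesis unfolding gam_add_expo[OF t(1) a(2)] t(2) by blast
qed

lemma um_Npart: "\<gamma> \<in> Dom l g d \<Longrightarrow> um l g d \<gamma> \<in> Npart l"
  by (rule um_factor[of g d \<gamma> l]) (auto simp: Dom_def)

lemma um_coeff_pos:
  assumes "\<gamma> \<in> Dom l g d" "0 < j"
  shows "loop_coeff (um l g d \<gamma>) j = 0"
proof -
  obtain f R where f: "um l g d \<gamma> = abs_loop (\<lambda>z. f (1 / z))" "1 < R" "hol2 f (ball 0 R)"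
    using um_Npart[OF assms(1)] unfolding Npart_iff by blast
  show ?thesis unfolding f(1) loop_coeff_disc_inv[OF f(3,2)] using assms(2) by simp
qed

text \<open>Positive degrees vanish identically. In the others, continuity is the sequential
  continuity of the factor, and the derivative formula, available at every point of the domain,
  gives holomorphy along a disc on each line.\<close>

lemma um_coeff_analytic:
  assumes lg: "l \<le> 1" "g \<in> carrier LGL2"
  shows "analytic_on_Dom l (Dom l g (delta m)) (\<lambda>\<gamma>. loop_coeff (um l g (delta m) \<gamma>) j $ a $ b)"
proof (cases "0 < j")
  case True
  show ?thesis
    by (rule analytic_on_Dom_cong[OF lg analytic_on_Dom_const[of _ _ 0]]) (use True um_coeff_pos in simp)
next
  case False
  let ?c = "\<lambda>\<gamma>. loop_coeff (um l g (delta m) \<gamma>) j $ a $ b" and ?D = "Dom l g (delta m)"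
  obtain n where n: "j = - int n" using False by (metis minus_minus nonneg_int_cases not_less neg_0_le_iff_le)
  have d: "(\<lambda>\<zeta>. ?c (\<gamma> \<otimes>\<^bsub>LGL2\<^esub> expo l s \<zeta>)) field_differentiable (at 0)" if "\<gamma> \<in> ?D" "s \<in> params" for \<gamma> s
    using um_derivative[OF lg that] unfolding mder_def n field_differentiable_def by blast
  show ?thesis unfolding analytic_on_Dom_def
  proof (intro conjI ballI)
    show "scont ?D ?c"
      by (rule scontI) (intro tendsto_vec_nth Dom_loop_lim(2)[OF lg])
    fix \<gamma> s assume a: "\<gamma> \<in> ?D" "s \<in> params"
    obtain \<rho> where r: "0 < \<rho>" "\<forall>\<zeta>\<in>cball 0 \<rho>. \<gamma> \<otimes>\<^bsub>LGL2\<^esub> expo l s \<zeta> \<in> ?D" using Dom_line[OF lg a] .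
    have "(\<lambda>\<zeta>. ?c (\<gamma> \<otimes>\<^bsub>LGL2\<^esub> expo l s \<zeta>)) holomorphic_on ball 0 \<rho>"
      by (rule holomorphic_lineI[OF d Dom_carrier[OF a(1)] a(2)]) (use r(2) a(2) in auto)
    then show "(\<lambda>\<zeta>. ?c (\<gamma> \<otimes>\<^bsub>LGL2\<^esub> expo l s \<zeta>)) analytic_on {0}"
      unfolding analytic_at using r(1) by (intro exI[of _ "ball 0 \<rho>"]) simp
  qed
qed

section \<open>Evaluation of formal series\<close>

text \<open>The formal variable is \<open>1 / z\<close>: index \<open>n\<close> belongs to the power
  \<open>z^(-n)\<close>. Series bounded above in \<open>z\<close> thus become Laurent series bounded
  below.\<close>

type_synonym lser = "complex fls^2^2"

definition mnth :: "lser \<Rightarrow> int \<Rightarrow> mat2" where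
  "mnth M n = (\<chi> a b. fls_nth (M $ a $ b) n)"

definition mser :: "(int \<Rightarrow> mat2) \<Rightarrow> lser" where
  "mser c = (\<chi> a b. Abs_fls (\<lambda>n. c n $ a $ b))"

lemma mnth_mser: "\<exists>N. \<forall>n<N. c n = 0 \<Longrightarrow> mnth (mser c) n = c n"
  by (auto simp: mnth_def mser_def mat2_eq_iff intro!: nth_Abs_fls_ex_lower_bound)

lemma mnth_eqI: "(\<And>n. mnth M n = mnth M' n) \<Longrightarrow> M = M'"
  by (simp add: mnth_def vec_eq_iff fls_eq_iff)

lemma mnth_add: "mnth (M + M') n = mnth M n + mnth M' n"
  by (simp add: mnth_def mat2_eq_iff)

lemma mnth_diff: "mnth (M - M') n = mnth M n - mnth M' n"
  by (simp add: mnth_def mat2_eq_iff)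

lemma mnth_one: "mnth (mat 1) n = (if n = 0 then mat 1 else 0)"
  by (simp add: mnth_def mat2_eq_iff mat_def)

lemma mnth_zero: "mnth 0 n = 0"
  by (simp add: mnth_def mat2_eq_iff)

text \<open>Any finite index set containing the joint support may replace the interval given by
  subdegrees. This permits comparison with sums indexed by supports in another ring.\<close>

lemma fls_times_nth_superset:
  fixes f g :: "complex fls"
  assumes "finite J" "{i. fls_nth f i \<noteq> 0 \<and> fls_nth g (n - i) \<noteq> 0} \<subseteq> J"
  shows "fls_nth (f * g) n = (\<Sum>i\<in>J. fls_nth f i * fls_nth g (n - i))"
proof -
  have "(\<Sum>i=fls_subdegree f..n - fls_subdegree g. fls_nth f i * fls_nth g (n - i)) =
    (\<Sum>i\<in>{i. fls_nth f i \<noteq> 0 \<and> fls_nth g (n - i) \<noteq> 0}. fls_nth f i * fls_nth g (n - i))"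
  proof (rule sum.mono_neutral_right)
    show "{i. fls_nth f i \<noteq> 0 \<and> fls_nth g (n - i) \<noteq> 0} \<subseteq> {fls_subdegree f..n - fls_subdegree g}"
      using fls_subdegree_leI[of f] fls_subdegree_leI[of g] by fastforce
  qed auto
  also have "\<dots> = (\<Sum>i\<in>J. fls_nth f i * fls_nth g (n - i))"
    by (rule sum.mono_neutral_left) (use assms in auto)
  finally show ?thesis by (simp only: fls_times_nth(2))
qed

lemma mnth_mult:
  assumes J: "finite J" "{i. mnth M i \<noteq> 0 \<and> mnth M' (n - i) \<noteq> 0} \<subseteq> J"
  shows "mnth (M ** M') n = (\<Sum>i\<in>J. mnth M i ** mnth M' (n - i))"
proof -
  have "fls_nth ((M ** M') $ a $ b) n = (\<Sum>i\<in>J. mnth M i ** mnth M' (n - i)) $ a $ b" for a b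
  proof -
    have "fls_nth (M $ a $ c * M' $ c $ b) n = (\<Sum>i\<in>J. fls_nth (M $ a $ c) i * fls_nth (M' $ c $ b) (n - i))" for c
    proof (rule fls_times_nth_superset[OF J(1) order_trans[OF _ J(2)]])
      show "{i. fls_nth (M $ a $ c) i \<noteq> 0 \<and> fls_nth (M' $ c $ b) (n - i) \<noteq> 0} \<subseteq> {i. mnth M i \<noteq> 0 \<and> mnth M' (n - i) \<noteq> 0}"
        by (auto simp: mnth_def vec_eq_iff)
    qed
    then show ?thesis by (simp add: matrix_matrix_mult_def sum_2 mnth_def sum.distrib)
  qed
  then show ?thesis by (subst mnth_def) (simp add: vec_eq_iff)
qed

text \<open>The monomial \<open>A z^k\<close>, hence placed at index \<open>- k\<close>.\<close>

definition mmon :: "mat2 \<Rightarrow> int \<Rightarrow> lser" where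
  "mmon A k = mser (\<lambda>n. if n = - k then A else 0)"

lemma mnth_mmon: "mnth (mmon A k) n = (if n = - k then A else 0)"
  unfolding mmon_def by (subst mnth_mser) (auto intro!: exI[of _ "- k"])

lemma mnth_mult_mmon: "mnth (M ** mmon A k) n = mnth M (n + k) ** A" "mnth (mmon A k ** M) n = A ** mnth M (n + k)"
proof -
  have "mnth (M ** mmon A k) n = (\<Sum>i\<in>{n + k}. mnth M i ** mnth (mmon A k) (n - i))"
    by (rule mnth_mult) (auto simp: mnth_mmon split: if_splits)
  then show "mnth (M ** mmon A k) n = mnth M (n + k) ** A" by (simp add: mnth_mmon)
  have "mnth (mmon A k ** M) n = (\<Sum>i\<in>{- k}. mnth (mmon A k) i ** mnth M (n - i))"
    by (rule mnth_mult) (auto simp: mnth_mmon split: if_splits)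
  then show "mnth (mmon A k ** M) n = A ** mnth M (n + k)" by (simp add: mnth_mmon)
qed

lemma mmon_mult: "mmon A j ** mmon B k = mmon (A ** B) (j + k)"
  by (rule mnth_eqI) (auto simp: mnth_mult_mmon mnth_mmon)

lemma mmon_scalar_commute: "M ** mmon (mat 1) k = mmon (mat 1) k ** M"
  by (rule mnth_eqI) (simp add: mnth_mult_mmon)

lemma gl2_simps:
  "carrier (gl2 R) = {A. \<forall>a b. A $ a $ b \<in> carrier R}"
  "A \<otimes>\<^bsub>gl2 R\<^esub> B = (\<chi> a b. \<Oplus>\<^bsub>R\<^esub>c\<in>UNIV. A $ a $ c \<otimes>\<^bsub>R\<^esub> B $ c $ b)"
  "\<one>\<^bsub>gl2 R\<^esub> = (\<chi> a b. if a = b then \<one>\<^bsub>R\<^esub> else \<zero>\<^bsub>R\<^esub>)"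
  "\<zero>\<^bsub>gl2 R\<^esub> = (\<chi> a b. \<zero>\<^bsub>R\<^esub>)" "A \<oplus>\<^bsub>gl2 R\<^esub> B = (\<chi> a b. A $ a $ b \<oplus>\<^bsub>R\<^esub> B $ a $ b)"
  by (simp_all add: gl2_def)

lemma laurent_simps:
  "carrier (laurent S) = {X. (\<forall>j. X j \<in> carrier S) \<and> (\<exists>N. \<forall>j>N. X j = \<zero>\<^bsub>S\<^esub>)}"
  "X \<otimes>\<^bsub>laurent S\<^esub> Y = (\<lambda>n. \<Oplus>\<^bsub>S\<^esub>j\<in>{j. X j \<noteq> \<zero>\<^bsub>S\<^esub> \<and> Y (n - j) \<noteq> \<zero>\<^bsub>S\<^esub>}. X j \<otimes>\<^bsub>S\<^esub> Y (n - j))"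
  "\<one>\<^bsub>laurent S\<^esub> = (\<lambda>j. if j = 0 then \<one>\<^bsub>S\<^esub> else \<zero>\<^bsub>S\<^esub>)"
  "\<zero>\<^bsub>laurent S\<^esub> = (\<lambda>j. \<zero>\<^bsub>S\<^esub>)" "X \<oplus>\<^bsub>laurent S\<^esub> Y = (\<lambda>j. X j \<oplus>\<^bsub>S\<^esub> Y j)"
  by (simp_all add: laurent_def)

lemma gl2_abelian_group:
  assumes "cring R"
  shows "abelian_group (gl2 R)"
proof -
  interpret cring R by (rule assms)
  show ?thesis
  proof (rule abelian_groupI)
    show "\<exists>y\<in>carrier (gl2 R). y \<oplus>\<^bsub>gl2 R\<^esub> x = \<zero>\<^bsub>gl2 R\<^esub>" if "x \<in> carrier (gl2 R)" for x
      by (rule bexI[of _ "\<chi> a b. \<ominus>\<^bsub>R\<^esub> (x $ a $ b)"]) (use that in \<open>simp_all add: gl2_simps l_neg\<close>)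
  qed (auto simp: gl2_simps vec_eq_iff a_ac)
qed

section \<open>Evaluation of matrices and series at a point of the domain\<close>

definition mev :: "loop \<Rightarrow> (loop \<Rightarrow> complex)^2^2 \<Rightarrow> mat2" where
  "mev \<gamma> A = (\<chi> a b. (A $ a $ b) \<gamma>)"

text \<open>Ring elements are extensional functions on the domain, so their values there determine
  them.\<close>

lemma mev_eqI:
  assumes "A \<in> carrier (gl2 (Rfun l g d))" "B \<in> carrier (gl2 (Rfun l g d))" "\<And>\<gamma>. \<gamma> \<in> Dom l g d \<Longrightarrow> mev \<gamma> A = mev \<gamma> B"
  shows "A = B"
proof -
  have "A $ a $ b = B $ a $ b" for a b
  proof (rule extensionalityI)
    show "A $ a $ b \<in> extensional (Dom l g d)" "B $ a $ b \<in> extensional (Dom l g d)"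
      using assms(1,2) by (simp_all add: gl2_simps Rfun_simps)
    show "(A $ a $ b) \<gamma> = (B $ a $ b) \<gamma>" if "\<gamma> \<in> Dom l g d" for \<gamma>
      using assms(3)[OF that] by (simp add: mev_def vec_eq_iff)
  qed
  then show ?thesis by (simp add: vec_eq_iff)
qed

lemma mev_simps:
  assumes "\<gamma> \<in> Dom l g d"
  shows "mev \<gamma> (A \<oplus>\<^bsub>gl2 (Rfun l g d)\<^esub> B) = mev \<gamma> A + mev \<gamma> B"
    "mev \<gamma> (\<one>\<^bsub>gl2 (Rfun l g d)\<^esub>) = mat 1" "mev \<gamma> (\<zero>\<^bsub>gl2 (Rfun l g d)\<^esub>) = 0"
  using assms by (simp_all add: mev_def gl2_simps Rfun_simps vec_eq_iff mat_def)

lemma Rfun_finsum: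
  assumes lg: "l \<le> 1" "g \<in> carrier LGL2" and a: "\<gamma> \<in> Dom l g (delta m)" 
  shows "finite A \<Longrightarrow> f \<in> A \<rightarrow> carrier (Rfun l g (delta m)) \<Longrightarrow> finsum (Rfun l g (delta m)) f A \<gamma> = (\<Sum>j\<in>A. f j \<gamma>)"
proof (induction A rule: finite_induct)
  interpret cring "Rfun l g (delta m)" by (rule Rfun_cring[OF lg])
  { case empty show ?case using a by (simp add: Rfun_simps) }
  { case (insert x A)
    then have "f \<in> A \<rightarrow> carrier (Rfun l g (delta m))" "f x \<in> carrier (Rfun l g (delta m))" by auto
    then show ?case using insert.hyps insert.IH a by (simp add: finsum_insert Rfun_simps(3)) }
qed

lemma gl2_mult_closed:
  assumes "l \<le> 1" "g \<in> carrier LGL2" "A \<in> carrier (gl2 (Rfun l g (delta m)))" "B \<in> carrier (gl2 (Rfun l g (delta m)))"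
  shows "A \<otimes>\<^bsub>gl2 (Rfun l g (delta m))\<^esub> B \<in> carrier (gl2 (Rfun l g (delta m)))"
proof -
  interpret cring "Rfun l g (delta m)" by (rule Rfun_cring[OF assms(1,2)])
  show ?thesis using assms(3,4) by (auto simp: gl2_simps intro!: finsum_closed)
qed

lemma mev_mult:
  assumes lg: "l \<le> 1" "g \<in> carrier LGL2" and a: "\<gamma> \<in> Dom l g (delta m)"
    and AB: "A \<in> carrier (gl2 (Rfun l g (delta m)))" "B \<in> carrier (gl2 (Rfun l g (delta m)))"
  shows "mev \<gamma> (A \<otimes>\<^bsub>gl2 (Rfun l g (delta m))\<^esub> B) = mev \<gamma> A ** mev \<gamma> B"
proof -
  interpret cring "Rfun l g (delta m)" by (rule Rfun_cring[OF lg])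
  have "(\<Oplus>\<^bsub>Rfun l g (delta m)\<^esub>c\<in>UNIV. A $ i $ c \<otimes>\<^bsub>Rfun l g (delta m)\<^esub> B $ c $ j) \<gamma> = (\<Sum>c\<in>UNIV. (A $ i $ c) \<gamma> * (B $ c $ j) \<gamma>)" for i j
    using AB a by (subst Rfun_finsum[OF lg a]) (auto simp: gl2_simps Rfun_simps(2) intro!: m_closed[unfolded Rfun_simps(2)])
  then show ?thesis by (simp add: mev_def gl2_simps(2) matrix_matrix_mult_def)
qed

lemma mev_finsum:
  assumes lg: "l \<le> 1" "g \<in> carrier LGL2" and a: "\<gamma> \<in> Dom l g (delta m)" 
  shows "finite A \<Longrightarrow> F \<in> A \<rightarrow> carrier (gl2 (Rfun l g (delta m))) \<Longrightarrow> mev \<gamma> (finsum (gl2 (Rfun l g (delta m))) F A) = (\<Sum>j\<in>A. mev \<gamma> (F j))"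
proof (induction A rule: finite_induct)
  interpret abelian_group "gl2 (Rfun l g (delta m))" by (rule gl2_abelian_group[OF Rfun_cring[OF lg]])
  { case empty show ?case using a by (simp add: mev_simps) }
  { case (insert x A)
    then have "F \<in> A \<rightarrow> carrier (gl2 (Rfun l g (delta m)))" "F x \<in> carrier (gl2 (Rfun l g (delta m)))" by auto
    then show ?case using insert.hyps insert.IH by (simp add: finsum_insert mev_simps(1)[OF a]) }
qed

definition lev :: "loop \<Rightarrow> (loop \<Rightarrow> complex) series \<Rightarrow> lser" where
  "lev \<gamma> X = mser (\<lambda>n. mev \<gamma> (X (- n)))"

lemma series_bound:
  assumes "X \<in> carrier (laurent S)"
  obtains N where "\<And>j. j > N \<Longrightarrow> X j = \<zero>\<^bsub>S\<^esub>"
  using assms by (auto simp: laurent_simps)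

lemma mnth_lev:
  assumes "X \<in> carrier (gl2z (Rfun l g d))" "\<gamma> \<in> Dom l g d"
  shows "mnth (lev \<gamma> X) n = mev \<gamma> (X (- n))"
proof -
  obtain N where N: "\<And>j. j > N \<Longrightarrow> X j = \<zero>\<^bsub>gl2 (Rfun l g d)\<^esub>" using series_bound[OF assms(1)] by blast
  show ?thesis unfolding lev_def
    by (rule mnth_mser, rule exI[of _ "- N"]) (simp add: N mev_simps(3)[OF assms(2)])
qed

lemma series_eqI:
  assumes "X \<in> carrier (gl2z (Rfun l g d))" "Y \<in> carrier (gl2z (Rfun l g d))" "\<And>\<gamma>. \<gamma> \<in> Dom l g d \<Longrightarrow> lev \<gamma> X = lev \<gamma> Y"
  shows "X = Y"
proof
  fix j show "X j = Y j"
  proof (rule mev_eqI)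
    show "X j \<in> carrier (gl2 (Rfun l g d))" "Y j \<in> carrier (gl2 (Rfun l g d))" using assms(1,2) by (auto simp: laurent_simps)
    show "mev \<gamma> (X j) = mev \<gamma> (Y j)" if "\<gamma> \<in> Dom l g d" for \<gamma>
      using mnth_lev[OF assms(1) that, of "-j"] mnth_lev[OF assms(2) that, of "-j"] assms(3)[OF that] by simp
  qed
qed

lemma support_finite:
  assumes "X \<in> carrier (laurent S)" "Y \<in> carrier (laurent S)"
  obtains N where "\<And>n. {j. X j \<noteq> \<zero>\<^bsub>S\<^esub> \<and> Y (n - j) \<noteq> \<zero>\<^bsub>S\<^esub>} \<subseteq> {n - N..N}"
proof -
  obtain a b where ab: "\<And>j. j > a \<Longrightarrow> X j = \<zero>\<^bsub>S\<^esub>" "\<And>j. j > b \<Longrightarrow> Y j = \<zero>\<^bsub>S\<^esub>"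
    using series_bound assms by metis
  have "j \<le> a" if "X j \<noteq> \<zero>\<^bsub>S\<^esub>" for j using ab(1)[of j] that by linarith
  moreover have "j \<le> b" if "Y j \<noteq> \<zero>\<^bsub>S\<^esub>" for j using ab(2)[of j] that by linarith
  ultimately have "{j. X j \<noteq> \<zero>\<^bsub>S\<^esub> \<and> Y (n - j) \<noteq> \<zero>\<^bsub>S\<^esub>} \<subseteq> {n - max a b..max a b}" for n by fastforce
  then show ?thesis by (rule that)
qed

lemma series_mult_closed:
  assumes lg: "l \<le> 1" "g \<in> carrier LGL2" and X: "X \<in> carrier (gl2z (Rfun l g (delta m)))" and Y: "Y \<in> carrier (gl2z (Rfun l g (delta m)))"
  shows "X \<otimes>\<^bsub>gl2z (Rfun l g (delta m))\<^esub> Y \<in> carrier (gl2z (Rfun l g (delta m)))"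
proof -
  let ?K = "gl2 (Rfun l g (delta m))"
  interpret abelian_group ?K by (rule gl2_abelian_group[OF Rfun_cring[OF lg]])
  have c: "X j \<in> carrier ?K" "Y j \<in> carrier ?K" for j using X Y by (auto simp: laurent_simps)
  obtain N where N: "\<And>n. {j. X j \<noteq> \<zero>\<^bsub>?K\<^esub> \<and> Y (n - j) \<noteq> \<zero>\<^bsub>?K\<^esub>} \<subseteq> {n - N..N}" using support_finite[OF X Y] by blast
  have "(X \<otimes>\<^bsub>laurent ?K\<^esub> Y) n = \<zero>\<^bsub>?K\<^esub>" if "n > 2 * N" for n
  proof -
    have "{j. X j \<noteq> \<zero>\<^bsub>?K\<^esub> \<and> Y (n - j) \<noteq> \<zero>\<^bsub>?K\<^esub>} = {}" using N[of n] that by fastforce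
    then show ?thesis by (simp only: laurent_simps(2) finsum_empty)
  qed
  moreover have "(X \<otimes>\<^bsub>laurent ?K\<^esub> Y) n \<in> carrier ?K" for n
    unfolding laurent_simps(2) by (intro finsum_closed Pi_I gl2_mult_closed lg c)
  ultimately show ?thesis unfolding laurent_simps(1) by blast
qed

lemma series_mult_nth:
  assumes lg: "l \<le> 1" "g \<in> carrier LGL2" and X: "X \<in> carrier (gl2z (Rfun l g (delta m)))" and Y: "Y \<in> carrier (gl2z (Rfun l g (delta m)))"
  obtains J where "finite J" "{j. X j \<noteq> \<zero>\<^bsub>gl2 (Rfun l g (delta m))\<^esub> \<and> Y (n - j) \<noteq> \<zero>\<^bsub>gl2 (Rfun l g (delta m))\<^esub>} = J"
    "\<forall>\<gamma>\<in>Dom l g (delta m). mev \<gamma> ((X \<otimes>\<^bsub>gl2z (Rfun l g (delta m))\<^esub> Y) n) = (\<Sum>j\<in>J. mev \<gamma> (X j) ** mev \<gamma> (Y (n - j)))"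
proof -
  let ?K = "gl2 (Rfun l g (delta m))"
  define J where "J = {j. X j \<noteq> \<zero>\<^bsub>?K\<^esub> \<and> Y (n - j) \<noteq> \<zero>\<^bsub>?K\<^esub>}"
  have c: "X j \<in> carrier ?K" "Y j \<in> carrier ?K" for j using X Y by (auto simp: laurent_simps)
  obtain N where N: "\<And>n. {j. X j \<noteq> \<zero>\<^bsub>?K\<^esub> \<and> Y (n - j) \<noteq> \<zero>\<^bsub>?K\<^esub>} \<subseteq> {n - N..N}" using support_finite[OF X Y] by blast
  have J: "finite J" unfolding J_def by (rule finite_subset[OF N]) simp
  have "mev \<gamma> ((X \<otimes>\<^bsub>gl2z (Rfun l g (delta m))\<^esub> Y) n) = (\<Sum>j\<in>J. mev \<gamma> (X j) ** mev \<gamma> (Y (n - j)))" if g: "\<gamma> \<in> Dom l g (delta m)" for \<gamma>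
  proof -
    have "mev \<gamma> ((X \<otimes>\<^bsub>gl2z (Rfun l g (delta m))\<^esub> Y) n) = (\<Sum>j\<in>J. mev \<gamma> (X j \<otimes>\<^bsub>?K\<^esub> Y (n - j)))"
      unfolding laurent_simps(2) J_def[symmetric] by (intro mev_finsum lg g J Pi_I gl2_mult_closed c)
    also have "\<dots> = (\<Sum>j\<in>J. mev \<gamma> (X j) ** mev \<gamma> (Y (n - j)))" by (intro sum.cong refl mev_mult lg g c)
    finally show ?thesis .
  qed
  then show ?thesis using that[OF J, of] J_def by blast
qed

text \<open>\<open>J\<close> only has to contain the joint support after evaluation at
  \<open>\<gamma>\<close>. This freedom is used for derivatives, with the index set taken from the
  undifferentiated product.\<close>

lemma mnth_mult_lev:
  assumes X: "X \<in> carrier (gl2z (Rfun l g d))" and Y: "Y \<in> carrier (gl2z (Rfun l g d))"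
    and a: "\<gamma> \<in> Dom l g d" and J: "finite J" "\<And>j. j \<notin> J \<Longrightarrow> mev \<gamma> (X j) = 0 \<or> mev \<gamma> (Y (n - j)) = 0"
  shows "mnth (lev \<gamma> X ** lev \<gamma> Y) (- n) = (\<Sum>j\<in>J. mev \<gamma> (X j) ** mev \<gamma> (Y (n - j)))"
proof -
  have "mnth (lev \<gamma> X ** lev \<gamma> Y) (- n) = (\<Sum>i\<in>uminus ` J. mnth (lev \<gamma> X) i ** mnth (lev \<gamma> Y) (- n - i))"
  proof (rule mnth_mult)
    show "{i. mnth (lev \<gamma> X) i \<noteq> 0 \<and> mnth (lev \<gamma> Y) (- n - i) \<noteq> 0} \<subseteq> uminus ` J"
    proof
      fix i assume i: "i \<in> {i. mnth (lev \<gamma> X) i \<noteq> 0 \<and> mnth (lev \<gamma> Y) (- n - i) \<noteq> 0}"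
      have e: "- (- n - i) = n - - i" by simp
      have "- i \<in> J" using J(2)[of "- i"] i unfolding mem_Collect_eq mnth_lev[OF X a] mnth_lev[OF Y a] e by blast
      then show "i \<in> uminus ` J" by (rule rev_image_eqI) simp
    qed
  qed (simp add: J)
  also have "\<dots> = (\<Sum>j\<in>J. mev \<gamma> (X j) ** mev \<gamma> (Y (n - j)))"
    by (subst sum.reindex) (auto simp: mnth_lev[OF X a] mnth_lev[OF Y a])
  finally show ?thesis .
qed

lemma lev_mult:
  assumes lg: "l \<le> 1" "g \<in> carrier LGL2" and X: "X \<in> carrier (gl2z (Rfun l g (delta m)))" and Y: "Y \<in> carrier (gl2z (Rfun l g (delta m)))"
    and a: "\<gamma> \<in> Dom l g (delta m)"
  shows "lev \<gamma> (X \<otimes>\<^bsub>gl2z (Rfun l g (delta m))\<^esub> Y) = lev \<gamma> X ** lev \<gamma> Y"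
proof (rule mnth_eqI)
  fix n
  obtain J where J: "finite J" "{j. X j \<noteq> \<zero>\<^bsub>gl2 (Rfun l g (delta m))\<^esub> \<and> Y (- n - j) \<noteq> \<zero>\<^bsub>gl2 (Rfun l g (delta m))\<^esub>} = J"
    "\<forall>\<gamma>\<in>Dom l g (delta m). mev \<gamma> ((X \<otimes>\<^bsub>gl2z (Rfun l g (delta m))\<^esub> Y) (- n)) = (\<Sum>j\<in>J. mev \<gamma> (X j) ** mev \<gamma> (Y (- n - j)))"
    using series_mult_nth[OF lg X Y, of "- n"] .
  have "mnth (lev \<gamma> X ** lev \<gamma> Y) (- (- n)) = (\<Sum>j\<in>J. mev \<gamma> (X j) ** mev \<gamma> (Y (- n - j)))"
    by (rule mnth_mult_lev[OF X Y a J(1)]) (use J(2) mev_simps(3)[OF a] in force)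
  then show "mnth (lev \<gamma> (X \<otimes>\<^bsub>gl2z (Rfun l g (delta m))\<^esub> Y)) n = mnth (lev \<gamma> X ** lev \<gamma> Y) n"
    using J(3) a by (simp add: mnth_lev[OF series_mult_closed[OF lg X Y] a])
qed

lemma series_add_closed:
  assumes lg: "l \<le> 1" "g \<in> carrier LGL2" and X: "X \<in> carrier (gl2z (Rfun l g (delta m)))" and Y: "Y \<in> carrier (gl2z (Rfun l g (delta m)))"
  shows "X \<oplus>\<^bsub>gl2z (Rfun l g (delta m))\<^esub> Y \<in> carrier (gl2z (Rfun l g (delta m)))"
proof -
  let ?K = "gl2 (Rfun l g (delta m))"
  interpret abelian_group ?K by (rule gl2_abelian_group[OF Rfun_cring[OF lg]])
  obtain a b where ab: "\<And>j. j > a \<Longrightarrow> X j = \<zero>\<^bsub>?K\<^esub>" "\<And>j. j > b \<Longrightarrow> Y j = \<zero>\<^bsub>?K\<^esub>"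
    using series_bound X Y by metis
  show ?thesis using X Y ab by (auto simp: laurent_simps intro!: exI[of _ "max a b"])
qed

lemma lev_add:
  assumes lg: "l \<le> 1" "g \<in> carrier LGL2" and X: "X \<in> carrier (gl2z (Rfun l g (delta m)))" and Y: "Y \<in> carrier (gl2z (Rfun l g (delta m)))"
    and a: "\<gamma> \<in> Dom l g (delta m)"
  shows "lev \<gamma> (X \<oplus>\<^bsub>gl2z (Rfun l g (delta m))\<^esub> Y) = lev \<gamma> X + lev \<gamma> Y"
  by (rule mnth_eqI, unfold mnth_add mnth_lev[OF series_add_closed[OF lg X Y] a] mnth_lev[OF X a] mnth_lev[OF Y a])
     (simp only: laurent_simps(5) mev_simps(1)[OF a])

lemma seriesI:
  fixes X :: "'r series" and R :: "(complex, 'r) module"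
  assumes "\<And>j a b. X j $ a $ b \<in> carrier R" "\<And>j. j > N \<Longrightarrow> X j = \<zero>\<^bsub>gl2 R\<^esub>"
  shows "X \<in> carrier (gl2z R)"
  using assms unfolding laurent_simps(1) gl2_simps(1) by blast

lemma Rfun_const:
  assumes "l \<le> 1" "g \<in> carrier LGL2"
  shows "(\<lambda>\<gamma>\<in>Dom l g (delta m). c) \<in> carrier (Rfun l g (delta m))"
  by (rule restrict_in_Rfun[OF assms analytic_on_Dom_const])

text \<open>\<open>\<ominus>\<close> is a definite description, so a candidate, multiplication by
  -1, is exhibited; that it is an inverse and the only one is decided after evaluation.\<close>

lemma lev_uminus:
  assumes lg: "l \<le> 1" "g \<in> carrier LGL2" and X: "X \<in> carrier (gl2z (Rfun l g (delta m)))"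
  shows "\<ominus>\<^bsub>gl2z (Rfun l g (delta m))\<^esub> X \<in> carrier (gl2z (Rfun l g (delta m)))"
    "\<gamma> \<in> Dom l g (delta m) \<Longrightarrow> lev \<gamma> (\<ominus>\<^bsub>gl2z (Rfun l g (delta m))\<^esub> X) = - lev \<gamma> X"
proof -
  let ?R = "Rfun l g (delta m)" and ?D = "Dom l g (delta m)"
  let ?S = "gl2z ?R"
  define Y where "Y = (\<lambda>j. \<chi> a b. (-1) \<odot>\<^bsub>?R\<^esub> (X j $ a $ b))"
  obtain N where N: "\<And>j. j > N \<Longrightarrow> X j = \<zero>\<^bsub>gl2 ?R\<^esub>" using series_bound[OF X] by blast
  have Y: "Y \<in> carrier ?S"
  proof (rule seriesI)
    show "Y j $ a $ b \<in> carrier ?R" for j a b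
      using X smult_in_Rfun[OF lg] by (simp add: Y_def laurent_simps gl2_simps)
    show "Y j = \<zero>\<^bsub>gl2 ?R\<^esub>" if "j > N" for j
      by (simp add: Y_def N[OF that] gl2_simps Rfun_simps vec_eq_iff cong: restrict_cong)
  qed
  have lY: "lev \<gamma> Y = - lev \<gamma> X" if a: "\<gamma> \<in> ?D" for \<gamma>
  proof (rule mnth_eqI)
    fix n
    have "mnth (- lev \<gamma> X) n = - mnth (lev \<gamma> X) n" by (simp add: mnth_def mat2_eq_iff)
    then show "mnth (lev \<gamma> Y) n = mnth (- lev \<gamma> X) n"
      using a by (simp add: mnth_lev[OF Y a] mnth_lev[OF X a]) (simp add: mev_def Y_def Rfun_simps mat2_eq_iff)
  qed
  have z: "\<zero>\<^bsub>?S\<^esub> \<in> carrier ?S"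
  proof (rule seriesI)
    show "\<zero>\<^bsub>?S\<^esub> j $ a $ b \<in> carrier ?R" for j a b
      using Rfun_const[OF lg] by (simp add: laurent_simps gl2_simps Rfun_simps(5))
    show "\<zero>\<^bsub>?S\<^esub> j = \<zero>\<^bsub>gl2 ?R\<^esub>" if "j > 0" for j by (simp add: laurent_simps)
  qed
  have lz: "lev \<gamma> (\<zero>\<^bsub>?S\<^esub>) = 0" if "\<gamma> \<in> ?D" for \<gamma>
    by (rule mnth_eqI, unfold mnth_lev[OF z that] mnth_zero) (simp only: laurent_simps(4) mev_simps(3)[OF that])
  have "\<ominus>\<^bsub>?S\<^esub> X = Y" unfolding a_inv_def m_inv_def
  proof (rule the_equality)
    have "X \<oplus>\<^bsub>?S\<^esub> Y = \<zero>\<^bsub>?S\<^esub>" "Y \<oplus>\<^bsub>?S\<^esub> X = \<zero>\<^bsub>?S\<^esub>"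
      by (rule series_eqI[OF series_add_closed[OF lg] z]; simp add: X Y lev_add[OF lg] lY lz)+
    then show "Y \<in> carrier (add_monoid ?S) \<and> X \<otimes>\<^bsub>add_monoid ?S\<^esub> Y = \<one>\<^bsub>add_monoid ?S\<^esub> \<and> Y \<otimes>\<^bsub>add_monoid ?S\<^esub> X = \<one>\<^bsub>add_monoid ?S\<^esub>"
      using Y by simp
    fix y assume "y \<in> carrier (add_monoid ?S) \<and> X \<otimes>\<^bsub>add_monoid ?S\<^esub> y = \<one>\<^bsub>add_monoid ?S\<^esub> \<and> y \<otimes>\<^bsub>add_monoid ?S\<^esub> X = \<one>\<^bsub>add_monoid ?S\<^esub>"
    then have y: "y \<in> carrier ?S" "X \<oplus>\<^bsub>?S\<^esub> y = \<zero>\<^bsub>?S\<^esub>" by auto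
    show "y = Y"
    proof (rule series_eqI[OF y(1) Y])
      fix \<gamma> assume a: "\<gamma> \<in> ?D"
      have "lev \<gamma> X + lev \<gamma> y = 0" using lev_add[OF lg X y(1) a] y(2) lz[OF a] by simp
      then show "lev \<gamma> y = lev \<gamma> Y" unfolding lY[OF a] by (simp add: eq_neg_iff_add_eq_0 add.commute)
    qed
  qed
  then show "\<ominus>\<^bsub>?S\<^esub> X \<in> carrier ?S" "\<gamma> \<in> ?D \<Longrightarrow> lev \<gamma> (\<ominus>\<^bsub>?S\<^esub> X) = - lev \<gamma> X"
    using Y lY by simp_all
qed

lemma lev_one:
  assumes lg: "l \<le> 1" "g \<in> carrier LGL2"
  shows "\<one>\<^bsub>gl2z (Rfun l g (delta m))\<^esub> \<in> carrier (gl2z (Rfun l g (delta m)))"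
    "\<gamma> \<in> Dom l g (delta m) \<Longrightarrow> lev \<gamma> (\<one>\<^bsub>gl2z (Rfun l g (delta m))\<^esub>) = mat 1"
proof -
  let ?R = "Rfun l g (delta m)"
  show c: "\<one>\<^bsub>gl2z ?R\<^esub> \<in> carrier (gl2z ?R)"
  proof (rule seriesI)
    show "\<one>\<^bsub>gl2z ?R\<^esub> j $ a $ b \<in> carrier ?R" for j a b
      using Rfun_const[OF lg] by (simp add: laurent_simps gl2_simps Rfun_simps(4,5))
    show "\<one>\<^bsub>gl2z ?R\<^esub> j = \<zero>\<^bsub>gl2 ?R\<^esub>" if "j > 0" for j using that by (simp add: laurent_simps)
  qed
  show "lev \<gamma> (\<one>\<^bsub>gl2z ?R\<^esub>) = mat 1" if "\<gamma> \<in> Dom l g (delta m)"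
    by (rule mnth_eqI, unfold mnth_lev[OF c that] mnth_one) (simp add: laurent_simps(3) mev_simps[OF that])
qed

text \<open>The inverse is again a definite description. Existence is the hypothesis on evaluations;
  uniqueness follows by cancelling with the left inverse at each point.\<close>

lemma series_inverse:
  assumes lg: "l \<le> 1" "g \<in> carrier LGL2" and X: "X \<in> carrier (gl2z (Rfun l g (delta m)))" and Y: "Y \<in> carrier (gl2z (Rfun l g (delta m)))"
    and inv: "\<And>\<gamma>. \<gamma> \<in> Dom l g (delta m) \<Longrightarrow> lev \<gamma> X ** lev \<gamma> Y = mat 1" "\<And>\<gamma>. \<gamma> \<in> Dom l g (delta m) \<Longrightarrow> lev \<gamma> Y ** lev \<gamma> X = mat 1"
  shows "inv\<^bsub>gl2z (Rfun l g (delta m))\<^esub> X = Y"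
  unfolding m_inv_def
proof (rule the_equality)
  let ?S = "gl2z (Rfun l g (delta m))"
  note m = series_mult_closed[OF lg] and o = lev_one[OF lg]
  show "Y \<in> carrier ?S \<and> X \<otimes>\<^bsub>?S\<^esub> Y = \<one>\<^bsub>?S\<^esub> \<and> Y \<otimes>\<^bsub>?S\<^esub> X = \<one>\<^bsub>?S\<^esub>"
    by (intro conjI Y series_eqI[OF m[OF X Y] o(1)] series_eqI[OF m[OF Y X] o(1)])
       (simp_all add: o(2) lev_mult[OF lg] X Y inv)
  fix y assume y: "y \<in> carrier ?S \<and> X \<otimes>\<^bsub>?S\<^esub> y = \<one>\<^bsub>?S\<^esub> \<and> y \<otimes>\<^bsub>?S\<^esub> X = \<one>\<^bsub>?S\<^esub>"
  show "y = Y"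
  proof (rule series_eqI[OF _ Y])
    fix \<gamma> assume a: "\<gamma> \<in> Dom l g (delta m)"
    have "lev \<gamma> X ** lev \<gamma> y = mat 1" using lev_mult[OF lg X _ a, of y] y o(2)[OF a] by simp
    then have "lev \<gamma> Y ** (lev \<gamma> X ** lev \<gamma> y) = lev \<gamma> Y" by simp
    then show "lev \<gamma> y = lev \<gamma> Y" unfolding matrix_mul_assoc inv(2)[OF a] by simp
  qed (use y in blast)
qed

section \<open>The wave series\<close>

text \<open>The formal image of the loop \<open>f (1 / z)\<close>: the Taylor series of
  \<open>f\<close> at 0, read in the variable \<open>1 / z\<close>.\<close>

definition FL :: "(complex \<Rightarrow> mat2) \<Rightarrow> lser" where
  "FL f = mser (\<lambda>n. if n \<ge> 0 then mfps f (nat n) else 0)"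

lemma mnth_FL: "mnth (FL f) n = (if n \<ge> 0 then mfps f (nat n) else 0)"
  unfolding FL_def by (subst mnth_mser) (auto intro!: exI[of _ 0])

lemma mnth_mult_nonneg:
  assumes "\<And>n. n < 0 \<Longrightarrow> mnth M n = 0" "\<And>n. n < 0 \<Longrightarrow> mnth M' n = 0"
  shows "mnth (M ** M') n = (if n \<ge> 0 then \<Sum>k\<le>nat n. mnth M (int k) ** mnth M' (n - int k) else 0)"
proof -
  have s: "{i. mnth M i \<noteq> 0 \<and> mnth M' (n - i) \<noteq> 0} \<subseteq> {0..n}"
    using assms(1) assms(2)[of "n - _"] by (auto simp: not_less[symmetric])
  have "mnth (M ** M') n = (\<Sum>i\<in>{0..n}. mnth M i ** mnth M' (n - i))" by (rule mnth_mult[OF _ s]) simp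
  also have "\<dots> = (if n \<ge> 0 then \<Sum>k\<le>nat n. mnth M (int k) ** mnth M' (n - int k) else 0)"
  proof (cases "n \<ge> 0")
    case True
    have "{0..n} = int ` {..nat n}"
    proof
      show "{0..n} \<subseteq> int ` {..nat n}"
      proof
        fix i assume "i \<in> {0..n}"
        then have "i = int (nat i)" "nat i \<in> {..nat n}" by auto
        then show "i \<in> int ` {..nat n}" by (rule image_eqI)
      qed
    qed (use True in auto)
    then show ?thesis using True by (simp add: sum.reindex)
  qed simp
  finally show ?thesis .
qed

lemma FL_mult:
  assumes "hol2 f (ball 0 R)" "hol2 h (ball 0 R)" "0 < R"
  shows "FL (\<lambda>x. f x ** h x) = FL f ** FL h"
proof (rule mnth_eqI)
  fix n
  have "mnth (FL f ** FL h) n = (if n \<ge> 0 then \<Sum>k\<le>nat n. mnth (FL f) (int k) ** mnth (FL h) (n - int k) else 0)"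
    by (rule mnth_mult_nonneg) (simp_all add: mnth_FL)
  also have "\<dots> = mnth (FL (\<lambda>x. f x ** h x)) n"
    by (auto simp: mnth_FL mfps_mult[OF assms] nat_diff_distrib intro!: sum.cong)
  finally show "mnth (FL (\<lambda>x. f x ** h x)) n = mnth (FL f ** FL h) n" ..
qed

lemma mfps_const: "mfps (\<lambda>x. A) n = (if n = 0 then A else 0)"
  by (simp add: mfps_def fps_expansion_def mat2_eq_iff)

lemma FL_const: "FL (\<lambda>x. A) = mmon A 0"
  by (rule mnth_eqI) (auto simp: mnth_FL mnth_mmon mfps_const)

lemma FL_cong: "(\<And>x. x \<in> ball 0 R \<Longrightarrow> f x = h x) \<Longrightarrow> 0 < R \<Longrightarrow> FL f = FL h"
proof -
  assume a: "\<And>x. x \<in> ball 0 R \<Longrightarrow> f x = h x" "0 < R"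
  have ev: "\<forall>\<^sub>F x in nhds 0. f x = h x" 
  proof -
    have "\<forall>\<^sub>F x in nhds 0. x \<in> ball (0::complex) R" using a(2) by (intro eventually_nhds_in_open) auto
    then show ?thesis by eventually_elim (rule a(1))
  qed
  have "(deriv ^^ n) (\<lambda>x. f x $ i $ j) 0 = (deriv ^^ n) (\<lambda>x. h x $ i $ j) 0" for n i j
    by (rule higher_deriv_cong_ev) (use ev in \<open>auto elim: eventually_mono\<close>)
  then show ?thesis by (intro mnth_eqI) (simp add: mnth_FL mfps_def fps_expansion_def)
qed

definition wave_series :: "nat \<Rightarrow> loop \<Rightarrow> int \<times> int \<Rightarrow> (loop \<Rightarrow> complex) series" where
  "wave_series l g m = series_of (Dom l g (delta m)) (um l g (delta m))"

text \<open>Candidate for the inverse series, built from the inverse loops. The work is to see that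
  its coefficients lie in the ring.\<close>

definition wave_inverse :: "nat \<Rightarrow> loop \<Rightarrow> int \<times> int \<Rightarrow> (loop \<Rightarrow> complex) series" where
  "wave_inverse l g m = series_of (Dom l g (delta m)) (\<lambda>\<gamma>. inv\<^bsub>LGL2\<^esub> um l g (delta m) \<gamma>)"

lemma inv_um:
  assumes "um l g d \<gamma> = abs_loop (\<lambda>z. u0 (1 / z))" "1 < R" "hol2 u0 (ball 0 R)" "u0 ` ball 0 R \<subseteq> GL2"
  shows "inv\<^bsub>LGL2\<^esub> um l g d \<gamma> = abs_loop (\<lambda>z. inv2 (u0 (1 / z)))"
proof -
  have R: "0 < R" "1 / R \<le> 1 / R" "0 < 1 / R" "1 / R < 1" using assms(2) by auto
  have "(\<lambda>z. u0 (1 / z)) ` ann (1 / R) \<subseteq> GL2" using ball_ann(2)[OF R(1)] assms(4) by blast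
  then show ?thesis unfolding assms(1) by (intro inv_LGL2_abs[of _ "1 / R"] hol2_ball_ann(2)[OF assms(3) R(2,1)] R)
qed

lemma inv_um_coeff:
  assumes "um l g d \<gamma> = abs_loop (\<lambda>z. u0 (1 / z))" "1 < R" "hol2 u0 (ball 0 R)" "u0 ` ball 0 R \<subseteq> GL2"
  shows "loop_coeff (um l g d \<gamma>) k = (if k \<le> 0 then mfps u0 (nat (- k)) else 0)"
    "loop_coeff (inv\<^bsub>LGL2\<^esub> um l g d \<gamma>) k = (if k \<le> 0 then mfps (\<lambda>x. inv2 (u0 x)) (nat (- k)) else 0)"
proof -
  show "loop_coeff (um l g d \<gamma>) k = (if k \<le> 0 then mfps u0 (nat (- k)) else 0)"
    unfolding assms(1) by (rule loop_coeff_disc_inv[OF assms(3,2)])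
  show "loop_coeff (inv\<^bsub>LGL2\<^esub> um l g d \<gamma>) k = (if k \<le> 0 then mfps (\<lambda>x. inv2 (u0 x)) (nat (- k)) else 0)"
    unfolding inv_um[OF assms] by (rule loop_coeff_disc_inv[OF hol2_inv2[OF assms(3,4)] assms(2)])
qed

lemma um_data:
  assumes "\<gamma> \<in> Dom l g d"
  obtains u0 R where "um l g d \<gamma> = abs_loop (\<lambda>z. u0 (1 / z))" "1 < R" "hol2 u0 (ball 0 R)" "u0 ` ball 0 R \<subseteq> GL2" "l = 0 \<longrightarrow> u0 0 = mat 1"
  using um_Npart[OF assms] unfolding Npart_iff by blast

section \<open>Analyticity of the inverse series\<close>

definition matrix_analytic :: "nat \<Rightarrow> loop set \<Rightarrow> (loop \<Rightarrow> mat2) \<Rightarrow> bool" where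
  "matrix_analytic l D F \<longleftrightarrow> (\<forall>a b. analytic_on_Dom l D (\<lambda>\<gamma>. F \<gamma> $ a $ b))"

lemma matrix_analytic_mult: "matrix_analytic l D F \<Longrightarrow> matrix_analytic l D H \<Longrightarrow> matrix_analytic l D (\<lambda>\<gamma>. F \<gamma> ** H \<gamma>)"
  unfolding matrix_analytic_def matrix_matrix_mult_def by (simp add: sum_2 analytic_on_Dom_add analytic_on_Dom_mult)

lemma matrix_analytic_const: "matrix_analytic l D (\<lambda>\<gamma>. A)"
  unfolding matrix_analytic_def by (simp add: analytic_on_Dom_const)

lemma matrix_analytic_add: "matrix_analytic l D F \<Longrightarrow> matrix_analytic l D H \<Longrightarrow> matrix_analytic l D (\<lambda>\<gamma>. F \<gamma> + H \<gamma>)"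
  unfolding matrix_analytic_def by (simp add: analytic_on_Dom_add)

lemma matrix_analytic_sum: "finite A \<Longrightarrow> (\<And>k. k \<in> A \<Longrightarrow> matrix_analytic l D (F k)) \<Longrightarrow> matrix_analytic l D (\<lambda>\<gamma>. \<Sum>k\<in>A. F k \<gamma>)"
  by (induction A rule: finite_induct) (auto intro: matrix_analytic_const matrix_analytic_add)

lemma matrix_analytic_cong:
  assumes "l \<le> 1" "g \<in> carrier LGL2" "matrix_analytic l (Dom l g (delta m)) F" "\<And>\<gamma>. \<gamma> \<in> Dom l g (delta m) \<Longrightarrow> F \<gamma> = H \<gamma>"
  shows "matrix_analytic l (Dom l g (delta m)) H"
  unfolding matrix_analytic_def
proof (intro allI)
  fix a b show "analytic_on_Dom l (Dom l g (delta m)) (\<lambda>\<gamma>. H \<gamma> $ a $ b)"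
    by (rule analytic_on_Dom_cong[OF assms(1,2), of m "\<lambda>\<gamma>. F \<gamma> $ a $ b"]) (use assms(3,4) in \<open>simp_all add: matrix_analytic_def\<close>)
qed

lemma matrix_analytic_inv2:
  assumes "matrix_analytic l D F" "\<And>\<gamma>. \<gamma> \<in> D \<Longrightarrow> F \<gamma> \<in> GL2" "D \<subseteq> carrier LGL2"
  shows "matrix_analytic l D (\<lambda>\<gamma>. inv2 (F \<gamma>))"
proof -
  have F: "analytic_on_Dom l D (\<lambda>\<gamma>. F \<gamma> $ a $ b)" for a b using assms(1) by (simp add: matrix_analytic_def)
  have m: "analytic_on_Dom l D (\<lambda>\<gamma>. - G \<gamma>)" if "analytic_on_Dom l D G" for G
    using analytic_on_Dom_mult[OF analytic_on_Dom_const that, of "-1"] by simp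
  have "analytic_on_Dom l D (\<lambda>\<gamma>. F \<gamma> $ 1 $ 1 * F \<gamma> $ 2 $ 2 + - (F \<gamma> $ 1 $ 2 * F \<gamma> $ 2 $ 1))"
    by (intro analytic_on_Dom_add m analytic_on_Dom_mult F)
  then have d: "analytic_on_Dom l D (\<lambda>\<gamma>. inverse (det (F \<gamma>)))"
    by (intro analytic_on_Dom_inverse) (use assms(2,3) in \<open>auto simp: det_2 GL2_iff\<close>)
  have a: "analytic_on_Dom l D (\<lambda>\<gamma>. adj2 (F \<gamma>) $ i $ j)" for i j
    using exhaust_2[of i] exhaust_2[of j] by (auto simp: adj2_def intro!: F m)
  show ?thesis unfolding matrix_analytic_def
  proof (intro allI)
    fix i j
    have "inv2 (F \<gamma>) $ i $ j = inverse (det (F \<gamma>)) * adj2 (F \<gamma>) $ i $ j" for \<gamma> by (simp add: inv2_def divide_inverse mult.commute)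
    then show "analytic_on_Dom l D (\<lambda>\<gamma>. inv2 (F \<gamma>) $ i $ j)" using analytic_on_Dom_mult[OF d a] by simp
  qed
qed

lemma um_matrix_analytic:
  assumes "l \<le> 1" "g \<in> carrier LGL2"
  shows "matrix_analytic l (Dom l g (delta m)) (\<lambda>\<gamma>. loop_coeff (um l g (delta m) \<gamma>) j)"
  unfolding matrix_analytic_def by (intro allI um_coeff_analytic assms)

text \<open>Comparing Taylor coefficients in \<open>u0 u0^(-1) = 1\<close> expresses each
  coefficient of the inverse by earlier ones, using only sums, products and the inverse of the
  invertible constant term. All of these operations preserve analyticity.\<close>

lemma inv_um_recursion:
  assumes "\<gamma> \<in> Dom l g d"
  shows "loop_coeff (um l g d \<gamma>) 0 \<in> GL2"
    "loop_coeff (inv\<^bsub>LGL2\<^esub> um l g d \<gamma>) (- int n) = (if n = 0 then inv2 (loop_coeff (um l g d \<gamma>) 0) else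
      - (inv2 (loop_coeff (um l g d \<gamma>) 0)) ** (\<Sum>k<n. loop_coeff (um l g d \<gamma>) (- int (n - k)) ** loop_coeff (inv\<^bsub>LGL2\<^esub> um l g d \<gamma>) (- int k)))"
proof -
  obtain u0 R where u: "um l g d \<gamma> = abs_loop (\<lambda>z. u0 (1 / z))" "1 < R" "hol2 u0 (ball 0 R)" "u0 ` ball 0 R \<subseteq> GL2" "l = 0 \<longrightarrow> u0 0 = mat 1"
    using um_data[OF assms] .
  note c = inv_um_coeff[OF u(1-4)]
  let ?v = "\<lambda>x. inv2 (u0 x)"
  have z: "u0 0 \<in> GL2" using u(2,4) by auto
  then show "loop_coeff (um l g d \<gamma>) 0 \<in> GL2" by (simp add: c mfps_0)
  have v: "hol2 ?v (ball 0 R)" by (intro hol2_inv2 u)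
  show "loop_coeff (inv\<^bsub>LGL2\<^esub> um l g d \<gamma>) (- int n) = (if n = 0 then inv2 (loop_coeff (um l g d \<gamma>) 0) else
      - (inv2 (loop_coeff (um l g d \<gamma>) 0)) ** (\<Sum>k<n. loop_coeff (um l g d \<gamma>) (- int (n - k)) ** loop_coeff (inv\<^bsub>LGL2\<^esub> um l g d \<gamma>) (- int k)))"
  proof (cases "n = 0")
    case True then show ?thesis by (simp add: c mfps_0)
  next
    case False
    have R0: "0 < R" using u(2) by simp
    have "FL (\<lambda>x. u0 x ** ?v x) = FL (\<lambda>x. mat 1)"
      by (rule FL_cong[of R]) (use u(2,4) in \<open>auto intro!: inv2_mult\<close>)
    then have "mnth (FL (\<lambda>x. u0 x ** ?v x)) (int n) = 0" unfolding FL_const using False by (simp add: mnth_mmon)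
    then have "mfps (\<lambda>x. u0 x ** ?v x) n = 0" by (simp add: mnth_FL)
    then have "(\<Sum>k\<le>n. mfps u0 k ** mfps ?v (n - k)) = 0" by (simp add: mfps_mult[OF u(3) v R0])
    moreover have "(\<Sum>k\<le>n. mfps u0 k ** mfps ?v (n - k)) = (\<Sum>k\<le>n. mfps u0 (n - k) ** mfps ?v k)"
      by (rule sum.reindex_bij_witness[of _ "\<lambda>k. n - k" "\<lambda>k. n - k"]) auto
    ultimately have s: "(\<Sum>k<n. mfps u0 (n - k) ** mfps ?v k) + u0 0 ** mfps ?v n = 0"
      by (simp add: lessThan_Suc_atMost[symmetric] mfps_0)
    have "mfps ?v n = inv2 (u0 0) ** (u0 0 ** mfps ?v n)" using z by (simp add: matrix_mul_assoc inv2_mult)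
    also have "\<dots> = inv2 (u0 0) ** (- (\<Sum>k<n. mfps u0 (n - k) ** mfps ?v k))" using s by (simp add: add_eq_0_iff)
    also have "\<dots> = - inv2 (u0 0) ** (\<Sum>k<n. mfps u0 (n - k) ** mfps ?v k)" by (simp add: mm.minus_left mm.minus_right)
    finally have "mfps ?v n = - inv2 (u0 0) ** (\<Sum>k<n. mfps u0 (n - k) ** mfps ?v k)" .
    moreover have "nat (int n - int k) = n - k" for k by arith
    ultimately show ?thesis using False by (simp add: c mfps_0)
  qed
qed

lemma inv_um_matrix_analytic:
  assumes lg: "l \<le> 1" "g \<in> carrier LGL2"
  shows "matrix_analytic l (Dom l g (delta m)) (\<lambda>\<gamma>. loop_coeff (inv\<^bsub>LGL2\<^esub> um l g (delta m) \<gamma>) (- int n))"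
proof (induction n rule: less_induct)
  case (less n)
  let ?D = "Dom l g (delta m)"
  have v: "matrix_analytic l ?D (\<lambda>\<gamma>. inv2 (loop_coeff (um l g (delta m) \<gamma>) 0))"
    by (rule matrix_analytic_inv2[OF um_matrix_analytic[OF lg] inv_um_recursion(1)]) (use Dom_carrier in auto)
  have w: "matrix_analytic l ?D (\<lambda>\<gamma>. - inv2 (loop_coeff (um l g (delta m) \<gamma>) 0))"
    by (rule matrix_analytic_cong[OF lg matrix_analytic_mult[OF matrix_analytic_const[of _ _ "- mat 1"] v]]) (simp add: mm.minus_left)
  show ?case
  proof (cases "n = 0")
    case True
    show ?thesis unfolding True
      by (rule matrix_analytic_cong[OF lg v]) (simp only: inv_um_recursion(2)[of _ l g "delta m" 0] if_True refl)
  next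
    case False
    have "matrix_analytic l ?D (\<lambda>\<gamma>. - (inv2 (loop_coeff (um l g (delta m) \<gamma>) 0)) **
      (\<Sum>k<n. loop_coeff (um l g (delta m) \<gamma>) (- int (n - k)) ** loop_coeff (inv\<^bsub>LGL2\<^esub> um l g (delta m) \<gamma>) (- int k)))"
      by (intro matrix_analytic_mult w matrix_analytic_sum um_matrix_analytic lg less) auto
    then show ?thesis by (rule matrix_analytic_cong[OF lg]) (simp add: inv_um_recursion(2)[of _ l g "delta m" n] False)
  qed
qed

lemma wave_series_in:
  assumes lg: "l \<le> 1" "g \<in> carrier LGL2"
  shows "wave_series l g m \<in> carrier (gl2z (Rfun l g (delta m)))"
proof (rule seriesI)
  show "wave_series l g m j $ a $ b \<in> carrier (Rfun l g (delta m))" for j a b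
    using restrict_in_Rfun[OF lg um_coeff_analytic[OF lg]] by (simp add: wave_series_def series_of_def)
  show "wave_series l g m j = \<zero>\<^bsub>gl2 (Rfun l g (delta m))\<^esub>" if "j > 0" for j
    using um_coeff_pos[OF _ that] by (simp add: wave_series_def series_of_def gl2_simps Rfun_simps vec_eq_iff cong: restrict_cong)
qed

lemma wave_inverse_in:
  assumes lg: "l \<le> 1" "g \<in> carrier LGL2"
  shows "wave_inverse l g m \<in> carrier (gl2z (Rfun l g (delta m)))"
proof (rule seriesI)
  have p: "loop_coeff (inv\<^bsub>LGL2\<^esub> um l g (delta m) \<gamma>) j = 0" if pa: "\<gamma> \<in> Dom l g (delta m)" "j > 0" for \<gamma> j
  proof -
    obtain u0 R where u: "um l g (delta m) \<gamma> = abs_loop (\<lambda>z. u0 (1 / z))" "1 < R" "hol2 u0 (ball 0 R)" "u0 ` ball 0 R \<subseteq> GL2" "l = 0 \<longrightarrow> u0 0 = mat 1"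
      using um_data[OF pa(1)] .
    show ?thesis unfolding inv_um_coeff(2)[OF u(1-4)] using pa(2) by simp
  qed
  show z: "wave_inverse l g m j = \<zero>\<^bsub>gl2 (Rfun l g (delta m))\<^esub>" if "j > 0" for j
    using p[OF _ that] by (simp add: wave_inverse_def series_of_def gl2_simps Rfun_simps vec_eq_iff cong: restrict_cong)
  show "wave_inverse l g m j $ a $ b \<in> carrier (Rfun l g (delta m))" for j a b
  proof (cases "j > 0")
    case True
    show ?thesis unfolding z[OF True] using Rfun_const[OF lg] by (simp add: gl2_simps Rfun_simps(5))
  next
    case False
    then have j: "j = - int (nat (- j))" by simp
    have "analytic_on_Dom l (Dom l g (delta m)) (\<lambda>\<gamma>. loop_coeff (inv\<^bsub>LGL2\<^esub> um l g (delta m) \<gamma>) j $ a $ b)"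
      using inv_um_matrix_analytic[OF lg, of m "nat (- j)"] unfolding matrix_analytic_def j[symmetric] by blast
    from restrict_in_Rfun[OF lg this] show ?thesis by (simp add: wave_inverse_def series_of_def)
  qed
qed

lemma lev_wave:
  assumes lg: "l \<le> 1" "g \<in> carrier LGL2" and a: "\<gamma> \<in> Dom l g (delta m)"
    and u: "um l g (delta m) \<gamma> = abs_loop (\<lambda>z. u0 (1 / z))" "1 < R" "hol2 u0 (ball 0 R)" "u0 ` ball 0 R \<subseteq> GL2"
  shows "lev \<gamma> (wave_series l g m) = FL u0" "lev \<gamma> (wave_inverse l g m) = FL (\<lambda>x. inv2 (u0 x))"
proof -
  have e: "mev \<gamma> (wave_series l g m j) = loop_coeff (um l g (delta m) \<gamma>) j"
    "mev \<gamma> (wave_inverse l g m j) = loop_coeff (inv\<^bsub>LGL2\<^esub> um l g (delta m) \<gamma>) j" for j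
    using a by (simp_all add: mev_def wave_series_def wave_inverse_def series_of_def mat2_eq_iff)
  show "lev \<gamma> (wave_series l g m) = FL u0"
    by (rule mnth_eqI, unfold mnth_lev[OF wave_series_in[OF lg] a] e inv_um_coeff[OF u] mnth_FL) simp
  show "lev \<gamma> (wave_inverse l g m) = FL (\<lambda>x. inv2 (u0 x))"
    by (rule mnth_eqI, unfold mnth_lev[OF wave_inverse_in[OF lg] a] e inv_um_coeff[OF u] mnth_FL) simp
qed

lemma lev_wave_inverse:
  assumes lg: "l \<le> 1" "g \<in> carrier LGL2" and a: "\<gamma> \<in> Dom l g (delta m)"
  shows "lev \<gamma> (wave_series l g m) ** lev \<gamma> (wave_inverse l g m) = mat 1"
    "lev \<gamma> (wave_inverse l g m) ** lev \<gamma> (wave_series l g m) = mat 1"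
proof -
  obtain u0 R where u: "um l g (delta m) \<gamma> = abs_loop (\<lambda>z. u0 (1 / z))" "1 < R" "hol2 u0 (ball 0 R)" "u0 ` ball 0 R \<subseteq> GL2" "l = 0 \<longrightarrow> u0 0 = mat 1"
    using um_data[OF a] .
  have v: "hol2 (\<lambda>x. inv2 (u0 x)) (ball 0 R)" by (intro hol2_inv2 u)
  have R: "0 < R" using u(2) by simp
  have one: "mmon (mat 1) 0 = (mat 1 :: lser)" by (rule mnth_eqI) (simp add: mnth_mmon mnth_one)
  note f = FL_cong[OF _ R, of _ "\<lambda>x. mat 1", unfolded FL_const one]
  show "lev \<gamma> (wave_series l g m) ** lev \<gamma> (wave_inverse l g m) = mat 1"
    unfolding lev_wave[OF lg a u(1-4)] FL_mult[OF u(3) v R, symmetric] by (rule f) (use u(4) in \<open>auto intro!: inv2_mult\<close>)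
  show "lev \<gamma> (wave_inverse l g m) ** lev \<gamma> (wave_series l g m) = mat 1"
    unfolding lev_wave[OF lg a u(1-4)] FL_mult[OF v u(3) R, symmetric] by (rule f) (use u(4) in \<open>auto intro!: inv2_mult\<close>)
qed

lemma inv_wave_series:
  assumes "l \<le> 1" "g \<in> carrier LGL2"
  shows "inv\<^bsub>gl2z (Rfun l g (delta m))\<^esub> wave_series l g m = wave_inverse l g m"
  by (rule series_inverse[OF assms wave_series_in[OF assms] wave_inverse_in[OF assms]]) (rule lev_wave_inverse[OF assms]; assumption)+

section \<open>Evaluation of monomials and of diagonal powers of \<open>z\<close>\<close>

lemma monomial_in:
  assumes lg: "l \<le> 1" "g \<in> carrier LGL2"
  shows "monomial (Rfun l g (delta m)) A k \<in> carrier (gl2z (Rfun l g (delta m)))"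
    "\<gamma> \<in> Dom l g (delta m) \<Longrightarrow> lev \<gamma> (monomial (Rfun l g (delta m)) A k) = mmon A k"
proof -
  let ?R = "Rfun l g (delta m)"
  show c: "monomial ?R A k \<in> carrier (gl2z ?R)"
  proof (rule seriesI)
    have o: "\<one>\<^bsub>?R\<^esub> \<in> carrier ?R" "\<zero>\<^bsub>?R\<^esub> \<in> carrier ?R" using Rfun_const[OF lg] by (simp_all add: Rfun_simps(4,5))
    show "monomial ?R A k j $ a $ b \<in> carrier ?R" for j a b
      using smult_in_Rfun[OF lg o(1)] o(2) by (simp add: monomial_def)
    show "monomial ?R A k j = \<zero>\<^bsub>gl2 ?R\<^esub>" if "j > k" for j using that by (simp add: monomial_def gl2_simps)
  qed
  show "lev \<gamma> (monomial ?R A k) = mmon A k" if "\<gamma> \<in> Dom l g (delta m)"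
    by (rule mnth_eqI, unfold mnth_lev[OF c that] mnth_mmon) (use that in \<open>auto simp: mev_def monomial_def Rfun_simps mat2_eq_iff\<close>)
qed

definition mdelta :: "int \<times> int \<Rightarrow> lser" where
  "mdelta m = mser (\<lambda>n. \<chi> a b. if a = b \<and> - n = (if a = 1 then fst m else snd m) then 1 else 0)"

lemma mnth_mdelta: "mnth (mdelta m) n = (\<chi> a b. if a = b \<and> - n = (if a = 1 then fst m else snd m) then 1 else 0)"
  unfolding mdelta_def by (rule mnth_mser) (auto simp: mat2_eq_iff intro!: exI[of _ "- max (fst m) (snd m)"])

lemma mdelta_Q0: "mdelta m ** mmon Q0 k = mmon Q0 k ** mdelta m"
  by (rule mnth_eqI, unfold mnth_mult_mmon mnth_mdelta) (auto simp: Q0_def mat2_eq_iff forall_2 matrix_matrix_mult_def sum_2)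

lemma delta_series_in:
  assumes lg: "l \<le> 1" "g \<in> carrier LGL2"
  shows "delta_series (Rfun l g (delta m)) m' \<in> carrier (gl2z (Rfun l g (delta m)))"
    "\<gamma> \<in> Dom l g (delta m) \<Longrightarrow> lev \<gamma> (delta_series (Rfun l g (delta m)) m') = mdelta m'"
proof -
  let ?R = "Rfun l g (delta m)"
  show c: "delta_series ?R m' \<in> carrier (gl2z ?R)"
  proof (rule seriesI)
    have o: "\<one>\<^bsub>?R\<^esub> \<in> carrier ?R" "\<zero>\<^bsub>?R\<^esub> \<in> carrier ?R" using Rfun_const[OF lg] by (simp_all add: Rfun_simps(4,5))
    show "delta_series ?R m' j $ a $ b \<in> carrier ?R" for j a b using o by (simp add: delta_series_def)
    show "delta_series ?R m' j = \<zero>\<^bsub>gl2 ?R\<^esub>" if "j > max (fst m') (snd m')" for j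
      using that by (simp add: delta_series_def gl2_simps vec_eq_iff)
  qed
  show "lev \<gamma> (delta_series ?R m') = mdelta m'" if "\<gamma> \<in> Dom l g (delta m)"
    by (rule mnth_eqI, unfold mnth_lev[OF c that] mnth_mdelta) (use that in \<open>simp add: mev_def delta_series_def Rfun_simps mat2_eq_iff\<close>)
qed

lemma lser_diff_left: "(A - B) ** C = A ** C - B ** (C :: lser)"
  by (simp add: matrix_matrix_mult_def vec_eq_iff sum_subtractf left_diff_distrib)

lemma lser_diff_right: "C ** (A - B) = C ** A - C ** (B :: lser)"
  by (simp add: matrix_matrix_mult_def vec_eq_iff sum_subtractf right_diff_distrib)

lemma lser_minus_left: "(- A) ** C = - (A ** (C :: lser))"
  by (simp add: matrix_matrix_mult_def vec_eq_iff sum_negf)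

lemma lser_minus_right: "C ** (- A) = - (C ** (A :: lser))"
  by (simp add: matrix_matrix_mult_def vec_eq_iff sum_negf)

section \<open>Derivations after evaluation\<close>

lemma mder_sum: "finite J \<Longrightarrow> (\<And>j. j \<in> J \<Longrightarrow> mder (F j) (E j) z) \<Longrightarrow> mder (\<lambda>\<zeta>. \<Sum>j\<in>J. F j \<zeta>) (\<Sum>j\<in>J. E j) z"
  unfolding mder_def by (auto simp: sum_component intro!: DERIV_sum)

lemma mder_unique: "mder F A z \<Longrightarrow> mder F B z \<Longrightarrow> A = B"
  unfolding mder_def mat2_eq_iff using DERIV_unique by blast

lemma mder_cong_ev: "\<forall>\<^sub>F \<zeta> in nhds z. F \<zeta> = H \<zeta> \<Longrightarrow> mder F A z \<Longrightarrow> mder H A z"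
  unfolding mder_def
proof (intro allI)
  fix i j assume a: "\<forall>\<^sub>F \<zeta> in nhds z. F \<zeta> = H \<zeta>" "\<forall>i j. ((\<lambda>z. F z $ i $ j) has_field_derivative A $ i $ j) (at z)"
  have "\<forall>\<^sub>F \<zeta> in nhds z. F \<zeta> $ i $ j = H \<zeta> $ i $ j" using a(1) by eventually_elim simp
  from DERIV_cong_ev[OF refl this refl] a(2) show "((\<lambda>z. H z $ i $ j) has_field_derivative A $ i $ j) (at z)" by blast
qed

lemma deriv_series_in:
  assumes lg: "l \<le> 1" "g \<in> carrier LGL2" and X: "X \<in> carrier (gl2z (Rfun l g (delta m)))"
  shows "deriv_series (part_t l g (delta m)) i X \<in> carrier (gl2z (Rfun l g (delta m)))"
proof -
  let ?R = "Rfun l g (delta m)" and ?D = "Dom l g (delta m)"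
  obtain N where N: "\<And>j. j > N \<Longrightarrow> X j = \<zero>\<^bsub>gl2 ?R\<^esub>" using series_bound[OF X] by blast
  have p: "part_t l g (delta m) i \<in> carrier ?R \<rightarrow> carrier ?R" 
    using Rfun_setting[OF lg, of UNIV m] unfolding setting_def by blast
  have z: "part_t l g (delta m) i (\<zero>\<^bsub>?R\<^esub>) = \<zero>\<^bsub>?R\<^esub>"
    unfolding part_t_restrict Rfun_simps(5)
  proof (rule restrict_ext)
    fix \<gamma> assume a: "\<gamma> \<in> ?D"
    have "ldiff l (unitv i) (\<lambda>\<gamma>\<in>?D. 0) \<gamma> = ldiff l (unitv i) (\<lambda>\<gamma>. 0) \<gamma>" by (rule ldiff_cong[OF lg a params_unitv]) simp
    then show "ldiff l (unitv i) (\<lambda>\<gamma>\<in>?D. 0) \<gamma> = 0" by (simp add: ldiff_def)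
  qed
  show ?thesis
  proof (rule seriesI)
    show "deriv_series (part_t l g (delta m)) i X j $ a $ b \<in> carrier ?R" for j a b
      using X p by (auto simp: deriv_series_def laurent_simps gl2_simps)
    show "deriv_series (part_t l g (delta m)) i X j = \<zero>\<^bsub>gl2 ?R\<^esub>" if "j > N" for j
      by (simp add: deriv_series_def N[OF that]) (simp add: gl2_simps z)
  qed
qed

lemma mder_mev:
  assumes lg: "l \<le> 1" "g \<in> carrier LGL2" and X: "X \<in> carrier (gl2z (Rfun l g (delta m)))" and a: "\<gamma> \<in> Dom l g (delta m)"
  shows "mder (\<lambda>\<zeta>. mev (\<gamma> \<otimes>\<^bsub>LGL2\<^esub> expo l (unitv i) \<zeta>) (X j)) (mev \<gamma> (deriv_series (part_t l g (delta m)) i X j)) 0"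
  unfolding mder_def
proof (intro allI)
  fix b c
  have "X j $ b $ c \<in> carrier (Rfun l g (delta m))" using X by (simp add: laurent_simps gl2_simps)
  then have "(\<lambda>\<zeta>. (X j $ b $ c) (\<gamma> \<otimes>\<^bsub>LGL2\<^esub> expo l (unitv i) \<zeta>)) analytic_on {0}"
    unfolding Rfun_carrier_iff[OF lg] analytic_on_Dom_def using a params_unitv by blast
  then have "(\<lambda>\<zeta>. (X j $ b $ c) (\<gamma> \<otimes>\<^bsub>LGL2\<^esub> expo l (unitv i) \<zeta>)) field_differentiable (at 0)"
    by (rule analytic_on_imp_differentiable_at) simp
  then have "((\<lambda>\<zeta>. (X j $ b $ c) (\<gamma> \<otimes>\<^bsub>LGL2\<^esub> expo l (unitv i) \<zeta>)) has_field_derivative ldiff l (unitv i) (X j $ b $ c) \<gamma>) (at 0)"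
    unfolding ldiff_def by (simp add: field_differentiable_derivI)
  then show "((\<lambda>\<zeta>. mev (\<gamma> \<otimes>\<^bsub>LGL2\<^esub> expo l (unitv i) \<zeta>) (X j) $ b $ c) has_field_derivative
      mev \<gamma> (deriv_series (part_t l g (delta m)) i X j) $ b $ c) (at 0)"
    using a by (simp add: mev_def deriv_series_def part_t_restrict)
qed

text \<open>Each coefficient of the product is a sum over a finite set \<open>J\<close> that is the
  same at all points, so it can be differentiated term by term. A coefficient that is zero in the
  ring also has zero derivative, hence \<open>J\<close> serves both terms of the Leibniz
  rule.\<close>

lemma lev_deriv_mult:
  assumes lg: "l \<le> 1" "g \<in> carrier LGL2" and X: "X \<in> carrier (gl2z (Rfun l g (delta m)))" and Y: "Y \<in> carrier (gl2z (Rfun l g (delta m)))"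
    and a: "\<gamma> \<in> Dom l g (delta m)"
  shows "lev \<gamma> (deriv_series (part_t l g (delta m)) i (X \<otimes>\<^bsub>gl2z (Rfun l g (delta m))\<^esub> Y)) =
    lev \<gamma> (deriv_series (part_t l g (delta m)) i X) ** lev \<gamma> Y + lev \<gamma> X ** lev \<gamma> (deriv_series (part_t l g (delta m)) i Y)"
proof (rule mnth_eqI)
  fix n
  let ?R = "Rfun l g (delta m)" and ?d = "deriv_series (part_t l g (delta m)) i" and ?D = "Dom l g (delta m)"
  let ?e = "\<lambda>\<zeta>. \<gamma> \<otimes>\<^bsub>LGL2\<^esub> expo l (unitv i) \<zeta>"
  obtain J where J: "finite J" "{j. X j \<noteq> \<zero>\<^bsub>gl2 ?R\<^esub> \<and> Y (- n - j) \<noteq> \<zero>\<^bsub>gl2 ?R\<^esub>} = J"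
    "\<forall>\<gamma>\<in>?D. mev \<gamma> ((X \<otimes>\<^bsub>gl2z ?R\<^esub> Y) (- n)) = (\<Sum>j\<in>J. mev \<gamma> (X j) ** mev \<gamma> (Y (- n - j)))"
    using series_mult_nth[OF lg X Y, of "- n"] .
  note d = deriv_series_in[OF lg]
  have z: "mev \<gamma> (?d X j) = 0" if "X j = \<zero>\<^bsub>gl2 ?R\<^esub>" "X \<in> carrier (gl2z ?R)" for X j
  proof (rule mder_unique[OF mder_mev[OF lg that(2) a]])
    have "\<forall>\<^sub>F \<zeta> in nhds 0. 0 = mev (?e \<zeta>) (X j)"
      using eventually_Dom_line[OF lg a params_unitv[of i]] by eventually_elim (simp only: that(1) mev_simps(3))
    then show "mder (\<lambda>\<zeta>. mev (?e \<zeta>) (X j)) 0 0" by (rule mder_cong_ev[OF _ mder_const])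
  qed
  have e0: "?e 0 = \<gamma>" using Dom_carrier[OF a] by (simp add: expo_0 params_unitv)
  have "mder (\<lambda>\<zeta>. mev (?e \<zeta>) ((X \<otimes>\<^bsub>gl2z ?R\<^esub> Y) (- n)))
     (\<Sum>j\<in>J. mev \<gamma> (?d X j) ** mev (?e 0) (Y (- n - j)) + mev (?e 0) (X j) ** mev \<gamma> (?d Y (- n - j))) 0"
  proof (rule mder_cong_ev)
    show "\<forall>\<^sub>F \<zeta> in nhds 0. (\<Sum>j\<in>J. mev (?e \<zeta>) (X j) ** mev (?e \<zeta>) (Y (- n - j))) = mev (?e \<zeta>) ((X \<otimes>\<^bsub>gl2z ?R\<^esub> Y) (- n))"
      using eventually_Dom_line[OF lg a params_unitv[of i]] by eventually_elim (simp only: J(3))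
    show "mder (\<lambda>\<zeta>. \<Sum>j\<in>J. mev (?e \<zeta>) (X j) ** mev (?e \<zeta>) (Y (- n - j)))
     (\<Sum>j\<in>J. mev \<gamma> (?d X j) ** mev (?e 0) (Y (- n - j)) + mev (?e 0) (X j) ** mev \<gamma> (?d Y (- n - j))) 0"
      by (intro mder_sum J(1) mder_mult mder_mev[OF lg X a] mder_mev[OF lg Y a])
  qed
  then have eq: "mev \<gamma> (?d (X \<otimes>\<^bsub>gl2z ?R\<^esub> Y) (- n)) = (\<Sum>j\<in>J. mev \<gamma> (?d X j) ** mev \<gamma> (Y (- n - j)) + mev \<gamma> (X j) ** mev \<gamma> (?d Y (- n - j)))"
    unfolding e0 by (rule mder_unique[OF mder_mev[OF lg series_mult_closed[OF lg X Y] a]])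
  have zX: "mev \<gamma> (X j) = 0 \<and> mev \<gamma> (?d X j) = 0 \<or> mev \<gamma> (Y (- n - j)) = 0 \<and> mev \<gamma> (?d Y (- n - j)) = 0" if "j \<notin> J" for j
  proof -
    have "X j = \<zero>\<^bsub>gl2 ?R\<^esub> \<or> Y (- n - j) = \<zero>\<^bsub>gl2 ?R\<^esub>" using that J(2) by blast
    then show ?thesis using z[OF _ X, of j] z[OF _ Y, of "- n - j"] mev_simps(3)[OF a] by metis
  qed
  have "mnth (lev \<gamma> (?d X) ** lev \<gamma> Y) (- (- n)) = (\<Sum>j\<in>J. mev \<gamma> (?d X j) ** mev \<gamma> (Y (- n - j)))"
    by (rule mnth_mult_lev[OF d[OF X] Y a J(1)]) (use zX in blast)
  moreover have "mnth (lev \<gamma> X ** lev \<gamma> (?d Y)) (- (- n)) = (\<Sum>j\<in>J. mev \<gamma> (X j) ** mev \<gamma> (?d Y (- n - j)))"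
    by (rule mnth_mult_lev[OF X d[OF Y] a J(1)]) (use zX in blast)
  moreover have "mnth (lev \<gamma> (?d (X \<otimes>\<^bsub>gl2z ?R\<^esub> Y))) n = mev \<gamma> (?d (X \<otimes>\<^bsub>gl2z ?R\<^esub> Y) (- n))"
    by (rule mnth_lev[OF d[OF series_mult_closed[OF lg X Y]] a])
  ultimately show "mnth (lev \<gamma> (?d (X \<otimes>\<^bsub>gl2z ?R\<^esub> Y))) n = mnth (lev \<gamma> (?d X) ** lev \<gamma> Y + lev \<gamma> X ** lev \<gamma> (?d Y)) n"
    by (simp add: mnth_add eq sum.distrib)
qed

lemma lev_deriv_const:
  assumes lg: "l \<le> 1" "g \<in> carrier LGL2" and X: "X \<in> carrier (gl2z (Rfun l g (delta m)))" and a: "\<gamma> \<in> Dom l g (delta m)"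
    and c: "\<And>\<gamma>. \<gamma> \<in> Dom l g (delta m) \<Longrightarrow> lev \<gamma> X = M"
  shows "lev \<gamma> (deriv_series (part_t l g (delta m)) i X) = 0"
proof (rule mnth_eqI, unfold mnth_lev[OF deriv_series_in[OF lg X] a] mnth_zero)
  fix n
  show "mev \<gamma> (deriv_series (part_t l g (delta m)) i X (- n)) = 0"
  proof (rule mder_unique[OF mder_mev[OF lg X a]])
    have "mnth M n = mev \<gamma>' (X (- n))" if "\<gamma>' \<in> Dom l g (delta m)" for \<gamma>'
      using mnth_lev[OF X that, of n] c[OF that] by simp
    then have "\<forall>\<^sub>F \<zeta> in nhds 0. mnth M n = mev (\<gamma> \<otimes>\<^bsub>LGL2\<^esub> expo l (unitv i) \<zeta>) (X (- n))"
      using eventually_Dom_line[OF lg a params_unitv[of i]] by (rule eventually_mono[rotated])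
    then show "mder (\<lambda>\<zeta>. mev (\<gamma> \<otimes>\<^bsub>LGL2\<^esub> expo l (unitv i) \<zeta>) (X (- n))) 0 0" by (rule mder_cong_ev[OF _ mder_const])
  qed
qed

text \<open>In the coordinate direction \<open>i\<close> the exponent is \<open>z^i\<close>, and
  multiplication by it shifts degrees: the coefficient of \<open>z^(-k)\<close> is the Taylor
  coefficient \<open>k + i\<close> of \<open>u0 Q0 u0^(-1)\<close>.\<close>

lemma lcoef_power:
  assumes u: "1 < R" "hol2 u0 (ball 0 R)" "u0 ` ball 0 R \<subseteq> GL2" and i: "l \<le> i"
  shows "lcoef u0 (tf l (unitv i)) k = mfps (\<lambda>x. u0 x ** Q0 ** inv2 (u0 x)) (k + i)"
proof -
  have "lcoef u0 (tf l (unitv i)) k = mcf (\<lambda>z. cscale (z powi int i) (u0 (1 / z) ** Q0 ** inv2 (u0 (1 / z)))) (- int k)"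
    by (simp add: lcoef_def tf_unitv[OF i] cscale_mult)
  also have "\<dots> = mcf (\<lambda>z. (\<lambda>x. u0 x ** Q0 ** inv2 (u0 x)) (1 / z)) (- int k - int i)" by (rule mcf_shift)
  also have "\<dots> = mfps (\<lambda>x. u0 x ** Q0 ** inv2 (u0 x)) (k + i)"
    by (subst mcf_disc_inv[OF _ u(1)]) (auto intro!: hol2_mult hol2_inv2 u simp: nat_add_distrib nat_int_add add.commute[of k i])
  finally show ?thesis .
qed

text \<open>The derivative of the factor becomes a single matrix identity: the sums of
  \<open>line_derivative\<close> are the coefficients of a product, because \<open>lcoef\<close>
  lists exactly the coefficients below degree \<open>l\<close> of the dressed
  \<open>Q0 z^i\<close>.\<close>

lemma lev_deriv_wave:
  assumes lg: "l \<le> 1" "g \<in> carrier LGL2" and a: "\<gamma> \<in> Dom l g (delta m)" and i: "l \<le> i"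
  shows "\<exists>N. lev \<gamma> (deriv_series (part_t l g (delta m)) i (wave_series l g m)) = - (N ** lev \<gamma> (wave_series l g m)) \<and>
    (\<forall>n. mnth N n = (if - n < int l then mnth (lev \<gamma> (wave_series l g m) ** mmon Q0 (int i) ** lev \<gamma> (wave_inverse l g m)) n else 0))"
proof -
  let ?H = "lev \<gamma> (wave_series l g m)" and ?H' = "lev \<gamma> (wave_inverse l g m)"
  let ?X = "wave_series l g m" and ?d = "deriv_series (part_t l g (delta m)) i"
  obtain u0 R where "1 < R \<and> hol2 u0 (ball 0 R) \<and> u0 ` ball 0 R \<subseteq> GL2 \<and> um l g (delta m) \<gamma> = abs_loop (\<lambda>z. u0 (1 / z)) \<and>
    (\<forall>n. mder (\<lambda>\<zeta>. loop_coeff (um l g (delta m) (\<gamma> \<otimes>\<^bsub>LGL2\<^esub> expo l (unitv i) \<zeta>)) (- int n))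
       (- (\<Sum>k\<le>n. if - int k < int l then lcoef u0 (tf l (unitv i)) k ** mfps u0 (n - k) else 0)) 0)"
    using um_derivative[OF lg a params_unitv[of i]] by (elim exE)
  then have u: "1 < R" "hol2 u0 (ball 0 R)" "u0 ` ball 0 R \<subseteq> GL2" "um l g (delta m) \<gamma> = abs_loop (\<lambda>z. u0 (1 / z))"
    and der: "\<And>n. mder (\<lambda>\<zeta>. loop_coeff (um l g (delta m) (\<gamma> \<otimes>\<^bsub>LGL2\<^esub> expo l (unitv i) \<zeta>)) (- int n))
       (- (\<Sum>k\<le>n. if - int k < int l then lcoef u0 (tf l (unitv i)) k ** mfps u0 (n - k) else 0)) 0" by blast+
  have R: "0 < R" using u(1) by simp
  let ?v = "\<lambda>x. inv2 (u0 x)" and ?W = "\<lambda>x. u0 x ** Q0 ** inv2 (u0 x)"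
  have v: "hol2 ?v (ball 0 R)" by (intro hol2_inv2 u)
  have H: "?H = FL u0" "?H' = FL ?v" by (rule lev_wave[OF lg a u(4) u(1-3)])+
  have W: "FL ?W = ?H ** mmon Q0 0 ** ?H'"
    unfolding H FL_const[symmetric] using FL_mult[OF hol2_mult[OF u(2) hol2_const] v R] FL_mult[OF u(2) hol2_const R] by simp
  have M: "mnth (?H ** mmon Q0 (int i) ** ?H') n = (if n + int i \<ge> 0 then mfps ?W (nat (n + int i)) else 0)" for n
  proof -
    have "mmon Q0 (int i) = mmon Q0 0 ** mmon (mat 1) (int i)" by (simp add: mmon_mult)
    then have "?H ** mmon Q0 (int i) ** ?H' = ?H ** mmon Q0 0 ** (mmon (mat 1) (int i) ** ?H')" by (simp only: matrix_mul_assoc)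
    also have "\<dots> = FL ?W ** mmon (mat 1) (int i)"
      unfolding W mmon_scalar_commute[of ?H', symmetric] by (simp only: matrix_mul_assoc)
    finally show ?thesis by (simp add: mnth_mult_mmon mnth_FL)
  qed
  define N where "N = mser (\<lambda>n. if - n < int l then mnth (?H ** mmon Q0 (int i) ** ?H') n else 0)"
  have N: "mnth N n = (if - n < int l then mnth (?H ** mmon Q0 (int i) ** ?H') n else 0)" for n
    unfolding N_def by (subst mnth_mser) (auto intro!: exI[of _ "- int l"])
  have Nneg: "mnth N n = 0" if "n < 0" for n using lg(1) that by (simp add: N)
  have "?d ?X \<in> carrier (gl2z (Rfun l g (delta m)))" by (rule deriv_series_in[OF lg wave_series_in[OF lg]])
  note dn = mnth_lev[OF this a]
  have "lev \<gamma> (?d ?X) = - (N ** ?H)"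
  proof (rule mnth_eqI)
    fix n
    have mneg: "mnth (- (N ** ?H)) n = - mnth (N ** ?H) n" by (simp add: mnth_def mat2_eq_iff)
    have NH: "mnth (N ** ?H) n = (if n \<ge> 0 then \<Sum>k\<le>nat n. mnth N (int k) ** mnth ?H (n - int k) else 0)"
      by (rule mnth_mult_nonneg) (simp_all add: Nneg H mnth_FL)
    have mX: "mev \<gamma>' (?X j) = loop_coeff (um l g (delta m) \<gamma>') j" if "\<gamma>' \<in> Dom l g (delta m)" for \<gamma>' j
      using that by (simp add: mev_def wave_series_def series_of_def mat2_eq_iff)
    have ev: "\<forall>\<^sub>F \<zeta> in nhds 0. loop_coeff (um l g (delta m) (\<gamma> \<otimes>\<^bsub>LGL2\<^esub> expo l (unitv i) \<zeta>)) j = mev (\<gamma> \<otimes>\<^bsub>LGL2\<^esub> expo l (unitv i) \<zeta>) (?X j)" for j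
      using eventually_Dom_line[OF lg a params_unitv[of i]] by eventually_elim (simp only: mX)
    have "mev \<gamma> (?d ?X (- n)) = - mnth (N ** ?H) n"
    proof (cases "n \<ge> 0")
      case True
      then obtain k where k: "n = int k" using nonneg_int_cases by blast
      have "mev \<gamma> (?d ?X (- int k)) = - (\<Sum>j\<le>k. if - int j < int l then lcoef u0 (tf l (unitv i)) j ** mfps u0 (k - j) else 0)"
        by (rule mder_unique[OF mder_mev[OF lg wave_series_in[OF lg] a] mder_cong_ev[OF ev der]])
      also have "(\<Sum>j\<le>k. if - int j < int l then lcoef u0 (tf l (unitv i)) j ** mfps u0 (k - j) else 0) = (\<Sum>j\<le>k. mnth N (int j) ** mnth ?H (int k - int j))"
      proof (rule sum.cong[OF refl])
        fix j assume "j \<in> {..k}"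
        then have "nat (int k - int j) = k - j" "int k - int j \<ge> 0" by auto
        moreover have "nat (int j + int i) = j + i" "int j + int i \<ge> 0" by auto
        ultimately show "(if - int j < int l then lcoef u0 (tf l (unitv i)) j ** mfps u0 (k - j) else 0) = mnth N (int j) ** mnth ?H (int k - int j)"
          unfolding N M unfolding H mnth_FL lcoef_power[OF u(1-3) i] by simp
      qed
      finally show ?thesis using NH unfolding k by simp
    next
      case False
      have "\<forall>\<^sub>F \<zeta> in nhds 0. 0 = mev (\<gamma> \<otimes>\<^bsub>LGL2\<^esub> expo l (unitv i) \<zeta>) (?X (- n))"
        using eventually_Dom_line[OF lg a params_unitv[of i]] by eventually_elim (use False mX um_coeff_pos in simp)
      then have "mev \<gamma> (?d ?X (- n)) = 0"
        by (intro mder_unique[OF mder_mev[OF lg wave_series_in[OF lg] a]] mder_cong_ev[OF _ mder_const])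
      then show ?thesis using False NH by simp
    qed
    then show "mnth (lev \<gamma> (?d ?X)) n = mnth (- (N ** ?H)) n" unfolding dn mneg .
  qed
  then show ?thesis using N by blast
qed

section \<open>Linear equations and Lax equations\<close>

definition trunc_series :: "(complex, 'r) module \<Rightarrow> int \<Rightarrow> 'r series \<Rightarrow> 'r series" where
  "trunc_series R l X = (\<lambda>j. if j \<ge> l then X j else \<zero>\<^bsub>gl2 R\<^esub>)"

lemma trunc_series_in:
  assumes lg: "l \<le> 1" "g \<in> carrier LGL2" and X: "X \<in> carrier (gl2z (Rfun l g (delta m)))"
  shows "trunc_series (Rfun l g (delta m)) k X \<in> carrier (gl2z (Rfun l g (delta m)))"
    "\<gamma> \<in> Dom l g (delta m) \<Longrightarrow> mnth (lev \<gamma> (trunc_series (Rfun l g (delta m)) k X)) n = (if - n \<ge> k then mnth (lev \<gamma> X) n else 0)"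
proof -
  let ?R = "Rfun l g (delta m)"
  obtain N where N: "\<And>j. j > N \<Longrightarrow> X j = \<zero>\<^bsub>gl2 ?R\<^esub>" using series_bound[OF X] by blast
  have z: "\<zero>\<^bsub>?R\<^esub> \<in> carrier ?R" using Rfun_const[OF lg] by (simp add: Rfun_simps(5))
  show c: "trunc_series ?R k X \<in> carrier (gl2z ?R)"
  proof (rule seriesI)
    show "trunc_series ?R k X j $ a $ b \<in> carrier ?R" for j a b
      using X z by (simp add: trunc_series_def laurent_simps gl2_simps)
    show "trunc_series ?R k X j = \<zero>\<^bsub>gl2 ?R\<^esub>" if "j > N" for j using N[OF that] by (simp add: trunc_series_def)
  qed
  show "mnth (lev \<gamma> (trunc_series ?R k X)) n = (if - n \<ge> k then mnth (lev \<gamma> X) n else 0)" if a: "\<gamma> \<in> Dom l g (delta m)"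
    unfolding mnth_lev[OF c a] mnth_lev[OF X a] by (simp add: trunc_series_def mev_simps(3)[OF a])
qed

text \<open>Write \<open>H\<close> for the evaluated factor, \<open>M\<close> for
  \<open>H Q0 z^i H^(-1)\<close> and \<open>N\<close> for its part below degree \<open>l\<close>.
  Then \<open>B = M - N\<close> and the derivative of \<open>H\<close> is \<open>- N H\<close>. The
  wave equation reads \<open>- N H + M H = B H\<close>, and the Lax equation follows because
  \<open>M\<close> commutes with \<open>Q\<close>.\<close>

lemma hierarchy_equations:
  fixes l :: nat and m :: "int \<times> int" and i :: nat
  assumes lg: "l \<le> 1" "g \<in> carrier LGL2" and i: "l \<le> i"
  defines "R \<equiv> Rfun l g (delta m)"
  defines "S \<equiv> gl2z R"
  defines "u \<equiv> wave_series l g m"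
  defines "Q \<equiv> dress R u (monomial R Q0 (int l))"
  defines "B \<equiv> trunc_series R (int l) (Q \<otimes>\<^bsub>S\<^esub> monomial R (mat 1) (int i - int l))"
  defines "\<psi> \<equiv> u \<otimes>\<^bsub>S\<^esub> delta_series R m"
  shows "Q \<otimes>\<^bsub>S\<^esub> \<psi> = \<psi> \<otimes>\<^bsub>S\<^esub> monomial R Q0 (int l)"
    "deriv_series (part_t l g (delta m)) i \<psi> \<oplus>\<^bsub>S\<^esub> \<psi> \<otimes>\<^bsub>S\<^esub> monomial R Q0 (int i) = B \<otimes>\<^bsub>S\<^esub> \<psi>"
    "deriv_series (part_t l g (delta m)) i Q = commutator R B Q"
proof -
  let ?d = "deriv_series (part_t l g (delta m)) i"
  note mult = series_mult_closed[OF lg, where m=m, folded R_def S_def] and lmult = lev_mult[OF lg, where m=m, folded R_def S_def]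
  note plus = series_add_closed[OF lg, where m=m, folded R_def S_def] and lplus = lev_add[OF lg, where m=m, folded R_def S_def]
  note mon = monomial_in[OF lg, where m=m, folded R_def S_def] and del = delta_series_in[OF lg, where m=m, folded R_def S_def]
  note dm = deriv_series_in[OF lg, where m=m, folded R_def S_def] and ldm = lev_deriv_mult[OF lg, where m=m, folded R_def S_def]
  note tr = trunc_series_in[OF lg, where m=m, folded R_def S_def]
  note um = lev_uminus[OF lg, where m=m, folded R_def S_def]
  note eqI = series_eqI[where l=l and g=g and d="delta m", folded R_def S_def]
  note ldc = lev_deriv_const[OF lg, where m=m, folded R_def S_def]
  have uS: "u \<in> carrier S" "wave_inverse l g m \<in> carrier S"
    unfolding u_def S_def R_def by (rule wave_series_in[OF lg], rule wave_inverse_in[OF lg])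
  have Q: "Q = u \<otimes>\<^bsub>S\<^esub> monomial R Q0 (int l) \<otimes>\<^bsub>S\<^esub> wave_inverse l g m"
    unfolding Q_def dress_def S_def R_def u_def inv_wave_series[OF lg] ..
  have QS: "Q \<in> carrier S" unfolding Q by (intro mult mon uS)
  have BS: "B \<in> carrier S" unfolding B_def by (intro tr mult QS mon)
  have pS: "\<psi> \<in> carrier S" unfolding \<psi>_def by (intro mult uS del)
  define H where "H \<gamma> = lev \<gamma> u" for \<gamma>
  define H' where "H' \<gamma> = lev \<gamma> (wave_inverse l g m)" for \<gamma>
  have HH: "H \<gamma> ** H' \<gamma> = mat 1" "H' \<gamma> ** H \<gamma> = mat 1" if "\<gamma> \<in> Dom l g (delta m)" for \<gamma>
    unfolding H_def H'_def u_def by (rule lev_wave_inverse[OF lg that])+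
  have c1: "A ** H' \<gamma> ** H \<gamma> = A" "A ** H \<gamma> ** H' \<gamma> = A" if "\<gamma> \<in> Dom l g (delta m)" for \<gamma> A
    by (simp_all add: matrix_mul_assoc[symmetric] HH[OF that])
  have LQ: "lev \<gamma> Q = H \<gamma> ** mmon Q0 (int l) ** H' \<gamma>" if "\<gamma> \<in> Dom l g (delta m)" for \<gamma>
    unfolding Q H_def H'_def using that by (simp add: lmult mult mon uS)
  have Lp: "lev \<gamma> \<psi> = H \<gamma> ** mdelta m" if "\<gamma> \<in> Dom l g (delta m)" for \<gamma>
    unfolding \<psi>_def H_def using that by (simp add: lmult uS del)
  show "Q \<otimes>\<^bsub>S\<^esub> \<psi> = \<psi> \<otimes>\<^bsub>S\<^esub> monomial R Q0 (int l)"
  proof (rule eqI[OF mult[OF QS pS] mult[OF pS mon(1)]])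
    fix \<gamma> assume a: "\<gamma> \<in> Dom l g (delta m)"
    have "lev \<gamma> (Q \<otimes>\<^bsub>S\<^esub> \<psi>) = H \<gamma> ** mmon Q0 (int l) ** H' \<gamma> ** H \<gamma> ** mdelta m"
      by (simp add: lmult[OF QS pS a] LQ[OF a] Lp[OF a] matrix_mul_assoc)
    also have "\<dots> = H \<gamma> ** (mmon Q0 (int l) ** mdelta m)" by (simp add: c1[OF a] matrix_mul_assoc)
    also have "\<dots> = lev \<gamma> (\<psi> \<otimes>\<^bsub>S\<^esub> monomial R Q0 (int l))"
      by (simp add: lmult[OF pS mon(1) a] Lp[OF a] mon(2)[OF a] mdelta_Q0[symmetric] matrix_mul_assoc)
    finally show "lev \<gamma> (Q \<otimes>\<^bsub>S\<^esub> \<psi>) = lev \<gamma> (\<psi> \<otimes>\<^bsub>S\<^esub> monomial R Q0 (int l))" .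
  qed
  define M where "M \<gamma> = H \<gamma> ** mmon Q0 (int i) ** H' \<gamma>" for \<gamma>
  have "\<exists>N. lev \<gamma> (?d u) = - (N ** H \<gamma>) \<and> (\<forall>n. mnth N n = (if - n < int l then mnth (M \<gamma>) n else 0))" if "\<gamma> \<in> Dom l g (delta m)" for \<gamma>
    unfolding M_def H_def H'_def u_def by (rule lev_deriv_wave[OF lg that i])
  then obtain N where N: "\<And>\<gamma>. \<gamma> \<in> Dom l g (delta m) \<Longrightarrow> lev \<gamma> (?d u) = - (N \<gamma> ** H \<gamma>)"
    "\<And>\<gamma> n. \<gamma> \<in> Dom l g (delta m) \<Longrightarrow> mnth (N \<gamma>) n = (if - n < int l then mnth (M \<gamma>) n else 0)" by metis
  \<comment> \<open>A scalar power of \<open>z\<close> passes through \<open>H'\<close>, so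
    \<open>Q z^(i - l)\<close> evaluates to \<open>M\<close>; truncation at degree \<open>l\<close>
    removes exactly \<open>N\<close>.\<close>
  have LB: "lev \<gamma> B = M \<gamma> - N \<gamma>" if a: "\<gamma> \<in> Dom l g (delta m)" for \<gamma>
  proof (rule mnth_eqI)
    fix n
    have "lev \<gamma> (Q \<otimes>\<^bsub>S\<^esub> monomial R (mat 1) (int i - int l)) = H \<gamma> ** (mmon Q0 (int l) ** (H' \<gamma> ** mmon (mat 1) (int i - int l)))"
      by (simp add: lmult[OF QS mon(1) a] LQ[OF a] mon(2)[OF a] matrix_mul_assoc)
    also have "\<dots> = H \<gamma> ** ((mmon Q0 (int l) ** mmon (mat 1) (int i - int l)) ** H' \<gamma>)"
      unfolding mmon_scalar_commute[of "H' \<gamma>"] by (simp add: matrix_mul_assoc)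
    also have "\<dots> = M \<gamma>" by (simp add: M_def mmon_mult matrix_mul_assoc)
    finally show "mnth (lev \<gamma> B) n = mnth (M \<gamma> - N \<gamma>) n"
      unfolding B_def tr(2)[OF mult[OF QS mon(1)] a] by (simp add: mnth_diff N(2)[OF a])
  qed
  show "?d \<psi> \<oplus>\<^bsub>S\<^esub> \<psi> \<otimes>\<^bsub>S\<^esub> monomial R Q0 (int i) = B \<otimes>\<^bsub>S\<^esub> \<psi>"
  proof (rule eqI[OF plus[OF dm[OF pS] mult[OF pS mon(1)]] mult[OF BS pS]])
    fix \<gamma> assume a: "\<gamma> \<in> Dom l g (delta m)"
    have "lev \<gamma> (?d (delta_series R m)) = 0" by (rule ldc[OF del(1) a del(2)])
    then have "lev \<gamma> (?d \<psi>) = - (N \<gamma> ** H \<gamma>) ** mdelta m"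
      unfolding \<psi>_def by (simp add: ldm[OF uS(1) del(1) a] N(1)[OF a] del(2)[OF a] matrix_matrix_mult_def vec_eq_iff)
    moreover have "lev \<gamma> (\<psi> \<otimes>\<^bsub>S\<^esub> monomial R Q0 (int i)) = M \<gamma> ** H \<gamma> ** mdelta m"
    proof -
      have "lev \<gamma> (\<psi> \<otimes>\<^bsub>S\<^esub> monomial R Q0 (int i)) = H \<gamma> ** (mdelta m ** mmon Q0 (int i))"
        by (simp add: lmult[OF pS mon(1) a] Lp[OF a] mon(2)[OF a] matrix_mul_assoc)
      also have "\<dots> = M \<gamma> ** H \<gamma> ** mdelta m" unfolding mdelta_Q0 M_def c1[OF a] by (simp add: matrix_mul_assoc)
      finally show ?thesis .
    qed
    ultimately show "lev \<gamma> (?d \<psi> \<oplus>\<^bsub>S\<^esub> \<psi> \<otimes>\<^bsub>S\<^esub> monomial R Q0 (int i)) = lev \<gamma> (B \<otimes>\<^bsub>S\<^esub> \<psi>)"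
      by (simp add: lplus[OF dm[OF pS] mult[OF pS mon(1)] a] lmult[OF BS pS a] LB[OF a] Lp[OF a] lser_diff_left lser_minus_left matrix_mul_assoc)
  qed
  show "?d Q = commutator R B Q"
    unfolding commutator_def S_def[symmetric] a_minus_def
  proof (rule eqI[OF dm[OF QS] plus[OF mult[OF BS QS] um(1)[OF mult[OF QS BS]]]])
    fix \<gamma> assume a: "\<gamma> \<in> Dom l g (delta m)"
    let ?c = "mmon Q0 (int l)" and ?Q = "lev \<gamma> Q"
    \<comment> \<open>Differentiating this identity instead of \<open>Q\<close> itself avoids the
      derivative of the inverse series.\<close>
    have "Q \<otimes>\<^bsub>S\<^esub> u = u \<otimes>\<^bsub>S\<^esub> monomial R Q0 (int l)"
    proof (rule eqI[OF mult[OF QS uS(1)] mult[OF uS(1) mon(1)]])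
      fix \<gamma> assume a: "\<gamma> \<in> Dom l g (delta m)"
      show "lev \<gamma> (Q \<otimes>\<^bsub>S\<^esub> u) = lev \<gamma> (u \<otimes>\<^bsub>S\<^esub> monomial R Q0 (int l))"
        by (simp add: lmult[OF QS uS(1) a] lmult[OF uS(1) mon(1) a] LQ[OF a] mon(2)[OF a] H_def[symmetric] c1[OF a])
    qed
    then have "lev \<gamma> (?d (Q \<otimes>\<^bsub>S\<^esub> u)) = lev \<gamma> (?d (u \<otimes>\<^bsub>S\<^esub> monomial R Q0 (int l)))" by simp
    moreover have "lev \<gamma> (?d (monomial R Q0 (int l))) = 0" by (rule ldc[OF mon(1) a mon(2)])
    moreover have "H \<gamma> ** (0::lser) = 0" by (simp add: matrix_matrix_mult_def vec_eq_iff)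
    ultimately have e: "lev \<gamma> (?d Q) ** H \<gamma> + ?Q ** (- (N \<gamma> ** H \<gamma>)) = - (N \<gamma> ** H \<gamma>) ** ?c"
      by (simp add: ldm[OF QS uS(1) a] ldm[OF uS(1) mon(1) a] N(1)[OF a] mon(2)[OF a] H_def[symmetric])
    have "lev \<gamma> (?d Q) ** H \<gamma> = ?Q ** N \<gamma> ** H \<gamma> - N \<gamma> ** H \<gamma> ** ?c"
      using e unfolding lser_minus_left lser_minus_right matrix_mul_assoc by (simp add: algebra_simps)
    then have "lev \<gamma> (?d Q) ** H \<gamma> ** H' \<gamma> = ?Q ** N \<gamma> ** H \<gamma> ** H' \<gamma> - N \<gamma> ** H \<gamma> ** ?c ** H' \<gamma>" by (simp add: lser_diff_left)
    then have dQ: "lev \<gamma> (?d Q) = ?Q ** N \<gamma> - N \<gamma> ** ?Q" unfolding c1[OF a] LQ[OF a] by (simp add: matrix_mul_assoc)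
    \<comment> \<open>\<open>M\<close> and \<open>Q\<close> are conjugates by the same
      \<open>H\<close> of two monomials in \<open>Q0\<close>, which commute.\<close>
    have "M \<gamma> ** ?Q = H \<gamma> ** (mmon Q0 (int i) ** ?c) ** H' \<gamma>" unfolding M_def LQ[OF a] by (simp add: matrix_mul_assoc c1[OF a])
    also have "\<dots> = H \<gamma> ** (?c ** mmon Q0 (int i)) ** H' \<gamma>" by (simp add: mmon_mult add.commute)
    also have "\<dots> = ?Q ** M \<gamma>" unfolding M_def LQ[OF a] by (simp add: matrix_mul_assoc c1[OF a])
    finally have MQ: "M \<gamma> ** ?Q = ?Q ** M \<gamma>" .
    show "lev \<gamma> (?d Q) = lev \<gamma> (B \<otimes>\<^bsub>S\<^esub> Q \<oplus>\<^bsub>S\<^esub> \<ominus>\<^bsub>S\<^esub> (Q \<otimes>\<^bsub>S\<^esub> B))"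
      by (simp add: lplus[OF mult[OF BS QS] um(1)[OF mult[OF QS BS]] a] um(2)[OF mult[OF QS BS] a] lmult[OF BS QS a] lmult[OF QS BS a] dQ LB[OF a] lser_diff_left lser_diff_right MQ)
  qed
qed

section \<open>Invariance\<close>

lemma isloop_ddg: "isloop (ddg m)"
  by (rule isloopI[of _ "1/2"]) (use ddg_ann(1)[of "1/2" m] in auto)

lemma delta_add: "delta (m + m') = delta m \<otimes>\<^bsub>LGL2\<^esub> delta m'"
proof -
  have "abs_loop (ddg (m + m')) = abs_loop (\<lambda>z. ddg m z ** ddg m' z)"
    by (rule abs_loop_eqI[of _ "1/2"]) (use ddg_ann(1)[of "1/2" "m + m'"] in \<open>auto simp: ann_def intro!: ddg_add\<close>)
  then show ?thesis by (simp add: delta_ddg isloop_ddg)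
qed

lemma delta_0: "delta 0 = \<one>\<^bsub>LGL2\<^esub>"
  by (simp add: delta_ddg LGL2_one ddg_0[abs_def])

lemma delta_minus: "delta (- m) = inv\<^bsub>LGL2\<^esub> delta m"
proof -
  have "delta (- m) \<otimes>\<^bsub>LGL2\<^esub> delta m = \<one>\<^bsub>LGL2\<^esub>" using delta_add[of "- m" m] by (simp only: delta_0 add.left_inverse)
  then show ?thesis by (intro LG.inv_equality[symmetric] delta_carrier)
qed

lemma delta_nat_pow: "delta (1, 1) [^]\<^bsub>LGL2\<^esub> (n::nat) = delta (int n, int n)"
proof (induction n)
  case 0
  have "delta (int 0, int 0) = delta 0" by (simp add: zero_prod_def)
  then show ?case by (simp only: delta_0 LG.nat_pow_0)
next
  case (Suc n)
  have "delta (int (Suc n), int (Suc n)) = delta ((int n, int n) + (1, 1))" by (simp add: add.commute)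
  then show ?case by (simp only: delta_add LG.nat_pow_Suc Suc)
qed

lemma delta_int_pow: "delta (1, 1) [^]\<^bsub>LGL2\<^esub> (k::int) = delta (k, k)"
proof (cases "k \<ge> 0")
  case True
  then obtain n where "k = int n" using nonneg_int_cases by blast
  then show ?thesis by (simp only: int_pow_int delta_nat_pow)
next
  case False
  then obtain n where n: "k = - int n" by (metis minus_minus nonneg_int_cases not_less neg_0_le_iff_le linear)
  have "delta (k, k) = delta (- (int n, int n))" by (simp add: n)
  then show ?thesis unfolding n LG.int_pow_neg_int[OF delta_carrier] delta_nat_pow delta_minus by simp
qed

lemma delta_central:
  assumes "x \<in> carrier LGL2"
  shows "delta (k, k) \<otimes>\<^bsub>LGL2\<^esub> x = x \<otimes>\<^bsub>LGL2\<^esub> delta (k, k)"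
proof -
  obtain f where f: "x = abs_loop f" "isloop f" by (rule abs_loop_cases)
  show ?thesis unfolding f(1) delta_ddg LGL2_mult_abs[OF isloop_ddg f(2)] LGL2_mult_abs[OF f(2) isloop_ddg] ddg_scalar ..
qed

lemma gam_rep:
  assumes "t \<in> params"
  obtains f R where "1 < R" "f holomorphic_on ball 0 R" "0 < l \<longrightarrow> f 0 = 0" "gam l t = abs_loop (\<lambda>z. dg (f z))" "gam_c l t = abs_loop (\<lambda>z. dg (f (1 / z)))"
    "isloop (\<lambda>z. dg (f z))" "isloop (\<lambda>z. dg (f (1 / z)))"
proof -
  obtain R where R: "1 < R" "ereal R \<le> conv_radius t" using params_radius[OF assms] .
  have h: "tf l t holomorphic_on ball 0 R" by (rule tf_holomorphic[OF R(2)])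
  have R': "1 / R \<le> 1 / R" "0 < R" "0 < 1 / R" "1 / R < 1" using R(1) by auto
  note b = hol2_ball_ann[OF hol2_dg[OF h] R'(1,2)]
  show ?thesis
    by (rule that[of R "tf l t"]) (use R(1) h tf_at_0[of l t] gam_eq[OF assms] gam_c_eq[OF assms] isloopI[OF b(1) R'(3,4)] isloopI[OF b(2) R'(3,4)] in auto)
qed

lemma gam_Ppart: "t \<in> params \<Longrightarrow> gam l t \<in> Ppart l"
proof -
  assume "t \<in> params"
  then obtain f R where f: "1 < R" "f holomorphic_on ball 0 R" "0 < l \<longrightarrow> f 0 = 0" "gam l t = abs_loop (\<lambda>z. dg (f z))" "gam_c l t = abs_loop (\<lambda>z. dg (f (1 / z)))"
    "isloop (\<lambda>z. dg (f z))" "isloop (\<lambda>z. dg (f (1 / z)))" by (rule gam_rep)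
  have "hol2 (\<lambda>z. dg (f z)) (ball 0 R)" by (rule hol2_dg[OF f(2)])
  then show ?thesis unfolding Ppart_iff f(4) using f(1,3) by (intro exI[of _ "\<lambda>z. dg (f z)"] exI[of _ R]) auto
qed

text \<open>Lowest index \<open>1 - l\<close> means that a constant term occurs only for
  \<open>l = 1\<close>, precisely when \<open>Npart l\<close> does not normalize it.\<close>

lemma gam_c_rep:
  assumes "t \<in> params"
  obtains f R where "gam_c (1 - l) t = abs_loop (\<lambda>z. dg (f (1 / z)))" "1 < R" "f holomorphic_on ball 0 R" "l = 0 \<longrightarrow> f 0 = 0" "gam_c (1 - l) t \<in> Npart l"
proof -
  obtain f R where f: "1 < R" "f holomorphic_on ball 0 R" "0 < 1 - l \<longrightarrow> f 0 = 0" "gam (1 - l) t = abs_loop (\<lambda>z. dg (f z))" "gam_c (1 - l) t = abs_loop (\<lambda>z. dg (f (1 / z)))"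
    "isloop (\<lambda>z. dg (f z))" "isloop (\<lambda>z. dg (f (1 / z)))" using assms by (rule gam_rep)
  have "hol2 (\<lambda>z. dg (f z)) (ball 0 R)" by (rule hol2_dg[OF f(2)])
  then have "gam_c (1 - l) t \<in> Npart l"
    unfolding Npart_iff f(5) using f(1,3) by (intro exI[of _ "\<lambda>z. dg (f z)"] exI[of _ R]) auto
  then show ?thesis using that f by simp
qed

lemma gam_commute:
  assumes "\<gamma> \<in> Gam l" "s \<in> params"
  shows "delta m \<otimes>\<^bsub>LGL2\<^esub> \<gamma> = \<gamma> \<otimes>\<^bsub>LGL2\<^esub> delta m" "delta m \<otimes>\<^bsub>LGL2\<^esub> gam_c l' s = gam_c l' s \<otimes>\<^bsub>LGL2\<^esub> delta m"
    "gam_c l' s \<otimes>\<^bsub>LGL2\<^esub> \<gamma> = \<gamma> \<otimes>\<^bsub>LGL2\<^esub> gam_c l' s"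
proof -
  obtain t where t: "t \<in> params" "\<gamma> = gam l t" using assms(1) unfolding Gam_def by blast
  obtain f R where f: "1 < R" "f holomorphic_on ball 0 R" "0 < l \<longrightarrow> f 0 = 0" "gam l t = abs_loop (\<lambda>z. dg (f z))" "gam_c l t = abs_loop (\<lambda>z. dg (f (1 / z)))"
    "isloop (\<lambda>z. dg (f z))" "isloop (\<lambda>z. dg (f (1 / z)))" using t(1) by (rule gam_rep)
  obtain h R' where h: "1 < R'" "h holomorphic_on ball 0 R'" "0 < l' \<longrightarrow> h 0 = 0" "gam l' s = abs_loop (\<lambda>z. dg (h z))" "gam_c l' s = abs_loop (\<lambda>z. dg (h (1 / z)))"
    "isloop (\<lambda>z. dg (h z))" "isloop (\<lambda>z. dg (h (1 / z)))" using assms(2) by (rule gam_rep)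
  show "delta m \<otimes>\<^bsub>LGL2\<^esub> \<gamma> = \<gamma> \<otimes>\<^bsub>LGL2\<^esub> delta m"
    unfolding t(2) f(4) delta_ddg LGL2_mult_abs[OF isloop_ddg f(6)] LGL2_mult_abs[OF f(6) isloop_ddg] dg_ddg ..
  show "delta m \<otimes>\<^bsub>LGL2\<^esub> gam_c l' s = gam_c l' s \<otimes>\<^bsub>LGL2\<^esub> delta m"
    unfolding h(5) delta_ddg LGL2_mult_abs[OF isloop_ddg h(7)] LGL2_mult_abs[OF h(7) isloop_ddg] dg_ddg ..
  show "gam_c l' s \<otimes>\<^bsub>LGL2\<^esub> \<gamma> = \<gamma> \<otimes>\<^bsub>LGL2\<^esub> gam_c l' s"
    unfolding t(2) f(4) h(5) LGL2_mult_abs[OF f(6) h(7)] LGL2_mult_abs[OF h(7) f(6)] by (simp only: dg_add[symmetric] add.commute)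
qed

text \<open>\<open>c\<close> commutes with \<open>d\<close> and \<open>\<gamma>\<close> and moves to
  the left end, and the central \<open>D\<close> cancels. Since \<open>d\<close> commutes with
  \<open>\<gamma>\<close>, the part \<open>d^(-1) p d\<close> in front of
  \<open>\<gamma>^(-1) d^(-1)\<close> turns into a right factor
  \<open>\<gamma> p \<gamma>^(-1)\<close> of the old conjugate.\<close>

lemma conj_loop_transform:
  assumes c: "c \<in> carrier LGL2" "g \<in> carrier LGL2" "p \<in> carrier LGL2" "d \<in> carrier LGL2" "\<gamma> \<in> carrier LGL2" "D \<in> carrier LGL2"
    and comm: "d \<otimes>\<^bsub>LGL2\<^esub> \<gamma> = \<gamma> \<otimes>\<^bsub>LGL2\<^esub> d" "d \<otimes>\<^bsub>LGL2\<^esub> c = c \<otimes>\<^bsub>LGL2\<^esub> d" "c \<otimes>\<^bsub>LGL2\<^esub> \<gamma> = \<gamma> \<otimes>\<^bsub>LGL2\<^esub> c"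
    and D: "\<And>x. x \<in> carrier LGL2 \<Longrightarrow> D \<otimes>\<^bsub>LGL2\<^esub> x = x \<otimes>\<^bsub>LGL2\<^esub> D"
  shows "conj_loop (c \<otimes>\<^bsub>LGL2\<^esub> g \<otimes>\<^bsub>LGL2\<^esub> inv\<^bsub>LGL2\<^esub> d \<otimes>\<^bsub>LGL2\<^esub> p \<otimes>\<^bsub>LGL2\<^esub> d) (D \<otimes>\<^bsub>LGL2\<^esub> d) \<gamma> =
    c \<otimes>\<^bsub>LGL2\<^esub> conj_loop g d \<gamma> \<otimes>\<^bsub>LGL2\<^esub> (\<gamma> \<otimes>\<^bsub>LGL2\<^esub> p \<otimes>\<^bsub>LGL2\<^esub> inv\<^bsub>LGL2\<^esub> \<gamma>)"
proof -
  let ?m = "\<lambda>x y. x \<otimes>\<^bsub>LGL2\<^esub> y" and ?i = "\<lambda>x. inv\<^bsub>LGL2\<^esub> x"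
  note a = LG.m_assoc
  have ic: "?i d \<in> carrier LGL2" "?i \<gamma> \<in> carrier LGL2" "?i D \<in> carrier LGL2" using c by simp_all
  have e1: "?m (?m d \<gamma>) c = ?m (?m c d) \<gamma>"
  proof -
    have "?m (?m d \<gamma>) c = ?m d (?m \<gamma> c)" using c by (simp add: a)
    also have "\<dots> = ?m d (?m c \<gamma>)" by (simp only: comm(3))
    also have "\<dots> = ?m (?m d c) \<gamma>" using c by (simp add: a)
    also have "\<dots> = ?m (?m c d) \<gamma>" by (simp only: comm(2))
    finally show ?thesis .
  qed
  have di: "?m (?i \<gamma>) (?i d) = ?m (?i d) (?i \<gamma>)"
    unfolding LG.inv_mult_group[OF c(4,5), symmetric] LG.inv_mult_group[OF c(5,4), symmetric] comm(1) ..
  have e2: "?m (?m d (?i \<gamma>)) (?i d) = ?i \<gamma>"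
  proof -
    have "?m (?m d (?i \<gamma>)) (?i d) = ?m d (?m (?i \<gamma>) (?i d))" using c ic by (simp add: a)
    also have "\<dots> = ?m d (?m (?i d) (?i \<gamma>))" by (simp only: di)
    also have "\<dots> = ?m (?m d (?i d)) (?i \<gamma>)" using c ic by (simp only: a)
    also have "\<dots> = ?i \<gamma>" using c ic by simp
    finally show ?thesis .
  qed
  have e3: "?m (?m (?i \<gamma>) (?i d)) \<gamma> = ?i d" unfolding di using c ic by (simp add: a)
  have "conj_loop (?m (?m (?m (?m c g) (?i d)) p) d) (?m D d) \<gamma> =
      ?m (?m D (?m (?m (?m (?m (?m (?m d \<gamma>) c) g) (?i d)) p) (?m (?m d (?i \<gamma>)) (?i d)))) (?i D)"
    using c ic by (simp add: conj_loop_def a LG.inv_mult_group)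
  also have "\<dots> = ?m (?m (?m (?m (?m (?m d \<gamma>) c) g) (?i d)) p) (?m (?m d (?i \<gamma>)) (?i d))"
  proof -
    define x where "x = ?m (?m (?m (?m (?m (?m d \<gamma>) c) g) (?i d)) p) (?m (?m d (?i \<gamma>)) (?i d))"
    have x: "x \<in> carrier LGL2" using c ic by (simp add: x_def)
    show ?thesis unfolding x_def[symmetric] D[OF x] using x c ic by (simp add: a)
  qed
  also have "\<dots> = ?m (?m (?m (?m (?m (?m c d) \<gamma>) g) (?m (?m (?i \<gamma>) (?i d)) \<gamma>)) p) (?i \<gamma>)" unfolding e1 e2 e3 ..
  also have "\<dots> = ?m (?m c (conj_loop g d \<gamma>)) (?m (?m \<gamma> p) (?i \<gamma>))"
    using c ic by (simp add: conj_loop_def a)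
  finally show ?thesis .
qed

text \<open>\<open>\<gamma>\<close> lies in \<open>Ppart l\<close>, so
  \<open>\<gamma> p \<gamma>^(-1)\<close> does as well. The new conjugate is therefore
  \<open>(u c^(-1))^(-1)\<close> times an element of \<open>Ppart l\<close>, and uniqueness
  identifies its left factor.\<close>

lemma invariance:
  fixes l :: nat and m :: "int \<times> int" and k :: int
  assumes l: "l \<le> 1" and g: "g \<in> carrier LGL2" and p: "p \<in> Ppart l" and s: "s \<in> params"
  defines "c \<equiv> gam_c (1 - l) s"
  defines "g' \<equiv> c \<otimes>\<^bsub>LGL2\<^esub> g \<otimes>\<^bsub>LGL2\<^esub> delta (- m) \<otimes>\<^bsub>LGL2\<^esub> p \<otimes>\<^bsub>LGL2\<^esub> delta m" and "m' \<equiv> (k, k) + m"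
  shows "g' \<in> carrier LGL2" "Dom l g' (delta m') = Dom l g (delta m)"
    "\<And>\<gamma>. \<gamma> \<in> Dom l g (delta m) \<Longrightarrow> um l g' (delta m') \<gamma> = um l g (delta m) \<gamma> \<otimes>\<^bsub>LGL2\<^esub> inv\<^bsub>LGL2\<^esub> c"
proof -
  have cN: "c \<in> Npart l" unfolding c_def using s by (rule gam_c_rep[of s l])
  have cc: "c \<in> carrier LGL2" "p \<in> carrier LGL2" using cN p Npart_carrier Ppart_carrier by auto
  then show "g' \<in> carrier LGL2" by (simp add: g'_def g)
  have conj: "conj_loop g' (delta m') \<gamma> = c \<otimes>\<^bsub>LGL2\<^esub> conj_loop g (delta m) \<gamma> \<otimes>\<^bsub>LGL2\<^esub> (\<gamma> \<otimes>\<^bsub>LGL2\<^esub> p \<otimes>\<^bsub>LGL2\<^esub> inv\<^bsub>LGL2\<^esub> \<gamma>)" if "\<gamma> \<in> Gam l" for \<gamma>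
    unfolding g'_def m'_def delta_add delta_minus
    by (rule conj_loop_transform[OF cc(1) g cc(2) delta_carrier Gam_carrier[OF that] delta_carrier gam_commute(1)[OF that s] _ _ delta_central])
       (simp_all add: c_def gam_commute[OF that s])
  have cj: "conj_loop g (delta m) \<gamma> \<in> carrier LGL2" if "\<gamma> \<in> Gam l" for \<gamma>
    using Gam_carrier[OF that] g by (simp add: conj_loop_def)
  have GP: "\<gamma> \<in> Ppart l" if "\<gamma> \<in> Gam l" for \<gamma> using that gam_Ppart unfolding Gam_def by blast
  have q: "\<gamma> \<otimes>\<^bsub>LGL2\<^esub> p \<otimes>\<^bsub>LGL2\<^esub> inv\<^bsub>LGL2\<^esub> \<gamma> \<in> Ppart l" if "\<gamma> \<in> Gam l" for \<gamma>
    by (intro Ppart_mult Ppart_inv GP p that)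
  have key: "inv\<^bsub>LGL2\<^esub> (u \<otimes>\<^bsub>LGL2\<^esub> inv\<^bsub>LGL2\<^esub> n) \<otimes>\<^bsub>LGL2\<^esub> (v \<otimes>\<^bsub>LGL2\<^esub> q) = n \<otimes>\<^bsub>LGL2\<^esub> (inv\<^bsub>LGL2\<^esub> u \<otimes>\<^bsub>LGL2\<^esub> v) \<otimes>\<^bsub>LGL2\<^esub> q"
    if "u \<in> Npart l" "n \<in> Npart l" "v \<in> Ppart l" "q \<in> Ppart l" for u n v q
    using Npart_carrier[OF that(1)] Npart_carrier[OF that(2)] Ppart_carrier[OF that(3)] Ppart_carrier[OF that(4)] by (simp add: LG.inv_mult_group LG.m_assoc)
  have bc: "n \<otimes>\<^bsub>LGL2\<^esub> x \<otimes>\<^bsub>LGL2\<^esub> q \<in> big_cell" if nb: "n \<in> Npart l" "q \<in> Ppart l" "x \<in> big_cell" for n x q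
  proof -
    obtain u v where uv: "u \<in> Npart l" "v \<in> Ppart l" "x = inv\<^bsub>LGL2\<^esub> u \<otimes>\<^bsub>LGL2\<^esub> v" using nb(3) unfolding big_cell_iff[of x l] by blast
    show ?thesis unfolding big_cell_iff[of _ l] uv(3) key[OF uv(1) nb(1) uv(2) nb(2), symmetric]
      using Npart_mult[OF uv(1) Npart_inv[OF nb(1)]] Ppart_mult[OF uv(2) nb(2)] by blast
  qed
  \<comment> \<open>The converse multiplies back by the inverse factors. Domains then coincide, so
    solutions at both points live over the same ring and can be compared literally.\<close>
  have iff: "conj_loop g' (delta m') \<gamma> \<in> big_cell \<longleftrightarrow> conj_loop g (delta m) \<gamma> \<in> big_cell" if G: "\<gamma> \<in> Gam l" for \<gamma>
  proof
    assume "conj_loop g (delta m) \<gamma> \<in> big_cell"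
    then show "conj_loop g' (delta m') \<gamma> \<in> big_cell" unfolding conj[OF G] by (rule bc[OF cN q[OF G]])
  next
    let ?q = "\<gamma> \<otimes>\<^bsub>LGL2\<^esub> p \<otimes>\<^bsub>LGL2\<^esub> inv\<^bsub>LGL2\<^esub> \<gamma>"
    assume "conj_loop g' (delta m') \<gamma> \<in> big_cell"
    then have "inv\<^bsub>LGL2\<^esub> c \<otimes>\<^bsub>LGL2\<^esub> (c \<otimes>\<^bsub>LGL2\<^esub> conj_loop g (delta m) \<gamma> \<otimes>\<^bsub>LGL2\<^esub> ?q) \<otimes>\<^bsub>LGL2\<^esub> inv\<^bsub>LGL2\<^esub> ?q \<in> big_cell"
      unfolding conj[OF G] by (rule bc[OF Npart_inv[OF cN] Ppart_inv[OF q[OF G]]])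
    moreover have "inv\<^bsub>LGL2\<^esub> c \<otimes>\<^bsub>LGL2\<^esub> (c \<otimes>\<^bsub>LGL2\<^esub> x \<otimes>\<^bsub>LGL2\<^esub> y) \<otimes>\<^bsub>LGL2\<^esub> inv\<^bsub>LGL2\<^esub> y = x" if "x \<in> carrier LGL2" "y \<in> carrier LGL2" for x y
      using that cc(1) by (simp add: LG.m_assoc[symmetric]) (simp add: LG.m_assoc)
    ultimately show "conj_loop g (delta m) \<gamma> \<in> big_cell" using cj[OF G] Ppart_carrier[OF q[OF G]] by simp
  qed
  then show "Dom l g' (delta m') = Dom l g (delta m)" unfolding Dom_def by blast
  fix \<gamma> assume a: "\<gamma> \<in> Dom l g (delta m)"
  then have G: "\<gamma> \<in> Gam l" "conj_loop g (delta m) \<gamma> \<in> big_cell" by (auto simp: Dom_def)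
  obtain v where v: "um l g (delta m) \<gamma> \<in> Npart l" "v \<in> Ppart l" "conj_loop g (delta m) \<gamma> = inv\<^bsub>LGL2\<^esub> (um l g (delta m) \<gamma>) \<otimes>\<^bsub>LGL2\<^esub> v"
    using um_factor[OF G(2), of l] by blast
  show "um l g' (delta m') \<gamma> = um l g (delta m) \<gamma> \<otimes>\<^bsub>LGL2\<^esub> inv\<^bsub>LGL2\<^esub> c"
  proof (rule um_eqI)
    show "um l g (delta m) \<gamma> \<otimes>\<^bsub>LGL2\<^esub> inv\<^bsub>LGL2\<^esub> c \<in> Npart l" by (intro Npart_mult Npart_inv v cN)
    show "v \<otimes>\<^bsub>LGL2\<^esub> (\<gamma> \<otimes>\<^bsub>LGL2\<^esub> p \<otimes>\<^bsub>LGL2\<^esub> inv\<^bsub>LGL2\<^esub> \<gamma>) \<in> Ppart l" by (intro Ppart_mult v q G)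
    show "conj_loop g' (delta m') \<gamma> = inv\<^bsub>LGL2\<^esub> (um l g (delta m) \<gamma> \<otimes>\<^bsub>LGL2\<^esub> inv\<^bsub>LGL2\<^esub> c) \<otimes>\<^bsub>LGL2\<^esub> (v \<otimes>\<^bsub>LGL2\<^esub> (\<gamma> \<otimes>\<^bsub>LGL2\<^esub> p \<otimes>\<^bsub>LGL2\<^esub> inv\<^bsub>LGL2\<^esub> \<gamma>))"
      unfolding key[OF v(1) cN v(2) q[OF G(1)]] conj[OF G(1)] v(3)[symmetric] ..
  qed
qed

lemma dress_in:
  assumes lg: "l \<le> 1" "g \<in> carrier LGL2"
  shows "dress (Rfun l g (delta m)) (wave_series l g m) (monomial (Rfun l g (delta m)) A k) \<in> carrier (gl2z (Rfun l g (delta m)))"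
  unfolding dress_def inv_wave_series[OF lg] by (intro series_mult_closed monomial_in wave_series_in wave_inverse_in lg)

lemma lev_dress:
  assumes lg: "l \<le> 1" "g \<in> carrier LGL2" and a: "\<gamma> \<in> Dom l g (delta m)"
    and u: "um l g (delta m) \<gamma> = abs_loop (\<lambda>z. u0 (1 / z))" "1 < R" "hol2 u0 (ball 0 R)" "u0 ` ball 0 R \<subseteq> GL2"
  shows "lev \<gamma> (dress (Rfun l g (delta m)) (wave_series l g m) (monomial (Rfun l g (delta m)) Q0 k)) =
    FL (\<lambda>x. u0 x ** Q0 ** inv2 (u0 x)) ** mmon (mat 1) k"
proof -
  let ?R = "Rfun l g (delta m)" and ?v = "\<lambda>x. inv2 (u0 x)"
  have R: "0 < R" using u(2) by simp
  have v: "hol2 ?v (ball 0 R)" by (intro hol2_inv2 u)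
  have "lev \<gamma> (dress ?R (wave_series l g m) (monomial ?R Q0 k)) = FL u0 ** mmon Q0 k ** FL ?v"
    unfolding dress_def inv_wave_series[OF lg] lev_wave[OF lg a u, symmetric]
    using a by (simp add: lev_mult[OF lg] series_mult_closed[OF lg] monomial_in[OF lg] wave_series_in[OF lg] wave_inverse_in[OF lg])
  also have "mmon Q0 k = mmon Q0 0 ** mmon (mat 1) k" by (simp add: mmon_mult)
  also have "FL u0 ** (mmon Q0 0 ** mmon (mat 1) k) ** FL ?v = FL u0 ** mmon Q0 0 ** (mmon (mat 1) k ** FL ?v)" by (simp only: matrix_mul_assoc)
  also have "\<dots> = FL u0 ** mmon Q0 0 ** FL ?v ** mmon (mat 1) k" unfolding mmon_scalar_commute[of "FL ?v", symmetric] by (simp only: matrix_mul_assoc)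
  also have "FL u0 ** mmon Q0 0 ** FL ?v = FL (\<lambda>x. u0 x ** Q0 ** inv2 (u0 x))"
    unfolding FL_const[symmetric] using FL_mult[OF hol2_mult[OF u(3) hol2_const] v R] FL_mult[OF u(3) hol2_const R] by simp
  finally show ?thesis .
qed

lemma dress_invariance:
  fixes l :: nat and m :: "int \<times> int" and k :: int
  assumes l: "l \<le> 1" and g: "g \<in> carrier LGL2" and p: "p \<in> Ppart l" and s: "s \<in> params"
  defines "c \<equiv> gam_c (1 - l) s"
  defines "g' \<equiv> c \<otimes>\<^bsub>LGL2\<^esub> g \<otimes>\<^bsub>LGL2\<^esub> delta (- m) \<otimes>\<^bsub>LGL2\<^esub> p \<otimes>\<^bsub>LGL2\<^esub> delta m" and "m' \<equiv> (k, k) + m"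
  shows "dress (Rfun l g' (delta m')) (wave_series l g' m') (monomial (Rfun l g' (delta m')) Q0 n) =
    dress (Rfun l g (delta m)) (wave_series l g m) (monomial (Rfun l g (delta m)) Q0 n)"
proof -
  note inv1 = invariance(1)[OF l g p s, where m=m, folded c_def, folded g'_def]
    and inv2 = invariance(2)[OF l g p s, where m=m and k=k, folded c_def, folded g'_def m'_def]
    and inv3 = invariance(3)[OF l g p s, where m=m and k=k, folded c_def, folded g'_def m'_def]
  have RR: "Rfun l g' (delta m') = Rfun l g (delta m)" unfolding Rfun_def inv2 ..
  show ?thesis
  proof (rule series_eqI[OF _ dress_in[OF l g]])
    show "dress (Rfun l g' (delta m')) (wave_series l g' m') (monomial (Rfun l g' (delta m')) Q0 n) \<in> carrier (gl2z (Rfun l g (delta m)))"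
      unfolding RR[symmetric] by (rule dress_in[OF l inv1])
    fix \<gamma> assume a: "\<gamma> \<in> Dom l g (delta m)"
    obtain u0 R where u: "um l g (delta m) \<gamma> = abs_loop (\<lambda>z. u0 (1 / z))" "1 < R" "hol2 u0 (ball 0 R)" "u0 ` ball 0 R \<subseteq> GL2" "l = 0 \<longrightarrow> u0 0 = mat 1"
      using um_data[OF a] .
    obtain f r where f: "c = abs_loop (\<lambda>z. dg (f (1 / z)))" "1 < r" "f holomorphic_on ball 0 r" "l = 0 \<longrightarrow> f 0 = 0" "c \<in> Npart l"
      unfolding c_def using s by (rule gam_c_rep[of s l])
    define R' where "R' = min R r"
    have R': "1 < R'" "0 < R'" "1 / R' \<le> 1 / R'" "0 < 1 / R'" "1 / R' < 1" "ball 0 R' \<subseteq> ball (0::complex) R" "ball 0 R' \<subseteq> ball (0::complex) r"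
      using u(2) f(2) by (auto simp: R'_def)
    \<comment> \<open>Representative of the new factor: \<open>dg (- f x)\<close> represents the
      inverse of \<open>c\<close> in the coordinate \<open>1 / z\<close>, and both functions are
      restricted to a common disc.\<close>
    define w where "w x = u0 x ** dg (- f x)" for x
    have f': "f holomorphic_on ball 0 R'" by (rule holomorphic_on_subset[OF f(3) R'(7)])
    have u': "hol2 u0 (ball 0 R')" "u0 ` ball 0 R' \<subseteq> GL2" using hol2_subset[OF u(3) R'(6)] u(4) R'(6) by blast+
    have d: "hol2 (\<lambda>x. dg (- f x)) (ball 0 R')" by (intro hol2_dg holomorphic_on_minus f')
    have w: "hol2 w (ball 0 R')" "w ` ball 0 R' \<subseteq> GL2"
      unfolding w_def using hol2_mult[OF u'(1) d] u'(2) by (auto intro!: GL2_mult)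
    have il: "isloop (\<lambda>z. u0 (1 / z))" "isloop (\<lambda>z. dg (- f (1 / z)))"
      by (rule isloopI[OF hol2_ball_ann(2)[OF u'(1) R'(3,2)] R'(4,5)], rule isloopI[OF hol2_ball_ann(2)[OF d R'(3,2)] R'(4,5)])
    have "inv\<^bsub>LGL2\<^esub> c = abs_loop (\<lambda>z. inv2 (dg (f (1 / z))))"
      unfolding f(1) by (rule inv_LGL2_abs[OF hol2_ball_ann(2)[OF hol2_dg[OF f'] R'(3,2)] _ R'(4,5)]) auto
    then have um': "um l g' (delta m') \<gamma> = abs_loop (\<lambda>z. w (1 / z))"
      unfolding inv3[OF a] u(1) w_def using il by simp
    have a': "\<gamma> \<in> Dom l g' (delta m')" using a inv2 by simp
    have "FL (\<lambda>x. w x ** Q0 ** inv2 (w x)) = FL (\<lambda>x. u0 x ** Q0 ** inv2 (u0 x))"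
    proof (rule FL_cong[OF _ R'(2)])
      fix x :: complex assume x: "x \<in> ball 0 R'"
      then have ux: "u0 x \<in> GL2" using u'(2) by blast
      have iw: "inv2 (w x) = dg (f x) ** inv2 (u0 x)"
      proof (rule inv2_unique)
        show "w x \<in> GL2" using w(2) x by blast
        have "w x ** (dg (f x) ** inv2 (u0 x)) = u0 x ** (dg (- f x) ** dg (f x)) ** inv2 (u0 x)" by (simp only: w_def matrix_mul_assoc)
        then show "w x ** (dg (f x) ** inv2 (u0 x)) = mat 1" by (simp add: dg_minus inv2_mult(1)[OF ux])
      qed
      have "w x ** Q0 ** inv2 (w x) = u0 x ** (dg (- f x) ** Q0 ** dg (f x)) ** inv2 (u0 x)" unfolding iw unfolding w_def by (simp only: matrix_mul_assoc)
      also have "dg (- f x) ** Q0 ** dg (f x) = Q0" unfolding dg_Q0 by (simp add: matrix_mul_assoc[symmetric] dg_minus)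
      finally show "w x ** Q0 ** inv2 (w x) = u0 x ** Q0 ** inv2 (u0 x)" .
    qed
    then show "lev \<gamma> (dress (Rfun l g' (delta m')) (wave_series l g' m') (monomial (Rfun l g' (delta m')) Q0 n)) =
        lev \<gamma> (dress (Rfun l g (delta m)) (wave_series l g m) (monomial (Rfun l g (delta m)) Q0 n))"
      unfolding lev_dress[OF l g a u(1-4)] lev_dress[OF l inv1 a' um' R'(1) w] by simp
  qed
qed

text \<open>Invertibility of the constant term in \<open>gl2 R\<close> needs an inverse with
  analytic entries; the constant term of \<open>wave_inverse\<close> is one, as is checked at each
  point.\<close>

lemma wave_series_G:
  assumes lg: "l \<le> 1" "g \<in> carrier LGL2"
  shows "l = 0 \<Longrightarrow> wave_series l g m \<in> G_lt0 (Rfun l g (delta m))" "wave_series l g m \<in> G_le0 (Rfun l g (delta m))"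
proof -
  let ?R = "Rfun l g (delta m)" and ?D = "Dom l g (delta m)"
  note uS = wave_series_in[OF lg, of m] and vS = wave_inverse_in[OF lg, of m]
  have u0c: "wave_series l g m 0 \<in> carrier (gl2 ?R)" "wave_inverse l g m 0 \<in> carrier (gl2 ?R)" using uS vS by (auto simp: laurent_simps)
  have one: "\<one>\<^bsub>gl2 ?R\<^esub> \<in> carrier (gl2 ?R)" using Rfun_const[OF lg] by (simp add: gl2_simps Rfun_simps(4,5))
  have pos: "wave_series l g m j = \<zero>\<^bsub>gl2 ?R\<^esub>" if "j > 0" for j
    using um_coeff_pos[OF _ that] by (simp add: wave_series_def series_of_def gl2_simps Rfun_simps vec_eq_iff cong: restrict_cong)
  have ev: "\<exists>A. A \<in> GL2 \<and> mev \<gamma> (wave_series l g m 0) = A \<and> mev \<gamma> (wave_inverse l g m 0) = inv2 A \<and> (l = 0 \<longrightarrow> A = mat 1)" if a: "\<gamma> \<in> ?D" for \<gamma>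
  proof -
    obtain u0 R where u: "um l g (delta m) \<gamma> = abs_loop (\<lambda>z. u0 (1 / z))" "1 < R" "hol2 u0 (ball 0 R)" "u0 ` ball 0 R \<subseteq> GL2" "l = 0 \<longrightarrow> u0 0 = mat 1"
      using um_data[OF a] .
    have "mev \<gamma> (wave_series l g m 0) = u0 0" "mev \<gamma> (wave_inverse l g m 0) = inv2 (u0 0)"
      using mnth_lev[OF uS a, of 0] mnth_lev[OF vS a, of 0] unfolding lev_wave[OF lg a u(1-4)] by (simp_all add: mnth_FL mfps_0)
    moreover have "u0 0 \<in> GL2" using u(2,4) by auto
    ultimately show ?thesis using u(5) by blast
  qed
  show "wave_series l g m \<in> G_lt0 ?R" if "l = 0"
  proof -
    have "wave_series l g m 0 = \<one>\<^bsub>gl2 ?R\<^esub>"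
      by (rule mev_eqI[OF u0c(1) one]) (use ev that mev_simps(2) in metis)
    then show ?thesis unfolding G_lt0_def using uS pos by blast
  qed
  have "wave_series l g m 0 \<otimes>\<^bsub>gl2 ?R\<^esub> wave_inverse l g m 0 = \<one>\<^bsub>gl2 ?R\<^esub>" "wave_inverse l g m 0 \<otimes>\<^bsub>gl2 ?R\<^esub> wave_series l g m 0 = \<one>\<^bsub>gl2 ?R\<^esub>"
  proof -
    have *: "mev \<gamma> (wave_series l g m 0) ** mev \<gamma> (wave_inverse l g m 0) = mat 1 \<and> mev \<gamma> (wave_inverse l g m 0) ** mev \<gamma> (wave_series l g m 0) = mat 1" if "\<gamma> \<in> ?D" for \<gamma>
      using ev[OF that] inv2_mult by auto
    show "wave_series l g m 0 \<otimes>\<^bsub>gl2 ?R\<^esub> wave_inverse l g m 0 = \<one>\<^bsub>gl2 ?R\<^esub>"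
      by (rule mev_eqI[OF gl2_mult_closed[OF lg u0c] one]) (use * in \<open>simp add: mev_mult[OF lg _ u0c] mev_simps(2)\<close>)
    show "wave_inverse l g m 0 \<otimes>\<^bsub>gl2 ?R\<^esub> wave_series l g m 0 = \<one>\<^bsub>gl2 ?R\<^esub>"
      by (rule mev_eqI[OF gl2_mult_closed[OF lg u0c(2,1)] one]) (use * in \<open>simp add: mev_mult[OF lg _ u0c(2,1)] mev_simps(2)\<close>)
  qed
  then have "wave_series l g m 0 \<in> Units (gl2 ?R)" unfolding Units_def using u0c by blast
  then show "wave_series l g m \<in> G_le0 ?R" unfolding G_le0_def using uS pos by blast
qed

section \<open>Specialization to the two hierarchies\<close>

lemma trunc_eq: "trunc_ge0 R X = trunc_series R 0 X" "trunc_gt0 R X = trunc_series R 1 X"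
  by (auto simp: trunc_ge0_def trunc_gt0_def trunc_series_def fun_eq_iff)

lemma wave_series_eq: "u_series g (delta m) = wave_series 0 g m" "p_series g (delta m) = wave_series 1 g m"
  by (simp_all add: u_series_def p_series_def wave_series_def u_minus_um)

lemma akns:
  assumes g: "g \<in> carrier LGL2"
  shows "akns_wave (Rfun 0 g (delta m)) (part_t 0 g (delta m)) m (Psi g m)"
    "akns_solution (Rfun 0 g (delta m)) (part_t 0 g (delta m)) (Qsol g (delta m))"
proof -
  note h = hierarchy_equations[of 0 g _ m, OF _ g, simplified]
  note G = wave_series_G(1)[OF _ g, of 0 m, simplified]
  show "akns_wave (Rfun 0 g (delta m)) (part_t 0 g (delta m)) m (Psi g m)"
    unfolding akns_wave_def Psi_def wave_series_eq Let_def osc_lact_def osc_ract_def osc_deriv_def osc.sel osc.inject trunc_eq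
    by (rule bexI[OF _ G]) (intro conjI allI impI refl h)
  show "akns_solution (Rfun 0 g (delta m)) (part_t 0 g (delta m)) (Qsol g (delta m))"
    unfolding akns_solution_def Qsol_def wave_series_eq Let_def trunc_eq
    by (intro conjI allI impI h bexI[OF refl G])
qed

lemma strict_akns:
  assumes g: "g \<in> carrier LGL2"
  shows "strict_akns_wave (Rfun 1 g (delta m)) (part_t 1 g (delta m)) m (Phi g m)"
    "strict_akns_solution (Rfun 1 g (delta m)) (part_t 1 g (delta m)) (Zsol g (delta m))"
proof -
  note h = hierarchy_equations[of 1 g _ m, OF order_refl g, unfolded of_nat_1]
  note G = wave_series_G(2)[OF order_refl g, of m]
  show "strict_akns_wave (Rfun 1 g (delta m)) (part_t 1 g (delta m)) m (Phi g m)"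
    unfolding strict_akns_wave_def Phi_def wave_series_eq Let_def osc_lact_def osc_ract_def osc_deriv_def osc.sel osc.inject trunc_eq
    by (rule bexI[OF _ G]) (intro conjI allI impI refl h(1)[OF order_refl] h(2))
  show "strict_akns_solution (Rfun 1 g (delta m)) (part_t 1 g (delta m)) (Zsol g (delta m))"
    unfolding strict_akns_solution_def Zsol_def wave_series_eq Let_def trunc_eq
    by (intro conjI allI impI h(3) bexI[OF refl G])
qed

text \<open>The power \<open>n\<close> of \<open>z\<close> is left open so that \<open>n = 0\<close>
  gives the invariance of \<open>Qsol\<close> and \<open>n = 1\<close> that of
  \<open>Zsol\<close>.\<close>

lemma orbit:
  fixes l :: nat and m :: "int \<times> int" and k :: int
  assumes l: "l \<le> 1" and g: "g \<in> carrier LGL2" and p: "p \<in> Ppart l" and c: "c \<in> gam_c (1 - l) ` params" and bc: "BC l g (delta m)"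
  defines "g' \<equiv> c \<otimes>\<^bsub>LGL2\<^esub> g \<otimes>\<^bsub>LGL2\<^esub> delta (- m) \<otimes>\<^bsub>LGL2\<^esub> p \<otimes>\<^bsub>LGL2\<^esub> delta m" and "d' \<equiv> delta (1, 1) [^]\<^bsub>LGL2\<^esub> k \<otimes>\<^bsub>LGL2\<^esub> delta m"
  shows "(g', d') \<in> Points \<and> BC l g' d' \<and> Dom l g' d' = Dom l g (delta m) \<and> d' = delta ((k, k) + m) \<and>
    dress (Rfun l g' d') (wave_series l g' ((k, k) + m)) (monomial (Rfun l g' d') Q0 n) =
    dress (Rfun l g (delta m)) (wave_series l g m) (monomial (Rfun l g (delta m)) Q0 n)"
proof -
  obtain s where s: "s \<in> params" "c = gam_c (1 - l) s" using c by blast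
  have d': "d' = delta ((k, k) + m)" unfolding d'_def delta_int_pow delta_add ..
  note inv1 = invariance(1)[OF l g p s(1), where m=m, folded s(2), folded g'_def]
    and inv2 = invariance(2)[OF l g p s(1), where m=m and k=k, folded s(2), folded g'_def d']
  have "BC l g' d'" using bc inv2 unfolding BC_def Dom_def by blast
  moreover have "(g', d') \<in> Points" unfolding Points_def using inv1 d' by blast
  moreover note dress_invariance[OF l g p s(1), where m=m and k=k and n=n, folded s(2), folded g'_def d']
  ultimately show ?thesis using inv2 d' by blast
qed

theorem theorem4p1:
  fixes g :: loop and m :: "int \<times> int"
  assumes "(g, delta m) \<in> Points"
  shows
    "(BC 0 g (delta m) \<longrightarrow>
       setting {0..} (Rfun 0 g (delta m)) (part_t 0 g (delta m)) \<and>
       akns_wave (Rfun 0 g (delta m)) (part_t 0 g (delta m)) m (Psi g m) \<and>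
       akns_solution (Rfun 0 g (delta m)) (part_t 0 g (delta m)) (Qsol g (delta m)) \<and>
       (\<forall>p1\<in>P_plus. \<forall>\<gamma>c\<in>Gam0c. \<forall>k::int.
          let g' = \<gamma>c \<otimes>\<^bsub>LGL2\<^esub> g \<otimes>\<^bsub>LGL2\<^esub> delta (- m) \<otimes>\<^bsub>LGL2\<^esub> p1 \<otimes>\<^bsub>LGL2\<^esub> delta m;
              d' = delta (1, 1) [^]\<^bsub>LGL2\<^esub> k \<otimes>\<^bsub>LGL2\<^esub> delta m
          in (g', d') \<in> Points \<and> BC 0 g' d' \<and>
             Dom 0 g' d' = Dom 0 g (delta m) \<and> Qsol g' d' = Qsol g (delta m))) \<and>
     (BC 1 g (delta m) \<longrightarrow>
       setting {1..} (Rfun 1 g (delta m)) (part_t 1 g (delta m)) \<and>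
       strict_akns_wave (Rfun 1 g (delta m)) (part_t 1 g (delta m)) m (Phi g m) \<and>
       strict_akns_solution (Rfun 1 g (delta m)) (part_t 1 g (delta m)) (Zsol g (delta m)) \<and>
       (\<forall>u1\<in>U_plus. \<forall>\<gamma>c\<in>Gam1c. \<forall>k::int.
          let g' = \<gamma>c \<otimes>\<^bsub>LGL2\<^esub> g \<otimes>\<^bsub>LGL2\<^esub> delta (- m) \<otimes>\<^bsub>LGL2\<^esub> u1 \<otimes>\<^bsub>LGL2\<^esub> delta m;
              d' = delta (1, 1) [^]\<^bsub>LGL2\<^esub> k \<otimes>\<^bsub>LGL2\<^esub> delta m
          in (g', d') \<in> Points \<and> BC 1 g' d' \<and>
             Dom 1 g' d' = Dom 1 g (delta m) \<and> Zsol g' d' = Zsol g (delta m)))"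
proof -
  have g: "g \<in> carrier LGL2" using assms by (simp add: Points_def)
  have P: "P_plus = Ppart 0" "U_plus = Ppart 1" "Gam0c = gam_c (1 - 0) ` params" "Gam1c = gam_c (1 - 1) ` params"
    by (simp_all add: Ppart_def Gam0c_def Gam1c_def)
  show ?thesis
  proof (intro conjI impI ballI allI Rfun_setting akns strict_akns g zero_le_one order_refl)
    fix p c k assume a: "BC 0 g (delta m)" "p \<in> P_plus" "c \<in> Gam0c"
    show "let g' = c \<otimes>\<^bsub>LGL2\<^esub> g \<otimes>\<^bsub>LGL2\<^esub> delta (- m) \<otimes>\<^bsub>LGL2\<^esub> p \<otimes>\<^bsub>LGL2\<^esub> delta m; d' = delta (1, 1) [^]\<^bsub>LGL2\<^esub> (k::int) \<otimes>\<^bsub>LGL2\<^esub> delta m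
      in (g', d') \<in> Points \<and> BC 0 g' d' \<and> Dom 0 g' d' = Dom 0 g (delta m) \<and> Qsol g' d' = Qsol g (delta m)"
      \<comment> \<open>\<open>d'\<close> is first recognized as \<open>delta ((k, k) + m)\<close>,
        since \<open>wave_series_eq\<close> speaks about series attached to an exponent.\<close>
      using orbit[OF zero_le_one g a(2)[unfolded P(1)] a(3)[unfolded P(3)] a(1), of k 0]
      unfolding Let_def Qsol_def wave_series_eq(1) by (metis wave_series_eq(1))
  next
    fix p c k assume a: "BC 1 g (delta m)" "p \<in> U_plus" "c \<in> Gam1c"
    show "let g' = c \<otimes>\<^bsub>LGL2\<^esub> g \<otimes>\<^bsub>LGL2\<^esub> delta (- m) \<otimes>\<^bsub>LGL2\<^esub> p \<otimes>\<^bsub>LGL2\<^esub> delta m; d' = delta (1, 1) [^]\<^bsub>LGL2\<^esub> (k::int) \<otimes>\<^bsub>LGL2\<^esub> delta m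
      in (g', d') \<in> Points \<and> BC 1 g' d' \<and> Dom 1 g' d' = Dom 1 g (delta m) \<and> Zsol g' d' = Zsol g (delta m)"
      using orbit[OF order_refl g a(2)[unfolded P(2)] a(3)[unfolded P(4)] a(1), of k 1]
      unfolding Let_def Zsol_def wave_series_eq(2) by (metis wave_series_eq(2))
  qed
qed

end
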